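(* Suppose that $\sigma$ is a supercuspidal irrep of $GSp_6$. Then the space of Shalika functionals for $\sigma$ is at most one-dimensional: $$\dim\left(\mathrm{Sh}(\sigma)\right)\le 1.$$
   Context: $k$ is a finite extension of $\mathbb{Q}_p$ and $\psi_k$ is a fixed smooth nontrivial additive character of $k$. An irrep is an irreducible smooth complex representation. $M_2$ denotes the $2\times2$ matrices over $k$; $g^T$ is the transpose. Let $I=\begin{pmatrix}1&0\\0&1\end{pmatrix}$, $J=\begin{pmatrix}0&-1\\1&0\end{pmatrix}$, and (in $2\times 2$ blocks) $J_3=\begin{pmatrix}0&0&J\\ 0&J&0\\ J&0&0\end{pmatrix}$. Then $$GSp_6=\{g\in GL_6(k): gJ_3g^T=\mathrm{sim}(g)J_3 \text{ for some } \mathrm{sim}(g)\in k^\times\}.$$ Let $$U_3=\left\{\begin{pmatrix}I&X&Z\\0&I&Y\\0&0&I\end{pmatrix}: X,Y,Z\in M_2,\ XJ+JY^T=0,\ ZJ+JZ^T=-XJX^T\right\},$$ and, for $g\in GL_2(k)$, let $\Delta(g)=\mathrm{diag}(g,g,g)\in GSp_6$ (block diagonal). The Shalika subgroup is $S=\Delta(GL_2(k))\ltimes U_3$. Define the character $\psi_S$ of $S$ by $\psi_S(\Delta(g)u)=\psi_k(-\mathrm{Tr}(X))$ for $g\in GL_2(k)$ and $u\in U_3$ with upper-middle block $X$. For a smooth representation $\sigma$ of $GSp_6$, the space of Shalika functionals is $\mathrm{Sh}(\sigma)=\mathrm{Hom}_S(\sigma,\psi_S)$. *)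

theory Defs
  imports "HOL-Analysis.Analysis" "HOL-Library.Function_Algebras"
begin

section \<open>Finite extensions of the p-adic numbers\<close>

definition padic_abs :: "nat \<Rightarrow> rat \<Rightarrow> real" where
  "padic_abs p q = (if q = 0 then 0 else
     real p powi (int (multiplicity (int p) (snd (quotient_of q)))
                  - int (multiplicity (int p) (fst (quotient_of q)))))"

text \<open>
  The field \<open>'k\<close> carries an absolute value that extends the p-adic one on the rationals and
  induces the metric (hence the topology) of the type. Completeness of the closure of the
  rationals in \<open>'k\<close> says that this closure is the completion of the rationals for the p-adic
  absolute value, i.e. the field of p-adic numbers, and \<open>'k\<close> has finite dimension over it.
\<close>

locale finite_extension_Qp =
  fixes p :: nat and absv :: "'k::{field_char_0,metric_space} \<Rightarrow> real"
  assumes prime_p: "prime p"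
    and dist_absv: "dist x y = absv (x - y)"
    and absv_mult: "absv (x * y) = absv x * absv y"
    and absv_ultrametric: "absv (x + y) \<le> max (absv x) (absv y)"
    and absv_of_rat: "absv (of_rat q) = padic_abs p q"
    and complete_Qp: "complete (closure \<rat> :: 'k set)"
    and finite_over_Qp:
      "\<exists>B. finite B \<and> (\<forall>x::'k. \<exists>c. (\<forall>b\<in>B. c b \<in> closure \<rat>) \<and> x = (\<Sum>b\<in>B. c b * b))"

definition smooth_additive_character :: "('k::{field,topological_space} \<Rightarrow> complex) \<Rightarrow> bool" where
  "smooth_additive_character \<psi> \<longleftrightarrow>
     \<psi> 0 = 1 \<and> (\<forall>x y. \<psi> (x + y) = \<psi> x * \<psi> y) \<and> open {x. \<psi> x = 1}"

definition nontrivial_character :: "('k \<Rightarrow> complex) \<Rightarrow> bool" where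
  "nontrivial_character \<psi> \<longleftrightarrow> (\<exists>x. \<psi> x \<noteq> 1)"


section \<open>Smooth representations of matrix groups\<close>

text \<open>
  A representation is given on the group \<open>G\<close> only; the values of \<open>\<sigma>\<close> outside \<open>G\<close> are irrelevant.
  All topological conditions refer to the subspace topology of \<open>G\<close> in the space of matrices.
\<close>

locale group_rep = vector_space smul
  for smul :: "complex \<Rightarrow> 'v::ab_group_add \<Rightarrow> 'v" +
  fixes G :: "('k::{field,topological_space}^'n^'n) set"
    and \<sigma> :: "'k^'n^'n \<Rightarrow> 'v \<Rightarrow> 'v"
  assumes rep_linear: "g \<in> G \<Longrightarrow> Vector_Spaces.linear smul smul (\<sigma> g)"
    and rep_one: "\<sigma> (mat 1) v = v"
    and rep_mult: "g \<in> G \<Longrightarrow> h \<in> G \<Longrightarrow> \<sigma> (g ** h) v = \<sigma> g (\<sigma> h v)"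

locale smooth_rep = group_rep +
  assumes smooth: "openin (top_of_set G) {g \<in> G. \<sigma> g v = v}"

locale smooth_irrep = smooth_rep smul G \<sigma>
  for smul :: "complex \<Rightarrow> 'v::ab_group_add \<Rightarrow> 'v"
    and G :: "('k::{field,topological_space}^'n^'n) set"
    and \<sigma> :: "'k^'n^'n \<Rightarrow> 'v \<Rightarrow> 'v" +
  assumes nonzero: "\<exists>v::'v. v \<noteq> 0"
    and irreducible: "subspace W \<Longrightarrow> (\<And>g. g \<in> G \<Longrightarrow> \<sigma> g ` W \<subseteq> W) \<Longrightarrow> W = {0} \<or> W = UNIV"

text \<open>The underlying space of the smooth contragredient.\<close>

definition smooth_dual ::
  "(complex \<Rightarrow> 'v::ab_group_add \<Rightarrow> 'v) \<Rightarrow> ('k::{field,topological_space}^'n^'n) set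
    \<Rightarrow> ('k^'n^'n \<Rightarrow> 'v \<Rightarrow> 'v) \<Rightarrow> ('v \<Rightarrow> complex) set" where
  "smooth_dual smul G \<sigma> =
     {\<xi>. Vector_Spaces.linear smul (*) \<xi> \<and>
         openin (top_of_set G) {g \<in> G. \<forall>v. \<xi> (\<sigma> g v) = \<xi> v}}"

definition matrix_group_centre :: "('k::field^'n^'n) set \<Rightarrow> ('k^'n^'n) set" where
  "matrix_group_centre G = {z \<in> G. \<forall>g\<in>G. z ** g = g ** z}"

text \<open>Every matrix coefficient has compact support modulo the centre.\<close>

definition supercuspidal ::
  "(complex \<Rightarrow> 'v::ab_group_add \<Rightarrow> 'v) \<Rightarrow> ('k::{field,topological_space}^'n^'n) set
    \<Rightarrow> ('k^'n^'n \<Rightarrow> 'v \<Rightarrow> 'v) \<Rightarrow> bool" where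
  "supercuspidal smul G \<sigma> \<longleftrightarrow>
     (\<forall>v. \<forall>\<xi>\<in>smooth_dual smul G \<sigma>. \<exists>C\<subseteq>G. compact C \<and>
        {g \<in> G. \<xi> (\<sigma> g v) \<noteq> 0} \<subseteq> {z ** c | z c. z \<in> matrix_group_centre G \<and> c \<in> C})"

definition Hom_character ::
  "(complex \<Rightarrow> 'v::ab_group_add \<Rightarrow> 'v) \<Rightarrow> ('k^'n^'n) set
    \<Rightarrow> ('k^'n^'n \<Rightarrow> 'v \<Rightarrow> 'v) \<Rightarrow> ('k^'n^'n \<Rightarrow> complex) \<Rightarrow> ('v \<Rightarrow> complex) set" where
  "Hom_character smul H \<sigma> \<theta> =
     {l. Vector_Spaces.linear smul (*) l \<and> (\<forall>h\<in>H. \<forall>v. l (\<sigma> h v) = \<theta> h * l v)}"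

definition fun_scale :: "complex \<Rightarrow> ('v \<Rightarrow> complex) \<Rightarrow> 'v \<Rightarrow> complex" where
  "fun_scale c l = (\<lambda>v. c * l v)"

lemma vector_space_fun_scale: "vector_space fun_scale"
  by unfold_locales (auto simp: fun_scale_def fun_eq_iff algebra_simps)

text \<open>
  The library's \<open>dim\<close> is \<open>0\<close> for spaces without a finite basis, so finite-dimensionality
  has to be required separately.
\<close>

definition functionals_dim_le :: "('v \<Rightarrow> complex) set \<Rightarrow> nat \<Rightarrow> bool" where
  "functionals_dim_le L n \<longleftrightarrow>
     (\<exists>B. finite B \<and> L \<subseteq> module.span fun_scale B) \<and> vector_space.dim fun_scale L \<le> n"


section \<open>The group GSp(6) and its Shalika subgroup\<close>

text \<open>
  A \<open>6 \<times> 6\<close> matrix is indexed by pairs (block, position inside the block), so that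
  \<open>of_blocks\<close> assembles a \<open>3 \<times> 3\<close> array of \<open>2 \<times> 2\<close> blocks.
\<close>

type_synonym 'k mat6 = "'k^(3 \<times> 2)^(3 \<times> 2)"

definition of_blocks :: "'k^2^2^3^3 \<Rightarrow> 'k mat6" where
  "of_blocks A = (\<chi> i j. A $ fst i $ fst j $ snd i $ snd j)"

definition J2 :: "'k::field^2^2" where
  "J2 = vector [vector [0, -1], vector [1, 0]]"

definition J3 :: "'k::field mat6" where
  "J3 = of_blocks (vector [vector [0, 0, J2],
                           vector [0, J2, 0],
                           vector [J2, 0, 0]])"

definition GSp6 :: "'k::field mat6 set" where
  "GSp6 = {g. invertible g \<and> (\<exists>c. c \<noteq> 0 \<and> g ** J3 ** transpose g = mat c ** J3)}"

definition unip :: "'k::field^2^2 \<Rightarrow> 'k^2^2 \<Rightarrow> 'k^2^2 \<Rightarrow> 'k mat6" where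
  "unip X Y Z = of_blocks (vector [vector [mat 1, X, Z],
                                   vector [0, mat 1, Y],
                                   vector [0, 0, mat 1]])"

definition U3_cond :: "'k::field^2^2 \<Rightarrow> 'k^2^2 \<Rightarrow> 'k^2^2 \<Rightarrow> bool" where
  "U3_cond X Y Z \<longleftrightarrow> X ** J2 + J2 ** transpose Y = 0 \<and>
     Z ** J2 + J2 ** transpose Z = - (X ** J2 ** transpose X)"

definition Delta :: "'k::field^2^2 \<Rightarrow> 'k mat6" where
  "Delta g = of_blocks (vector [vector [g, 0, 0],
                                vector [0, g, 0],
                                vector [0, 0, g]])"

definition Shalika_subgroup :: "'k::field mat6 set" where
  "Shalika_subgroup = {Delta g ** unip X Y Z | g X Y Z. invertible g \<and> U3_cond X Y Z}"

text \<open>Well-definedness is \<open>Shalika_character_eq\<close> below.\<close>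

definition Shalika_character :: "('k::field \<Rightarrow> complex) \<Rightarrow> 'k mat6 \<Rightarrow> complex" where
  "Shalika_character \<psi> s =
     (THE c. \<exists>g X Y Z. invertible g \<and> U3_cond X Y Z \<and>
        s = Delta g ** unip X Y Z \<and> c = \<psi> (- trace X))"

definition Shalika_functionals ::
  "('k::field \<Rightarrow> complex) \<Rightarrow> (complex \<Rightarrow> 'v::ab_group_add \<Rightarrow> 'v)
    \<Rightarrow> ('k mat6 \<Rightarrow> 'v \<Rightarrow> 'v) \<Rightarrow> ('v \<Rightarrow> complex) set" where
  "Shalika_functionals \<psi> smul \<sigma> =
     Hom_character smul Shalika_subgroup \<sigma> (Shalika_character \<psi>)"

lemma of_blocks_mult:
  fixes A B :: "'k::field^2^2^3^3"
  shows "of_blocks A ** of_blocks B = of_blocks (\<chi> i j. \<Sum>k\<in>UNIV. A $ i $ k ** B $ k $ j)"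
proof -
  have "(\<Sum>k\<in>UNIV. of_blocks A $ i $ k * of_blocks B $ k $ j)
      = (\<Sum>k\<in>UNIV. A $ fst i $ k ** B $ k $ fst j) $ snd i $ snd j" for i j
    by (simp add: of_blocks_def matrix_matrix_mult_def sum_component sum.cartesian_product
        split_beta flip: UNIV_Times_UNIV)
  then show ?thesis
    by (simp add: vec_eq_iff matrix_matrix_mult_def[of "of_blocks A"] of_blocks_def[of "\<chi> i j. _ i j"])
qed

lemma of_blocks_transpose:
  "transpose (of_blocks A) = of_blocks (\<chi> i j. transpose (A $ j $ i))"
  by (simp add: vec_eq_iff transpose_def of_blocks_def)

lemma of_blocks_eq_iff: "of_blocks A = of_blocks B \<longleftrightarrow> A = B"
  by (auto simp: vec_eq_iff of_blocks_def)

lemma vec3_eq_iff: "A = vector [vector [a11, a12, a13], vector [a21, a22, a23], vector [a31, a32, a33]]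
    \<longleftrightarrow> A $ 1 $ 1 = a11 \<and> A $ 1 $ 2 = a12 \<and> A $ 1 $ 3 = a13 \<and>
        A $ 2 $ 1 = a21 \<and> A $ 2 $ 2 = a22 \<and> A $ 2 $ 3 = a23 \<and>
        A $ 3 $ 1 = a31 \<and> A $ 3 $ 2 = a32 \<and> (A :: ('a::zero)^3^3) $ 3 $ 3 = a33"
  by (auto simp: vec_eq_iff[where 'b = 3] forall_3)

lemma Delta_mult_unip:
  "Delta g ** unip X Y Z = of_blocks (vector [vector [g, g ** X, g ** Z],
                                              vector [0, g, g ** Y],
                                              vector [0, 0, g]])"
  unfolding Delta_def unip_def of_blocks_mult of_blocks_eq_iff vec3_eq_iff
  by (simp add: sum_3)

lemma Delta_mult_unip_inj:
  assumes "invertible g" "Delta g ** unip X Y Z = Delta g' ** unip X' Y' Z'"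
  shows "g = g' \<and> X = X' \<and> Y = Y' \<and> Z = Z'"
proof -
  from assms(2) have *: "g = g'" "g ** X = g ** X'" "g ** Y = g ** Y'" "g ** Z = g ** Z'"
    by (auto simp: Delta_mult_unip of_blocks_eq_iff vec3_eq_iff)
  moreover obtain h where "h ** g = mat 1"
    using assms(1) by (auto simp: invertible_def)
  ultimately show ?thesis
    by (metis matrix_mul_assoc matrix_mul_lid)
qed

lemma Shalika_character_eq:
  assumes "invertible g" "U3_cond X Y Z"
  shows "Shalika_character \<psi> (Delta g ** unip X Y Z) = \<psi> (- trace X)"
  unfolding Shalika_character_def
  using assms by (intro the_equality) (auto dest: Delta_mult_unip_inj)

lemma transpose_zero: "transpose (0 :: 'a::zero^'n^'m) = 0"
  by (simp add: vec_eq_iff transpose_def)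

lemma Delta_in_GSp6:
  assumes "invertible (g :: 'k::field^2^2)"
  shows "Delta g \<in> GSp6"
proof -
  obtain h where h: "g ** h = mat 1" "h ** g = mat 1"
    using assms by (auto simp: invertible_def)
  have one: "of_blocks (vector [vector [mat 1, 0, 0], vector [0, mat 1, 0], vector [0, 0, mat 1]])
      = (mat 1 :: 'k mat6)"
    by (auto simp: of_blocks_def vec_eq_iff mat_def forall_3 split_beta prod_eq_iff)
  have "Delta g ** Delta h = mat 1" "Delta h ** Delta g = mat 1"
    unfolding one[symmetric] Delta_def of_blocks_mult of_blocks_eq_iff vec3_eq_iff
    by (simp_all add: sum_3 h)
  then have "invertible (Delta g)"
    by (auto simp: invertible_def)
  moreover have *: "g ** J2 ** transpose g = mat (det g) ** J2"
    by (auto simp: vec_eq_iff matrix_matrix_mult_def mat_def J2_def transpose_def sum_2 det_2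
        forall_2 algebra_simps)
  have mat: "mat (det g) = of_blocks (vector [vector [mat (det g), 0, 0],
      vector [0, mat (det g), 0], vector [0, 0, mat (det g)]])"
    by (auto simp: of_blocks_def vec_eq_iff mat_def forall_3 split_beta prod_eq_iff)
  have "Delta g ** J3 ** transpose (Delta g) = mat (det g) ** J3"
    unfolding mat J3_def Delta_def of_blocks_mult of_blocks_transpose of_blocks_eq_iff
    by (simp add: vec_eq_iff[where 'b = 3] forall_3 sum_3 * transpose_zero)
  moreover have "det g \<noteq> 0"
    using assms by (simp add: invertible_det_nz)
  ultimately show ?thesis
    by (auto simp: GSp6_def)
qed

lemma unip_in_GSp6:
  assumes "U3_cond X Y (Z :: 'k::field^2^2)"
  shows "unip X Y Z \<in> GSp6"
proof -
  have XY: "X ** J2 + J2 ** transpose Y = 0"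
    and Z: "Z ** J2 + J2 ** transpose Z = - (X ** J2 ** transpose X)"
    using assms by (auto simp: U3_cond_def)
  have YX: "Y ** J2 + J2 ** transpose X = 0"
  proof -
    have "Y ** J2 + J2 ** transpose X = - transpose (X ** J2 + J2 ** transpose Y)"
      by (simp add: vec_eq_iff matrix_matrix_mult_def J2_def transpose_def sum_2 forall_2)
    then show ?thesis
      by (simp add: XY transpose_zero)
  qed
  have Z': "Z ** J2 + X ** J2 ** transpose X + J2 ** transpose Z = 0"
  proof -
    have "Z ** J2 + X ** J2 ** transpose X + J2 ** transpose Z
        = (Z ** J2 + J2 ** transpose Z) + X ** J2 ** transpose X"
      by (simp only: ac_simps)
    then show ?thesis
      by (simp add: Z)
  qed
  have neg_one: "of_blocks (vector [vector [- mat 1, 0, 0], vector [0, - mat 1, 0],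
      vector [0, 0, - mat 1]]) = - (mat 1 :: 'k mat6)"
    by (auto simp: of_blocks_def vec_eq_iff mat_def forall_3 split_beta prod_eq_iff)
  have JJ: "J2 ** J2 = - (mat 1 :: 'k^2^2)"
    by (auto simp: vec_eq_iff matrix_matrix_mult_def mat_def J2_def sum_2 forall_2)
  have J3J3: "J3 ** J3 = - (mat 1 :: 'k mat6)"
    unfolding neg_one[symmetric] J3_def of_blocks_mult of_blocks_eq_iff vec3_eq_iff
    by (simp add: sum_3 JJ)
  have sim: "unip X Y Z ** J3 ** transpose (unip X Y Z) = J3"
    unfolding J3_def unip_def of_blocks_mult of_blocks_transpose of_blocks_eq_iff
    by (simp add: vec_eq_iff[where 'b = 3] forall_3 sum_3 transpose_zero XY YX Z')
  have "unip X Y Z ** (J3 ** transpose (unip X Y Z) ** - J3) = mat 1"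
  proof -
    have "unip X Y Z ** (J3 ** transpose (unip X Y Z) ** - J3) = J3 ** - J3"
      by (simp only: matrix_mul_assoc sim)
    also have "\<dots> = - (J3 ** J3)"
      by (simp only: vec_eq_iff matrix_matrix_mult_def vec_lambda_beta vector_uminus_component
          mult_minus_right sum_negf) simp
    finally show ?thesis
      by (simp add: J3J3)
  qed
  then have "invertible (unip X Y Z)"
    by (auto simp: invertible_right_inverse)
  with sim show ?thesis
    unfolding GSp6_def by (intro CollectI conjI exI[of _ 1]) auto
qed

end

theory Submission
  imports Defs "HOL-Computational_Algebra.Fundamental_Theorem_Algebra"
begin

text \<open>
  This is the method of Gelfand and Kazhdan. Let \<open>S\<close> be the Shalika subgroup, \<open>\<chi>\<close> its character and
  \<open>\<tau>(x) = \<epsilon> x\<^sup>-\<^sup>1 \<epsilon>\<close> with \<open>\<epsilon> = diag(I, -I, I)\<close>; then \<open>\<tau>\<close> preserves \<open>S\<close> and \<open>\<chi>\<close>. Since matrix coefficients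
  have compact support modulo the centre, the representation is unitary, and two Shalika functionals
  \<open>l1, l2\<close> give a distribution \<open>T\<close> on the group with \<open>T(f(s\<^sup>-\<^sup>1 x)) = \<chi>(s) T(f)\<close> and
  \<open>T(f(x s)) = \<chi>(s)\<^sup>-\<^sup>1 T(f)\<close>. If every such distribution is \<open>\<tau>\<close>-invariant, then comparing the values of
  \<open>T\<close> on indicators of double cosets of small open subgroups shows that all relations satisfied by \<open>l1\<close> hold for
  \<open>l2\<close>, so that the two are proportional.

  It remains to see that \<open>D(f) = T(f) - T(f \<circ> \<tau>)\<close> vanishes. No Haar measure is used: \<open>D\<close> is localized along
  closed invariant sets, and a point \<open>x\<close> of such a set carries no part of \<open>D\<close> if either \<open>a x = x b\<close> with
  \<open>a, b\<close> in \<open>S\<close>, \<open>\<chi>(a) \<noteq> \<chi>(b)\<close>, or \<open>(x\<^sup>-\<^sup>1 y)\<^sup>2\<close> is scalar for some \<open>y\<close> in \<open>S \<epsilon>\<close>, where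
  \<open>a, b, y\<close> vary continuously in the set near \<open>x\<close>; in the second case \<open>x \<mapsto> y x\<^sup>-\<^sup>1 y\<close> acts on \<open>D\<close> by \<open>-1\<close> and fixes
  \<open>x\<close> up to the centre. Removing such points repeatedly exhausts the group. All of this is explicit because
  2 by 2 matrices with the adjugate as involution turn the symplectic condition into a hermitian one.
\<close>

section \<open>Cosets of open subgroups\<close>

text \<open>The involution is dictated by the character: conjugation by \<open>eps\<close> negates
  the middle block of a unipotent element, hence inverts the character, and inversion restores it. A
  nonzero Shalika functional forces the centre to act trivially, because the character is trivial on
  scalars; therefore all subgroups used below contain the scalars and are compact only modulo them,
  and integrals become finite sums over cosets. Unitarity serves to represent both functionals by
  vectors of the space itself, level by level, so that a distribution can compare them. Inversion
  exchanges left and right translation at the cost of a modular factor, which is trivial on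
  \<open>S\<close> but not assumed trivial on the group. In the localization one good element per
  orbit is not enough: such elements must exist along a whole neighbourhood in the closed set,
  inside a subgroup compact modulo the centre. This fixes the order of the strata: each normal form
  relies on equations that earlier stages have imposed on the entire set, and \<tau>-invariance of
  the set mirrors a condition on the last block row into one on the first block column.\<close>

class mult_group = monoid_mult + inverse +
  assumes inv_mult_self [simp]: "inverse x * x = 1"
    and divide_eq: "x / y = x * inverse y"
begin

sublocale mg: group "(*)" 1 inverse
  by standard simp_all

lemma mult_inv_self [simp]: "x * inverse x = 1"
  by (rule mg.right_inverse)

lemma inv_mult_cancel [simp]: "inverse x * (x * y) = y"
  by (simp flip: mult.assoc)

lemma mult_inv_cancel [simp]: "x * (inverse x * y) = y"
  by (simp flip: mult.assoc)

lemma inv_mult_distrib [simp]: "inverse (x * y) = inverse y * inverse x"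
  by (rule mg.inverse_distrib_swap)

lemma inv_inv [simp]: "inverse (inverse x) = x"
  by (rule mg.inverse_inverse)

lemma inv_one [simp]: "inverse 1 = 1"
  by (rule mg.inverse_neutral)

lemma mult_left_cancel_iff [simp]: "x * y = x * z \<longleftrightarrow> y = z"
  by (rule mg.left_cancel)

lemma mult_right_cancel_iff [simp]: "y * x = z * x \<longleftrightarrow> y = z"
  by (rule mg.right_cancel)

lemma inv_unique: "x * y = 1 \<Longrightarrow> inverse x = y"
  by (rule mg.inverse_unique)

end

definition subgp :: "'g::mult_group set \<Rightarrow> bool" where
  "subgp K \<longleftrightarrow> 1 \<in> K \<and> (\<forall>x\<in>K. \<forall>y\<in>K. x * y \<in> K) \<and> (\<forall>x\<in>K. inverse x \<in> K)"

text \<open>This is \<open>x K x^-1\<close>, so conjugation acts on subgroups from the left.\<close>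

definition conjs :: "'g::mult_group \<Rightarrow> 'g set \<Rightarrow> 'g set" where
  "conjs x K = {y. inverse x * y * x \<in> K}"

definition lcos :: "'g::mult_group \<Rightarrow> 'g set \<Rightarrow> 'g set" where
  "lcos x L = {y. inverse x * y \<in> L}"

text \<open>The left cosets of \<open>L\<close> that meet \<open>A\<close>; the set \<open>A\<close>
  need not be a union of cosets.\<close>

definition cosets :: "'g::mult_group set \<Rightarrow> 'g set \<Rightarrow> 'g set set" where
  "cosets A L = (\<lambda>x. lcos x L) ` A"

text \<open>For subgroups this is the index of \<open>K \<inter> L\<close> in \<open>K\<close>;
  \<open>L\<close> need not lie in \<open>K\<close>.\<close>

definition idx :: "'g::mult_group set \<Rightarrow> 'g set \<Rightarrow> nat" where
  "idx K L = card (cosets K L)"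

definition rp :: "'g set \<Rightarrow> 'g" where
  "rp c = (SOME x. x \<in> c)"

definition rinv :: "'g::mult_group set \<Rightarrow> ('g \<Rightarrow> 'b) \<Rightarrow> bool" where
  "rinv L \<phi> \<longleftrightarrow> (\<forall>x. \<forall>k\<in>L. \<phi> (x * k) = \<phi> x)"

definition fsupp :: "'g::mult_group set \<Rightarrow> ('g \<Rightarrow> 'b::zero) \<Rightarrow> bool" where
  "fsupp L \<phi> \<longleftrightarrow> finite (cosets {x. \<phi> x \<noteq> 0} L)"

text \<open>The integral over \<open>G / L\<close> for counting measure of a right
  \<open>L\<close>-invariant function. Only cosets meeting the support enter, so the sum is finite
  although \<open>G / L\<close> is not.\<close>

definition tsum :: "'g::mult_group set \<Rightarrow> ('g \<Rightarrow> 'b::comm_monoid_add) \<Rightarrow> 'b" where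
  "tsum L \<phi> = (\<Sum>c\<in>cosets {x. \<phi> x \<noteq> 0} L. \<phi> (rp c))"

lemma subgpD:
  assumes "subgp K"
  shows "1 \<in> K" "x \<in> K \<Longrightarrow> y \<in> K \<Longrightarrow> x * y \<in> K" "x \<in> K \<Longrightarrow> inverse x \<in> K"
  using assms by (auto simp: subgp_def)

lemma subgp_conjs:
  assumes K: "subgp K"
  shows "subgp (conjs x K)"
  unfolding subgp_def
proof (intro conjI ballI)
  fix y z assume "y \<in> conjs x K" "z \<in> conjs x K"
  then have "inverse x * y * x * (inverse x * z * x) \<in> K"
    unfolding conjs_def using subgpD(2)[OF K] by blast
  then show "y * z \<in> conjs x K" by (simp add: conjs_def mult.assoc)
next
  fix y assume "y \<in> conjs x K"
  then have "inverse (inverse x * y * x) \<in> K"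
    unfolding conjs_def using subgpD(3)[OF K] by blast
  then show "inverse y \<in> conjs x K" by (simp add: conjs_def mult.assoc)
qed (simp add: conjs_def subgpD(1)[OF K])

lemma conjs_conjs: "conjs x (conjs y K) = conjs (x * y) K"
  by (auto simp: conjs_def mult.assoc)

lemma conjs_Int: "conjs x (K \<inter> L) = conjs x K \<inter> conjs x L"
  by (auto simp: conjs_def)

lemma conjs_one [simp]: "conjs 1 K = K"
  by (auto simp: conjs_def)

lemma conjs_mono: "K \<subseteq> L \<Longrightarrow> conjs x K \<subseteq> conjs x L"
  by (auto simp: conjs_def)

lemma conjs_self: "subgp K \<Longrightarrow> x \<in> K \<Longrightarrow> conjs x K = K"
  unfolding conjs_def
proof (intro set_eqI iffI; clarsimp)
  fix y assume K: "subgp K" "x \<in> K" "inverse x * y * x \<in> K"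
  have "y = x * (inverse x * y * x) * inverse x" by (simp add: mult.assoc)
  moreover have "x * (inverse x * y * x) * inverse x \<in> K"
    by (intro subgpD(2)[OF K(1) subgpD(2)[OF K(1) K(2,3)]] subgpD(3)[OF K(1,2)])
  ultimately show "y \<in> K" by simp
next
  fix y assume K: "subgp K" "x \<in> K" "y \<in> K"
  show "inverse x * y * x \<in> K"
    by (intro subgpD(2)[OF K(1) subgpD(2)[OF K(1) subgpD(3)[OF K(1,2)] K(3)] K(2)])
qed

lemma lcos_eq_iff: "subgp L \<Longrightarrow> lcos x L = lcos y L \<longleftrightarrow> inverse x * y \<in> L"
proof
  assume "subgp L" "lcos x L = lcos y L"
  then have "y \<in> lcos x L" by (simp add: lcos_def subgpD(1))
  then show "inverse x * y \<in> L" by (simp add: lcos_def)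
next
  assume L: "subgp L" "inverse x * y \<in> L"
  have "inverse x * z \<in> L \<longleftrightarrow> inverse y * z \<in> L" for z
  proof
    assume "inverse x * z \<in> L"
    then have "inverse (inverse x * y) * (inverse x * z) \<in> L" using L by (blast intro: subgpD)
    then show "inverse y * z \<in> L" by (simp add: mult.assoc)
  next
    assume "inverse y * z \<in> L"
    then have "(inverse x * y) * (inverse y * z) \<in> L" using L by (blast intro: subgpD)
    then show "inverse x * z \<in> L" by (simp add: mult.assoc)
  qed
  then show "lcos x L = lcos y L" by (auto simp: lcos_def)
qed

lemma mem_lcos_self: "subgp L \<Longrightarrow> x \<in> lcos x L"
  by (simp add: lcos_def subgpD)

lemma lcos_eqI: "subgp L \<Longrightarrow> y \<in> lcos x L \<Longrightarrow> lcos y L = lcos x L"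
  using lcos_eq_iff[of L x y] by (simp add: lcos_def)

lemma rp_lcos: "subgp L \<Longrightarrow> rp (lcos x L) \<in> lcos x L"
  unfolding rp_def by (rule someI) (rule mem_lcos_self)

lemma lcos_rp: "subgp L \<Longrightarrow> lcos (rp (lcos x L)) L = lcos x L"
  by (rule lcos_eqI[OF _ rp_lcos])

lemma lcos_rp': "subgp L \<Longrightarrow> c \<in> cosets A L \<Longrightarrow> lcos (rp c) L = c"
  by (auto simp: cosets_def lcos_rp)

lemma rinvD:
  assumes "rinv L \<phi>" "subgp L" "y \<in> lcos x L"
  shows "\<phi> y = \<phi> x"
proof -
  have "\<phi> (x * (inverse x * y)) = \<phi> x"
    using assms(1,3) unfolding rinv_def lcos_def by blast
  then show ?thesis by simp
qed

lemma rinv_rp: "rinv L \<phi> \<Longrightarrow> subgp L \<Longrightarrow> \<phi> (rp (lcos x L)) = \<phi> x"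
  by (rule rinvD[OF _ _ rp_lcos])

lemma rinv_mono: "rinv L \<phi> \<Longrightarrow> M \<subseteq> L \<Longrightarrow> rinv M \<phi>"
  by (auto simp: rinv_def)

text \<open>Cosets off the support contribute zero, so any finite set of cosets covering the support
  may index the sum; in this way two functions get a common index set.\<close>

lemma tsum_eq:
  assumes L: "subgp L" "rinv L \<phi>" and S: "finite S" "S \<subseteq> cosets UNIV L" "cosets {x. \<phi> x \<noteq> 0} L \<subseteq> S"
  shows "tsum L \<phi> = (\<Sum>c\<in>S. \<phi> (rp c))"
  unfolding tsum_def
proof (rule sum.mono_neutral_left[OF S(1,3)], safe)
  fix c assume c: "c \<in> S" "c \<notin> cosets {x. \<phi> x \<noteq> 0} L"
  then have "lcos (rp c) L = c" using S(2) L(1) lcos_rp' by blast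
  then show "\<phi> (rp c) = 0" using c(2) by (auto simp: cosets_def)
qed

lemma cosets_mono: "A \<subseteq> B \<Longrightarrow> cosets A L \<subseteq> cosets B L"
  by (auto simp: cosets_def)

lemma cosets_Un: "cosets (A \<union> B) L = cosets A L \<union> cosets B L"
  by (auto simp: cosets_def)

lemma fsupp_subset:
  "fsupp L \<phi> \<Longrightarrow> (\<And>x. \<psi> x \<noteq> 0 \<Longrightarrow> \<phi> x \<noteq> 0) \<Longrightarrow> fsupp L \<psi>"
  unfolding fsupp_def by (erule finite_subset[rotated]) (rule cosets_mono, blast)

lemma fsupp_add:
  fixes \<phi> :: "'g::mult_group \<Rightarrow> 'b::monoid_add"
  assumes "fsupp L \<phi>" "fsupp L \<psi>"
  shows "fsupp L (\<lambda>x. \<phi> x + \<psi> x)"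
proof -
  have "cosets {x. \<phi> x + \<psi> x \<noteq> 0} L \<subseteq> cosets {x. \<phi> x \<noteq> 0} L \<union> cosets {x. \<psi> x \<noteq> 0} L"
    unfolding cosets_Un[symmetric] by (rule cosets_mono) auto
  then show ?thesis using assms unfolding fsupp_def by (meson finite_UnI finite_subset)
qed

lemma tsum_add:
  assumes "subgp L" "rinv L \<phi>" "rinv L \<psi>" "fsupp L \<phi>" "fsupp L \<psi>"
  shows "tsum L (\<lambda>x. \<phi> x + \<psi> x) = tsum L \<phi> + tsum L \<psi>"
proof -
  let ?S = "cosets {x. \<phi> x \<noteq> 0} L \<union> cosets {x. \<psi> x \<noteq> 0} L"
  have S: "finite ?S" "?S \<subseteq> cosets UNIV L"
    using assms unfolding fsupp_def by (auto simp: cosets_def)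
  have "cosets {x. \<phi> x + \<psi> x \<noteq> 0} L \<subseteq> ?S"
    unfolding cosets_Un[symmetric] by (rule cosets_mono) auto
  moreover have "rinv L (\<lambda>x. \<phi> x + \<psi> x)" using assms by (simp add: rinv_def)
  ultimately show ?thesis
    using S assms by (simp add: tsum_eq[where S = ?S] sum.distrib)
qed

lemma tsum_hom:
  assumes L: "subgp L" "rinv L \<phi>" "fsupp L \<phi>" and h: "h 0 = 0" "\<And>a b. h (a + b) = h a + h b"
  shows "h (tsum L \<phi>) = tsum L (\<lambda>x. h (\<phi> x))"
proof -
  let ?S = "cosets {x. \<phi> x \<noteq> 0} L"
  have S: "finite ?S" "?S \<subseteq> cosets UNIV L"
    using assms unfolding fsupp_def by (auto simp: cosets_def)
  have "cosets {x. h (\<phi> x) \<noteq> 0} L \<subseteq> ?S"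
    by (rule cosets_mono) (auto simp: h)
  moreover have "rinv L (\<lambda>x. h (\<phi> x))" using L by (simp add: rinv_def)
  ultimately have "tsum L (\<lambda>x. h (\<phi> x)) = (\<Sum>c\<in>?S. h (\<phi> (rp c)))"
    using S L by (intro tsum_eq)
  also have "\<dots> = h (\<Sum>c\<in>?S. \<phi> (rp c))"
    using S(1) by (induction rule: finite_induct) (auto simp: h)
  finally show ?thesis by (simp add: tsum_def)
qed

lemma tsum_mult_left:
  fixes \<phi> :: "'g::mult_group \<Rightarrow> 'a::semiring_0"
  assumes "subgp L" "rinv L \<phi>" "fsupp L \<phi>"
  shows "tsum L (\<lambda>x. a * \<phi> x) = a * tsum L \<phi>"
  by (rule tsum_hom[OF assms, symmetric]) (auto simp: algebra_simps)

lemma lcos_translate: "(\<lambda>x. g * x * s) ` lcos x (conjs s L) = lcos (g * x * s) L"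
proof (intro set_eqI iffI)
  fix y assume "y \<in> lcos (g * x * s) L"
  then have "inverse g * y * inverse s \<in> lcos x (conjs s L)"
    by (simp add: lcos_def conjs_def mult.assoc)
  moreover have "y = g * (inverse g * y * inverse s) * s" by (simp add: mult.assoc)
  ultimately show "y \<in> (\<lambda>x. g * x * s) ` lcos x (conjs s L)" by blast
qed (auto simp: lcos_def conjs_def mult.assoc)

lemma rinv_translate: "rinv L \<phi> \<Longrightarrow> rinv (conjs s L) (\<lambda>x. \<phi> (g * x * s))"
  unfolding rinv_def conjs_def
proof clarify
  fix x k assume *: "\<forall>x. \<forall>k\<in>L. \<phi> (x * k) = \<phi> x" "inverse s * k * s \<in> L"
  have "g * (x * k) * s = g * x * s * (inverse s * k * s)" by (simp add: mult.assoc)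
  then show "\<phi> (g * (x * k) * s) = \<phi> (g * x * s)" using * by metis
qed

lemma cosets_translate:
  "cosets {x. P (g * x * s)} (conjs s L)
    = (\<lambda>c. (\<lambda>x. inverse g * x * inverse s) ` c) ` cosets {x. P x} L"
proof -
  have *: "(\<lambda>x. inverse g * x * inverse s) ` lcos y L = lcos (inverse g * y * inverse s) (conjs s L)" for y
    using lcos_translate[of "inverse g" "inverse s" y "conjs s L"] by (simp add: conjs_conjs)
  have "{x. P (g * x * s)} = (\<lambda>x. inverse g * x * inverse s) ` {x. P x}"
  proof (intro set_eqI iffI)
    fix x assume "x \<in> {x. P (g * x * s)}"
    moreover have "x = inverse g * (g * x * s) * inverse s" by (simp add: mult.assoc)
    ultimately show "x \<in> (\<lambda>x. inverse g * x * inverse s) ` {x. P x}" by blast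
  qed (auto simp: mult.assoc)
  then show ?thesis by (auto simp: cosets_def image_image *)
qed

lemma fsupp_translate: "fsupp L \<phi> \<Longrightarrow> fsupp (conjs s L) (\<lambda>x. \<phi> (g * x * s))"
  unfolding fsupp_def by (simp add: cosets_translate[where P = "\<lambda>x. \<phi> x \<noteq> 0"])

text \<open>Left translation permutes the cosets, while right translation by \<open>s\<close> turns
  left cosets of \<open>L\<close> into left cosets of \<open>s L s^-1\<close>; hence the subgroup
  changes along with the function.\<close>

lemma tsum_translate:
  assumes "subgp L" "rinv L \<phi>"
  shows "tsum (conjs s L) (\<lambda>x. \<phi> (g * x * s)) = tsum L \<phi>"
proof -
  let ?F = "\<lambda>c. (\<lambda>x. inverse g * x * inverse s) ` c"
  have inj: "inj_on ?F A" for A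
    by (rule inj_on_inverseI[where g = "\<lambda>c. (\<lambda>x. g * x * s) ` c"]) (simp add: image_image mult.assoc)
  have "tsum (conjs s L) (\<lambda>x. \<phi> (g * x * s)) = (\<Sum>c\<in>cosets {x. \<phi> x \<noteq> 0} L. \<phi> (g * rp (?F c) * s))"
    unfolding tsum_def cosets_translate[where P = "\<lambda>x. \<phi> x \<noteq> 0"] by (subst sum.reindex[OF inj]) simp
  also have "\<dots> = tsum L \<phi>"
    unfolding tsum_def
  proof (intro sum.cong refl)
    fix c assume "c \<in> cosets {x. \<phi> x \<noteq> 0} L"
    then have c: "lcos (rp c) L = c" using assms lcos_rp' by blast
    have F: "?F c = lcos (inverse g * rp c * inverse s) (conjs s L)"
      using lcos_translate[of "inverse g" "inverse s" "rp c" "conjs s L"] c by (simp add: conjs_conjs)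
    then have "rp (?F c) \<in> ?F c" using rp_lcos[OF subgp_conjs[OF assms(1)]] by metis
    then have "g * rp (?F c) * s \<in> c" by (auto simp: mult.assoc)
    then show "\<phi> (g * rp (?F c) * s) = \<phi> (rp c)"
      by (intro rinvD[OF assms(2,1)]) (simp add: c)
  qed
  finally show ?thesis .
qed

text \<open>Each coset \<open>x L\<close> splits into the cosets \<open>x d M\<close> with
  \<open>d\<close> running through \<open>L / M\<close>; chosen representatives turn this into a
  bijection with pairs. Multiplicativity of indices and the change of level in sums both rest on
  it.\<close>

lemma cosets_refine:
  assumes L: "subgp L" "subgp M" "M \<subseteq> L" and A: "\<And>x k. x \<in> A \<Longrightarrow> k \<in> L \<Longrightarrow> x * k \<in> A"
  shows "bij_betw (\<lambda>(c, d). lcos (rp c * rp d) M) (cosets A L \<times> cosets L M) (cosets A M)"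
proof (rule bij_betw_imageI)
  show "inj_on (\<lambda>(c, d). lcos (rp c * rp d) M) (cosets A L \<times> cosets L M)"
  proof (rule inj_onI)
  fix p q assume p: "p \<in> cosets A L \<times> cosets L M" and q: "q \<in> cosets A L \<times> cosets L M"
    and eq: "(case p of (c, d) \<Rightarrow> lcos (rp c * rp d) M) = (case q of (c, d) \<Rightarrow> lcos (rp c * rp d) M)"
  obtain c d where [simp]: "p = (c, d)" by force
  obtain c' d' where [simp]: "q = (c', d')" by force
  have m: "c \<in> cosets A L" "c' \<in> cosets A L" "d \<in> cosets L M" "d' \<in> cosets L M"
    using p q by simp_all
  have cd: "lcos (rp c) L = c" "lcos (rp c') L = c'" "lcos (rp d) M = d" "lcos (rp d') M = d'"
    by (rule lcos_rp'[OF L(1) m(1)] lcos_rp'[OF L(1) m(2)] lcos_rp'[OF L(2) m(3)] lcos_rp'[OF L(2) m(4)])+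
  have d: "rp d \<in> L" "rp d' \<in> L"
  proof -
    have "rp d \<in> L" if "d \<in> cosets L M" for d
    proof -
      obtain x where x: "x \<in> L" "d = lcos x M" using \<open>d \<in> cosets L M\<close> by (auto simp: cosets_def)
      then have "inverse x * rp d \<in> L" using rp_lcos[OF L(2), of x] L(3) by (auto simp: lcos_def)
      then have "x * (inverse x * rp d) \<in> L" by (rule subgpD(2)[OF L(1) x(1)])
      then show ?thesis by simp
    qed
    then show "rp d \<in> L" "rp d' \<in> L" using m by auto
  qed
  have e: "inverse (rp d) * (inverse (rp c) * rp c') * rp d' \<in> M"
    using eq by (simp add: lcos_eq_iff L mult.assoc)
  then have "rp d * (inverse (rp d) * (inverse (rp c) * rp c') * rp d') * inverse (rp d') \<in> L"
    using L(3) by (intro subgpD(2)[OF L(1) subgpD(2)[OF L(1) d(1)] subgpD(3)[OF L(1) d(2)]]) blast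
  then have "inverse (rp c) * rp c' \<in> L" by (simp add: mult.assoc)
  then have cc: "c = c'" using cd(1,2) lcos_eq_iff[OF L(1), of "rp c" "rp c'"] by simp
  then have "inverse (rp d) * rp d' \<in> M" using e by (simp add: mult.assoc)
  then have "d = d'" using cd(3,4) lcos_eq_iff[OF L(2), of "rp d" "rp d'"] by simp
  then show "p = q" using cc by simp
  qed
  show "(\<lambda>(c, d). lcos (rp c * rp d) M) ` (cosets A L \<times> cosets L M) = cosets A M"
  proof (rule set_eqI, rule iffI)
  fix e assume "e \<in> (\<lambda>(c, d). lcos (rp c * rp d) M) ` (cosets A L \<times> cosets L M)"
  then obtain x l where x: "x \<in> A" "l \<in> L" and e: "e = lcos (rp (lcos x L) * rp (lcos l M)) M"
    by (auto simp: cosets_def)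
  have a: "inverse x * rp (lcos x L) \<in> L" using rp_lcos[OF L(1), of x] by (simp add: lcos_def)
  have b: "inverse l * rp (lcos l M) \<in> L" using rp_lcos[OF L(2), of l] L(3) by (auto simp: lcos_def)
  have "inverse x * rp (lcos x L) * (l * (inverse l * rp (lcos l M))) \<in> L"
    by (rule subgpD(2)[OF L(1) a subgpD(2)[OF L(1) x(2) b]])
  then have "x * (inverse x * rp (lcos x L) * (l * (inverse l * rp (lcos l M)))) \<in> A" by (rule A[OF x(1)])
  then have "rp (lcos x L) * rp (lcos l M) \<in> A" by (simp add: mult.assoc)
  then show "e \<in> cosets A M" unfolding e cosets_def by (rule imageI)
next
  fix e assume "e \<in> cosets A M"
  then obtain x where x: "x \<in> A" "e = lcos x M" by (auto simp: cosets_def)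
  let ?c = "lcos x L"
  have r: "inverse (rp ?c) * x \<in> L" using rp_lcos[OF L(1), of x] L subgpD(3)[OF L(1), of "inverse x * rp ?c"]
    by (simp add: lcos_def)
  let ?d = "lcos (inverse (rp ?c) * x) M"
  have "inverse (rp ?c) * x \<in> lcos (rp ?d) M"
    unfolding lcos_rp[OF L(2)] by (rule mem_lcos_self[OF L(2)])
  then have "inverse (rp ?d) * (inverse (rp ?c) * x) \<in> M" by (simp only: lcos_def mem_Collect_eq)
  then have "lcos (rp ?c * rp ?d) M = e"
    by (simp only: x(2) lcos_eq_iff[OF L(2)] inv_mult_distrib mult.assoc)
  moreover have "(?c, ?d) \<in> cosets A L \<times> cosets L M"
    using x(1) r unfolding cosets_def by blast
  ultimately show "e \<in> (\<lambda>(c, d). lcos (rp c * rp d) M) ` (cosets A L \<times> cosets L M)"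
    by (metis (no_types, lifting) case_prod_conv image_eqI)
  qed
qed

lemma tsum_refine:
  assumes L: "subgp L" "subgp M" "M \<subseteq> L" and fin: "finite (cosets L M)"
    and S: "finite (cosets {x. P x} L)" "rinv L P"
    and \<phi>: "rinv M \<phi>" "\<And>x. \<phi> x \<noteq> 0 \<Longrightarrow> P x"
  shows "tsum M \<phi> = (\<Sum>c\<in>cosets {x. P x} L. \<Sum>d\<in>cosets L M. \<phi> (rp c * rp d))"
proof -
  let ?A = "{x. P x}"
  have A: "x * k \<in> ?A" if "x \<in> ?A" "k \<in> L" for x k using S(2) that by (auto simp: rinv_def)
  have bij: "bij_betw (\<lambda>(c, d). lcos (rp c * rp d) M) (cosets ?A L \<times> cosets L M) (cosets ?A M)"
    by (rule cosets_refine[OF L A])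
  have fA: "finite (cosets ?A M)" using bij fin S by (metis bij_betw_finite finite_cartesian_product)
  have "tsum M \<phi> = (\<Sum>e\<in>cosets ?A M. \<phi> (rp e))"
    using L \<phi> fA by (intro tsum_eq cosets_mono) auto
  also have "\<dots> = (\<Sum>(c, d)\<in>cosets ?A L \<times> cosets L M. \<phi> (rp (lcos (rp c * rp d) M)))"
    by (subst sum.reindex_bij_betw[OF bij, symmetric]) (simp add: case_prod_unfold)
  also have "\<dots> = (\<Sum>(c, d)\<in>cosets ?A L \<times> cosets L M. \<phi> (rp c * rp d))"
    by (simp add: rinv_rp \<phi> L)
  finally show ?thesis by (simp add: sum.cartesian_product)
qed

lemma idx_mult:
  assumes L: "subgp L" "subgp M" "M \<subseteq> L" "L \<subseteq> K" "subgp K" 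
  shows "idx K M = idx K L * idx L M"
  unfolding idx_def
  using bij_betw_same_card[OF cosets_refine[OF L(1,2,3), of K]] L(4) subgpD(2)[OF L(5)]
  by (simp add: card_cartesian_product subset_iff)

section \<open>Modulus\<close>

text \<open>An abstraction of the open subgroups that are compact modulo the centre. Any two members
  are commensurable, and this replaces the topology in all counting arguments.\<close>

locale coset_system =
  fixes KK :: "'g::mult_group set set"
  assumes KK_subgp: "K \<in> KK \<Longrightarrow> subgp K"
    and KK_nonempty: "KK \<noteq> {}"
    and KK_Int: "K \<in> KK \<Longrightarrow> L \<in> KK \<Longrightarrow> K \<inter> L \<in> KK"
    and KK_conjs: "K \<in> KK \<Longrightarrow> conjs x K \<in> KK"
    and KK_finite: "K \<in> KK \<Longrightarrow> L \<in> KK \<Longrightarrow> finite (cosets K L)"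
begin

definition K0 where "K0 = (SOME K. K \<in> KK)"

lemma K0: "K0 \<in> KK"
  unfolding K0_def using KK_nonempty by (simp add: some_in_eq)

text \<open>Haar volume normalized at \<open>K0\<close>, computed as the ratio of the indices of the
  intersection in the two groups.\<close>

definition mu :: "'g set \<Rightarrow> real" where
  "mu K = real (idx K (K \<inter> K0)) / real (idx K0 (K \<inter> K0))"

lemma idx_pos: "K \<in> KK \<Longrightarrow> L \<in> KK \<Longrightarrow> idx K L > 0"
  unfolding idx_def using KK_finite subgpD(1)[OF KK_subgp] by (auto simp: card_gt_0_iff cosets_def)

lemma mu_pos: "K \<in> KK \<Longrightarrow> mu K > 0"
  unfolding mu_def using idx_pos KK_Int K0 by simp

lemma mu_eq:
  assumes "K \<in> KK" "M \<in> KK" "M \<subseteq> K" "M \<subseteq> K0"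
  shows "mu K = real (idx K M) / real (idx K0 M)"
proof -
  have "idx K M = idx K (K \<inter> K0) * idx (K \<inter> K0) M" "idx K0 M = idx K0 (K \<inter> K0) * idx (K \<inter> K0) M"
    using assms K0 KK_Int KK_subgp by (auto intro!: idx_mult)
  moreover have "idx (K \<inter> K0) M > 0" using idx_pos KK_Int K0 assms by blast
  ultimately show ?thesis by (simp add: mu_def)
qed

lemma mu_idx:
  assumes "K \<in> KK" "L \<in> KK" "L \<subseteq> K"
  shows "mu K = real (idx K L) * mu L"
proof -
  have "L \<inter> K0 \<in> KK" using assms K0 KK_Int by blast
  moreover from this have "idx K (L \<inter> K0) = idx K L * idx L (L \<inter> K0)"
    using assms K0 KK_Int KK_subgp by (intro idx_mult) auto
  ultimately show ?thesis
    using assms by (subst (1 2) mu_eq[where M = "L \<inter> K0"]) auto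
qed

lemma idx_conjs: "idx (conjs x K) (conjs x L) = idx K L"
proof -
  have "cosets (conjs x K) (conjs x L) = (\<lambda>c. (\<lambda>y. x * y * inverse x) ` c) ` cosets K L"
    using cosets_translate[where P = "\<lambda>y. y \<in> K" and g = "inverse x" and s = x and L = L]
    by (simp add: conjs_def)
  moreover have "inj_on (\<lambda>c. (\<lambda>y. x * y * inverse x) ` c) A" for A
    by (rule inj_on_inverseI[where g = "\<lambda>c. (\<lambda>y. inverse x * y * x) ` c"]) (simp add: image_image mult.assoc)
  ultimately show ?thesis by (simp add: idx_def card_image)
qed

definition modulus :: "'g \<Rightarrow> real" where
  "modulus x = mu (conjs (inverse x) K0) / mu K0"

text \<open>Conjugation preserves indices, so the ratio of the volumes before and after conjugation
  is unchanged on passing to a commensurable group. Comparing \<open>K\<close> and \<open>K0\<close>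
  with \<open>K \<inter> K0\<close> yields the factor defined by \<open>K0\<close>.\<close>

lemma mu_conjs:
  assumes "K \<in> KK"
  shows "mu (conjs (inverse x) K) = modulus x * mu K"
proof -
  let ?L = "K \<inter> K0"
  have L: "?L \<in> KK" using assms K0 KK_Int by blast
  have *: "mu (conjs (inverse x) M) = real (idx M ?L) * mu (conjs (inverse x) ?L)" "mu M = real (idx M ?L) * mu ?L"
    if "M \<in> KK" "?L \<subseteq> M" for M
    using mu_idx[OF KK_conjs[OF that(1), of "inverse x"] KK_conjs[OF L] conjs_mono[OF that(2)]] mu_idx[OF that(1) L that(2)]
    by (auto simp: idx_conjs)
  show ?thesis
    unfolding modulus_def using *[OF assms] *[OF K0] mu_pos[OF L] idx_pos[OF assms L] idx_pos[OF K0 L] by simp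
qed

lemma modulus_mult: "modulus (x * y) = modulus x * modulus y"
proof -
  have "modulus (x * y) * mu K0 = mu (conjs (inverse y) (conjs (inverse x) K0))"
    by (simp add: mu_conjs[OF K0, symmetric] conjs_conjs)
  also have "\<dots> = modulus y * (modulus x * mu K0)"
    by (simp add: mu_conjs KK_conjs K0)
  finally show ?thesis using mu_pos[OF K0] by simp
qed

lemma modulus_pos: "modulus x > 0"
  unfolding modulus_def using mu_pos KK_conjs K0 by simp

text \<open>An element normalizes every subgroup that contains it, so conjugation by it leaves the
  volume of that subgroup unchanged.\<close>

lemma modulus_eq_1: "K \<in> KK \<Longrightarrow> x \<in> K \<Longrightarrow> modulus x = 1"
  using mu_conjs[of K x] conjs_self[OF KK_subgp, of K "inverse x"] mu_pos[of K]
    subgpD(3)[OF KK_subgp, of K x] by auto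

definition dcos :: "'g set \<Rightarrow> 'g \<Rightarrow> 'g set" where
  "dcos K x = {k * x * l | k l. k \<in> K \<and> l \<in> K}"

lemma cosets_dcos:
  assumes "subgp K"
  shows "cosets (dcos K x) K = (\<lambda>k. lcos (k * x) K) ` K"
proof (intro set_eqI iffI)
  fix c assume "c \<in> cosets (dcos K x) K"
  then obtain k l where "k \<in> K" "l \<in> K" "c = lcos (k * x * l) K" by (auto simp: cosets_def dcos_def)
  moreover from this have "c = lcos (k * x) K"
    using assms lcos_eq_iff[OF assms, of "k * x" "k * x * l"] by (simp add: mult.assoc)
  ultimately show "c \<in> (\<lambda>k. lcos (k * x) K) ` K" by blast
next
  fix c assume "c \<in> (\<lambda>k. lcos (k * x) K) ` K"
  then obtain k where "k \<in> K" "c = lcos (k * x * 1) K" by auto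
  then show "c \<in> cosets (dcos K x) K" using subgpD(1)[OF assms] unfolding cosets_def dcos_def by blast
qed

text \<open>\<open>K\<close> acts transitively on the left cosets in \<open>K x K\<close>, and the
  stabilizer of \<open>x K\<close> is \<open>K \<inter> x K x^-1\<close>.\<close>

lemma card_cosets_dcos:
  assumes "K \<in> KK"
  shows "card (cosets (dcos K x) K) = idx K (K \<inter> conjs x K)"
proof -
  have K: "subgp K" "subgp (K \<inter> conjs x K)" using assms KK_subgp KK_Int KK_conjs by auto
  have "lcos (k * x) K = lcos (l * x) K \<longleftrightarrow> lcos k (K \<inter> conjs x K) = lcos l (K \<inter> conjs x K)"
    if "k \<in> K" "l \<in> K" for k l
    using that K subgpD[OF K(1)] by (auto simp: lcos_eq_iff conjs_def mult.assoc)
  then have "bij_betw (\<lambda>c. lcos (rp c * x) K) (cosets K (K \<inter> conjs x K)) ((\<lambda>k. lcos (k * x) K) ` K)"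
  proof -
    assume eq: "\<And>k l. k \<in> K \<Longrightarrow> l \<in> K \<Longrightarrow> lcos (k * x) K = lcos (l * x) K \<longleftrightarrow> lcos k (K \<inter> conjs x K) = lcos l (K \<inter> conjs x K)"
    let ?M = "K \<inter> conjs x K"
    have r: "rp (lcos k ?M) \<in> K" if "k \<in> K" for k
      using rp_lcos[OF K(2), of k] that subgpD(2)[OF K(1), of k "inverse k * rp (lcos k ?M)"] by (auto simp: lcos_def)
    have "lcos (rp (lcos k ?M) * x) K = lcos (k * x) K" if "k \<in> K" for k
      using eq[OF r[OF that] that] lcos_rp[OF K(2)] by simp
    then show ?thesis unfolding bij_betw_def inj_on_def cosets_def
      using eq by (auto simp: image_image)
  qed
  then show ?thesis
    unfolding cosets_dcos[OF K(1)] idx_def by (metis bij_betw_same_card)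
qed

text \<open>\<open>K \<inter> x^-1 K x\<close> is the conjugate of
  \<open>K \<inter> x K x^-1\<close> by \<open>x^-1\<close>, so the two indices in \<open>K\<close>
  differ by the modulus.\<close>

lemma card_dcos_inverse:
  assumes "K \<in> KK"
  shows "real (card (cosets (dcos K x) K)) = modulus x * real (card (cosets (dcos K (inverse x)) K))"
proof -
  let ?M = "K \<inter> conjs x K"
  have M: "?M \<in> KK" "K \<inter> conjs (inverse x) K \<in> KK" using assms KK_Int KK_conjs by auto
  have "conjs (inverse x) ?M = K \<inter> conjs (inverse x) K" by (auto simp: conjs_Int conjs_conjs)
  then have "mu (K \<inter> conjs (inverse x) K) = modulus x * mu ?M" using mu_conjs[OF M(1)] by metis
  moreover have "mu K = real (idx K ?M) * mu ?M" "mu K = real (idx K (K \<inter> conjs (inverse x) K)) * mu (K \<inter> conjs (inverse x) K)"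
    by (rule mu_idx[OF assms]; use M in blast)+
  ultimately show ?thesis
    using mu_pos[OF M(1)] by (simp add: card_cosets_dcos assms mult.commute)
qed

end

section \<open>Supercuspidal representations\<close>

text \<open>Compact support modulo the centre becomes finiteness of a set of cosets
  \<open>K x\<close>, the members of \<open>KK\<close> being meant to contain the centre. A
  functional fixed by some member of \<open>KK\<close> plays the role of a vector of the smooth
  dual.\<close>

locale cuspidal_rep = vector_space smul + coset_system KK
  for smul :: "complex \<Rightarrow> 'v::ab_group_add \<Rightarrow> 'v"
    and KK :: "'g::mult_group set set" +
  fixes \<rho> :: "'g \<Rightarrow> 'v \<Rightarrow> 'v"
  assumes rho_linear: "Vector_Spaces.linear smul smul (\<rho> g)"
    and rho_one [simp]: "\<rho> 1 v = v"
    and rho_mult: "\<rho> (g * h) v = \<rho> g (\<rho> h v)"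
    and rho_smooth: "\<exists>K\<in>KK. \<forall>k\<in>K. \<rho> k v = v"
    and irreducible: "subspace W \<Longrightarrow> (\<And>g v. v \<in> W \<Longrightarrow> \<rho> g v \<in> W) \<Longrightarrow> W = {0} \<or> W = UNIV"
    and cuspidal: "Vector_Spaces.linear smul (*) \<xi> \<Longrightarrow> K \<in> KK \<Longrightarrow> (\<And>k v. k \<in> K \<Longrightarrow> \<xi> (\<rho> k v) = \<xi> v)
      \<Longrightarrow> finite ((\<lambda>x. (\<lambda>k. k * x) ` K) ` {x. \<xi> (\<rho> x v) \<noteq> 0})"
begin

abbreviation lfun :: "('v \<Rightarrow> complex) \<Rightarrow> bool" where
  "lfun \<equiv> Vector_Spaces.linear smul (*)"

lemma vs_complex: "vector_space ((*) :: complex \<Rightarrow> complex \<Rightarrow> complex)"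
  by unfold_locales (auto simp: algebra_simps)

lemma vs_pair: "vector_space_pair smul ((*) :: complex \<Rightarrow> complex \<Rightarrow> complex)"
  by (intro vector_space_pair.intro vector_space_axioms vs_complex)

lemma lfunI: "(\<And>v w. \<xi> (v + w) = \<xi> v + \<xi> w) \<Longrightarrow> (\<And>c v. \<xi> (smul c v) = c * \<xi> v) \<Longrightarrow> lfun \<xi>"
  using vector_space_axioms vs_complex by (simp add: Vector_Spaces.linear_iff)

lemma lfunD:
  assumes "lfun \<xi>"
  shows "\<xi> (v + w) = \<xi> v + \<xi> w" "\<xi> (smul c v) = c * \<xi> v" "\<xi> 0 = 0" "\<xi> (v - w) = \<xi> v - \<xi> w"
    "\<xi> (sum f A) = (\<Sum>a\<in>A. \<xi> (f a))"
proof -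
  interpret Vector_Spaces.linear smul "(*)" \<xi> by fact
  show "\<xi> (v + w) = \<xi> v + \<xi> w" "\<xi> (smul c v) = c * \<xi> v" "\<xi> 0 = 0" "\<xi> (v - w) = \<xi> v - \<xi> w"
    "\<xi> (sum f A) = (\<Sum>a\<in>A. \<xi> (f a))"
    by (auto simp: add scale diff sum)
qed

lemma rhoD:
  "\<rho> g (v + w) = \<rho> g v + \<rho> g w" "\<rho> g (smul c v) = smul c (\<rho> g v)" "\<rho> g 0 = 0"
  "\<rho> g (v - w) = \<rho> g v - \<rho> g w" "\<rho> g (sum f A) = (\<Sum>a\<in>A. \<rho> g (f a))"
proof -
  interpret Vector_Spaces.linear smul smul "\<rho> g" by (rule rho_linear)
  show "\<rho> g (v + w) = \<rho> g v + \<rho> g w" "\<rho> g (smul c v) = smul c (\<rho> g v)" "\<rho> g 0 = 0"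
    "\<rho> g (v - w) = \<rho> g v - \<rho> g w" "\<rho> g (sum f A) = (\<Sum>a\<in>A. \<rho> g (f a))"
    by (auto simp: add scale diff sum)
qed

lemma rho_inv [simp]: "\<rho> (inverse g) (\<rho> g v) = v" "\<rho> g (\<rho> (inverse g) v) = v"
  by (simp_all flip: rho_mult)

definition fixd :: "'g set \<Rightarrow> 'v set" where
  "fixd K = {v. \<forall>k\<in>K. \<rho> k v = v}"

lemma fixd_subspace: "subspace (fixd K)"
  by (auto simp: fixd_def subspace_def rhoD)

lemma fixd_mono: "K \<subseteq> L \<Longrightarrow> fixd L \<subseteq> fixd K"
  by (auto simp: fixd_def)

lemma fixd_translate: "v \<in> fixd K \<Longrightarrow> \<rho> g v \<in> fixd (conjs g K)"
  unfolding fixd_def conjs_def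
proof (intro CollectI ballI)
  fix k assume *: "v \<in> {v. \<forall>k\<in>K. \<rho> k v = v}" "k \<in> {y. inverse g * y * g \<in> K}"
  have "\<rho> k (\<rho> g v) = \<rho> (g * (inverse g * k * g)) v" by (simp add: mult.assoc rho_mult)
  also have "\<dots> = \<rho> g v" using * unfolding rho_mult[of g] by auto
  finally show "\<rho> k (\<rho> g v) = \<rho> g v" .
qed

lemma rinv_rho: "v \<in> fixd K \<Longrightarrow> rinv K (\<lambda>x. \<rho> x v)"
  by (auto simp: rinv_def fixd_def rho_mult)

lemma cyclic_span:
  assumes "v \<noteq> 0"
  shows "span (range (\<lambda>g. \<rho> g v)) = UNIV"
proof -
  have "\<rho> g w \<in> span (range (\<lambda>g. \<rho> g v))" if "w \<in> span (range (\<lambda>g. \<rho> g v))" for g w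
    using that
  proof (induction rule: span_induct_alt)
    case (step c x y)
    then show ?case
      by (auto simp: rhoD simp flip: rho_mult intro!: span_add span_scale intro: span_base)
  qed (simp add: rhoD span_zero)
  then have "span (range (\<lambda>g. \<rho> g v)) = {0} \<or> span (range (\<lambda>g. \<rho> g v)) = UNIV"
    by (intro irreducible) auto
  moreover have "v \<in> span (range (\<lambda>g. \<rho> g v))"
    by (rule span_base) (metis rangeI rho_one)
  ultimately show ?thesis using assms by auto
qed

text \<open>The vectors all of whose translates are killed by \<xi> form an invariant subspace, and
  this subspace is not everything.\<close>

lemma lfun_orbit_zero:
  assumes "lfun \<xi>" "\<xi> w \<noteq> 0" "\<And>g. \<xi> (\<rho> g v) = 0"
  shows "v = 0"
proof -
  have "{v. \<forall>g. \<xi> (\<rho> g v) = 0} = {0} \<or> {v. \<forall>g. \<xi> (\<rho> g v) = 0} = UNIV"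
    by (rule irreducible) (auto simp: subspace_def rhoD lfunD[OF assms(1)] simp flip: rho_mult)
  then show ?thesis
  proof
    assume "{v. \<forall>g. \<xi> (\<rho> g v) = 0} = UNIV"
    then have "\<xi> (\<rho> 1 w) = 0" by blast
    then show ?thesis using assms(2) by simp
  qed (use assms(3) in blast)
qed

subsection \<open>Averaging\<close>

definition csum :: "'g set \<Rightarrow> 'g set \<Rightarrow> 'v \<Rightarrow> 'v" where
  "csum K M v = (\<Sum>c\<in>cosets K M. \<rho> (rp c) v)"

lemma KKD: "K \<in> KK \<Longrightarrow> M \<in> KK \<Longrightarrow> finite (cosets K M)" "K \<in> KK \<Longrightarrow> subgp K"
  by (auto intro: KK_finite KK_subgp)

lemma csum_tsum:
  assumes "K \<in> KK" "M \<in> KK" "M \<subseteq> K" "v \<in> fixd M"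
  shows "csum K M v = tsum M (\<lambda>x. if x \<in> K then \<rho> x v else 0)"
proof -
  have K: "x * k \<in> K \<longleftrightarrow> x \<in> K" if "k \<in> M" for x k
    using that assms(3) subgpD(2)[OF KKD(2)[OF assms(1)], of x k]
      subgpD(2)[OF KKD(2)[OF assms(1)], of "x * k" "inverse k"] subgpD(3)[OF KKD(2)[OF assms(1)], of k]
    by (auto simp: mult.assoc)
  have "rinv M (\<lambda>x. if x \<in> K then \<rho> x v else 0)"
    using assms(4) by (auto simp: rinv_def K fixd_def rho_mult)
  then have "tsum M (\<lambda>x. if x \<in> K then \<rho> x v else 0) = (\<Sum>c\<in>cosets K M. if rp c \<in> K then \<rho> (rp c) v else 0)"
    using assms KKD by (intro tsum_eq cosets_mono) (auto split: if_splits)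
  also have "\<dots> = csum K M v"
    unfolding csum_def
  proof (intro sum.cong refl)
    fix c assume "c \<in> cosets K M"
    then obtain x where x: "x \<in> K" "c = lcos x M" by (auto simp: cosets_def)
    then have "inverse x * rp c \<in> M" using rp_lcos[OF KKD(2)[OF assms(2)], of x] by (simp add: lcos_def)
    then have "rp c \<in> K" using K[of "inverse x * rp c" x] x by simp
    then show "(if rp c \<in> K then \<rho> (rp c) v else 0) = \<rho> (rp c) v" by simp
  qed
  finally show ?thesis by simp
qed

lemma sum_const_smul: "finite A \<Longrightarrow> (\<Sum>a\<in>A. v) = smul (of_nat (card A)) v"
  by (induction rule: finite_induct) (auto simp: scale_left_distrib add.commute)

lemma csum_const: "K \<in> KK \<Longrightarrow> M \<in> KK \<Longrightarrow> M \<subseteq> K \<Longrightarrow> v \<in> fixd K \<Longrightarrow> csum K M v = smul (of_nat (idx K M)) v"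
proof -
  assume *: "K \<in> KK" "M \<in> KK" "M \<subseteq> K" "v \<in> fixd K"
  have "rp c \<in> K" if "c \<in> cosets K M" for c
  proof -
    from that obtain x where x: "x \<in> K" "c = lcos x M" by (auto simp: cosets_def)
    then have "inverse x * rp c \<in> K" using rp_lcos[OF KKD(2)[OF *(2)], of x] *(3) by (auto simp: lcos_def)
    then have "x * (inverse x * rp c) \<in> K" by (rule subgpD(2)[OF KKD(2)[OF *(1)] x(1)])
    then show ?thesis by simp
  qed
  then have "csum K M v = (\<Sum>c\<in>cosets K M. v)"
    unfolding csum_def using *(4) by (intro sum.cong) (auto simp: fixd_def)
  then show ?thesis using KKD(1)[OF *(1,2)] by (simp add: sum_const_smul idx_def)
qed

lemma csum_translate:
  assumes "K \<in> KK" "M \<in> KK" "M \<subseteq> K" "v \<in> fixd M" "k \<in> K"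
  shows "\<rho> k (csum K M v) = csum K M v"
proof -
  let ?\<phi> = "\<lambda>x. if x \<in> K then \<rho> x v else 0"
  have K: "x * l \<in> K \<longleftrightarrow> x \<in> K" if "l \<in> M" for x l
    using that assms(3) subgpD(2)[OF KKD(2)[OF assms(1)], of x l]
      subgpD(2)[OF KKD(2)[OF assms(1)], of "x * l" "inverse l"] subgpD(3)[OF KKD(2)[OF assms(1)], of l]
    by (auto simp: mult.assoc)
  have ri: "rinv M ?\<phi>"
    using assms(4) by (auto simp: rinv_def K fixd_def rho_mult)
  have kK: "k * x \<in> K \<longleftrightarrow> x \<in> K" for x
    using subgpD(2)[OF KKD(2)[OF assms(1)] assms(5), of x]
      subgpD(2)[OF KKD(2)[OF assms(1)] subgpD(3)[OF KKD(2)[OF assms(1)] assms(5)], of "k * x"] by auto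
  have fs: "fsupp M ?\<phi>"
    unfolding fsupp_def by (rule finite_subset[OF cosets_mono KKD(1)[OF assms(1,2)]]) (auto split: if_splits)
  have "\<rho> k (tsum M ?\<phi>) = tsum M (\<lambda>x. \<rho> k (?\<phi> x))"
    by (rule tsum_hom[OF KKD(2)[OF assms(2)] ri fs]) (auto simp: rhoD)
  also have "(\<lambda>x. \<rho> k (?\<phi> x)) = (\<lambda>x. ?\<phi> (k * x * 1))"
    by (auto simp: kK rho_mult rhoD)
  also have "tsum M \<dots> = tsum M ?\<phi>"
    using tsum_translate[OF KKD(2)[OF assms(2)] ri, where s = 1] by simp
  finally show ?thesis by (simp add: csum_tsum assms)
qed

lemma csum_fixd: "K \<in> KK \<Longrightarrow> M \<in> KK \<Longrightarrow> M \<subseteq> K \<Longrightarrow> v \<in> fixd M \<Longrightarrow> csum K M v \<in> fixd K"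
  using csum_translate by (auto simp: fixd_def)

lemma csum_refine:
  assumes K: "K \<in> KK" and M: "M \<in> KK" "M \<subseteq> K" and N: "N \<in> KK" "N \<subseteq> M" and v: "v \<in> fixd M"
  shows "csum K N v = smul (of_nat (idx M N)) (csum K M v)"
proof -
  have vN: "v \<in> fixd N" using v N fixd_mono by blast
  have KM: "x * k \<in> K \<longleftrightarrow> x \<in> K" if "k \<in> M" for x k
    using that M(2) subgpD(2)[OF KKD(2)[OF K], of x k]
      subgpD(2)[OF KKD(2)[OF K], of "x * k" "inverse k"] subgpD(3)[OF KKD(2)[OF K], of k]
    by (auto simp: mult.assoc)
  have "rinv N (\<lambda>x. if x \<in> K then \<rho> x v else 0)"
    using vN KM N(2) by (auto simp: rinv_def fixd_def rho_mult)
  then have "csum K N v = (\<Sum>c\<in>cosets {x. x \<in> K} M. \<Sum>d\<in>cosets M N. if rp c * rp d \<in> K then \<rho> (rp c * rp d) v else 0)"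
    unfolding csum_tsum[OF K N(1) order_trans[OF N(2) M(2)] vN]
    using K M N KKD KM by (intro tsum_refine) (auto simp: rinv_def split: if_splits)
  also have "\<dots> = (\<Sum>c\<in>cosets K M. \<Sum>d\<in>cosets M N. \<rho> (rp c) v)"
  proof (intro sum.cong)
    fix c d assume c: "c \<in> cosets K M" and d: "d \<in> cosets M N"
    obtain x where x: "x \<in> K" "c = lcos x M" using c by (auto simp: cosets_def)
    then have "inverse x * rp c \<in> M" using rp_lcos[OF KKD(2)[OF M(1)], of x] by (simp add: lcos_def)
    then have rc: "rp c \<in> K" using KM[of "inverse x * rp c" x] x by simp
    obtain y where y: "y \<in> M" "d = lcos y N" using d by (auto simp: cosets_def)
    then have "inverse y * rp d \<in> M" using rp_lcos[OF KKD(2)[OF N(1)], of y] N(2) by (auto simp: lcos_def)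
    then have "y * (inverse y * rp d) \<in> M" by (rule subgpD(2)[OF KKD(2)[OF M(1)] y(1)])
    then have "rp d \<in> M" by simp
    then show "(if rp c * rp d \<in> K then \<rho> (rp c * rp d) v else 0) = \<rho> (rp c) v"
      using rc KM v by (auto simp: rho_mult fixd_def)
  qed auto
  also have "\<dots> = smul (of_nat (idx M N)) (csum K M v)"
    unfolding csum_def scale_sum_right idx_def using KKD(1)[OF M(1) N(1)]
    by (intro sum.cong refl) (simp add: sum_const_smul)
  finally show ?thesis .
qed

definition stb :: "'v \<Rightarrow> 'g set" where
  "stb v = (SOME K. K \<in> KK \<and> v \<in> fixd K)"

lemma stb: "stb v \<in> KK" "v \<in> fixd (stb v)"
proof -
  have "\<exists>K. K \<in> KK \<and> v \<in> fixd K" using rho_smooth[of v] by (auto simp: fixd_def)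
  then have "stb v \<in> KK \<and> v \<in> fixd (stb v)" unfolding stb_def by (rule someI_ex)
  then show "stb v \<in> KK" "v \<in> fixd (stb v)" by auto
qed

text \<open>The projector onto the \<open>K\<close>-fixed vectors. The index set of the sum depends
  on the stabilizer chosen for \<open>v\<close>, so even linearity needs the comparison of levels in
  \<open>avg_eq\<close>.\<close>

definition avg :: "'g set \<Rightarrow> 'v \<Rightarrow> 'v" where
  "avg K v = smul (1 / of_nat (idx K (K \<inter> stb v))) (csum K (K \<inter> stb v) v)"

lemma avg_eq:
  assumes K: "K \<in> KK" and M: "M \<in> KK" "M \<subseteq> K" "v \<in> fixd M"
  shows "avg K v = smul (1 / of_nat (idx K M)) (csum K M v)"
proof -
  have *: "smul (1 / of_nat (idx K M)) (csum K M v) = smul (1 / of_nat (idx K N)) (csum K N v)"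
    if M: "M \<in> KK" "M \<subseteq> K" "v \<in> fixd M" and N: "N \<in> KK" "N \<subseteq> M" for M N
  proof -
    have "idx K N = idx K M * idx M N"
      using K M N KKD(2) by (intro idx_mult) auto
    then show ?thesis
      using csum_refine[OF K M(1,2) N M(3)] idx_pos[OF M(1) N(1)] by simp
  qed
  let ?N = "M \<inter> (K \<inter> stb v)"
  have N: "?N \<in> KK" "K \<inter> stb v \<in> KK" using M K stb KK_Int by auto
  have "v \<in> fixd (K \<inter> stb v)" using stb(2) fixd_mono by blast
  then show ?thesis
    unfolding avg_def using *[OF N(2) _ _ N(1)] *[OF M N(1)] by auto
qed

lemma avg_common:
  assumes "K \<in> KK"
  obtains M where "M \<in> KK" "M \<subseteq> K" "v \<in> fixd M" "w \<in> fixd M"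
proof -
  have "K \<inter> (stb v \<inter> stb w) \<in> KK" using assms stb KK_Int by auto
  moreover have "v \<in> fixd (K \<inter> (stb v \<inter> stb w))" "w \<in> fixd (K \<inter> (stb v \<inter> stb w))"
    using stb(2)[of v] stb(2)[of w] by (auto simp: fixd_def)
  ultimately show ?thesis using that by blast
qed

lemma avg_add: "K \<in> KK \<Longrightarrow> avg K (v + w) = avg K v + avg K w"
proof -
  assume K: "K \<in> KK"
  obtain M where M: "M \<in> KK" "M \<subseteq> K" "v \<in> fixd M" "w \<in> fixd M" using avg_common[OF K] .
  moreover from this have "v + w \<in> fixd M" using fixd_subspace subspace_add by blast
  ultimately show ?thesis
    using avg_eq[OF K M(1,2)] by (simp add: csum_def rhoD sum.distrib scale_right_distrib)
qed

lemma avg_scale: "K \<in> KK \<Longrightarrow> avg K (smul c v) = smul c (avg K v)"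
proof -
  assume K: "K \<in> KK"
  obtain M where M: "M \<in> KK" "M \<subseteq> K" "v \<in> fixd M" "v \<in> fixd M" using avg_common[OF K] .
  moreover from this have "smul c v \<in> fixd M" using fixd_subspace subspace_scale by blast
  ultimately show ?thesis
    using avg_eq[OF K M(1,2)] by (simp add: csum_def rhoD mult.commute flip: scale_sum_right)
qed

lemma avg_id: "K \<in> KK \<Longrightarrow> v \<in> fixd K \<Longrightarrow> avg K v = v"
  using avg_eq[of K K v] csum_const[of K K v] idx_pos[of K K] by simp

lemma avg_translate: "K \<in> KK \<Longrightarrow> k \<in> K \<Longrightarrow> avg K (\<rho> k v) = avg K v"
proof -
  assume K: "K \<in> KK" and k: "k \<in> K"
  obtain M where M: "M \<in> KK" "M \<subseteq> K" "v \<in> fixd M" "v \<in> fixd M" using avg_common[OF K] .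
  let ?\<phi> = "\<lambda>x. if x \<in> K then \<rho> x v else 0"
  have Ks: "subgp K" using K KKD by blast
  have xK: "x * l \<in> K \<longleftrightarrow> x \<in> K" if "l \<in> K" for x l
    using that subgpD(2)[OF Ks, of x l] subgpD(2)[OF Ks, of "x * l" "inverse l"] subgpD(3)[OF Ks, of l]
    by (auto simp: mult.assoc)
  have ri: "rinv M ?\<phi>"
    using M xK by (auto simp: rinv_def fixd_def rho_mult)
  have cK: "conjs k K = K" using conjs_self[OF Ks k] .
  have M': "conjs k M \<in> KK" "conjs k M \<subseteq> K" "\<rho> k v \<in> fixd (conjs k M)"
    using M KK_conjs conjs_mono[of M K k] cK fixd_translate by auto
  have "csum K (conjs k M) (\<rho> k v) = tsum (conjs k M) (\<lambda>x. ?\<phi> (1 * x * k))"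
    unfolding csum_tsum[OF K M'] by (intro arg_cong[where f = "tsum _"] ext) (simp add: xK k rho_mult)
  also have "\<dots> = csum K M v"
    unfolding csum_tsum[OF K M(1-3)] using M KKD by (intro tsum_translate ri) auto
  finally show ?thesis
    using avg_eq[OF K M(1-3)] avg_eq[OF K M'] idx_conjs[of k K M] cK by simp
qed

subsection \<open>Admissibility\<close>

text \<open>The fixed space is spanned by the projected translates of one vector. On a maximal
  independent set \<open>B\<close> of these let \<eta> be constantly one; then \<xi>, the composite
  of \<eta> with the projector, is \<open>K\<close>-invariant and its coefficient is nonzero at a
  representative of each member of \<open>B\<close>. Different members give different cosets
  \<open>K x\<close>, because the projector absorbs \<open>K\<close>; cuspidality therefore makes
  \<open>B\<close> finite.\<close>

lemma fixd_finite_dim: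
  assumes K: "K \<in> KK"
  obtains B where "finite B" "fixd K \<subseteq> span B"
proof (cases "\<exists>v::'v. v \<noteq> 0")
  case False
  then have "fixd K \<subseteq> span {}" by auto
  then show ?thesis using that by blast
next
  case True
  then obtain v0 :: 'v where v0: "v0 \<noteq> 0" by blast
  let ?P = "range (\<lambda>g. avg K (\<rho> g v0))"
  have "avg K w \<in> span ?P" if "w \<in> span (range (\<lambda>g. \<rho> g v0))" for w
    using that
  proof (induction rule: span_induct_alt)
    case base
    have "avg K (smul 0 v0) = smul 0 (avg K v0)" by (rule avg_scale[OF K])
    then show ?case by (simp add: span_zero)
  next
    case (step c x y)
    then show ?case
      by (auto simp: avg_add avg_scale K intro!: span_add span_scale intro: span_base)
  qed
  then have P: "fixd K \<subseteq> span ?P"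
    using cyclic_span[OF v0] avg_id[OF K] by (metis UNIV_I subsetI)
  obtain B where B: "B \<subseteq> ?P" "independent B" "?P \<subseteq> span B"
    using maximal_independent_subset by blast
  obtain \<eta> where \<eta>: "lfun \<eta>" "\<And>b. b \<in> B \<Longrightarrow> \<eta> b = 1"
    using vector_space_pair.linear_independent_extend[OF vs_pair B(2), of "\<lambda>_. 1"] by blast
  define \<xi> where "\<xi> = (\<lambda>v. \<eta> (avg K v))"
  have "lfun \<xi>" unfolding \<xi>_def
    by (rule lfunI) (auto simp: avg_add avg_scale K lfunD[OF \<eta>(1)])
  then have fin: "finite ((\<lambda>x. (\<lambda>k. k * x) ` K) ` {x. \<xi> (\<rho> x v0) \<noteq> 0})"
    by (rule cuspidal[OF _ K]) (simp add: \<xi>_def avg_translate K)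
  define r where "r = (\<lambda>b. SOME x. b = avg K (\<rho> x v0))"
  have r: "b = avg K (\<rho> (r b) v0)" if "b \<in> B" for b
  proof -
    have "\<exists>x. b = avg K (\<rho> x v0)" using that B(1) by auto
    then show ?thesis unfolding r_def by (rule someI_ex)
  qed
  have "inj_on (\<lambda>b. (\<lambda>k. k * r b) ` K) B"
  proof (rule inj_onI)
    fix b b' assume b: "b \<in> B" "b' \<in> B" "(\<lambda>k. k * r b) ` K = (\<lambda>k. k * r b') ` K"
    have "1 * r b \<in> (\<lambda>k. k * r b) ` K" using subgpD(1)[OF KKD(2)[OF K]] by blast
    then obtain k where k: "k \<in> K" "r b = k * r b'" using b(3) by auto
    have "b = avg K (\<rho> k (\<rho> (r b') v0))" using r[OF b(1)] k(2) by (simp add: rho_mult)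
    also have "\<dots> = b'" using r[OF b(2)] avg_translate[OF K k(1)] by simp
    finally show "b = b'" .
  qed
  moreover have "(\<lambda>b. (\<lambda>k. k * r b) ` K) ` B \<subseteq> (\<lambda>x. (\<lambda>k. k * x) ` K) ` {x. \<xi> (\<rho> x v0) \<noteq> 0}"
  proof clarify
    fix b assume b: "b \<in> B"
    have "\<xi> (\<rho> (r b) v0) = 1" unfolding \<xi>_def using r[OF b] \<eta>(2)[OF b] by simp
    then show "(\<lambda>k. k * r b) ` K \<in> (\<lambda>x. (\<lambda>k. k * x) ` K) ` {x. \<xi> (\<rho> x v0) \<noteq> 0}" by auto
  qed
  ultimately have "finite B" using fin by (meson finite_imageD finite_subset)
  moreover have "fixd K \<subseteq> span B" using P B(3) span_minimal[OF B(3) subspace_span] by blast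
  ultimately show ?thesis using that by blast
qed

subsection \<open>Schur's lemma\<close>

text \<open>Induction on the degree of a polynomial \<open>p\<close> in \<open>B\<close> that kills
  \<open>v\<close>. For a root \<open>r\<close> of \<open>p\<close>, either \<open>v\<close> is an
  eigenvector for \<open>r\<close>, or \<open>B v - r v\<close> is nonzero and killed by the
  quotient of \<open>p\<close> by the linear factor.\<close>

lemma eigenvector:
  assumes B: "Vector_Spaces.linear smul smul B" and W: "subspace W" "\<And>w. w \<in> W \<Longrightarrow> B w \<in> W"
    and p: "p \<noteq> 0" and v: "v \<in> W" "v \<noteq> 0" "(\<Sum>i\<le>degree p. smul (coeff p i) ((B ^^ i) v)) = 0"
  shows "\<exists>w c. w \<in> W \<and> w \<noteq> 0 \<and> B w = smul c w"
  using p v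
proof (induction "degree p" arbitrary: p v)
  case 0
  then obtain a where "p = [:a:]" by (metis degree_eq_zeroE)
  then show ?case using 0 by simp
next
  case (Suc n)
  interpret B: Vector_Spaces.linear smul smul B by fact
  obtain r where "poly p r = 0"
    using fundamental_theorem_of_algebra[of p] Suc(2) by (metis constant_degree nat.distinct(1))
  then obtain q where q: "p = [:-r, 1:] * q" using poly_eq_0_iff_dvd by (metis dvdE)
  have q0: "q \<noteq> 0" using q Suc(3) by auto
  have "degree ([:-r, 1:] * q) = degree [:-r, 1:] + degree q"
    by (rule degree_mult_eq) (use q0 in auto)
  moreover have "degree [:-r, 1:] = 1" by simp
  ultimately have dq: "degree p = Suc (degree q)" by (metis plus_1_eq_Suc q)
  show ?case
  proof (cases "B v = smul r v")
    case True
    then show ?thesis using Suc by blast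
  next
    case False
    let ?v = "B v - smul r v"
    have iter: "(B ^^ i) (B v - smul r v) = (B ^^ Suc i) v - smul r ((B ^^ i) v)" for i
      by (induction i) (simp_all add: B.diff B.scale)
    have cp: "coeff p i = (if i = 0 then 0 else coeff q (i - 1)) - r * coeff q i" for i
      unfolding q by (cases i) simp_all
    let ?s = "\<lambda>i. smul (coeff q i) ((B ^^ Suc i) v)" and ?t = "\<lambda>i. smul (r * coeff q i) ((B ^^ i) v)"
    have "(\<Sum>i\<le>degree p. smul (coeff p i) ((B ^^ i) v))
        = (\<Sum>i\<le>Suc (degree q). smul ((if i = 0 then 0 else coeff q (i - 1))) ((B ^^ i) v) - ?t i)"
      unfolding dq cp by (intro sum.cong refl) (simp only: scale_left_diff_distrib)
    also have "\<dots> = (\<Sum>i\<le>degree q. ?s i) - (\<Sum>i\<le>Suc (degree q). ?t i)"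
      unfolding sum_subtractf by (subst (1) sum.atMost_Suc_shift) simp
    also have "(\<Sum>i\<le>Suc (degree q). ?t i) = (\<Sum>i\<le>degree q. ?t i)"
      by (simp add: coeff_eq_0)
    also have "(\<Sum>i\<le>degree q. ?s i) - \<dots> = (\<Sum>i\<le>degree q. smul (coeff q i) ((B ^^ i) ?v))"
      unfolding iter by (simp add: scale_right_diff_distrib sum_subtractf mult.commute)
    finally have "(\<Sum>i\<le>degree q. smul (coeff q i) ((B ^^ i) ?v)) = 0" using Suc(6) by simp
    moreover have "?v \<in> W" using W Suc(4) by (auto intro: subspace_diff subspace_scale)
    ultimately show ?thesis using Suc(1)[of q ?v] dq Suc(2) q0 False by auto
  qed
qed

lemma eigenvector_finite_dim:
  assumes B: "Vector_Spaces.linear smul smul B" and W: "subspace W" "\<And>w. w \<in> W \<Longrightarrow> B w \<in> W"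
    and fin: "finite S" "W \<subseteq> span S" and v: "v \<in> W" "v \<noteq> 0"
  obtains w c where "w \<in> W" "w \<noteq> 0" "B w = smul c w"
proof -
  let ?n = "card S"
  have Wi: "(B ^^ i) v \<in> W" for i using v W by (induction i) auto
  have "\<exists>a. (\<exists>i\<le>?n. a i \<noteq> 0) \<and> (\<Sum>i\<le>?n. smul (a i) ((B ^^ i) v)) = 0"
  proof (cases "inj_on (\<lambda>i. (B ^^ i) v) {..?n}")
    case True
    let ?X = "(\<lambda>i. (B ^^ i) v) ` {..?n}"
    have "card ?X = Suc ?n" using True by (simp add: card_image)
    then have "dependent ?X"
      using independent_span_bound[OF fin(1), of ?X] Wi fin(2) by fastforce
    then obtain u where u: "\<exists>x\<in>?X. u x \<noteq> 0" "(\<Sum>x\<in>?X. smul (u x) x) = 0"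
      using dependent_finite[of ?X] by auto
    then show ?thesis
      by (intro exI[of _ "\<lambda>i. u ((B ^^ i) v)"]) (auto simp: sum.reindex[OF True])
  next
    case False
    then obtain i j where ij: "i \<le> ?n" "j \<le> ?n" "i \<noteq> j" "(B ^^ i) v = (B ^^ j) v"
      by (auto simp: inj_on_def)
    \<comment> \<open>Two equal iterates give the relation with polynomial
      \<open>X^i - X^j\<close>.\<close>
    let ?a = "\<lambda>k. if k = i then 1 else if k = j then -1 else 0 :: complex"
    have "(\<Sum>k\<le>?n. smul (?a k) ((B ^^ k) v)) = (\<Sum>k\<le>?n. (if k = i then (B ^^ i) v else 0) - (if k = j then (B ^^ j) v else 0))"
      using ij(3) by (intro sum.cong) auto
    also have "\<dots> = 0" using ij by (simp add: sum_subtractf)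
    finally show ?thesis using ij(1) by (intro exI[of _ ?a]) auto
  qed
  then obtain a where a: "\<exists>i\<le>?n. a i \<noteq> 0" "(\<Sum>i\<le>?n. smul (a i) ((B ^^ i) v)) = 0" by blast
  define p where "p = (\<Sum>i\<le>?n. monom (a i) i)"
  have cp: "coeff p i = (if i \<le> ?n then a i else 0)" for i
    unfolding p_def by (simp add: coeff_sum)
  have p0: "p \<noteq> 0" using a(1) cp by (metis coeff_0)
  have dp: "degree p \<le> ?n" using cp by (intro degree_le) auto
  have "(\<Sum>i\<le>degree p. smul (coeff p i) ((B ^^ i) v)) = (\<Sum>i\<le>?n. smul (coeff p i) ((B ^^ i) v))"
    using dp by (intro sum.mono_neutral_left) (auto simp: coeff_eq_0)
  also have "\<dots> = 0" using a(2) by (simp add: cp)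
  finally show ?thesis using eigenvector[OF B W p0 v(1,2)] that by blast
qed

text \<open>Since relations among the translates of \<open>p\<close> persist for \<open>p'\<close>,
  sending \<open>\<rho> x p\<close> to \<open>\<rho> x p'\<close> defines an operator
  \<open>B\<close> commuting with the group. It preserves the finite-dimensional space
  \<open>fixd K\<close>, so it has an eigenvector there, and the eigenspace is invariant, hence
  everything.\<close>

lemma schur:
  assumes K: "K \<in> KK" and p: "p \<in> fixd K" "p \<noteq> 0"
    and rel: "\<And>(S::'g set) a. finite S \<Longrightarrow> (\<Sum>x\<in>S. smul (a x) (\<rho> x p)) = 0 \<Longrightarrow> (\<Sum>x\<in>S. smul (a x) (\<rho> x p')) = 0"
  obtains c where "p' = smul c p"
proof -
  obtain Bs where Bs: "Bs \<subseteq> range (\<lambda>g. \<rho> g p)" "independent Bs" "range (\<lambda>g. \<rho> g p) \<subseteq> span Bs"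
    using maximal_independent_subset by blast
  define r where "r = (\<lambda>b. SOME x. b = \<rho> x p)"
  have r: "b = \<rho> (r b) p" if "b \<in> Bs" for b
  proof -
    have "\<exists>x. b = \<rho> x p" using that Bs(1) by auto
    then show ?thesis unfolding r_def by (rule someI_ex)
  qed
  have vp: "vector_space_pair smul smul"
    by (intro vector_space_pair.intro vector_space_axioms)
  obtain B where B: "Vector_Spaces.linear smul smul B" "\<And>b. b \<in> Bs \<Longrightarrow> B b = \<rho> (r b) p'"
    using vector_space_pair.linear_independent_extend[OF vp Bs(2), of "\<lambda>b. \<rho> (r b) p'"] by blast
  interpret B: Vector_Spaces.linear smul smul B by fact
  have Bx: "B (\<rho> x p) = \<rho> x p'" for x
  proof -
    have "\<rho> x p \<in> span Bs" using Bs(3) by blast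
    then obtain S a where S: "finite S" "S \<subseteq> Bs" "\<rho> x p = (\<Sum>b\<in>S. smul (a b) b)"
      unfolding span_explicit by blast
    have inj: "inj_on r S" using r S(2) by (metis inj_on_def subsetD)
    define T where "T = insert x (r ` S)"
    \<comment> \<open>The expansion of \<open>\<rho> x p\<close> in the basis, written as one
      relation over group elements; the two contributions are subtracted because \<open>x\<close>
      may coincide with some \<open>r b\<close>.\<close>
    define a' where "a' = (\<lambda>y. (if y \<in> r ` S then a (the_inv_into S r y) else 0) - (if y = x then 1 else 0))"
    have sum_eq: "(\<Sum>y\<in>T. smul (a' y) (\<rho> y q)) = (\<Sum>b\<in>S. smul (a b) (\<rho> (r b) q)) - \<rho> x q" for q
    proof -
      have "(\<Sum>y\<in>T. smul (a' y) (\<rho> y q)) = (\<Sum>y\<in>T. (if y \<in> r ` S then smul (a (the_inv_into S r y)) (\<rho> y q) else 0)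
          - (if y = x then \<rho> x q else 0))"
        unfolding a'_def by (intro sum.cong refl) (auto simp: scale_left_diff_distrib)
      also have "\<dots> = (\<Sum>y\<in>r ` S. smul (a (the_inv_into S r y)) (\<rho> y q)) - \<rho> x q"
        using S(1) unfolding T_def sum_subtractf
        by (simp add: sum.If_cases) (metis Int_insert_left inf.idem inf_sup_absorb insert_absorb sup.idem Int_absorb2 subset_insertI)
      also have "(\<Sum>y\<in>r ` S. smul (a (the_inv_into S r y)) (\<rho> y q)) = (\<Sum>b\<in>S. smul (a b) (\<rho> (r b) q))"
        by (subst sum.reindex[OF inj]) (simp add: the_inv_into_f_f[OF inj])
      finally show ?thesis .
    qed
    have "(\<Sum>b\<in>S. smul (a b) (\<rho> (r b) p)) = \<rho> x p"
      unfolding S(3) using S(2) r by (intro sum.cong refl) (metis subsetD)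
    then have "(\<Sum>y\<in>T. smul (a' y) (\<rho> y p)) = 0" by (simp add: sum_eq)
    then have "(\<Sum>y\<in>T. smul (a' y) (\<rho> y p')) = 0" using S(1) by (intro rel) (auto simp: T_def)
    then have "(\<Sum>b\<in>S. smul (a b) (\<rho> (r b) p')) = \<rho> x p'" by (simp add: sum_eq)
    moreover have "B (\<rho> x p) = (\<Sum>b\<in>S. smul (a b) (\<rho> (r b) p'))"
      unfolding S(3) B.sum B.scale using S(2) B(2) by (intro sum.cong refl) (metis subsetD)
    ultimately show ?thesis by simp
  qed
  have comm: "B (\<rho> g v) = \<rho> g (B v)" for g v
  proof -
    have "v \<in> span (range (\<lambda>g. \<rho> g p))" using cyclic_span[OF p(2)] by simp
    then show ?thesis
    proof (induction rule: span_induct_alt)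
      case base
      show ?case by (simp add: rhoD B.zero)
    next
      case (step c x y)
      then obtain h where h: "x = \<rho> h p" by blast
      have "B (\<rho> g x) = \<rho> g (B x)" unfolding h by (simp add: Bx flip: rho_mult)
      then show ?case using step by (simp add: rhoD B.add B.scale)
    qed
  qed
  obtain S where S: "finite S" "fixd K \<subseteq> span S" using fixd_finite_dim[OF K] .
  have "B w \<in> fixd K" if "w \<in> fixd K" for w
    using that by (auto simp: fixd_def simp flip: comm)
  then obtain w c where w: "w \<in> fixd K" "w \<noteq> 0" "B w = smul c w"
    using eigenvector_finite_dim[OF B(1) fixd_subspace _ S p] by blast
  have "{v. B v = smul c v} = {0} \<or> {v. B v = smul c v} = UNIV"
    by (rule irreducible)
      (auto simp: subspace_def B.zero B.add B.scale comm rhoD scale_right_distrib mult.commute)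
  then have "B p = smul c p" using w by blast
  then have "p' = smul c p" using Bx[of 1] by simp
  then show ?thesis using that by blast
qed

end

lemma lcos_image_mult: "(\<lambda>y. x * y) ` lcos l M = lcos (x * l) M"
proof (intro set_eqI iffI)
  fix y assume "y \<in> lcos (x * l) M"
  then have "inverse x * y \<in> lcos l M" by (simp add: lcos_def mult.assoc)
  moreover have "y = x * (inverse x * y)" by simp
  ultimately show "y \<in> (\<lambda>y. x * y) ` lcos l M" by blast
qed (auto simp: lcos_def mult.assoc)

section \<open>Test functions and skew distributions on the group\<close>

context coset_system
begin

lemma finite_cosets_lcos:
  assumes "L \<in> KK" "M \<in> KK"
  shows "finite (cosets (lcos x L) M)"
proof -
  have "cosets (lcos x L) M \<subseteq> (\<lambda>c. (\<lambda>y. x * y) ` c) ` cosets L M"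
  proof
    fix c assume "c \<in> cosets (lcos x L) M"
    then obtain y where y: "inverse x * y \<in> L" "c = lcos y M" by (auto simp: cosets_def lcos_def)
    then have "c = (\<lambda>z. x * z) ` lcos (inverse x * y) M" by (simp add: lcos_image_mult)
    then show "c \<in> (\<lambda>c. (\<lambda>y. x * y) ` c) ` cosets L M" using y(1) by (auto simp: cosets_def)
  qed
  then show ?thesis using KK_finite[OF assms] by (rule finite_surj[rotated])
qed

text \<open>By commensurability one coset of \<open>L\<close> meets only finitely many cosets of
  \<open>M\<close>, so finiteness of a support does not depend on the level.\<close>

lemma finite_cosets_change:
  assumes "L \<in> KK" "M \<in> KK" "finite (cosets A L)"
  shows "finite (cosets A M)"
proof -
  have "cosets A M \<subseteq> (\<Union>c\<in>cosets A L. cosets c M)"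
    using mem_lcos_self[OF KK_subgp[OF assms(1)]] by (fastforce simp: cosets_def)
  moreover have "finite (\<Union>c\<in>cosets A L. cosets c M)"
    using assms finite_cosets_lcos by (intro finite_UN_I) (auto simp: cosets_def)
  ultimately show ?thesis by (rule finite_subset)
qed

text \<open>Locally constant functions with compact support modulo the centre. Invariance on both
  sides is part of the notion, so that left averages and right averages are both finite
  sums.\<close>

definition testf :: "('g \<Rightarrow> complex) \<Rightarrow> bool" where
  "testf f \<longleftrightarrow> (\<exists>L\<in>KK. rinv L f \<and> (\<forall>k\<in>L. \<forall>x. f (k * x) = f x) \<and> fsupp L f)"

lemma testfD:
  assumes "testf f"
  shows "\<exists>L. L \<in> KK \<and> rinv L f \<and> (\<forall>k\<in>L. \<forall>x. f (k * x) = f x) \<and> (\<forall>M\<in>KK. fsupp M f)"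
proof -
  obtain L where L: "L \<in> KK" "rinv L f" "\<forall>k\<in>L. \<forall>x. f (k * x) = f x" "fsupp L f"
    using assms unfolding testf_def by blast
  have "\<forall>M\<in>KK. fsupp M f" using L(4) finite_cosets_change[OF L(1)] unfolding fsupp_def by blast
  then show ?thesis using L(1-3) by blast
qed

lemma testfI:
  assumes "L \<in> KK" "rinv L f" "M \<in> KK" "\<And>k x. k \<in> M \<Longrightarrow> f (k * x) = f x" "N \<in> KK" "fsupp N f"
  shows "testf f"
proof -
  have LM: "L \<inter> M \<in> KK" using assms(1,3) by (rule KK_Int)
  have "fsupp (L \<inter> M) f"
    using assms(6) unfolding fsupp_def by (rule finite_cosets_change[OF assms(5) LM])
  moreover have "rinv (L \<inter> M) f" by (rule rinv_mono[OF assms(2)]) simp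
  ultimately show ?thesis unfolding testf_def using assms(4) LM by blast
qed

lemma testf_add:
  assumes "testf f" "testf g"
  shows "testf (\<lambda>x. f x + g x)"
proof -
  obtain L where L: "L \<in> KK" "rinv L f" "\<forall>k\<in>L. \<forall>x. f (k * x) = f x" "\<forall>M\<in>KK. fsupp M f"
    using testfD[OF assms(1)] by blast
  obtain M where M: "M \<in> KK" "rinv M g" "\<forall>k\<in>M. \<forall>x. g (k * x) = g x" "\<forall>M\<in>KK. fsupp M g"
    using testfD[OF assms(2)] by blast
  have "L \<inter> M \<in> KK" using L M KK_Int by blast
  moreover from this have "fsupp (L \<inter> M) (\<lambda>x. f x + g x)" using L(4) M(4) by (intro fsupp_add) auto
  ultimately show ?thesis using L M by (intro testfI[of "L \<inter> M" _ "L \<inter> M" "L \<inter> M"]) (auto simp: rinv_def)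
qed

lemma testf_scale:
  assumes "testf f"
  shows "testf (\<lambda>x. c * f x)"
proof -
  obtain L where L: "L \<in> KK" "rinv L f" "\<forall>k\<in>L. \<forall>x. f (k * x) = f x" "\<forall>M\<in>KK. fsupp M f"
    using testfD[OF assms(1)] by blast
  then have "fsupp L (\<lambda>x. c * f x)" using fsupp_subset[of L f "\<lambda>x. c * f x"] by auto
  then show ?thesis using L by (intro testfI[of L _ L L]) (auto simp: rinv_def)
qed

lemma testf_translate:
  assumes "testf f"
  shows "testf (\<lambda>x. f (g * x * s))"
proof -
  obtain L where L: "L \<in> KK" "rinv L f" "\<forall>k\<in>L. \<forall>x. f (k * x) = f x" "\<forall>M\<in>KK. fsupp M f"
    using testfD[OF assms(1)] by blast
  have "f (g * (k * x) * s) = f (g * x * s)" if "k \<in> conjs (inverse g) L" for k x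
  proof -
    have "g * k * inverse g \<in> L" using that by (simp add: conjs_def)
    then have "f ((g * k * inverse g) * (g * x * s)) = f (g * x * s)" using L(3) by blast
    then show ?thesis by (simp add: mult.assoc)
  qed
  moreover have "fsupp (conjs s L) (\<lambda>x. f (g * x * s))" using L by (intro fsupp_translate) auto
  ultimately show ?thesis
    using L KK_conjs rinv_translate[OF L(2), of s g] by (intro testfI[of "conjs s L" _ "conjs (inverse g) L" "conjs s L"])
qed

text \<open>Inversion sends \<open>y L\<close> to \<open>L y^-1\<close>, which is the left coset of
  \<open>y L y^-1\<close> through \<open>y^-1\<close> and hence lies in finitely many left cosets of
  \<open>L\<close>.\<close>

lemma testf_inverse:
  assumes "testf f"
  shows "testf (\<lambda>x. f (inverse x))"
proof -
  obtain L where L: "L \<in> KK" "rinv L f" "\<forall>k\<in>L. \<forall>x. f (k * x) = f x" "\<forall>M\<in>KK. fsupp M f"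
    using testfD[OF assms(1)] by blast
  have Ls: "subgp L" using L KK_subgp by blast
  have sub: "inverse x \<in> lcos (inverse y) (conjs y L)" if "x \<in> lcos y L" for x y
    using that subgpD(3)[OF Ls, of "inverse y * x"] by (auto simp: lcos_def conjs_def mult.assoc)
  have "cosets {x. f (inverse x) \<noteq> 0} L \<subseteq> (\<Union>c\<in>cosets {x. f x \<noteq> 0} L. cosets (lcos (inverse (rp c)) (conjs (rp c) L)) L)"
  proof
    fix d assume "d \<in> cosets {x. f (inverse x) \<noteq> 0} L"
    then obtain x where x: "f (inverse x) \<noteq> 0" "d = lcos x L" by (auto simp: cosets_def)
    let ?c = "lcos (inverse x) L"
    have "inverse x \<in> lcos (rp ?c) L" unfolding lcos_rp[OF Ls] by (rule mem_lcos_self[OF Ls])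
    then have "x \<in> lcos (inverse (rp ?c)) (conjs (rp ?c) L)" using sub by fastforce
    then show "d \<in> (\<Union>c\<in>cosets {x. f x \<noteq> 0} L. cosets (lcos (inverse (rp c)) (conjs (rp c) L)) L)"
      using x by (intro UN_I[of ?c]) (auto simp: cosets_def)
  qed
  moreover have "finite (\<Union>c\<in>cosets {x. f x \<noteq> 0} L. cosets (lcos (inverse (rp c)) (conjs (rp c) L)) L)"
    using bspec[OF L(4) L(1)] L(1) by (intro finite_UN_I finite_cosets_lcos KK_conjs) (auto simp: fsupp_def)
  ultimately have "fsupp L (\<lambda>x. f (inverse x))" unfolding fsupp_def by (rule finite_subset)
  moreover have "rinv L (\<lambda>x. f (inverse x))"
    using L(3) subgpD(3)[OF Ls] by (auto simp: rinv_def)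
  moreover have "f (inverse (k * x)) = f (inverse x)" if "k \<in> L" for k x
    using L(2) subgpD(3)[OF Ls that] by (auto simp: rinv_def)
  ultimately show ?thesis using L(1) by (intro testfI[of L _ L L])
qed

text \<open>The shape of the difference of a biequivariant distribution and its image under the
  involution. \<open>D\<close> is a total function, but it is constrained only on test
  functions.\<close>

definition skew_distribution ::
    "'g set \<Rightarrow> ('g \<Rightarrow> complex) \<Rightarrow> 'g \<Rightarrow> (('g \<Rightarrow> complex) \<Rightarrow> complex) \<Rightarrow> bool" where
  "skew_distribution H \<theta> \<epsilon> D \<longleftrightarrow>
     (\<forall>f g. testf f \<longrightarrow> testf g \<longrightarrow> D (\<lambda>x. f x + g x) = D f + D g) \<and>
     (\<forall>f c. testf f \<longrightarrow> D (\<lambda>x. c * f x) = c * D f) \<and>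
     (\<forall>f. \<forall>s\<in>H. testf f \<longrightarrow> D (\<lambda>x. f (inverse s * x)) = \<theta> s * D f) \<and>
     (\<forall>f. \<forall>s\<in>H. testf f \<longrightarrow> D (\<lambda>x. f (x * s)) = inverse (\<theta> s) * D f) \<and>
     (\<forall>f. testf f \<longrightarrow> D (\<lambda>x. f (\<epsilon> * inverse x * \<epsilon>)) = - D f)"

lemma dcos_mult:
  assumes K: "subgp K" and a: "a \<in> K"
  shows "a * y \<in> dcos K x \<longleftrightarrow> y \<in> dcos K x" "y * a \<in> dcos K x \<longleftrightarrow> y \<in> dcos K x"
proof -
  have *: "a * y \<in> dcos K x" "y * a \<in> dcos K x" if "a \<in> K" "y \<in> dcos K x" for a y
  proof -
    obtain k l where kl: "k \<in> K" "l \<in> K" "y = k * x * l" using \<open>y \<in> dcos K x\<close> by (auto simp: dcos_def)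
    have "a * y = (a * k) * x * l" "y * a = k * x * (l * a)" by (simp_all add: kl mult.assoc)
    then show "a * y \<in> dcos K x" "y * a \<in> dcos K x"
      unfolding dcos_def using kl subgpD(2)[OF K that(1) kl(1)] subgpD(2)[OF K kl(2) that(1)] by blast+
  qed
  have i: "inverse a \<in> K" using subgpD(3)[OF K a] .
  show "a * y \<in> dcos K x \<longleftrightarrow> y \<in> dcos K x"
  proof
    assume "a * y \<in> dcos K x"
    from *(1)[OF i this] show "y \<in> dcos K x" by simp
  qed (rule *(1)[OF a])
  show "y * a \<in> dcos K x \<longleftrightarrow> y \<in> dcos K x"
  proof
    assume "y * a \<in> dcos K x"
    from *(2)[OF i this] show "y \<in> dcos K x" by (simp add: mult.assoc)
  qed (rule *(2)[OF a])
qed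

lemma testf_dcos:
  assumes K: "K \<in> KK"
  shows "testf (\<lambda>y. if y \<in> dcos K x then 1 else 0)"
proof -
  have Ks: "subgp K" using K KK_subgp by blast
  note A = dcos_mult[OF Ks]
  have "finite (cosets (dcos K x) K)"
    using idx_pos[OF K KK_Int[OF K KK_conjs[OF K]]] card_cosets_dcos[OF K, of x] by (metis card_ge_0_finite)
  then show ?thesis using K A by (intro testfI[of K _ K K]) (auto simp: rinv_def fsupp_def)
qed

end

section \<open>Unitarity and the distribution attached to two functionals\<close>

locale cuspidal_rep_form = cuspidal_rep smul KK \<rho>
  for smul :: "complex \<Rightarrow> 'v::ab_group_add \<Rightarrow> 'v"
    and KK :: "'g::mult_group set set" and \<rho> +
  fixes \<xi>0 :: "'v \<Rightarrow> complex" and Kx :: "'g set"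
  assumes xi0: "lfun \<xi>0" "\<exists>w. \<xi>0 w \<noteq> 0"
    and Kx: "Kx \<in> KK" "\<And>k v. k \<in> Kx \<Longrightarrow> \<xi>0 (\<rho> k v) = \<xi>0 v"
begin

text \<open>The inverse makes the coefficient right invariant under \<open>Kx\<close>, as summation
  over left cosets requires.\<close>

definition coef :: "'v \<Rightarrow> 'g \<Rightarrow> complex" where
  "coef v x = \<xi>0 (\<rho> (inverse x) v)"

text \<open>The L2 pairing of coefficients against the fixed functional \<open>\<xi>0\<close>.
  Cuspidality makes the sum finite, and irreducibility makes the form definite, as a vector with
  zero coefficients has an orbit killed by \<open>\<xi>0\<close>.\<close>

definition ip :: "'v \<Rightarrow> 'v \<Rightarrow> complex" where
  "ip v w = tsum Kx (\<lambda>x. coef v x * cnj (coef w x))"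

lemma coef_rinv: "rinv Kx (coef v)"
  using subgpD(3)[OF KK_subgp[OF Kx(1)]] Kx(2) by (auto simp: rinv_def coef_def rho_mult)

lemma coef_fsupp: "fsupp Kx (coef v)"
proof -
  have Ks: "subgp Kx" using KK_subgp Kx by blast
  have "lcos x Kx = inverse ` (\<lambda>k. k * inverse x) ` Kx" for x
  proof (intro set_eqI iffI)
    fix y assume "y \<in> lcos x Kx"
    then have "inverse (inverse x * y) \<in> Kx" using subgpD(3)[OF Ks, of "inverse x * y"] by (simp add: lcos_def)
    moreover have "y = inverse (inverse (inverse x * y) * inverse x)" by simp
    ultimately show "y \<in> inverse ` (\<lambda>k. k * inverse x) ` Kx" by blast
  qed (auto simp: lcos_def subgpD(3)[OF Ks])
  then have "cosets {x. coef v x \<noteq> 0} Kx = image inverse ` (\<lambda>x. (\<lambda>k. k * x) ` Kx) ` inverse ` {x. coef v x \<noteq> 0}"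
    unfolding cosets_def image_image by simp
  moreover have "inverse ` {x. coef v x \<noteq> 0} = {x. \<xi>0 (\<rho> x v) \<noteq> 0}"
  proof (intro set_eqI iffI)
    fix x assume "x \<in> {x. \<xi>0 (\<rho> x v) \<noteq> 0}"
    then have "inverse x \<in> {x. coef v x \<noteq> 0}" by (simp add: coef_def)
    then show "x \<in> inverse ` {x. coef v x \<noteq> 0}" by (metis imageI inv_inv)
  qed (auto simp: coef_def)
  ultimately show ?thesis
    using cuspidal[OF xi0(1) Kx, of v] by (simp add: fsupp_def)
qed

lemma ip_aux: "rinv Kx (\<lambda>x. coef v x * cnj (coef w x))" "fsupp Kx (\<lambda>x. coef v x * cnj (coef w x))"
  using coef_rinv[of v] coef_rinv[of w] by (auto simp: rinv_def intro: fsupp_subset[OF coef_fsupp[of v]])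

lemma ip_add_left: "ip (v + v') w = ip v w + ip v' w"
  unfolding ip_def
  by (subst tsum_add[OF KK_subgp[OF Kx(1)] ip_aux(1,1,2,2), symmetric])
    (simp add: coef_def rhoD lfunD[OF xi0(1)] algebra_simps)

lemma ip_scale_left: "ip (smul a v) w = a * ip v w"
  unfolding ip_def
  by (subst tsum_mult_left[OF KK_subgp[OF Kx(1)] ip_aux, symmetric])
    (simp add: coef_def rhoD lfunD[OF xi0(1)] algebra_simps)

lemma ip_cnj: "cnj (ip v w) = ip w v"
  unfolding ip_def
  by (subst tsum_hom[OF KK_subgp[OF Kx(1)] ip_aux]) (simp_all add: mult.commute)

lemma ip_lfun: "lfun (\<lambda>v. ip v w)"
  by (rule lfunI) (simp_all add: ip_add_left ip_scale_left)

lemma ip_add_right: "ip v (w + w') = ip v w + ip v w'"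
  by (subst (1 2 3) ip_cnj[symmetric]) (simp add: ip_add_left)

lemma ip_scale_right: "ip v (smul a w) = cnj a * ip v w"
  by (subst (1 2) ip_cnj[symmetric]) (simp add: ip_scale_left)

lemma ip_zero_right: "ip v 0 = 0"
  using ip_scale_right[of v 0 0] by simp

lemma ip_diff_right: "ip v (w - w') = ip v w - ip v w'"
  using ip_add_right[of v "w - w'" w'] by simp

lemma ip_sum_right: "ip v (sum f A) = (\<Sum>a\<in>A. ip v (f a))"
  by (induction A rule: infinite_finite_induct) (auto simp: ip_zero_right ip_add_right)

lemma ip_rho: "ip (\<rho> g v) (\<rho> g w) = ip v w"
proof -
  have "coef (\<rho> g u) x = coef u (inverse g * x * 1)" for u x
    by (simp add: coef_def rho_mult)
  then show ?thesis
    unfolding ip_def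
    using tsum_translate[OF KK_subgp[OF Kx(1)] ip_aux(1), where s = 1 and g = "inverse g"] by simp
qed

lemma ip_rho': "ip (\<rho> g v) w = ip v (\<rho> (inverse g) w)"
  using ip_rho[of "inverse g" "\<rho> g v" w] by simp

lemma ip_pos:
  assumes "v \<noteq> 0"
  shows "ip v v \<noteq> 0"
proof
  assume *: "ip v v = 0"
  let ?S = "cosets {x. coef v x * cnj (coef v x) \<noteq> 0} Kx"
  have fin: "finite ?S" using ip_aux(2) unfolding fsupp_def by blast
  have "complex_of_real (\<Sum>c\<in>?S. (cmod (coef v (rp c)))\<^sup>2) = ip v v"
    unfolding ip_def tsum_def by (simp only: of_real_sum complex_norm_square)
  then have "(\<Sum>c\<in>?S. (cmod (coef v (rp c)))\<^sup>2) = 0" using * by (simp only: of_real_eq_0_iff)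
  then have z: "coef v (rp c) = 0" if "c \<in> ?S" for c
    using that by (subst (asm) sum_nonneg_eq_0_iff[OF fin]) auto
  have "coef v x = 0" for x
  proof (rule ccontr)
    assume x: "coef v x \<noteq> 0"
    then have "lcos x Kx \<in> ?S" by (auto simp: cosets_def)
    then have "coef v (rp (lcos x Kx)) = 0" by (rule z)
    then show False using x rinv_rp[OF coef_rinv KK_subgp[OF Kx(1)]] by simp
  qed
  then have "\<xi>0 (\<rho> g v) = 0" for g unfolding coef_def using inv_inv by metis
  then show False using lfun_orbit_zero[OF xi0(1)] xi0(2) assms by blast
qed

text \<open>A Gram-Schmidt step: the new generator \<open>b\<close> is replaced by its component
  \<open>b'\<close> orthogonal to the old span, and a multiple of \<open>b'\<close> corrects the
  value there. Definiteness allows the division by \<open>ip b' b'\<close>.\<close>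

lemma riesz_span:
  assumes "finite S" "lfun \<ll>"
  shows "\<exists>w\<in>span S. \<forall>v\<in>span S. \<ll> v = ip v w"
  using assms
proof (induction S arbitrary: \<ll> rule: finite_induct)
  case empty
  then show ?case by (auto simp: lfunD ip_zero_right)
next
  case (insert b S)
  obtain w0 where w0: "w0 \<in> span S" "\<And>v. v \<in> span S \<Longrightarrow> \<ll> v = ip v w0" using insert by blast
  obtain u where u: "u \<in> span S" "\<And>v. v \<in> span S \<Longrightarrow> ip v b = ip v u" using insert.IH[OF ip_lfun[of b]] by blast
  define b' where "b' = b - u"
  have orth: "ip v b' = 0" if "v \<in> span S" for v using u(2)[OF that] by (simp add: b'_def ip_diff_right)
  show ?case
  proof (cases "b' = 0")
    case True
    then have "b \<in> span S" using u(1) by (simp add: b'_def)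
    then show ?thesis using w0 by (simp add: span_redundant) blast
  next
    case False
    let ?a = "\<ll> b' / ip b' b'"
    let ?w = "w0 + smul (cnj ?a) b'"
    have orth': "ip b' w0 = 0" using orth[OF w0(1)] ip_cnj[of w0 b'] by simp
    have bin: "b \<in> span (insert b S)" by (rule span_base) simp
    have sub: "span S \<subseteq> span (insert b S)" by (rule span_mono) auto
    have "?w \<in> span (insert b S)"
      unfolding b'_def using w0(1) u(1) sub bin by (auto intro!: span_add span_scale span_diff)
    moreover have "\<ll> v = ip v ?w" if "v \<in> span (insert b S)" for v
    proof -
      from that have "\<exists>k. v - smul k b \<in> span S" by (simp add: span_breakdown_eq)
      then obtain k where k: "v - smul k b \<in> span S" by blast
      define s where "s = v - smul k b + smul k u"
      have s: "s \<in> span S" unfolding s_def using k u(1) by (intro span_add span_scale)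
      have v: "v = smul k b' + s" by (simp add: s_def b'_def scale_right_diff_distrib)
      show ?thesis
        using ip_pos[OF False] orth[OF s] orth' w0(2)[OF s] insert(4)
        by (simp add: v ip_add_left ip_scale_left ip_add_right ip_scale_right lfunD)
    qed
    ultimately show ?thesis by blast
  qed
qed

lemma riesz:
  assumes K: "K \<in> KK" and l: "lfun \<ll>"
  shows "\<exists>w. w \<in> fixd K \<and> (\<forall>v\<in>fixd K. ip v w = \<ll> v)"
proof -
  obtain S where S: "finite S" "fixd K \<subseteq> span S" using fixd_finite_dim[OF K] .
  obtain B where B: "B \<subseteq> fixd K" "independent B" "fixd K \<subseteq> span B"
    using maximal_independent_subset by blast
  have "finite B" using independent_span_bound[OF S(1) B(2)] B(1) S(2) by blast
  moreover have "span B = fixd K" using B fixd_subspace by (meson span_minimal subset_antisym)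
  ultimately show ?thesis using riesz_span[OF _ l, of B] by auto
qed

text \<open>A functional that is not smooth has no representing vector, but its restriction to each
  finite-dimensional level \<open>fixd K\<close> has one. These vectors are compatible under
  averaging, see \<open>rz_refine\<close>.\<close>

definition rz :: "('v \<Rightarrow> complex) \<Rightarrow> 'g set \<Rightarrow> 'v" where
  "rz \<ll> K = (SOME w. w \<in> fixd K \<and> (\<forall>v\<in>fixd K. ip v w = \<ll> v))"

lemma rz:
  assumes "K \<in> KK" "lfun \<ll>"
  shows "rz \<ll> K \<in> fixd K" "v \<in> fixd K \<Longrightarrow> ip v (rz \<ll> K) = \<ll> v"
  using someI_ex[OF riesz[OF assms]] unfolding rz_def by auto

lemma rz_unique:
  assumes "w \<in> fixd K" "w' \<in> fixd K" "\<And>v. v \<in> fixd K \<Longrightarrow> ip v w = ip v w'"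
  shows "w = w'"
proof -
  have "w - w' \<in> fixd K" using assms fixd_subspace subspace_diff by blast
  then have "ip (w - w') (w - w') = 0" using assms(3) by (simp add: ip_diff_right)
  then show ?thesis using ip_pos[of "w - w'"] by auto
qed

lemma rz_refine:
  assumes L: "L \<in> KK" "M \<in> KK" "M \<subseteq> L" and l: "lfun \<ll>"
  shows "csum L M (rz \<ll> M) = smul (of_nat (idx L M)) (rz \<ll> L)"
proof (rule rz_unique)
  show "csum L M (rz \<ll> M) \<in> fixd L" using L l by (intro csum_fixd rz(1))
  show "smul (of_nat (idx L M)) (rz \<ll> L) \<in> fixd L" using rz(1)[OF L(1) l] fixd_subspace subspace_scale by blast
  fix v assume v: "v \<in> fixd L"
  have "ip v (csum L M (rz \<ll> M)) = (\<Sum>c\<in>cosets L M. \<ll> v)"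
    unfolding csum_def ip_sum_right
  proof (intro sum.cong refl)
    fix c assume "c \<in> cosets L M"
    then obtain x where x: "x \<in> L" "c = lcos x M" by (auto simp: cosets_def)
    have Ls: "subgp L" using L KK_subgp by blast
    have "inverse x * rp c \<in> L" using rp_lcos[OF KK_subgp[OF L(2)], of x] x(2) L(3) by (auto simp: lcos_def)
    then have "x * (inverse x * rp c) \<in> L" by (rule subgpD(2)[OF Ls x(1)])
    then have "inverse (rp c) \<in> L" using subgpD(3)[OF Ls] by simp
    then have "\<rho> (inverse (rp c)) v = v" using v by (simp add: fixd_def)
    then have "ip v (\<rho> (rp c) (rz \<ll> M)) = ip v (rz \<ll> M)"
      using ip_rho[of "inverse (rp c)" v "\<rho> (rp c) (rz \<ll> M)"] by simp
    also have "\<dots> = \<ll> v" using v L(3) fixd_mono rz(2)[OF L(2) l] by blast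
    finally show "ip v (\<rho> (rp c) (rz \<ll> M)) = \<ll> v" .
  qed
  also have "\<dots> = ip v (smul (of_nat (idx L M)) (rz \<ll> L))"
    using rz(2)[OF L(1) l v] by (simp add: ip_scale_right idx_def)
  finally show "ip v (csum L M (rz \<ll> M)) = ip v (smul (of_nat (idx L M)) (rz \<ll> L))" .
qed

lemma rz_translate:
  assumes L: "L \<in> KK" and l: "lfun \<ll>" and s: "\<And>v. \<ll> (\<rho> s v) = z * \<ll> v" "cmod z = 1"
  shows "rz \<ll> (conjs s L) = smul (inverse z) (\<rho> s (rz \<ll> L))"
proof (rule rz_unique)
  show "rz \<ll> (conjs s L) \<in> fixd (conjs s L)" using KK_conjs[OF L] l by (rule rz(1))
  show "smul (inverse z) (\<rho> s (rz \<ll> L)) \<in> fixd (conjs s L)"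
    using fixd_translate[OF rz(1)[OF L l], of s] fixd_subspace subspace_scale by blast
  fix v assume v: "v \<in> fixd (conjs s L)"
  have "z * cnj z = 1" using complex_norm_square[of z] s(2) by simp
  then have z: "cnj (inverse z) = z"
    unfolding complex_cnj_inverse by (intro inverse_unique) (simp add: mult.commute)
  have "\<rho> (inverse s) v \<in> fixd L" using fixd_translate[OF v, of "inverse s"] by (simp add: conjs_conjs)
  then have "ip (\<rho> (inverse s) v) (rz \<ll> L) = \<ll> (\<rho> (inverse s) v)" by (rule rz(2)[OF L l])
  moreover have "\<ll> v = z * \<ll> (\<rho> (inverse s) v)" using s(1)[of "\<rho> (inverse s) v"] by simp
  ultimately show "ip v (rz \<ll> (conjs s L)) = ip v (smul (inverse z) (\<rho> s (rz \<ll> L)))"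
    using rz(2)[OF KK_conjs[OF L] l v] z ip_rho'[of "inverse s" v "rz \<ll> L"] by (simp add: ip_scale_right)
qed

text \<open>The Bessel distribution of the pair, formally \<ll> applied to the action of
  \<open>f\<close> on \<open>m\<close>, where \<open>m\<close> is replaced by its representing
  vector at a level under which \<open>f\<close> is right invariant; \<open>mu L\<close> is the
  volume of one coset.\<close>

definition tl :: "('v \<Rightarrow> complex) \<Rightarrow> ('v \<Rightarrow> complex) \<Rightarrow> ('g \<Rightarrow> complex) \<Rightarrow> 'g set \<Rightarrow> complex" where
  "tl \<ll> m f L = of_real (mu L) * tsum L (\<lambda>x. f x * \<ll> (\<rho> x (rz m L)))"

definition TT :: "('v \<Rightarrow> complex) \<Rightarrow> ('v \<Rightarrow> complex) \<Rightarrow> ('g \<Rightarrow> complex) \<Rightarrow> complex" where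
  "TT \<ll> m f = tl \<ll> m f (SOME L. L \<in> KK \<and> rinv L f)"

lemma tl_aux:
  fixes \<ll> :: "'v \<Rightarrow> complex"
  assumes "L \<in> KK" "lfun m" "rinv L f" "fsupp L f"
  shows "rinv L (\<lambda>x. f x * \<ll> (\<rho> x (rz m L)))" "fsupp L (\<lambda>x. f x * \<ll> (\<rho> x (rz m L)))"
proof -
  show "rinv L (\<lambda>x. f x * \<ll> (\<rho> x (rz m L)))"
    using assms(3) rinv_rho[OF rz(1)[OF assms(1,2)]] by (auto simp: rinv_def)
  show "fsupp L (\<lambda>x. f x * \<ll> (\<rho> x (rz m L)))"
    by (rule fsupp_subset[OF assms(4)]) auto
qed

text \<open>On passing to \<open>N\<close> the sum grows by the index, because the representing
  vectors at level \<open>N\<close> average to the one at level \<open>L\<close>; the volume shrinks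
  by the same index.\<close>

lemma tl_refine:
  assumes L: "L \<in> KK" "N \<in> KK" "N \<subseteq> L" and l: "lfun \<ll>" "lfun m" and f: "rinv L f" "fsupp L f"
  shows "tl \<ll> m f N = tl \<ll> m f L"
proof -
  let ?A = "{x. f x \<noteq> 0}"
  have Ls: "subgp L" "subgp N" using L KK_subgp by auto
  have "tsum N (\<lambda>x. f x * \<ll> (\<rho> x (rz m N)))
      = (\<Sum>c\<in>cosets ?A L. \<Sum>d\<in>cosets L N. f (rp c * rp d) * \<ll> (\<rho> (rp c * rp d) (rz m N)))"
  proof (rule tsum_refine[OF Ls L(3) KK_finite[OF L(1,2)]])
    show "finite (cosets {x. f x \<noteq> 0} L)" using f(2) by (simp add: fsupp_def)
    show "rinv L (\<lambda>x. f x \<noteq> 0)" using f(1) by (simp add: rinv_def)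
    show "rinv N (\<lambda>x. f x * \<ll> (\<rho> x (rz m N)))"
      using rinv_mono[OF f(1) L(3)] rinv_rho[OF rz(1)[OF L(2) l(2)]] by (auto simp: rinv_def)
  qed auto
  also have "\<dots> = (\<Sum>c\<in>cosets ?A L. f (rp c) * \<ll> (\<rho> (rp c) (csum L N (rz m N))))"
  proof (intro sum.cong refl)
    fix c
    have "f (rp c * rp d) = f (rp c)" if d: "d \<in> cosets L N" for d
    proof -
      obtain x where x: "x \<in> L" "d = lcos x N" using d by (auto simp: cosets_def)
      have "inverse x * rp d \<in> L" using rp_lcos[OF Ls(2), of x] x(2) L(3) by (auto simp: lcos_def)
      then have "x * (inverse x * rp d) \<in> L" by (rule subgpD(2)[OF Ls(1) x(1)])
      then show ?thesis using f(1) by (simp add: rinv_def)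
    qed
    then have "(\<Sum>d\<in>cosets L N. f (rp c * rp d) * \<ll> (\<rho> (rp c * rp d) (rz m N)))
        = (\<Sum>d\<in>cosets L N. f (rp c) * \<ll> (\<rho> (rp c) (\<rho> (rp d) (rz m N))))"
      by (intro sum.cong) (auto simp: rho_mult)
    also have "\<dots> = f (rp c) * \<ll> (\<rho> (rp c) (csum L N (rz m N)))"
      by (simp add: csum_def rhoD lfunD[OF l(1)] sum_distrib_left)
    finally show "(\<Sum>d\<in>cosets L N. f (rp c * rp d) * \<ll> (\<rho> (rp c * rp d) (rz m N)))
        = f (rp c) * \<ll> (\<rho> (rp c) (csum L N (rz m N)))" .
  qed
  also have "\<dots> = of_nat (idx L N) * (\<Sum>c\<in>cosets ?A L. f (rp c) * \<ll> (\<rho> (rp c) (rz m L)))"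
    unfolding rz_refine[OF L l(2)] by (simp add: rhoD lfunD[OF l(1)] sum_distrib_left algebra_simps)
  also have "(\<Sum>c\<in>cosets ?A L. f (rp c) * \<ll> (\<rho> (rp c) (rz m L))) = tsum L (\<lambda>x. f x * \<ll> (\<rho> x (rz m L)))"
    using f(2) tl_aux(1)[OF L(1) l(2) f] unfolding fsupp_def
    by (intro tsum_eq[OF Ls(1), symmetric] cosets_mono) auto
  finally show ?thesis
    unfolding tl_def mu_idx[OF L] by simp
qed

lemma TT_eq:
  assumes "L \<in> KK" "lfun \<ll>" "lfun m" "rinv L f" "fsupp L f"
  shows "TT \<ll> m f = tl \<ll> m f L"
proof -
  define M where "M = (SOME L. L \<in> KK \<and> rinv L f)"
  have M: "M \<in> KK \<and> rinv M f" unfolding M_def by (rule someI[of _ L]) (use assms in auto)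
  have N: "L \<inter> M \<in> KK" using assms M KK_Int by blast
  have "fsupp M f" using assms M finite_cosets_change unfolding fsupp_def by blast
  then have "tl \<ll> m f (L \<inter> M) = tl \<ll> m f M"
    using M by (intro tl_refine[OF _ N Int_lower2 assms(2,3)]) auto
  moreover have "tl \<ll> m f (L \<inter> M) = tl \<ll> m f L"
    by (rule tl_refine[OF assms(1) N Int_lower1 assms(2-5)])
  ultimately show ?thesis unfolding TT_def M_def by simp
qed

lemma TT_add:
  assumes l: "lfun \<ll>" "lfun m" and "testf f" "testf g"
  shows "TT \<ll> m (\<lambda>x. f x + g x) = TT \<ll> m f + TT \<ll> m g"
proof -
  obtain L where L: "L \<in> KK" "rinv L f" "\<forall>k\<in>L. \<forall>x. f (k * x) = f x" "\<forall>M\<in>KK. fsupp M f"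
    using testfD[OF assms(3)] by blast
  obtain M where M: "M \<in> KK" "rinv M g" "\<forall>k\<in>M. \<forall>x. g (k * x) = g x" "\<forall>M\<in>KK. fsupp M g"
    using testfD[OF assms(4)] by blast
  let ?N = "L \<inter> M"
  have N: "?N \<in> KK" using L M KK_Int by blast
  have r: "rinv ?N f" "rinv ?N g" "rinv ?N (\<lambda>x. f x + g x)" using L M by (auto simp: rinv_def)
  have s: "fsupp ?N f" "fsupp ?N g" using L M N by auto
  then have s': "fsupp ?N (\<lambda>x. f x + g x)" by (rule fsupp_add)
  show ?thesis
    unfolding TT_eq[OF N l r(1) s(1)] TT_eq[OF N l r(2) s(2)] TT_eq[OF N l r(3) s'] tl_def
    by (simp add: distrib_right tsum_add[OF KK_subgp[OF N] tl_aux(1)[OF N l(2) r(1) s(1)]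
          tl_aux(1)[OF N l(2) r(2) s(2)] tl_aux(2)[OF N l(2) r(1) s(1)] tl_aux(2)[OF N l(2) r(2) s(2)]] distrib_left)
qed

lemma TT_scale:
  assumes l: "lfun \<ll>" "lfun m" and "testf f"
  shows "TT \<ll> m (\<lambda>x. c * f x) = c * TT \<ll> m f"
proof -
  obtain L where L: "L \<in> KK" "rinv L f" "\<forall>k\<in>L. \<forall>x. f (k * x) = f x" "\<forall>M\<in>KK. fsupp M f"
    using testfD[OF assms(3)] by blast
  have r: "rinv L (\<lambda>x. c * f x)" using L by (auto simp: rinv_def)
  have s: "fsupp L f" using L by auto
  then have s': "fsupp L (\<lambda>x. c * f x)" by (rule fsupp_subset) auto
  show ?thesis
    unfolding TT_eq[OF L(1) l L(2) s] TT_eq[OF L(1) l r s'] tl_def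
    by (simp add: mult.assoc tsum_mult_left[OF KK_subgp[OF L(1)] tl_aux[OF L(1) l(2) L(2) s]])
qed

lemma TT_left:
  assumes l: "lfun \<ll>" "lfun m" and f: "testf f" and s: "\<And>v. \<ll> (\<rho> s v) = z * \<ll> v"
  shows "TT \<ll> m (\<lambda>x. f (inverse s * x)) = z * TT \<ll> m f"
proof -
  obtain L where L: "L \<in> KK" "rinv L f" "\<forall>k\<in>L. \<forall>x. f (k * x) = f x" "\<forall>M\<in>KK. fsupp M f"
    using testfD[OF f] by blast
  have Ls: "fsupp L f" using L by auto
  have L': "rinv L (\<lambda>x. f (inverse s * x))" "fsupp L (\<lambda>x. f (inverse s * x))"
    using rinv_translate[OF L(2), of 1 "inverse s"] fsupp_translate[OF Ls, of 1 "inverse s"] by simp_all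
  let ?F = "\<lambda>x. f x * \<ll> (\<rho> x (rz m L))"
  have "tsum L (\<lambda>x. f (inverse s * x) * \<ll> (\<rho> x (rz m L))) = tsum L (\<lambda>x. z * ?F (inverse s * x))"
  proof -
    have "f (inverse s * x) * \<ll> (\<rho> x (rz m L)) = z * ?F (inverse s * x)" for x
      using s[of "\<rho> (inverse s * x) (rz m L)"] by (simp flip: rho_mult)
    then show ?thesis by (simp only:)
  qed
  also have "\<dots> = tsum L (\<lambda>x. z * ?F x)"
  proof -
    have "rinv L (\<lambda>x. z * ?F x)" using tl_aux(1)[OF L(1) l(2) L(2) Ls] by (simp add: rinv_def)
    from tsum_translate[OF KK_subgp[OF L(1)] this, of 1 "inverse s"] show ?thesis by simp
  qed
  also have "\<dots> = z * tsum L ?F"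
    by (rule tsum_mult_left[OF KK_subgp[OF L(1)] tl_aux[OF L(1) l(2) L(2) Ls]])
  finally show ?thesis
    unfolding TT_eq[OF L(1) l L'] TT_eq[OF L(1) l L(2) Ls] tl_def by simp
qed

text \<open>Right translation moves the level from \<open>L\<close> to \<open>s L s^-1\<close>. A
  trivial modulus keeps the volume, and a factor \<open>z\<close> of absolute value one is needed
  because the representing vector depends on \<open>m\<close> conjugate-linearly.\<close>

lemma TT_right:
  assumes l: "lfun \<ll>" "lfun m" and f: "testf f" and s: "\<And>v. m (\<rho> s v) = z * m v" "cmod z = 1" "modulus s = 1"
  shows "TT \<ll> m (\<lambda>x. f (x * s)) = inverse z * TT \<ll> m f"
proof -
  obtain L where L: "L \<in> KK" "rinv L f" "\<forall>k\<in>L. \<forall>x. f (k * x) = f x" "\<forall>M\<in>KK. fsupp M f"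
    using testfD[OF f] by blast
  have Ls: "fsupp L f" using L by auto
  let ?M = "conjs s L"
  have M: "?M \<in> KK" using L KK_conjs by blast
  have L': "rinv ?M (\<lambda>x. f (x * s))" "fsupp ?M (\<lambda>x. f (x * s))"
    using rinv_translate[OF L(2), of s 1] fsupp_translate[OF Ls, of s 1] by simp_all
  let ?F = "\<lambda>x. f x * \<ll> (\<rho> x (rz m L))"
  have "tsum ?M (\<lambda>x. f (x * s) * \<ll> (\<rho> x (rz m ?M))) = tsum ?M (\<lambda>x. inverse z * ?F (x * s))"
    unfolding rz_translate[OF L(1) l(2) s(1,2)]
    by (simp add: rhoD lfunD[OF l(1)] rho_mult algebra_simps)
  also have "\<dots> = tsum L (\<lambda>x. inverse z * ?F x)"
  proof -
    have "rinv L (\<lambda>x. inverse z * ?F x)" using tl_aux(1)[OF L(1) l(2) L(2) Ls] by (simp add: rinv_def)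
    from tsum_translate[OF KK_subgp[OF L(1)] this, of s 1] show ?thesis by simp
  qed
  also have "\<dots> = inverse z * tsum L ?F"
    by (rule tsum_mult_left[OF KK_subgp[OF L(1)] tl_aux[OF L(1) l(2) L(2) Ls]])
  also have "mu ?M = mu L"
  proof -
    have "modulus s * modulus (inverse s) = modulus 1" by (simp flip: modulus_mult)
    moreover have "modulus 1 = 1" using modulus_eq_1[OF L(1) subgpD(1)[OF KK_subgp[OF L(1)]]] .
    ultimately show ?thesis using mu_conjs[OF L(1), of "inverse s"] s(3) by simp
  qed
  ultimately show ?thesis
    unfolding TT_eq[OF M l L'] TT_eq[OF L(1) l L(2) Ls] tl_def by simp
qed

text \<open>Summing the translates of the representing vector over \<open>K x K / K\<close> gives a
  \<open>K\<close>-fixed vector, on which \<ll> is an inner product; by invariance each coset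
  contributes the same value.\<close>

lemma TT_dcos:
  assumes K: "K \<in> KK" and l: "lfun \<ll>" "lfun m"
  shows "TT \<ll> m (\<lambda>y. if y \<in> dcos K x then 1 else 0)
    = of_real (mu K * real (card (cosets (dcos K x) K))) * ip (\<rho> x (rz m K)) (rz \<ll> K)"
proof -
  let ?A = "dcos K x" and ?w = "rz m K"
  have Ks: "subgp K" using K KK_subgp by blast
  note A = dcos_mult[OF Ks]
  have fin: "finite (cosets ?A K)"
    using idx_pos[OF K KK_Int[OF K KK_conjs[OF K]]] card_cosets_dcos[OF K, of x] by (metis card_ge_0_finite)
  let ?\<phi> = "\<lambda>y. if y \<in> ?A then \<rho> y ?w else 0"
  have ri: "rinv K ?\<phi>" using A(2) rz(1)[OF K l(2)] by (auto simp: rinv_def fixd_def rho_mult)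
  have fs: "fsupp K ?\<phi>" unfolding fsupp_def by (rule finite_subset[OF cosets_mono fin]) (auto split: if_splits)
  define v where "v = tsum K ?\<phi>"
  have "\<rho> k v = v" if k: "k \<in> K" for k
  proof -
    have "\<rho> k v = tsum K (\<lambda>y. \<rho> k (?\<phi> y))" unfolding v_def
      by (rule tsum_hom[OF Ks ri fs]) (auto simp: rhoD)
    also have "(\<lambda>y. \<rho> k (?\<phi> y)) = (\<lambda>y. ?\<phi> (k * y * 1))"
      by (auto simp: A(1)[OF k] rho_mult rhoD)
    also have "tsum K \<dots> = v" unfolding v_def
      using tsum_translate[OF Ks ri, where s = 1 and g = k] by simp
    finally show ?thesis .
  qed
  then have vK: "v \<in> fixd K" by (simp add: fixd_def)
  have inA: "rp c \<in> ?A" if c: "c \<in> cosets ?A K" for c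
  proof -
    obtain y where y: "y \<in> ?A" "c = lcos y K" using c by (auto simp: cosets_def)
    then have "inverse y * rp c \<in> K" using rp_lcos[OF Ks, of y] by (simp add: lcos_def)
    then show ?thesis using A(2)[of "inverse y * rp c" y x] y(1) by simp
  qed
  have v: "v = (\<Sum>c\<in>cosets ?A K. \<rho> (rp c) ?w)"
  proof -
    have "v = (\<Sum>c\<in>cosets ?A K. ?\<phi> (rp c))" unfolding v_def
      by (intro tsum_eq[OF Ks ri fin] cosets_mono) (auto split: if_splits)
    then show ?thesis using inA by (simp cong: sum.cong)
  qed
  have ipc: "ip (\<rho> y ?w) (rz \<ll> K) = ip (\<rho> x ?w) (rz \<ll> K)" if y: "y \<in> ?A" for y
  proof -
    obtain k l where kl: "k \<in> K" "l \<in> K" "y = k * x * l" using y by (auto simp: dcos_def)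
    have "\<rho> (inverse k) (rz \<ll> K) = rz \<ll> K"
      using rz(1)[OF K l(1)] subgpD(3)[OF Ks kl(1)] by (simp add: fixd_def)
    moreover have "\<rho> y ?w = \<rho> k (\<rho> x ?w)" using rz(1)[OF K l(2)] kl by (simp add: rho_mult fixd_def)
    ultimately show ?thesis by (simp add: ip_rho')
  qed
  have "\<ll> v = ip v (rz \<ll> K)" using rz(2)[OF K l(1) vK] by simp
  also have "\<dots> = (\<Sum>c\<in>cosets ?A K. ip (\<rho> (rp c) ?w) (rz \<ll> K))"
    unfolding v by (simp add: lfunD(5)[OF ip_lfun])
  also have "\<dots> = of_nat (card (cosets ?A K)) * ip (\<rho> x ?w) (rz \<ll> K)"
    using inA ipc by (simp cong: sum.cong)
  finally have lv: "\<ll> v = of_nat (card (cosets ?A K)) * ip (\<rho> x ?w) (rz \<ll> K)" .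
  let ?f = "\<lambda>y. if y \<in> ?A then 1 else 0 :: complex"
  have f: "rinv K ?f" "fsupp K ?f" using A(2) fin by (auto simp: rinv_def fsupp_def)
  have "tsum K (\<lambda>y. ?f y * \<ll> (\<rho> y ?w)) = \<ll> v"
  proof -
    have "\<ll> (tsum K ?\<phi>) = tsum K (\<lambda>y. \<ll> (?\<phi> y))"
      by (rule tsum_hom[OF Ks ri fs]) (auto simp: lfunD[OF l(1)])
    moreover have "(\<lambda>y. \<ll> (?\<phi> y)) = (\<lambda>y. ?f y * \<ll> (\<rho> y ?w))" by (auto simp: lfunD[OF l(1)])
    ultimately show ?thesis by (simp add: v_def)
  qed
  then show ?thesis
    unfolding TT_eq[OF K l f] tl_def lv by simp
qed

lemma mult_one_form:
  assumes H: "\<And>s. s \<in> H \<Longrightarrow> modulus s = 1 \<and> cmod (\<theta> s) = 1 \<and> \<epsilon> * s * \<epsilon> \<in> H \<and> \<theta> (\<epsilon> * s * \<epsilon>) = inverse (\<theta> s)"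
    and eps: "\<epsilon> * \<epsilon> = 1"
    and GK: "\<And>D f. skew_distribution H \<theta> \<epsilon> D \<Longrightarrow> testf f \<Longrightarrow> D f = 0"
    and l: "lfun \<ll>" "\<And>s v. s \<in> H \<Longrightarrow> \<ll> (\<rho> s v) = \<theta> s * \<ll> v"
    and l': "lfun \<ll>'" "\<And>s v. s \<in> H \<Longrightarrow> \<ll>' (\<rho> s v) = \<theta> s * \<ll>' v"
    and ne: "\<ll> u \<noteq> 0"
  shows "\<exists>c. \<forall>v. \<ll>' v = c * \<ll> v"
proof -
  have eps': "inverse \<epsilon> = \<epsilon>" by (rule inv_unique[OF eps])
  have ee: "\<epsilon> * (\<epsilon> * x) = x" for x using eps by (simp flip: mult.assoc)
  have ee': "\<rho> \<epsilon> (\<rho> \<epsilon> v) = v" for v using eps by (simp flip: rho_mult)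
  \<comment> \<open>The pairs of \<ll> with itself and of \<open>\<ll>'\<close> with \<ll> are both
    needed, so one functional stays variable.\<close>
  have symm: "TT \<mm> \<ll> f = TT \<mm> \<ll> (\<lambda>x. f (\<epsilon> * inverse x * \<epsilon>))"
    if m: "lfun \<mm>" "\<And>s v. s \<in> H \<Longrightarrow> \<mm> (\<rho> s v) = \<theta> s * \<mm> v" and f: "testf f" for \<mm> f
  proof -
    let ?\<tau> = "\<lambda>x. \<epsilon> * inverse x * \<epsilon>"
    have tau: "testf (\<lambda>x. f (?\<tau> x))" if "testf f" for f
      using testf_inverse[OF testf_translate[OF that, of \<epsilon> \<epsilon>]] by simp
    have tau2: "?\<tau> (?\<tau> x) = x" for x by (simp add: eps' ee mult.assoc eps)
    define D where "D = (\<lambda>f. TT \<mm> \<ll> f - TT \<mm> \<ll> (\<lambda>x. f (?\<tau> x)))"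
    have "D f = 0"
    proof (rule GK[OF _ f], unfold skew_distribution_def, intro conjI allI ballI impI)
      fix f g assume "testf f" "testf g"
      then show "D (\<lambda>x. f x + g x) = D f + D g"
        unfolding D_def using m(1) l(1) tau by (simp add: TT_add)
    next
      fix f c assume "testf f"
      then show "D (\<lambda>x. c * f x) = c * D f"
        unfolding D_def using m(1) l(1) tau by (simp add: TT_scale algebra_simps)
    next
      fix f assume "testf f"
      show "D (\<lambda>x. f (\<epsilon> * inverse x * \<epsilon>)) = - D f"
        unfolding D_def tau2 by simp
    next
      fix f s assume f: "testf f" and s: "s \<in> H"
      let ?s = "\<epsilon> * s * \<epsilon>"
      have s': "?s \<in> H" "\<theta> ?s = inverse (\<theta> s)" "cmod (\<theta> ?s) = 1" "modulus ?s = 1"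
        using H[OF s] H[of ?s] by auto
      have eq: "f (inverse s * ?\<tau> x) = f (?\<tau> (x * ?s))" for x
        by (simp add: eps' ee mult.assoc eps)
      have "TT \<mm> \<ll> (\<lambda>x. f (?\<tau> (x * ?s))) = inverse (inverse (\<theta> s)) * TT \<mm> \<ll> (\<lambda>x. f (?\<tau> x))"
        using l(2)[OF s'(1)] s' by (intro TT_right[OF m(1) l(1) tau[OF f], where s = ?s]) auto
      then show "D (\<lambda>x. f (inverse s * x)) = \<theta> s * D f"
        unfolding D_def eq TT_left[OF m(1) l(1) f m(2)[OF s]] by (simp add: algebra_simps)
    next
      fix f s assume f: "testf f" and s: "s \<in> H"
      let ?s = "\<epsilon> * s * \<epsilon>"
      have s': "?s \<in> H" "\<theta> ?s = inverse (\<theta> s)" using H[OF s] by auto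
      have eq: "f (?\<tau> x * s) = f (?\<tau> (inverse ?s * x))" for x
        by (simp add: eps' ee mult.assoc eps)
      have "TT \<mm> \<ll> (\<lambda>x. f (?\<tau> (inverse ?s * x))) = inverse (\<theta> s) * TT \<mm> \<ll> (\<lambda>x. f (?\<tau> x))"
        using m(2)[OF s'(1)] s' by (intro TT_left[OF m(1) l(1) tau[OF f], where s = ?s]) auto
      moreover have "TT \<mm> \<ll> (\<lambda>x. f (x * s)) = inverse (\<theta> s) * TT \<mm> \<ll> f"
        using H[OF s] l(2)[OF s] by (intro TT_right[OF m(1) l(1) f]) auto
      ultimately show "D (\<lambda>x. f (x * s)) = inverse (\<theta> s) * D f"
        unfolding D_def eq by (simp add: algebra_simps)
    qed
    then show ?thesis by (simp add: D_def)
  qed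
  \<comment> \<open>Invariance of the distribution, applied to the indicator of
    \<open>K x K\<close>, whose image is the double coset of
    \<open>\<epsilon> * inverse x * \<epsilon>\<close>. As \<open>K\<close> is stable under
    \<epsilon>, the two coset counts are those of \<open>x\<close> and its inverse, and their ratio
    is the modulus.\<close>
  have star: "of_real (modulus x) * ip (\<rho> x (rz \<ll> K)) (rz \<mm> K) = ip (\<rho> \<epsilon> (rz \<ll> K)) (\<rho> x (\<rho> \<epsilon> (rz \<mm> K)))"
    if m: "lfun \<mm>" "\<And>s v. s \<in> H \<Longrightarrow> \<mm> (\<rho> s v) = \<theta> s * \<mm> v" and K: "K \<in> KK" "conjs \<epsilon> K = K" for \<mm> K x
  proof -
    let ?n = "\<lambda>x. card (cosets (dcos K x) K)" and ?x = "\<epsilon> * inverse x * \<epsilon>"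
    have Ks: "subgp K" using K KK_subgp by blast
    have eK: "\<epsilon> * k * \<epsilon> \<in> K \<longleftrightarrow> k \<in> K" for k
      using K(2) by (auto simp: conjs_def eps' set_eq_iff)
    have flip: "\<epsilon> * inverse y * \<epsilon> \<in> dcos K z'" if y: "y \<in> dcos K z" and z: "z' = \<epsilon> * inverse z * \<epsilon>" for y z z'
    proof -
      obtain k l where kl: "k \<in> K" "l \<in> K" "y = k * z * l" using y by (auto simp: dcos_def)
      have "\<epsilon> * inverse y * \<epsilon> = (\<epsilon> * inverse l * \<epsilon>) * z' * (\<epsilon> * inverse k * \<epsilon>)"
        by (simp add: kl z ee mult.assoc)
      moreover have "\<epsilon> * inverse l * \<epsilon> \<in> K" "\<epsilon> * inverse k * \<epsilon> \<in> K"
        using eK subgpD(3)[OF Ks] kl by auto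
      ultimately show ?thesis unfolding dcos_def by blast
    qed
    have "(\<epsilon> * inverse y * \<epsilon> \<in> dcos K x) = (y \<in> dcos K ?x)" for y
      using flip[of y ?x x] flip[of "\<epsilon> * inverse y * \<epsilon>" x ?x] by (auto simp: eps' ee mult.assoc eps)
    then have "TT \<mm> \<ll> (\<lambda>y. if y \<in> dcos K x then 1 else 0) = TT \<mm> \<ll> (\<lambda>y. if y \<in> dcos K ?x then 1 else 0)"
      using symm[OF m testf_dcos[OF K(1), of x]] by simp
    then have "of_nat (?n x) * ip (\<rho> x (rz \<ll> K)) (rz \<mm> K) = of_nat (?n ?x) * ip (\<rho> ?x (rz \<ll> K)) (rz \<mm> K)"
      using mu_pos[OF K(1)] by (simp add: TT_dcos[OF K(1) m(1) l(1)])
    moreover have "?n ?x = ?n (inverse x)"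
    proof -
      have "conjs ?x K = conjs \<epsilon> (conjs (inverse x) K)"
        using K(2) by (simp add: conjs_conjs flip: conjs_conjs[of "\<epsilon> * inverse x" \<epsilon>])
      then have "K \<inter> conjs ?x K = conjs \<epsilon> (K \<inter> conjs (inverse x) K)"
        using K(2) by (simp add: conjs_Int)
      then show ?thesis
        using idx_conjs[of \<epsilon> K "K \<inter> conjs (inverse x) K"] K(2) by (simp add: card_cosets_dcos[OF K(1)])
    qed
    moreover have "complex_of_real (real (?n x)) = of_real (modulus x) * of_nat (?n (inverse x))"
      unfolding card_dcos_inverse[OF K(1), of x] by simp
    moreover have "?n (inverse x) > 0"
      unfolding card_cosets_dcos[OF K(1)] using K(1) by (intro idx_pos KK_Int KK_conjs)
    moreover have "ip (\<rho> ?x (rz \<ll> K)) (rz \<mm> K) = ip (\<rho> \<epsilon> (rz \<ll> K)) (\<rho> x (\<rho> \<epsilon> (rz \<mm> K)))"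
      by (simp add: rho_mult ip_rho' eps')
    ultimately show ?thesis by simp
  qed
  have proportional: "\<exists>c. \<forall>v\<in>fixd K. \<ll>' v = c * \<ll> v" if K: "K \<in> KK" "conjs \<epsilon> K = K" and u: "u \<in> fixd K" for K
  proof -
    let ?w = "rz \<ll> K" and ?w' = "rz \<ll>' K"
    have w: "?w \<noteq> 0" using rz(2)[OF K(1) l(1) u] ne ip_zero_right by auto
    have ew: "\<rho> \<epsilon> ?w \<noteq> 0" using w ee' rhoD(3) by metis
    have ewK: "\<rho> \<epsilon> ?w \<in> fixd K" using fixd_translate[OF rz(1)[OF K(1) l(1)], of \<epsilon>] K(2) by simp
    \<comment> \<open>Using \<open>star\<close> for \<ll> itself, a relation among translates of
      \<open>\<rho> \<epsilon> ?w\<close> becomes the vanishing of \<open>?z\<close>, a combination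
      with conjugate coefficients weighted by the modulus; using \<open>star\<close> for
      \<open>\<ll>'\<close> the vanishing of \<open>?z\<close> becomes the same relation for
      \<open>?w'\<close>.\<close>
    have rel: "(\<Sum>x\<in>S. smul (a x) (\<rho> x (\<rho> \<epsilon> ?w'))) = 0"
      if S: "finite S" "(\<Sum>x\<in>S. smul (a x) (\<rho> x (\<rho> \<epsilon> ?w))) = 0" for S :: "'g set" and a
    proof -
      let ?z = "\<Sum>x\<in>S. smul (cnj (a x) * of_real (modulus x)) (\<rho> x ?w)"
      have key: "of_real (modulus g) * ip (\<rho> g ?z) (rz \<mm> K)
          = ip (\<rho> \<epsilon> ?w) (\<rho> g (\<Sum>x\<in>S. smul (a x) (\<rho> x (\<rho> \<epsilon> (rz \<mm> K)))))"
        if m: "lfun \<mm>" "\<And>s v. s \<in> H \<Longrightarrow> \<mm> (\<rho> s v) = \<theta> s * \<mm> v" for \<mm> g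
      proof -
        have "of_real (modulus g) * ip (\<rho> g ?z) (rz \<mm> K)
          = (\<Sum>x\<in>S. cnj (a x) * (of_real (modulus (g * x)) * ip (\<rho> (g * x) ?w) (rz \<mm> K)))"
          by (simp add: rhoD lfunD[OF ip_lfun] sum_distrib_left modulus_mult rho_mult algebra_simps)
        also have "\<dots> = (\<Sum>x\<in>S. cnj (a x) * ip (\<rho> \<epsilon> ?w) (\<rho> g (\<rho> x (\<rho> \<epsilon> (rz \<mm> K)))))"
          by (simp only: star[OF m K] rho_mult[symmetric, of g])
        also have "\<dots> = ip (\<rho> \<epsilon> ?w) (\<rho> g (\<Sum>x\<in>S. smul (a x) (\<rho> x (\<rho> \<epsilon> (rz \<mm> K)))))"
          by (simp add: rhoD ip_sum_right ip_scale_right)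
        finally show ?thesis .
      qed
      have "ip (\<rho> g ?z) ?w = 0" for g
        using key[OF l, of g] modulus_pos[of g] by (simp only: S(2) rhoD ip_zero_right) simp
      then have "?z = 0" using ip_pos[OF w] by (intro lfun_orbit_zero[OF ip_lfun[of ?w], of ?w])
      let ?y = "\<Sum>x\<in>S. smul (a x) (\<rho> x (\<rho> \<epsilon> ?w'))"
      have "ip (\<rho> g ?y) (\<rho> \<epsilon> ?w) = 0" for g
        using key[OF l', of g] ip_cnj[of "\<rho> \<epsilon> ?w" "\<rho> g ?y"] lfunD(3)[OF ip_lfun]
        by (simp only: \<open>?z = 0\<close> rhoD) (metis complex_cnj_zero mult_zero_right)
      then show ?thesis using ip_pos[OF ew] by (intro lfun_orbit_zero[OF ip_lfun[of "\<rho> \<epsilon> ?w"], of "\<rho> \<epsilon> ?w"])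
    qed
    obtain c where c: "\<rho> \<epsilon> ?w' = smul c (\<rho> \<epsilon> ?w)"
      using schur[OF K(1) ewK ew rel] by blast
    have "?w' = smul c ?w" using arg_cong[OF c, of "\<rho> \<epsilon>"] by (simp add: rhoD ee')
    then have "\<ll>' v = cnj c * \<ll> v" if "v \<in> fixd K" for v
      using rz(2)[OF K(1) l(1) that] rz(2)[OF K(1) l'(1) that] by (simp add: ip_scale_right)
    then show ?thesis by blast
  qed
  \<comment> \<open>The constant at each level can be read off at \<open>u\<close>; a level stable
    under \<epsilon> that fixes both \<open>u\<close> and \<open>v\<close> thus gives a constant
    independent of \<open>v\<close>.\<close>
  have "\<ll>' v = (\<ll>' u / \<ll> u) * \<ll> v" for v
  proof -
    let ?M = "stb u \<inter> stb v"
    let ?K = "?M \<inter> conjs \<epsilon> ?M"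
    have M: "?M \<in> KK" by (intro KK_Int stb)
    have K: "?K \<in> KK" using M by (intro KK_Int[OF M] KK_conjs)
    have eK: "conjs \<epsilon> ?K = ?K" by (auto simp: conjs_Int conjs_conjs eps)
    have uv: "u \<in> fixd ?K" "v \<in> fixd ?K" using stb(2)[of u] stb(2)[of v] by (auto simp: fixd_def)
    obtain c where "\<forall>v\<in>fixd ?K. \<ll>' v = c * \<ll> v" using proportional[OF K eK uv(1)] by blast
    then show ?thesis using uv ne by simp
  qed
  then show ?thesis by blast
qed

end

context cuspidal_rep
begin

text \<open>Composing \<ll> with the projector onto a level on which it is nonzero yields a nonzero
  smooth functional, and this starts the construction of the inner product.\<close>

theorem mult_one:
  assumes H: "\<And>s. s \<in> H \<Longrightarrow> modulus s = 1 \<and> cmod (\<theta> s) = 1 \<and> \<epsilon> * s * \<epsilon> \<in> H \<and> \<theta> (\<epsilon> * s * \<epsilon>) = inverse (\<theta> s)"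
    and eps: "\<epsilon> * \<epsilon> = 1"
    and GK: "\<And>D f. skew_distribution H \<theta> \<epsilon> D \<Longrightarrow> testf f \<Longrightarrow> D f = 0"
    and l: "lfun \<ll>" "\<And>s v. s \<in> H \<Longrightarrow> \<ll> (\<rho> s v) = \<theta> s * \<ll> v"
    and l': "lfun \<ll>'" "\<And>s v. s \<in> H \<Longrightarrow> \<ll>' (\<rho> s v) = \<theta> s * \<ll>' v"
    and ne: "\<ll> u \<noteq> 0"
  shows "\<exists>c. \<forall>v. \<ll>' v = c * \<ll> v"
proof -
  have K: "stb u \<in> KK" by (rule stb)
  interpret F: cuspidal_rep_form smul KK \<rho> "(\<lambda>v. \<ll> (avg (stb u) v))" "stb u"
  proof (intro cuspidal_rep_form.intro cuspidal_rep_axioms cuspidal_rep_form_axioms.intro)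
    show "lfun (\<lambda>v. \<ll> (avg (stb u) v))"
      by (rule lfunI) (simp_all add: avg_add avg_scale K lfunD[OF l(1)])
    show "\<exists>w. \<ll> (avg (stb u) w) \<noteq> 0" using avg_id[OF stb] ne by metis
    show "stb u \<in> KK" by (rule stb)
    show "\<ll> (avg (stb u) (\<rho> k v)) = \<ll> (avg (stb u) v)" if "k \<in> stb u" for k v
      by (simp add: avg_translate K that)
  qed
  show ?thesis
    by (rule F.mult_one_form[where H = H and \<theta> = \<theta> and \<epsilon> = \<epsilon>]) (fact assms)+
qed

end

section \<open>Two by two matrices as a ring with involution\<close>

datatype 'a m2 = M2 (e11: 'a) (e12: 'a) (e21: 'a) (e22: 'a)

lemma m2_eq_iff: "A = B \<longleftrightarrow> e11 A = e11 B \<and> e12 A = e12 B \<and> e21 A = e21 B \<and> e22 A = e22 B"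
  by (cases A; cases B) simp

instantiation m2 :: (comm_ring_1) ring_1
begin
definition "0 = M2 0 0 0 0"
definition "1 = M2 1 0 0 1"
definition "A + B = M2 (e11 A + e11 B) (e12 A + e12 B) (e21 A + e21 B) (e22 A + e22 B)"
definition "A - B = M2 (e11 A - e11 B) (e12 A - e12 B) (e21 A - e21 B) (e22 A - e22 B)"
definition "- A = M2 (- e11 A) (- e12 A) (- e21 A) (- e22 A)"
definition "A * B = M2 (e11 A * e11 B + e12 A * e21 B) (e11 A * e12 B + e12 A * e22 B)
  (e21 A * e11 B + e22 A * e21 B) (e21 A * e12 B + e22 A * e22 B)"
instance
  by standard
    (auto simp: m2_eq_iff zero_m2_def one_m2_def plus_m2_def minus_m2_def uminus_m2_def times_m2_def algebra_simps)
end

lemma m2_sel [simp]: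
  "e11 0 = 0" "e12 0 = 0" "e21 0 = 0" "e22 0 = 0"
  "e11 1 = 1" "e12 1 = 0" "e21 1 = 0" "e22 1 = 1"
  "e11 (A + B) = e11 A + e11 B" "e12 (A + B) = e12 A + e12 B"
  "e21 (A + B) = e21 A + e21 B" "e22 (A + B) = e22 A + e22 B"
  "e11 (A - B) = e11 A - e11 B" "e12 (A - B) = e12 A - e12 B"
  "e21 (A - B) = e21 A - e21 B" "e22 (A - B) = e22 A - e22 B"
  "e11 (- A) = - e11 A" "e12 (- A) = - e12 A" "e21 (- A) = - e21 A" "e22 (- A) = - e22 A"
  "e11 (A * B) = e11 A * e11 B + e12 A * e21 B" "e12 (A * B) = e11 A * e12 B + e12 A * e22 B"
  "e21 (A * B) = e21 A * e11 B + e22 A * e21 B" "e22 (A * B) = e21 A * e12 B + e22 A * e22 B"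
  by (simp_all add: zero_m2_def one_m2_def plus_m2_def minus_m2_def uminus_m2_def times_m2_def)

text \<open>The adjugate equals \<open>J A^T J^-1\<close> with \<open>J = J2\<close>; through this
  identity the inner blocks of the symplectic form disappear.\<close>

definition star :: "'a::comm_ring_1 m2 \<Rightarrow> 'a m2" where
  "star A = M2 (e22 A) (- e12 A) (- e21 A) (e11 A)"

definition tr :: "'a::comm_ring_1 m2 \<Rightarrow> 'a" where
  "tr A = e11 A + e22 A"

definition nrm :: "'a::comm_ring_1 m2 \<Rightarrow> 'a" where
  "nrm A = e11 A * e22 A - e12 A * e21 A"

definition sc :: "'a::comm_ring_1 \<Rightarrow> 'a m2" where
  "sc c = M2 c 0 0 c"

lemma star_sel [simp]:
  "e11 (star A) = e22 A" "e12 (star A) = - e12 A" "e21 (star A) = - e21 A" "e22 (star A) = e11 A"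
  "e11 (sc c) = c" "e12 (sc c) = 0" "e21 (sc c) = 0" "e22 (sc c) = c"
  by (simp_all add: star_def sc_def)

lemma star_simps [simp]:
  "star (star A) = A" "star (A * B) = star B * star A" "star (A + B) = star A + star B"
  "star (A - B) = star A - star B" "star (- A) = - star A" "star 0 = 0" "star 1 = 1" "star (sc c) = sc c"
  by (simp_all add: m2_eq_iff algebra_simps)

lemma mult_star: "A * star A = sc (nrm A)" "star A * A = sc (nrm A)" "A + star A = sc (tr A)"
  by (simp_all add: m2_eq_iff nrm_def tr_def algebra_simps)

lemma sc_simps [simp]:
  "sc 0 = 0" "sc 1 = 1" "sc (a + b) = sc a + sc b" "sc (a - b) = sc a - sc b" "sc (- a) = - sc a"
  "sc (a * b) = sc a * sc b"
  by (simp_all add: m2_eq_iff)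

lemma sc_eq_iff [simp]: "sc a = sc b \<longleftrightarrow> a = b" "sc a = 0 \<longleftrightarrow> a = 0"
  by (auto simp: m2_eq_iff)

lemma sc_comm: "A * sc c = sc c * A"
  by (simp add: m2_eq_iff algebra_simps)

lemma sc_left: "A * (sc c * B) = sc c * (A * B)"
  by (simp add: m2_eq_iff algebra_simps)

lemma sc_inverse: "c \<noteq> 0 \<Longrightarrow> sc (1 / c) * sc (c::'k::field) = 1" "c \<noteq> 0 \<Longrightarrow> sc c * sc (1 / c) = 1"
  by (simp_all add: m2_eq_iff)

lemma nrm_simps [simp]:
  "nrm 0 = 0" "nrm 1 = 1" "nrm (A * B) = nrm A * nrm B" "nrm (star A) = nrm A" "nrm (sc c) = c * c"
  "nrm (- A) = nrm A"
  by (simp_all add: nrm_def algebra_simps)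

lemma tr_simps [simp]:
  "tr 0 = 0" "tr (A + B) = tr A + tr B" "tr (A - B) = tr A - tr B" "tr (- A) = - tr A" "tr (star A) = tr A"
  "tr (sc c) = c + c" "tr (sc c * A) = c * tr A" "tr (A * sc c) = c * tr A"
  by (simp_all add: tr_def algebra_simps)

lemma tr_comm: "tr (A * B) = tr (B * A)"
  by (simp add: tr_def algebra_simps)

definition tov :: "'a::comm_ring_1 m2 \<Rightarrow> 'a^2^2" where
  "tov A = vector [vector [e11 A, e12 A], vector [e21 A, e22 A]]"

definition fromv :: "'a::comm_ring_1^2^2 \<Rightarrow> 'a m2" where
  "fromv V = M2 (V $ 1 $ 1) (V $ 1 $ 2) (V $ 2 $ 1) (V $ 2 $ 2)"

lemma tov_nth [simp]:
  "tov A $ 1 $ 1 = e11 A" "tov A $ 1 $ 2 = e12 A" "tov A $ 2 $ 1 = e21 A" "tov A $ 2 $ 2 = e22 A"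
  by (simp_all add: tov_def)

lemma fromv_sel [simp]:
  "e11 (fromv V) = V $ 1 $ 1" "e12 (fromv V) = V $ 1 $ 2" "e21 (fromv V) = V $ 2 $ 1" "e22 (fromv V) = V $ 2 $ 2"
  by (simp_all add: fromv_def)

lemma tov_fromv [simp]: "tov (fromv V) = V" "fromv (tov A) = A"
  by (simp_all add: vec_eq_iff forall_2 m2_eq_iff)

section \<open>The group as a type\<close>

definition rv :: "3 \<Rightarrow> 3" where
  "rv i = (if i = 1 then 3 else if i = 2 then 2 else 1)"

lemma rv_simps [simp]: "rv 1 = 3" "rv 2 = 2" "rv 3 = 1"
  by (simp_all add: rv_def)

lemma index3: "P 1 \<Longrightarrow> P 2 \<Longrightarrow> P 3 \<Longrightarrow> P (i::3)"
  using exhaust_3[of i] by metis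

lemma rv_rv [simp]: "rv (rv i) = i"
  by (induct i rule: index3) simp_all

definition blk :: "'k::comm_ring_1 mat6 \<Rightarrow> 3 \<Rightarrow> 3 \<Rightarrow> 'k m2" where
  "blk A i j = M2 (A $ (i, 1) $ (j, 1)) (A $ (i, 1) $ (j, 2)) (A $ (i, 2) $ (j, 1)) (A $ (i, 2) $ (j, 2))"

definition mk :: "('k::comm_ring_1 m2)^3^3 \<Rightarrow> 'k mat6" where
  "mk F = of_blocks (\<chi> i j. tov (F $ i $ j))"

lemma blk_mk [simp]: "blk (mk F) i j = F $ i $ j"
  by (simp add: blk_def mk_def of_blocks_def m2_eq_iff)

lemma blk_eqI: "(\<And>i j. blk A i j = blk B i j) \<Longrightarrow> A = B"
  by (auto simp: vec_eq_iff blk_def forall_2)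

lemma sum_32: "(\<Sum>k\<in>(UNIV::(3 \<times> 2) set). f k) = (\<Sum>i\<in>UNIV. f (i, 1) + f (i, 2))"
  using sum.cartesian_product[of "\<lambda>i j. f (i, j)" UNIV UNIV] by (simp add: sum_2)

lemma blk_mult: "blk (A ** B) i j = blk A i 1 * blk B 1 j + blk A i 2 * blk B 2 j + blk A i 3 * blk B 3 j"
  by (simp add: m2_eq_iff blk_def matrix_matrix_mult_def sum_32 sum_3)

lemma blk_mat: "blk (mat c) i j = (if i = j then sc c else 0)"
  by (simp add: blk_def mat_def m2_eq_iff)

text \<open>The block \<open>(i, j)\<close> of \<open>A ** J3 ** transpose A\<close> with its right
  factor \<open>J2\<close> stripped off, for \<open>f = blk A\<close>.\<close>

definition herm :: "(3 \<Rightarrow> 3 \<Rightarrow> 'k::comm_ring_1 m2) \<Rightarrow> 3 \<Rightarrow> 3 \<Rightarrow> 'k m2" where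
  "herm f i j = f i 1 * star (f j 3) + f i 2 * star (f j 2) + f i 3 * star (f j 1)"

definition hrel :: "(3 \<Rightarrow> 3 \<Rightarrow> 'k::comm_ring_1 m2) \<Rightarrow> 'k \<Rightarrow> bool" where
  "hrel f c \<longleftrightarrow> (\<forall>i j. herm f i j = (if j = rv i then sc c else 0))"

lemma J3_nth: "J3 $ (i, a) $ (j, b) = (if j = rv i then J2 $ a $ b else 0)"
proof -
  have "\<forall>i j. J3 $ (i, a) $ (j, b) = (if j = rv i then J2 $ a $ b else 0)"
    unfolding forall_3 by (simp add: J3_def of_blocks_def)
  then show ?thesis by blast
qed

lemma J2_nth [simp]: "J2 $ 1 $ 1 = 0" "J2 $ 1 $ 2 = -1" "J2 $ 2 $ 1 = 1" "J2 $ 2 $ 2 = 0"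
  by (simp_all add: J2_def)

lemma J3_rel: "A ** J3 ** transpose A = mat c ** J3 \<longleftrightarrow> hrel (blk A) c"
proof -
  have 1: "(A ** J3) $ r $ (k, 1) = A $ r $ (rv k, 2)" "(A ** J3) $ r $ (k, 2) = - A $ r $ (rv k, 1)" for r k
    by (induct k rule: index3) (simp_all add: matrix_matrix_mult_def sum_32 sum_3 J3_nth)
  have 2: "(A ** J3 ** transpose A) $ r $ s =
      (\<Sum>k\<in>UNIV. A $ r $ (rv k, 2) * A $ s $ (k, 1) - A $ r $ (rv k, 1) * A $ s $ (k, 2))" for r s
    by (simp add: matrix_matrix_mult_def[of "A ** J3"] sum_32 1 transpose_def)
  have 3: "(mat c ** J3) $ r $ s = c * J3 $ r $ s" for r s
    by (simp add: matrix_matrix_mult_def mat_def if_distrib[where f = "\<lambda>x. x * _"] cong: if_cong)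
  have 4: "(A ** J3 ** transpose A) $ (i, 1) $ (j, 1) = e12 (herm (blk A) i j)"
    "(A ** J3 ** transpose A) $ (i, 1) $ (j, 2) = - e11 (herm (blk A) i j)"
    "(A ** J3 ** transpose A) $ (i, 2) $ (j, 1) = e22 (herm (blk A) i j)"
    "(A ** J3 ** transpose A) $ (i, 2) $ (j, 2) = - e21 (herm (blk A) i j)" for i j
    by (simp_all add: 2 sum_3 herm_def blk_def)
  have "(A ** J3 ** transpose A = mat c ** J3)
      \<longleftrightarrow> (\<forall>i a j b. (A ** J3 ** transpose A) $ (i, a) $ (j, b) = c * J3 $ (i, a) $ (j, b))"
    by (auto simp: vec_eq_iff 3)
  also have "\<dots> \<longleftrightarrow> (\<forall>i j. herm (blk A) i j = (if j = rv i then sc c else 0))"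
  proof -
    have "(\<forall>a b. (A ** J3 ** transpose A) $ (i, a) $ (j, b) = c * J3 $ (i, a) $ (j, b))
        \<longleftrightarrow> herm (blk A) i j = (if j = rv i then sc c else 0)" for i j
      unfolding forall_2 4 J3_nth by (auto simp: m2_eq_iff)
    then show ?thesis by blast
  qed
  finally show ?thesis by (simp add: hrel_def)
qed

text \<open>The relation says that reflecting the blocks in the antidiagonal and applying
  \<open>star\<close> gives a right inverse up to \<open>c\<close>. For square matrices this is also
  a left inverse.\<close>

lemma invertible_of_hrel:
  assumes "hrel (blk A) c" "c \<noteq> (0::'k::field)"
  shows "invertible A" "mk (\<chi> i j. sc (1 / c) * star (blk A (rv j) (rv i))) ** A = mat 1"
proof -
  let ?B = "mk (\<chi> i j. sc (1 / c) * star (blk A (rv j) (rv i)))"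
  have "blk (A ** ?B) i j = sc (1 / c) * herm (blk A) i (rv j)" for i j
    by (induct j rule: index3) (simp_all add: blk_mult herm_def sc_left distrib_left)
  moreover have "sc (1 / c) * herm (blk A) i (rv j) = blk (mat 1) i j" for i j
    using assms by (induct i rule: index3; induct j rule: index3) (simp_all add: hrel_def blk_mat flip: sc_simps(6))
  ultimately have *: "A ** ?B = mat 1" by (intro blk_eqI) simp
  then show "invertible A" by (auto simp: invertible_right_inverse)
  show "?B ** A = mat 1" using * matrix_left_right_inverse by blast
qed

lemma GSp6_iff: "A \<in> GSp6 \<longleftrightarrow> (\<exists>c. c \<noteq> 0 \<and> hrel (blk A) c)"
  unfolding GSp6_def J3_rel using invertible_of_hrel(1) by blast

lemma hrel_one: "hrel (blk (mat 1)) 1"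
  unfolding hrel_def
proof (intro allI)
  fix i j show "herm (blk (mat 1)) i j = (if j = rv i then sc 1 else 0)"
    by (induct i rule: index3; induct j rule: index3) (simp_all add: herm_def blk_mat)
qed

lemma hrel_mult:
  assumes "hrel (blk A) c" "hrel (blk B) d"
  shows "hrel (blk (A ** B)) (c * d)"
proof -
  let ?a = "blk A" and ?b = "blk B"
  have "herm (blk (A ** B)) i j =
      ?a i 1 * (herm ?b 1 1 * star (?a j 1) + herm ?b 1 2 * star (?a j 2) + herm ?b 1 3 * star (?a j 3)) +
      ?a i 2 * (herm ?b 2 1 * star (?a j 1) + herm ?b 2 2 * star (?a j 2) + herm ?b 2 3 * star (?a j 3)) +
      ?a i 3 * (herm ?b 3 1 * star (?a j 1) + herm ?b 3 2 * star (?a j 2) + herm ?b 3 3 * star (?a j 3))" for i j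
    by (simp add: herm_def[of "blk (A ** B)"] herm_def[of "blk B"] blk_mult algebra_simps)
  also have "\<dots> i j = sc d * herm ?a i j" for i j
    using assms(2) by (simp add: hrel_def herm_def[of ?a] sc_left distrib_left)
  finally show ?thesis
    using assms(1) by (simp add: hrel_def mult.commute[of c] flip: sc_simps(6))
qed

lemma hrel_inverse:
  assumes "hrel (blk A) c" "c \<noteq> (0::'k::field)"
  shows "hrel (blk (mk (\<chi> i j. sc (1 / c) * star (blk A (rv j) (rv i))))) (1 / c)"
proof -
  let ?B = "mk (\<chi> i j. sc (1 / c) * star (blk A (rv j) (rv i)))"
  have comm: "star (sc (1 / c) * star X) = sc (1 / c) * X" for X :: "'k m2"
    by (simp add: sc_comm[of X])
  have "herm (blk ?B) i j = sc (1 / c) * blk (?B ** A) i (rv j)" for i j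
    by (simp only: herm_def blk_mult blk_mk vec_lambda_beta comm rv_simps mult.assoc sc_left[of "star _"] distrib_left)
  moreover have "(if i = rv j then a else b) = (if j = rv i then a else b)" for i j and a b :: "'k m2"
    by (metis rv_rv)
  ultimately show ?thesis
    unfolding hrel_def by (simp add: invertible_of_hrel(2)[OF assms] blk_mat)
qed

typedef (overloaded) ('k::field) gsp6 = "GSp6 :: 'k mat6 set"
  morphisms mat_of Abs_gsp6
  by (rule exI[of _ "mat 1"]) (use hrel_one in \<open>auto simp: GSp6_iff intro!: exI[of _ 1]\<close>)

definition bl :: "'k::field gsp6 \<Rightarrow> 3 \<Rightarrow> 3 \<Rightarrow> 'k m2" where
  "bl x = blk (mat_of x)"

definition sim :: "'k::field gsp6 \<Rightarrow> 'k" where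
  "sim x = (SOME c. c \<noteq> 0 \<and> hrel (bl x) c)"

lemma sim: "sim x \<noteq> 0" "hrel (bl x) (sim x)"
proof -
  have "\<exists>c. c \<noteq> 0 \<and> hrel (bl x) c" using mat_of[of x] by (simp add: GSp6_iff bl_def)
  then have "sim x \<noteq> 0 \<and> hrel (bl x) (sim x)" unfolding sim_def by (rule someI_ex)
  then show "sim x \<noteq> 0" "hrel (bl x) (sim x)" by auto
qed

lemma sim_unique: "hrel (bl x) c \<Longrightarrow> sim x = c"
proof -
  assume "hrel (bl x) c"
  then have "sc (sim x) = sc c" using sim(2)[of x] unfolding hrel_def by (metis rv_simps(2))
  then show ?thesis by simp
qed

instantiation gsp6 :: (field) mult_group
begin
definition "(1 :: 'a gsp6) = Abs_gsp6 (mat 1)"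
definition "x * y = Abs_gsp6 (mat_of x ** mat_of y)"
definition "inverse x = Abs_gsp6 (mk (\<chi> i j. sc (1 / sim x) * star (bl x (rv j) (rv i))))"
definition "divide (x :: 'a gsp6) y =
  Abs_gsp6 (mat_of x ** mat_of (Abs_gsp6 (mk (\<chi> i j. sc (1 / sim y) * star (bl y (rv j) (rv i))))))"

lemma mat_of_one [simp]: "mat_of (1 :: 'a gsp6) = mat 1"
  unfolding one_gsp6_def using hrel_one by (subst Abs_gsp6_inverse) (auto simp: GSp6_iff intro!: exI[of _ 1])

lemma mat_of_mult [simp]: "mat_of (x * y) = mat_of x ** mat_of (y :: 'a gsp6)"
  unfolding times_gsp6_def using hrel_mult[OF sim(2)[of x, unfolded bl_def] sim(2)[of y, unfolded bl_def]] sim(1)[of x] sim(1)[of y]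
  by (subst Abs_gsp6_inverse) (auto simp: GSp6_iff intro!: exI[of _ "sim x * sim y"])

lemma mat_of_inverse:
  "mat_of (inverse x) = mk (\<chi> i j. sc (1 / sim x) * star (bl (x :: 'a gsp6) (rv j) (rv i)))"
  unfolding inverse_gsp6_def bl_def using hrel_inverse[OF sim(2)[of x, unfolded bl_def] sim(1)[of x]] sim(1)[of x]
  by (subst Abs_gsp6_inverse) (auto simp: GSp6_iff intro!: exI[of _ "1 / sim x"])

instance
proof
  fix x y z :: "'a gsp6"
  have inj: "mat_of a = mat_of b \<Longrightarrow> a = b" for a b :: "'a gsp6" by (simp only: mat_of_inject)
  show "x * y * z = x * (y * z)" by (rule inj) (simp only: mat_of_mult matrix_mul_assoc)
  show "1 * x = x" "x * 1 = x"
    by (rule inj, simp only: mat_of_mult mat_of_one matrix_mul_lid matrix_mul_rid)+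
  show "inverse x * x = 1"
  proof (rule inj)
    show "mat_of (inverse x * x) = mat_of 1"
      unfolding mat_of_mult mat_of_inverse mat_of_one
      using invertible_of_hrel(2)[OF sim(2)[of x, unfolded bl_def] sim(1)[of x]] by (simp only: bl_def)
  qed
  show "x div y = x * inverse y" by (simp add: divide_gsp6_def times_gsp6_def inverse_gsp6_def)
qed
end

lemma bl_mult: "bl (x * y) i j = bl x i 1 * bl y 1 j + bl x i 2 * bl y 2 j + bl x i 3 * bl y 3 j"
  by (simp add: bl_def blk_mult)

lemma bl_one: "bl 1 i j = (if i = j then 1 else 0)"
  by (simp add: bl_def blk_mat)

lemma bl_inverse: "bl (inverse x) i j = sc (1 / sim x) * star (bl x (rv j) (rv i))"
  by (simp add: bl_def mat_of_inverse)

lemma bl_eqI: "(\<And>i j. bl x i j = bl y i j) \<Longrightarrow> x = y"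
  unfolding bl_def mat_of_inject[symmetric] by (rule blk_eqI)

lemma sim_mult: "sim (x * y) = sim x * sim y"
  using hrel_mult[OF sim(2)[of x, unfolded bl_def] sim(2)[of y, unfolded bl_def]]
  by (intro sim_unique) (simp add: bl_def)

lemma sim_one [simp]: "sim 1 = 1"
  by (intro sim_unique) (simp add: bl_def hrel_one)

lemma row_rel: "bl x i 1 * star (bl x j 3) + bl x i 2 * star (bl x j 2) + bl x i 3 * star (bl x j 1)
    = (if j = rv i then sc (sim x) else 0)"
  using sim(2)[of x] by (simp add: hrel_def herm_def)

text \<open>The row relations express \<open>x * inverse x = 1\<close>, the column relations
  \<open>inverse x * x = 1\<close>. Both are used as explicit equations between blocks on the
  strata.\<close>

lemma col_rel: "star (bl x 3 i) * bl x 1 j + star (bl x 2 i) * bl x 2 j + star (bl x 1 i) * bl x 3 j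
    = (if j = rv i then sc (sim x) else 0)"
proof -
  have "sc (1 / sim x) * (star (bl x 3 i) * bl x 1 j + star (bl x 2 i) * bl x 2 j + star (bl x 1 i) * bl x 3 j)
      = bl (inverse x * x) (rv i) j"
    unfolding bl_mult bl_inverse by (simp add: distrib_left mult.assoc)
  also have "\<dots> = (if j = rv i then 1 else 0)" by (auto simp: bl_one)
  finally have "sc (sim x) * (sc (1 / sim x) * (star (bl x 3 i) * bl x 1 j + star (bl x 2 i) * bl x 2 j + star (bl x 1 i) * bl x 3 j))
      = (if j = rv i then sc (sim x) else 0)" by simp
  moreover have "sc (sim x) * sc (1 / sim x) = 1" using sim(1)[of x] by (simp flip: sc_simps(6))
  ultimately show ?thesis by (simp flip: mult.assoc)
qed

definition gmk :: "('k::field m2)^3^3 \<Rightarrow> 'k gsp6" where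
  "gmk F = Abs_gsp6 (mk F)"

lemma bl_gmk:
  assumes "hrel (\<lambda>i j. F $ i $ j) c" "c \<noteq> 0"
  shows "bl (gmk F) i j = F $ i $ j" "sim (gmk F) = c"
proof -
  have "blk (mk F) = (\<lambda>i j. F $ i $ j)" by (intro ext) simp
  then have "mk F \<in> GSp6" using assms by (auto simp: GSp6_iff)
  then have *: "bl (gmk F) = (\<lambda>i j. F $ i $ j)"
    by (intro ext) (simp add: bl_def gmk_def Abs_gsp6_inverse)
  then show "bl (gmk F) i j = F $ i $ j" "sim (gmk F) = c"
    using assms by (auto intro: sim_unique)
qed

definition del :: "'k::field m2 \<Rightarrow> 'k gsp6" where
  "del g = gmk (vector [vector [g, 0, 0], vector [0, g, 0], vector [0, 0, g]])"

text \<open>The second block of the unipotent radical is a function of the first and is built in; on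
  \<open>Z\<close> there remains only the condition \<open>tr Z = - nrm X\<close>.\<close>

definition uel :: "'k::field m2 \<Rightarrow> 'k m2 \<Rightarrow> 'k gsp6" where
  "uel X Z = gmk (vector [vector [1, X, Z], vector [0, 1, - star X], vector [0, 0, 1]])"

definition eps :: "'k::field gsp6" where
  "eps = gmk (vector [vector [1, 0, 0], vector [0, -1, 0], vector [0, 0, 1]])"

lemma hrel_iff3: "hrel f c \<longleftrightarrow>
    herm f 1 1 = 0 \<and> herm f 1 2 = 0 \<and> herm f 1 3 = sc c \<and>
    herm f 2 1 = 0 \<and> herm f 2 2 = sc c \<and> herm f 2 3 = 0 \<and>
    herm f 3 1 = sc c \<and> herm f 3 2 = 0 \<and> herm f 3 3 = 0"
  by (auto simp: hrel_def forall_3)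

lemma bl_del:
  assumes "nrm g \<noteq> 0"
  shows "bl (del g) i j = (if i = j then g else 0)" "sim (del g) = nrm g"
proof -
  have h: "hrel (\<lambda>i j. vector [vector [g, 0, 0], vector [0, g, 0], vector [0, 0, g]] $ i $ j) (nrm g)"
    by (simp add: hrel_iff3 herm_def mult_star)
  show "bl (del g) i j = (if i = j then g else 0)"
    by (induct i rule: index3; induct j rule: index3) (simp_all add: del_def bl_gmk(1)[OF h assms])
  show "sim (del g) = nrm g" by (simp add: del_def bl_gmk(2)[OF h assms])
qed

lemma bl_uel:
  assumes "tr Z = - nrm X"
  shows "bl (uel X Z) 1 1 = 1" "bl (uel X Z) 1 2 = X" "bl (uel X Z) 1 3 = Z"
    "bl (uel X Z) 2 1 = 0" "bl (uel X Z) 2 2 = 1" "bl (uel X Z) 2 3 = - star X"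
    "bl (uel X Z) 3 1 = 0" "bl (uel X Z) 3 2 = 0" "bl (uel X Z) 3 3 = 1" "sim (uel X Z) = 1"
proof -
  have "Z + star Z + sc (nrm X) = 0" unfolding mult_star(3) assms by simp
  then have "hrel (\<lambda>i j. vector [vector [1, X, Z], vector [0, 1, - star X], vector [0, 0, 1]] $ i $ j) 1"
    by (simp add: hrel_iff3 herm_def mult_star(1) add_ac)
  from bl_gmk[OF this] show "bl (uel X Z) 1 1 = 1" "bl (uel X Z) 1 2 = X" "bl (uel X Z) 1 3 = Z"
    "bl (uel X Z) 2 1 = 0" "bl (uel X Z) 2 2 = 1" "bl (uel X Z) 2 3 = - star X"
    "bl (uel X Z) 3 1 = 0" "bl (uel X Z) 3 2 = 0" "bl (uel X Z) 3 3 = 1" "sim (uel X Z) = 1"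
    by (simp_all add: uel_def)
qed

lemma bl_eps:
  fixes e :: "'k::field gsp6"
  defines "e \<equiv> eps"
  shows "bl e 1 1 = 1" "bl e 1 2 = 0" "bl e 1 3 = 0" "bl e 2 1 = 0" "bl e 2 2 = -1" "bl e 2 3 = 0"
    "bl e 3 1 = 0" "bl e 3 2 = 0" "bl e 3 3 = 1" "sim e = 1"
proof -
  have "hrel (\<lambda>i j. vector [vector [1, 0, 0], vector [0, -1, 0], vector [0, 0, 1]] $ i $ j) (1::'k)"
    by (simp add: hrel_iff3 herm_def)
  from bl_gmk[OF this] show "bl e 1 1 = 1" "bl e 1 2 = 0" "bl e 1 3 = 0" "bl e 2 1 = 0" "bl e 2 2 = -1" "bl e 2 3 = 0"
    "bl e 3 1 = 0" "bl e 3 2 = 0" "bl e 3 3 = 1" "sim e = 1"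
    by (simp_all add: e_def eps_def)
qed

lemma bl_eqI3:
  assumes "bl x 1 1 = bl y 1 1" "bl x 1 2 = bl y 1 2" "bl x 1 3 = bl y 1 3"
    "bl x 2 1 = bl y 2 1" "bl x 2 2 = bl y 2 2" "bl x 2 3 = bl y 2 3"
    "bl x 3 1 = bl y 3 1" "bl x 3 2 = bl y 3 2" "bl x 3 3 = bl y 3 3"
  shows "x = y"
proof (rule bl_eqI)
  fix i j show "bl x i j = bl y i j"
    by (induct i rule: index3; induct j rule: index3) (use assms in simp_all)
qed

section \<open>The Shalika subgroup\<close>

definition Sh :: "'k::field gsp6 set" where
  "Sh = {x. mat_of x \<in> Shalika_subgroup}"

definition chi :: "('k::field \<Rightarrow> complex) \<Rightarrow> 'k gsp6 \<Rightarrow> complex" where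
  "chi \<psi> x = Shalika_character \<psi> (mat_of x)"

lemma blk_of_blocks: "blk (of_blocks A) i j = fromv (A $ i $ j)"
  by (simp add: blk_def of_blocks_def m2_eq_iff)

lemma fromv_simps [simp]: "fromv (A ** B) = fromv A * fromv B" "fromv 0 = 0" "fromv (mat 1) = 1"
  by (simp_all add: m2_eq_iff matrix_matrix_mult_def sum_2 mat_def)

lemma det_nrm: "det A = nrm (fromv A)"
  by (simp add: det_2 nrm_def)

lemma trace_tr: "trace A = tr (fromv A)"
  by (simp add: trace_def sum_2 tr_def)

text \<open>Cancelling \<open>J2\<close> on the right turns the two conditions into
  \<open>X + star Y = 0\<close> and \<open>Z + star Z = - (X * star X)\<close>, and both sides of
  the second are scalar.\<close>

lemma U3_cond_iff: "U3_cond X Y Z \<longleftrightarrow> fromv Y = - star (fromv X) \<and> tr (fromv Z) = - nrm (fromv X)"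
proof -
  have 1: "X ** J2 + J2 ** transpose Y = 0 \<longleftrightarrow> fromv Y = - star (fromv X)"
    by (auto simp: vec_eq_iff forall_2 matrix_matrix_mult_def sum_2 transpose_def m2_eq_iff)
       (simp_all add: add_eq_0_iff, metis minus_minus)
  have 2: "Z ** J2 + J2 ** transpose Z = - (X ** J2 ** transpose X) \<longleftrightarrow> tr (fromv Z) = - nrm (fromv X)"
    by (auto simp: vec_eq_iff forall_2 matrix_matrix_mult_def sum_2 transpose_def tr_def nrm_def algebra_simps)
  show ?thesis unfolding U3_cond_def 1 2 ..
qed

lemma mat_of_del_uel:
  assumes "nrm g \<noteq> 0" "tr Z = - nrm X"
  shows "mat_of (del g * uel X Z) = Delta (tov g) ** unip (tov X) (tov (- star X)) (tov Z)"
proof -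
  have "bl (del g * uel X Z) i j = blk (Delta (tov g) ** unip (tov X) (tov (- star X)) (tov Z)) i j" for i j
    by (induct i rule: index3; induct j rule: index3)
      (simp_all add: bl_mult bl_del[OF assms(1)] bl_uel[OF assms(2)] Delta_mult_unip blk_of_blocks)
  then show ?thesis by (intro blk_eqI) (simp add: bl_def)
qed

lemma Sh_eq: "Sh = {del g * uel X Z | g X Z. nrm g \<noteq> 0 \<and> tr Z = - nrm X}"
proof (intro set_eqI iffI)
  fix x :: "'a gsp6" assume "x \<in> Sh"
  then obtain g X Y Z where *: "invertible g" "U3_cond X Y Z" "mat_of x = Delta g ** unip X Y Z"
    by (auto simp: Sh_def Shalika_subgroup_def)
  then have g: "nrm (fromv g) \<noteq> 0" and U: "fromv Y = - star (fromv X)" "tr (fromv Z) = - nrm (fromv X)"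
    by (simp_all add: invertible_det_nz det_nrm U3_cond_iff)
  have "Y = tov (- star (fromv X))" using U(1) by (metis tov_fromv(1))
  then have "x = del (fromv g) * uel (fromv X) (fromv Z)"
    unfolding mat_of_inject[symmetric] mat_of_del_uel[OF g U(2)] using *(3) by simp
  then show "x \<in> {del g * uel X Z | g X Z. nrm g \<noteq> 0 \<and> tr Z = - nrm X}" using g U(2) by blast
next
  fix x :: "'a gsp6" assume "x \<in> {del g * uel X Z | g X Z. nrm g \<noteq> 0 \<and> tr Z = - nrm X}"
  then obtain g X Z where *: "x = del g * uel X Z" "nrm g \<noteq> 0" "tr Z = - nrm X" by blast
  moreover have "invertible (tov g)" "U3_cond (tov X) (tov (- star X)) (tov Z)"
    using * by (simp_all add: invertible_det_nz det_nrm U3_cond_iff)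
  ultimately show "x \<in> Sh" unfolding Sh_def Shalika_subgroup_def
    using mat_of_del_uel[OF *(2,3)] by blast
qed

lemma chi_del_uel: "nrm g \<noteq> 0 \<Longrightarrow> tr Z = - nrm X \<Longrightarrow> chi \<psi> (del g * uel X Z) = \<psi> (- tr X)"
  unfolding chi_def mat_of_del_uel
  by (subst Shalika_character_eq) (simp_all add: invertible_det_nz det_nrm U3_cond_iff trace_tr)

text \<open>After division by the diagonal block, the similitude relations force the remaining
  blocks into unipotent shape, so four block equations suffice. They are visibly closed.\<close>

lemma mem_Sh_iff: "x \<in> Sh \<longleftrightarrow> bl x 3 1 = 0 \<and> bl x 3 2 = 0 \<and> bl x 2 1 = 0 \<and> bl x 1 1 = bl x 2 2"
proof
  assume "x \<in> Sh"
  then show "bl x 3 1 = 0 \<and> bl x 3 2 = 0 \<and> bl x 2 1 = 0 \<and> bl x 1 1 = bl x 2 2"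
    by (auto simp: Sh_eq bl_mult bl_del bl_uel)
next
  assume *: "bl x 3 1 = 0 \<and> bl x 3 2 = 0 \<and> bl x 2 1 = 0 \<and> bl x 1 1 = bl x 2 2"
  let ?g = "bl x 2 2" and ?l = "sim x"
  have "sc (nrm ?g) = sc ?l" using row_rel[of x 2 2] * by (simp add: mult_star)
  then have g: "nrm ?g = ?l" by simp
  let ?h = "sc (1 / ?l) * star ?g"
  have hg: "?h * ?g = 1" "?g * ?h = 1"
    unfolding mult.assoc sc_left[of ?g] mult_star(1,2) g by (simp_all only: sc_inverse(1)[OF sim(1)])
  have l0: "nrm ?g \<noteq> 0" using g sim(1)[of x] by simp
  let ?u = "inverse (del ?g) * x"
  have di: "bl (inverse (del ?g)) i j = (if i = j then ?h else 0)" for i j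
    by (induct i rule: index3; induct j rule: index3) (simp_all add: bl_inverse bl_del[OF l0] g)
  have u: "bl ?u 1 1 = 1" "bl ?u 2 1 = 0" "bl ?u 2 2 = 1" "bl ?u 3 1 = 0" "bl ?u 3 2 = 0"
    using * hg by (simp_all add: bl_mult di)
  have "sc 1 = sc (sim ?u)" using row_rel[of ?u 2 2] u by simp
  then have s1: "sim ?u = 1" by (simp only: sc_eq_iff)
  have u33: "bl ?u 3 3 = 1" using row_rel[of ?u 3 1] u s1 by simp
  have "bl ?u 1 2 + star (bl ?u 2 3) = 0" using row_rel[of ?u 1 2] u by (simp add: add.commute)
  then have "star (bl ?u 1 2 + star (bl ?u 2 3)) = star 0" by (rule arg_cong)
  then have u23: "bl ?u 2 3 = - star (bl ?u 1 2)" by (simp add: add_eq_0_iff)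
  have "bl ?u 1 3 + star (bl ?u 1 3) + sc (nrm (bl ?u 1 2)) = 0"
    using row_rel[of ?u 1 1] u by (simp add: mult_star(1) add_ac)
  then have "sc (tr (bl ?u 1 3) + nrm (bl ?u 1 2)) = 0" by (simp only: mult_star(3) sc_simps)
  then have u13: "tr (bl ?u 1 3) = - nrm (bl ?u 1 2)" by (simp only: sc_eq_iff add_eq_0_iff2)
  have "?u = uel (bl ?u 1 2) (bl ?u 1 3)"
    by (rule bl_eqI3) (simp_all add: bl_uel[OF u13] u u33 u23)
  then have "x = del ?g * uel (bl ?u 1 2) (bl ?u 1 3)" by (metis mult_inv_cancel)
  then show "x \<in> Sh" unfolding Sh_eq using l0 u13 by blast
qed

text \<open>\<open>star\<close> of the diagonal block over its norm is the inverse of that block, so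
  \<open>X\<close> is read off from \<open>x\<close> by a continuous formula without decomposing
  \<open>x\<close>.\<close>

lemma chi_eq:
  assumes "x \<in> Sh"
  shows "chi \<psi> x = \<psi> (- (tr (star (bl x 1 1) * bl x 1 2) / nrm (bl x 1 1)))"
proof -
  obtain g X Z where *: "x = del g * uel X Z" "nrm g \<noteq> 0" "tr Z = - nrm X" using assms by (auto simp: Sh_eq)
  have "star (bl x 1 1) * bl x 1 2 = sc (nrm g) * X" "bl x 1 1 = g"
    by (simp_all add: * bl_mult bl_del[OF *(2)] bl_uel[OF *(3)] mult_star flip: mult.assoc)
  then show ?thesis using * by (simp add: chi_del_uel)
qed

section \<open>Killing test functions along a closed set\<close>

locale skew_system = coset_system KK
  for KK :: "'g::mult_group set set" +
  fixes H Z :: "'g set" and \<theta> :: "'g \<Rightarrow> complex" and \<epsilon> :: 'g and D :: "('g \<Rightarrow> complex) \<Rightarrow> complex"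
  assumes H: "subgp H"
    and theta_mult: "s \<in> H \<Longrightarrow> t \<in> H \<Longrightarrow> \<theta> (s * t) = \<theta> s * \<theta> t"
    and theta_nz: "s \<in> H \<Longrightarrow> \<theta> s \<noteq> 0"
    and theta_smooth: "\<exists>N\<in>KK. \<forall>s\<in>H \<inter> N. \<theta> s = 1"
    and eps_sq: "\<epsilon> * \<epsilon> = 1"
    and eps_H: "s \<in> H \<Longrightarrow> \<epsilon> * s * \<epsilon> \<in> H"
    and theta_eps: "s \<in> H \<Longrightarrow> \<theta> (\<epsilon> * s * \<epsilon>) = inverse (\<theta> s)"
    and Z_sub: "K \<in> KK \<Longrightarrow> Z \<subseteq> K"
    and Z_central: "z \<in> Z \<Longrightarrow> z * x = x * z"
    and skew: "skew_distribution H \<theta> \<epsilon> D"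
begin

lemma D_add: "testf f \<Longrightarrow> testf g \<Longrightarrow> D (\<lambda>x. f x + g x) = D f + D g"
  and D_scale: "testf f \<Longrightarrow> D (\<lambda>x. c * f x) = c * D f"
  and D_left: "testf f \<Longrightarrow> s \<in> H \<Longrightarrow> D (\<lambda>x. f (inverse s * x)) = \<theta> s * D f"
  and D_right: "testf f \<Longrightarrow> s \<in> H \<Longrightarrow> D (\<lambda>x. f (x * s)) = inverse (\<theta> s) * D f"
  and D_skew: "testf f \<Longrightarrow> D (\<lambda>x. f (\<epsilon> * inverse x * \<epsilon>)) = - D f"
  using skew unfolding skew_distribution_def by simp_all

lemma testf_zero: "testf (\<lambda>x. 0)"
proof -
  obtain K where K: "K \<in> KK" using KK_nonempty by blast
  show ?thesis by (rule testfI[OF K _ K _ K]) (simp_all add: rinv_def fsupp_def cosets_def)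
qed

lemma testf_sum: "finite A \<Longrightarrow> (\<And>a. a \<in> A \<Longrightarrow> testf (F a)) \<Longrightarrow> testf (\<lambda>x. \<Sum>a\<in>A. F a x)"
  by (induction A rule: finite_induct) (simp_all add: testf_zero testf_add)

lemma D_sum: "finite A \<Longrightarrow> (\<And>a. a \<in> A \<Longrightarrow> testf (F a)) \<Longrightarrow> D (\<lambda>x. \<Sum>a\<in>A. F a x) = (\<Sum>a\<in>A. D (F a))"
proof (induction A rule: finite_induct)
  case empty
  show ?case using D_scale[OF testf_zero, of 0] by simp
next
  case (insert a A)
  then show ?case using D_add[of "F a" "\<lambda>x. \<Sum>a\<in>A. F a x"] testf_sum[of A F] by simp
qed

text \<open>
  Averaging over a compact group of operators \<open>f \<mapsto> (x \<mapsto> w a * f (\<alpha> a x))\<close> under which \<open>D\<close> is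
  invariant: only finitely many translates of \<open>f\<close> are distinct, so no Haar measure is needed.
\<close>

lemma average:
  fixes \<alpha> :: "'g \<Rightarrow> 'g \<Rightarrow> 'g" and w :: "'g \<Rightarrow> complex" and f :: "'g \<Rightarrow> complex"
  defines "T \<equiv> \<lambda>a (h::'g \<Rightarrow> complex) x. w a * h (\<alpha> a x)"
  assumes M: "1 \<in> M" "\<And>a b. a \<in> M \<Longrightarrow> b \<in> M \<Longrightarrow> a * b \<in> M"
    and f: "testf f" and fin: "finite ((\<lambda>a. T a f) ` M)"
    and tst: "\<And>a h. a \<in> M \<Longrightarrow> testf h \<Longrightarrow> testf (T a h)"
    and D: "\<And>a h. a \<in> M \<Longrightarrow> testf h \<Longrightarrow> D (T a h) = D h"
    and act: "\<And>a b. a \<in> M \<Longrightarrow> b \<in> M \<Longrightarrow> T a (T b f) = T (a * b) f"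
    and inj: "\<And>a. a \<in> M \<Longrightarrow> inj (T a)"
  obtains g where "testf g" "D g = D f" "\<And>a x. a \<in> M \<Longrightarrow> w a * g (\<alpha> a x) = g x"
    "\<And>x. g x \<noteq> 0 \<Longrightarrow> \<exists>a\<in>M. f (\<alpha> a x) \<noteq> 0"
    "\<And>b c. (\<And>a x. a \<in> M \<Longrightarrow> \<alpha> a (x * b) = \<alpha> a x * b) \<Longrightarrow> (\<And>x. f (x * b) = c * f x) \<Longrightarrow> \<forall>x. g (x * b) = c * g x"
    "\<And>b c. (\<And>a x. a \<in> M \<Longrightarrow> \<alpha> a (b * x) = b * \<alpha> a x) \<Longrightarrow> (\<And>x. f (b * x) = c * f x) \<Longrightarrow> \<forall>x. g (b * x) = c * g x"
proof -
  let ?O = "(\<lambda>a. T a f) ` M"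
  define n where "n = (of_nat (card ?O) :: complex)"
  have n: "n \<noteq> 0" using fin M(1) unfolding n_def by (auto simp: card_gt_0_iff)
  define g where "g = (\<lambda>x. (1 / n) * (\<Sum>\<phi>\<in>?O. \<phi> x))"
  have tO: "testf \<phi>" if "\<phi> \<in> ?O" for \<phi> using that tst f by auto
  have DO: "D \<phi> = D f" if "\<phi> \<in> ?O" for \<phi> using that D f by auto
  have s: "testf (\<lambda>x. \<Sum>\<phi>\<in>?O. \<phi> x)" by (rule testf_sum[OF fin tO])
  have 1: "testf g" unfolding g_def by (rule testf_scale[OF s])
  have 2: "D g = D f"
  proof -
    have "D g = (1 / n) * (\<Sum>\<phi>\<in>?O. D \<phi>)" unfolding g_def by (simp only: D_scale[OF s] D_sum[OF fin tO])
    also have "(\<Sum>\<phi>\<in>?O. D \<phi>) = n * D f" using DO by (simp add: n_def)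
    finally show ?thesis using n by simp
  qed
  have 3: "w a * g (\<alpha> a x) = g x" if a: "a \<in> M" for a x
  proof -
    have sub: "T a ` ?O \<subseteq> ?O" using act[OF a] M(2)[OF a] by auto
    have i: "inj_on (T a) ?O" using inj[OF a] by (rule inj_on_subset) simp
    have img: "T a ` ?O = ?O" using endo_inj_surj[OF fin sub i] .
    have "w a * g (\<alpha> a x) = (1 / n) * (\<Sum>\<phi>\<in>?O. T a \<phi> x)"
      unfolding g_def T_def by (simp add: sum_distrib_left mult.left_commute)
    also have "(\<Sum>\<phi>\<in>?O. T a \<phi> x) = (\<Sum>\<phi>\<in>T a ` ?O. \<phi> x)"
      by (simp add: sum.reindex[OF i])
    finally show ?thesis unfolding img g_def .
  qed
  have 4: "\<exists>a\<in>M. f (\<alpha> a x) \<noteq> 0" if "g x \<noteq> 0" for x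
  proof -
    have "(\<Sum>\<phi>\<in>?O. \<phi> x) \<noteq> 0" using that by (auto simp: g_def)
    then obtain \<phi> where "\<phi> \<in> ?O" "\<phi> x \<noteq> 0" by (meson sum.not_neutral_contains_not_neutral)
    then show ?thesis by (auto simp: T_def)
  qed
  have 5: "\<forall>x. g (x * b) = c * g x"
    if "\<And>a x. a \<in> M \<Longrightarrow> \<alpha> a (x * b) = \<alpha> a x * b" "\<And>x. f (x * b) = c * f x" for b c
  proof
    fix x
    have "\<phi> (x * b) = c * \<phi> x" if "\<phi> \<in> ?O" for \<phi>
      using that \<open>\<And>a x. a \<in> M \<Longrightarrow> \<alpha> a (x * b) = \<alpha> a x * b\<close> \<open>\<And>x. f (x * b) = c * f x\<close>
      by (auto simp: T_def)
    then show "g (x * b) = c * g x" unfolding g_def by (simp add: sum_distrib_left mult.left_commute)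
  qed
  have 6: "\<forall>x. g (b * x) = c * g x"
    if "\<And>a x. a \<in> M \<Longrightarrow> \<alpha> a (b * x) = b * \<alpha> a x" "\<And>x. f (b * x) = c * f x" for b c
  proof
    fix x
    have "\<phi> (b * x) = c * \<phi> x" if "\<phi> \<in> ?O" for \<phi>
      using that \<open>\<And>a x. a \<in> M \<Longrightarrow> \<alpha> a (b * x) = b * \<alpha> a x\<close> \<open>\<And>x. f (b * x) = c * f x\<close>
      by (auto simp: T_def)
    then show "g (b * x) = c * g x" unfolding g_def by (simp add: sum_distrib_left mult.left_commute)
  qed
  show ?thesis using that 1 2 3 4 5 6 by blast
qed

lemma theta_one: "\<theta> 1 = 1"
  using theta_mult[of 1 1] theta_nz[of 1] subgpD(1)[OF H] by simp

lemma theta_inverse: "s \<in> H \<Longrightarrow> \<theta> (inverse s) = inverse (\<theta> s)"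
  using theta_mult[of s "inverse s"] subgpD(3)[OF H, of s] theta_one theta_nz[of s]
  by (simp add: divide_simps inverse_eq_divide mult.commute)

lemma H_Int: "K \<in> KK \<Longrightarrow> 1 \<in> H \<inter> K" "K \<in> KK \<Longrightarrow> a \<in> H \<inter> K \<Longrightarrow> b \<in> H \<inter> K \<Longrightarrow> a * b \<in> H \<inter> K"
    "K \<in> KK \<Longrightarrow> a \<in> H \<inter> K \<Longrightarrow> inverse a \<in> H \<inter> K"
  using subgpD[OF H] subgpD[OF KK_subgp] by auto

text \<open>An operator depends only on the class of its parameter modulo \<open>L\<close>, and
  \<open>K\<close> meets finitely many classes. This supplies the finiteness that averaging
  needs.\<close>

lemma finite_translates:
  assumes K: "K \<in> KK" and L: "L \<in> KK" and eq: "\<And>a b. a \<in> K \<Longrightarrow> b \<in> K \<Longrightarrow> a \<in> H \<Longrightarrow> b \<in> H \<Longrightarrow> inverse a * b \<in> L \<Longrightarrow> F a = F b"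
  shows "finite (F ` (H \<inter> K))"
proof -
  define r where "r c = (SOME a. a \<in> H \<inter> K \<and> a \<in> c)" for c :: "'g set"
  have Ls: "subgp L" using L KK_subgp by blast
  have "F ` (H \<inter> K) \<subseteq> (\<lambda>c. F (r c)) ` cosets K L"
  proof
    fix y assume "y \<in> F ` (H \<inter> K)"
    then obtain a where a: "a \<in> H" "a \<in> K" "y = F a" by blast
    have "r (lcos a L) \<in> H \<inter> K \<and> r (lcos a L) \<in> lcos a L"
      unfolding r_def by (rule someI[of _ a]) (use a mem_lcos_self[OF Ls] in auto)
    then have "F a = F (r (lcos a L))" using a by (intro eq) (auto simp: lcos_def)
    then show "y \<in> (\<lambda>c. F (r c)) ` cosets K L" using a by (auto simp: cosets_def)
  qed
  then show ?thesis using KK_finite[OF K L] by (rule finite_surj[rotated])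
qed

lemma average_left:
  assumes K: "K \<in> KK" and f: "testf f"
  obtains g where "testf g" "D g = D f" "\<And>a x. a \<in> H \<inter> K \<Longrightarrow> g (a * x) = inverse (\<theta> a) * g x"
    "\<And>x. g x \<noteq> 0 \<Longrightarrow> \<exists>a\<in>H \<inter> K. f (a * x) \<noteq> 0"
proof -
  obtain L where L: "L \<in> KK" "rinv L f" "\<forall>k\<in>L. \<forall>x. f (k * x) = f x" using testfD[OF f] by blast
  obtain N where N: "N \<in> KK" "\<forall>s\<in>H \<inter> N. \<theta> s = 1" using theta_smooth by blast
  have KL: "conjs (inverse a) K \<in> KK" for a using K KK_conjs by blast
  have fin: "finite ((\<lambda>a x. inverse (\<theta> a) * f (inverse a * x)) ` (H \<inter> K))"
  proof (rule finite_translates[OF K KK_Int[OF L(1) N(1)]])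
    fix a b assume ab: "a \<in> K" "b \<in> K" "a \<in> H" "b \<in> H" "inverse a * b \<in> L \<inter> N"
    have "\<theta> (inverse a * b) = 1" using ab N(2) subgpD[OF H] by simp
    then have "\<theta> a = \<theta> b" using ab theta_mult[of a "inverse a * b"] subgpD[OF H] by simp
    moreover have "f (inverse a * x) = f (inverse b * x)" for x
      using bspec[OF L(3), of "inverse a * b"] ab(5) by (metis IntD1 mult.assoc mult_inv_cancel)
    ultimately show "(\<lambda>x. inverse (\<theta> a) * f (inverse a * x)) = (\<lambda>x. inverse (\<theta> b) * f (inverse b * x))" by simp
  qed
  have inj: "inj (\<lambda>(h :: 'g \<Rightarrow> complex) x. inverse (\<theta> a) * h (inverse a * x))" if "a \<in> H \<inter> K" for a
  proof (rule injI)
    fix h h' :: "'g \<Rightarrow> complex"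
    assume eq: "(\<lambda>x. inverse (\<theta> a) * h (inverse a * x)) = (\<lambda>x. inverse (\<theta> a) * h' (inverse a * x))"
    have "h x = h' x" for x
      using fun_cong[OF eq, of "a * x"] theta_nz[of a] that by simp
    then show "h = h'" by blast
  qed
  have t: "testf (\<lambda>x. h (inverse a * x))" if "testf h" for h a
    using testf_translate[OF that, of "inverse a" 1] by simp
  show ?thesis
  proof (rule average[where M = "H \<inter> K" and w = "\<lambda>a. inverse (\<theta> a)" and \<alpha> = "\<lambda>a x. inverse a * x", OF H_Int(1)[OF K] H_Int(2)[OF K] f fin _ _ _ inj])
    fix a h assume a: "a \<in> H \<inter> K" and h: "testf h"
    show "testf (\<lambda>x. inverse (\<theta> a) * h (inverse a * x))" using t[OF h] by (rule testf_scale)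
    show "D (\<lambda>x. inverse (\<theta> a) * h (inverse a * x)) = D h"
      using a theta_nz[of a] D_left[OF h, of a] by (simp add: D_scale[OF t[OF h]])
  next
    fix a b assume "a \<in> H \<inter> K" "b \<in> H \<inter> K"
    then show "(\<lambda>x. inverse (\<theta> a) * (inverse (\<theta> b) * f (inverse b * (inverse a * x))))
        = (\<lambda>x. inverse (\<theta> (a * b)) * f (inverse (a * b) * x))"
      by (simp add: theta_mult mult.assoc)
  next
    fix g assume g: "testf g" "D g = D f" "\<And>a x. a \<in> H \<inter> K \<Longrightarrow> inverse (\<theta> a) * g (inverse a * x) = g x"
      "\<And>x. g x \<noteq> 0 \<Longrightarrow> \<exists>a\<in>H \<inter> K. f (inverse a * x) \<noteq> 0"
    show thesis
    proof (rule that[OF g(1,2)])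
      show "g (a * x) = inverse (\<theta> a) * g x" if "a \<in> H \<inter> K" for a x
        using g(3)[OF that, of "a * x"] by simp
      show "\<exists>a\<in>H \<inter> K. f (a * x) \<noteq> 0" if "g x \<noteq> 0" for x
        using g(4)[OF that] H_Int(3)[OF K] by blast
    qed
  qed
qed

lemma average_right:
  assumes K: "K \<in> KK" and f: "testf f"
  obtains g where "testf g" "D g = D f" "\<And>a x. a \<in> H \<inter> K \<Longrightarrow> g (x * a) = inverse (\<theta> a) * g x"
    "\<And>x. g x \<noteq> 0 \<Longrightarrow> \<exists>a\<in>H \<inter> K. f (x * a) \<noteq> 0"
    "\<And>b c. (\<And>x. f (b * x) = c * f x) \<Longrightarrow> \<forall>x. g (b * x) = c * g x"
proof -
  obtain L where L: "L \<in> KK" "rinv L f" using testfD[OF f] by blast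
  obtain N where N: "N \<in> KK" "\<forall>s\<in>H \<inter> N. \<theta> s = 1" using theta_smooth by blast
  have fin: "finite ((\<lambda>a x. \<theta> a * f (x * a)) ` (H \<inter> K))"
  proof (rule finite_translates[OF K KK_Int[OF L(1) N(1)]])
    fix a b assume ab: "a \<in> K" "b \<in> K" "a \<in> H" "b \<in> H" "inverse a * b \<in> L \<inter> N"
    have "\<theta> (inverse a * b) = 1" using ab N(2) subgpD[OF H] by simp
    then have "\<theta> a = \<theta> b" using ab theta_mult[of a "inverse a * b"] subgpD[OF H] by simp
    moreover have "f (x * a) = f (x * b)" for x
    proof -
      have "f (x * a * (inverse a * b)) = f (x * a)" using L(2) ab(5) unfolding rinv_def by blast
      then show ?thesis by (simp add: mult.assoc)
    qed
    ultimately show "(\<lambda>x. \<theta> a * f (x * a)) = (\<lambda>x. \<theta> b * f (x * b))" by simp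
  qed
  have inj: "inj (\<lambda>(h :: 'g \<Rightarrow> complex) x. \<theta> a * h (x * a))" if "a \<in> H \<inter> K" for a
  proof (rule injI)
    fix h h' :: "'g \<Rightarrow> complex"
    assume eq: "(\<lambda>x. \<theta> a * h (x * a)) = (\<lambda>x. \<theta> a * h' (x * a))"
    have "h x = h' x" for x
      using fun_cong[OF eq, of "x * inverse a"] theta_nz[of a] that by (simp add: mult.assoc)
    then show "h = h'" by blast
  qed
  have t: "testf (\<lambda>x. h (x * a))" if "testf h" for h a
    using testf_translate[OF that, of 1 a] by simp
  show ?thesis
  proof (rule average[where M = "H \<inter> K" and w = \<theta> and \<alpha> = "\<lambda>a x. x * a", OF H_Int(1)[OF K] H_Int(2)[OF K] f fin _ _ _ inj])
    fix a h assume a: "a \<in> H \<inter> K" and h: "testf h"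
    show "testf (\<lambda>x. \<theta> a * h (x * a))" using t[OF h] by (rule testf_scale)
    show "D (\<lambda>x. \<theta> a * h (x * a)) = D h"
      using a theta_nz[of a] D_right[OF h, of a] by (simp add: D_scale[OF t[OF h]])
  next
    fix a b assume "a \<in> H \<inter> K" "b \<in> H \<inter> K"
    then show "(\<lambda>x. \<theta> a * (\<theta> b * f (x * a * b))) = (\<lambda>x. \<theta> (a * b) * f (x * (a * b)))"
      by (simp add: theta_mult mult.assoc)
  next
    fix g assume g: "testf g" "D g = D f" "\<And>a x. a \<in> H \<inter> K \<Longrightarrow> \<theta> a * g (x * a) = g x"
      "\<And>x. g x \<noteq> 0 \<Longrightarrow> \<exists>a\<in>H \<inter> K. f (x * a) \<noteq> 0"
      "\<And>b c. (\<And>a x. a \<in> H \<inter> K \<Longrightarrow> b * x * a = b * (x * a)) \<Longrightarrow> (\<And>x. f (b * x) = c * f x) \<Longrightarrow> \<forall>x. g (b * x) = c * g x"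
    show thesis
    proof (rule that[OF g(1,2)])
      show "g (x * a) = inverse (\<theta> a) * g x" if "a \<in> H \<inter> K" for a x
        using g(3)[OF that, of x] theta_nz[of a] that by (simp add: field_simps)
      show "\<exists>a\<in>H \<inter> K. f (x * a) \<noteq> 0" if "g x \<noteq> 0" for x
        using g(4)[OF that] .
      show "\<forall>x. g (b * x) = c * g x" if "\<And>x. f (b * x) = c * f x" for b c
        using that by (intro g(5)) (simp_all add: mult.assoc)
    qed
  qed
qed

text \<open>Right averaging commutes with left translations, so the left equivariance gained first
  survives the second average.\<close>

lemma average_both:
  assumes K: "K \<in> KK" "K' \<in> KK" and f: "testf f"
  obtains g where "testf g" "D g = D f" "\<And>a x. a \<in> H \<inter> K \<Longrightarrow> g (a * x) = inverse (\<theta> a) * g x"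
    "\<And>b x. b \<in> H \<inter> K' \<Longrightarrow> g (x * b) = inverse (\<theta> b) * g x"
    "\<And>x. g x \<noteq> 0 \<Longrightarrow> \<exists>a\<in>H \<inter> K. \<exists>b\<in>H \<inter> K'. f (a * x * b) \<noteq> 0"
proof -
  obtain g1 where g1: "testf g1" "D g1 = D f" "\<And>a x. a \<in> H \<inter> K \<Longrightarrow> g1 (a * x) = inverse (\<theta> a) * g1 x"
    "\<And>x. g1 x \<noteq> 0 \<Longrightarrow> \<exists>a\<in>H \<inter> K. f (a * x) \<noteq> 0"
    using average_left[OF K(1) f] by blast
  obtain g where g: "testf g" "D g = D g1" "\<And>a x. a \<in> H \<inter> K' \<Longrightarrow> g (x * a) = inverse (\<theta> a) * g x"
    "\<And>x. g x \<noteq> 0 \<Longrightarrow> \<exists>a\<in>H \<inter> K'. g1 (x * a) \<noteq> 0"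
    "\<And>b c. (\<And>x. g1 (b * x) = c * g1 x) \<Longrightarrow> \<forall>x. g (b * x) = c * g x"
    using average_right[OF K(2) g1(1)] by blast
  show ?thesis
  proof (rule that[of g])
    show "g (a * x) = inverse (\<theta> a) * g x" if "a \<in> H \<inter> K" for a x
      using g(5)[OF g1(3)[OF that]] by blast
    show "\<exists>a\<in>H \<inter> K. \<exists>b\<in>H \<inter> K'. f (a * x * b) \<noteq> 0" if "g x \<noteq> 0" for x
      using g(4)[OF that] g1(4) by (metis mult.assoc)
  qed (use g g1 in auto)
qed

text \<open>Near \<open>x\<close> every test function can be replaced, without changing
  \<open>D\<close>, by one vanishing on \<open>E\<close>. If \<open>D\<close> depends only on values
  on \<open>E\<close>, then it vanishes near \<open>x\<close>.\<close>

definition killable :: "'g set \<Rightarrow> 'g \<Rightarrow> bool" where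
  "killable E x \<longleftrightarrow> (\<exists>K\<in>KK. \<forall>f. testf f \<longrightarrow> (\<forall>y. f y \<noteq> 0 \<longrightarrow> y \<in> lcos x K) \<longrightarrow>
     (\<exists>g. testf g \<and> D g = D f \<and> (\<forall>y\<in>E. g y = 0)))"

definition invariant :: "'g set \<Rightarrow> bool" where
  "invariant E \<longleftrightarrow> (\<forall>s\<in>H. \<forall>t\<in>H. \<forall>x\<in>E. s * x * t \<in> E) \<and> (\<forall>x\<in>E. \<epsilon> * inverse x * \<epsilon> \<in> E)"

text \<open>After averaging on both sides, evaluating \<open>g\<close> at
  \<open>a * y = y * b\<close> in two ways gives \<open>g y = 0\<close>, the characters being
  different. Any point of \<open>E\<close> where \<open>g\<close> is nonzero is moved by the
  averaging groups into the given neighbourhood, where this applies.\<close>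

lemma killable_stabilizer:
  assumes E: "invariant E" and K: "K \<in> KK" "K1 \<in> KK" "K2 \<in> KK"
    and st: "\<And>y. y \<in> lcos x K \<Longrightarrow> y \<in> E \<Longrightarrow> \<exists>a\<in>H \<inter> K1. \<exists>b\<in>H \<inter> K2. a * y = y * b \<and> \<theta> a \<noteq> \<theta> b"
  shows "killable E x"
  unfolding killable_def
proof (intro bexI[OF _ K(1)] allI impI)
  fix f assume f: "testf f" "\<forall>y. f y \<noteq> 0 \<longrightarrow> y \<in> lcos x K"
  obtain g where g: "testf g" "D g = D f" "\<And>a x. a \<in> H \<inter> K1 \<Longrightarrow> g (a * x) = inverse (\<theta> a) * g x"
    "\<And>b x. b \<in> H \<inter> K2 \<Longrightarrow> g (x * b) = inverse (\<theta> b) * g x"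
    "\<And>x. g x \<noteq> 0 \<Longrightarrow> \<exists>a\<in>H \<inter> K1. \<exists>b\<in>H \<inter> K2. f (a * x * b) \<noteq> 0"
    using average_both[OF K(2,3) f(1)] by blast
  have "g y = 0" if y: "y \<in> E" for y
  proof (rule ccontr)
    assume gy: "g y \<noteq> 0"
    then obtain a b where ab: "a \<in> H \<inter> K1" "b \<in> H \<inter> K2" "f (a * y * b) \<noteq> 0" using g(5) by blast
    let ?y = "a * y * b"
    have yE: "?y \<in> E" using E y ab unfolding invariant_def by blast
    have yN: "?y \<in> lcos x K" using f(2) ab(3) by blast
    obtain a' b' where ab': "a' \<in> H \<inter> K1" "b' \<in> H \<inter> K2" "a' * ?y = ?y * b'" "\<theta> a' \<noteq> \<theta> b'" using st[OF yN yE] by blast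
    have "inverse (\<theta> a') * g ?y = g (a' * ?y)" by (rule g(3)[OF ab'(1), symmetric])
    also have "\<dots> = g (?y * b')" by (simp only: ab'(3))
    also have "\<dots> = inverse (\<theta> b') * g ?y" by (rule g(4)[OF ab'(2)])
    finally have "inverse (\<theta> a') * g ?y = inverse (\<theta> b') * g ?y" .
    moreover have "inverse (\<theta> a') \<noteq> inverse (\<theta> b')" using ab'(4) by simp
    ultimately have "g ?y = 0"
      using mult_right_cancel[of "g ?y" "inverse (\<theta> a')" "inverse (\<theta> b')"] by blast
    moreover have "g ?y = inverse (\<theta> b) * (inverse (\<theta> a) * g y)"
      using g(4)[OF ab(2), of "a * y"] g(3)[OF ab(1), of y] by simp
    ultimately show False using gy theta_nz ab(1,2) by auto
  qed
  then show "\<exists>g. testf g \<and> D g = D f \<and> (\<forall>y\<in>E. g y = 0)" using g(1,2) by blast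
qed

text \<open>Put \<open>y0 = s * \<epsilon>\<close>. The map
  \<open>x \<mapsto> y0 * inverse x * y0\<close> acts on \<open>D\<close> by \<open>-1\<close>, and
  on \<open>E\<close> the averaged function \<open>g\<close> is invariant under it. Half the
  difference of \<open>g\<close> and its transform therefore vanishes on \<open>E\<close> and has
  the same value of \<open>D\<close>.\<close>

lemma killable_involution:
  assumes E: "invariant E" and K: "K \<in> KK" "K1 \<in> KK" and s: "s \<in> H"
    and st: "\<And>y. y \<in> lcos x K \<Longrightarrow> y \<in> E \<Longrightarrow> \<exists>a\<in>H \<inter> K1. (inverse y * (a * s * \<epsilon>)) * (inverse y * (a * s * \<epsilon>)) \<in> Z"
  shows "killable E x"
  unfolding killable_def
proof (intro bexI[OF _ K(1)] allI impI)
  fix f assume f: "testf f" "\<forall>y. f y \<noteq> 0 \<longrightarrow> y \<in> lcos x K"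
  define y0 where "y0 = s * \<epsilon>"
  \<comment> \<open>This level makes \<open>inverse y0 * a * y0\<close> available on the right
    whenever \<open>a\<close> is averaged on the left.\<close>
  let ?K2 = "conjs (inverse y0) K1"
  have K2: "?K2 \<in> KK" using K KK_conjs by blast
  have K1s: "subgp K1" using K KK_subgp by blast
  have ei: "inverse \<epsilon> = \<epsilon>" by (rule inv_unique[OF eps_sq])
  have ee: "\<epsilon> * (\<epsilon> * x) = x" for x using eps_sq by (simp flip: mult.assoc)
  have si: "inverse s \<in> H" using subgpD(3)[OF H s] .
  have conj: "inverse y0 * a * y0 \<in> H \<inter> ?K2" "\<theta> (inverse y0 * a * y0) = inverse (\<theta> a)" if a: "a \<in> H \<inter> K1" for a
  proof -
    have h: "inverse s * a * s \<in> H" using a si s subgpD(2)[OF H] by auto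
    have eq: "inverse y0 * a * y0 = \<epsilon> * (inverse s * a * s) * \<epsilon>" by (simp add: y0_def ei mult.assoc)
    have "inverse y0 * a * y0 \<in> H" unfolding eq by (rule eps_H[OF h])
    moreover have "inverse y0 * a * y0 \<in> ?K2" using a by (simp add: conjs_def mult.assoc)
    ultimately show "inverse y0 * a * y0 \<in> H \<inter> ?K2" by blast
    have "\<theta> (inverse s * a * s) = \<theta> a"
      using a s si subgpD(2)[OF H si, of a] theta_nz[OF s] by (simp add: theta_mult theta_inverse)
    then show "\<theta> (inverse y0 * a * y0) = inverse (\<theta> a)" unfolding eq theta_eps[OF h] by simp
  qed
  obtain g where g: "testf g" "D g = D f" "\<And>a x. a \<in> H \<inter> K1 \<Longrightarrow> g (a * x) = inverse (\<theta> a) * g x"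
    "\<And>b x. b \<in> H \<inter> ?K2 \<Longrightarrow> g (x * b) = inverse (\<theta> b) * g x"
    "\<And>x. g x \<noteq> 0 \<Longrightarrow> \<exists>a\<in>H \<inter> K1. \<exists>b\<in>H \<inter> ?K2. f (a * x * b) \<noteq> 0"
    using average_both[OF K(2) K2 f(1)] by blast
  let ?t = "\<lambda>x. y0 * inverse x * y0"
  have tt: "?t (?t x) = x" for x by (simp add: mult.assoc)
  define good where "good y \<longleftrightarrow> (\<exists>a\<in>H \<inter> K1. (inverse y * (a * y0)) * (inverse y * (a * y0)) \<in> Z)" for y
  have eq0: "g y = g (?t y)" if gd: "good y" for y
  proof -
    obtain a z where a: "a \<in> H \<inter> K1" and z: "(inverse y * (a * y0)) * (inverse y * (a * y0)) = z" "z \<in> Z"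
      using gd unfolding good_def by blast
    let ?b = "inverse y0 * a * y0"
    \<comment> \<open>Up to the centre, \<open>y\<close> is its transform moved by \<open>a\<close>
      and \<open>?b\<close>, whose characters are inverse to each other.\<close>
    have "y * z = a * (?t y * ?b)" unfolding z(1)[symmetric] by (simp add: mult.assoc)
    moreover have "g (y * z) = g y"
    proof -
      obtain L where L: "L \<in> KK" "rinv L g" using testfD[OF g(1)] by blast
      then show ?thesis using Z_sub[OF L(1)] z(2) by (auto simp: rinv_def)
    qed
    moreover have "g (a * (?t y * ?b)) = inverse (\<theta> a) * (inverse (\<theta> ?b) * g (?t y))"
      using g(3)[OF a] g(4)[OF conj(1)[OF a]] by simp
    ultimately have "g y = inverse (\<theta> a) * (inverse (\<theta> ?b) * g (?t y))" by simp
    also have "\<dots> = g (?t y)" unfolding conj(2)[OF a] using theta_nz[of a] a by simp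
    finally show ?thesis .
  qed
  \<comment> \<open>The averaged function lives on translates of the neighbourhood, so the property
    has to be carried along by the averaging groups.\<close>
  have good_f: "good (a * y * b)" if gd: "good y" and a: "a \<in> H \<inter> K1" and b: "b \<in> H \<inter> ?K2" for a y b
  proof -
    obtain c where c: "c \<in> H \<inter> K1" "(inverse y * (c * y0)) * (inverse y * (c * y0)) \<in> Z" using gd unfolding good_def by blast
    define d where "d = a * c * (y0 * b * inverse y0)"
    have "y0 * b * inverse y0 \<in> K1" using b by (simp add: conjs_def)
    moreover have "y0 * b * inverse y0 = s * (\<epsilon> * b * \<epsilon>) * inverse s" by (simp add: y0_def ei mult.assoc)
    then have "y0 * b * inverse y0 \<in> H" using eps_H[of b] b s si subgpD(2)[OF H] by auto
    ultimately have d: "d \<in> H \<inter> K1" unfolding d_def using a c H_Int(2)[OF K(2)] by blast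
    have e: "inverse (a * y * b) * (d * y0) = inverse b * (inverse y * (c * y0)) * b"
      by (simp add: d_def mult.assoc)
    have "inverse (a * y * b) * (d * y0) * (inverse (a * y * b) * (d * y0))
        = inverse b * (inverse y * (c * y0) * (inverse y * (c * y0)) * b)"
      unfolding e by (simp add: mult.assoc)
    also have "\<dots> = inverse y * (c * y0) * (inverse y * (c * y0))"
      unfolding Z_central[OF c(2)] by simp
    finally have "inverse (a * y * b) * (d * y0) * (inverse (a * y * b) * (d * y0)) \<in> Z"
      using c(2) by (simp only:)
    then show ?thesis unfolding good_def using d by blast
  qed
  have good_g: "good y" if yE: "y \<in> E" and gy: "g y \<noteq> 0" for y
  proof -
    obtain a b where ab: "a \<in> H \<inter> K1" "b \<in> H \<inter> ?K2" "f (a * y * b) \<noteq> 0" using g(5)[OF gy] by blast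
    have "a * y * b \<in> E" using E yE ab unfolding invariant_def by blast
    moreover have "a * y * b \<in> lcos x K" using f(2) ab(3) by blast
    ultimately have "good (a * y * b)" using st[of "a * y * b"] unfolding good_def y0_def by (simp add: mult.assoc)
    from good_f[OF this H_Int(3)[OF K(2) ab(1)] H_Int(3)[OF K2 ab(2)]] show "good y" by (simp add: mult.assoc)
  qed
  let ?u = "\<epsilon> * s * \<epsilon>"
  have t_eq: "?t y = s * (\<epsilon> * inverse y * \<epsilon>) * ?u" for y by (simp add: y0_def mult.assoc ee)
  have tE: "?t y \<in> E" if "y \<in> E" for y
    unfolding t_eq using E that s eps_H[OF s] unfolding invariant_def by blast
  have same: "g y = g (?t y)" if y: "y \<in> E" for y
  proof (cases "g y = 0 \<and> g (?t y) = 0")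
    case False
    then show ?thesis
    proof (cases "g y = 0")
      case True
      then have "good (?t y)" using False good_g[OF tE[OF y]] by blast
      from eq0[OF this] show ?thesis by (simp only: tt)
    next
      case False
      then show ?thesis using eq0[OF good_g[OF y]] by blast
    qed
  qed simp
  have testt: "testf (\<lambda>x. g (?t x))"
    using testf_inverse[OF testf_translate[OF g(1), of y0 y0]] by simp
  have "D (\<lambda>x. g (?t x)) = - D g"
  proof -
    have 1: "testf (\<lambda>x. g (s * x))" using testf_translate[OF g(1), of s 1] by simp
    have 2: "testf (\<lambda>x. g (s * (x * ?u)))" using testf_translate[OF g(1), of s ?u] by (simp add: mult.assoc)
    have "D (\<lambda>x. g (?t x)) = - D (\<lambda>x. g (s * (x * ?u)))"
      using D_skew[OF 2] unfolding t_eq by (simp add: mult.assoc)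
    also have "D (\<lambda>x. g (s * (x * ?u))) = inverse (\<theta> ?u) * D (\<lambda>x. g (s * x))"
      by (rule D_right[OF 1 eps_H[OF s]])
    also have "D (\<lambda>x. g (s * x)) = inverse (\<theta> s) * D g"
      using D_left[OF g(1) si] by (simp add: theta_inverse[OF s])
    finally show ?thesis using theta_nz[OF s] by (simp add: theta_eps[OF s])
  qed
  then have Dg: "D (\<lambda>x. (1 / 2) * (g x + (- 1) * g (?t x))) = D g"
    by (simp only: D_scale[OF testf_add[OF g(1) testf_scale[OF testt]]] D_add[OF g(1) testf_scale[OF testt]] D_scale[OF testt]) simp
  show "\<exists>g. testf g \<and> D g = D f \<and> (\<forall>y\<in>E. g y = 0)"
  proof (intro exI[of _ "\<lambda>x. (1 / 2) * (g x + (- 1) * g (?t x))"] conjI ballI)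
    show "testf (\<lambda>x. (1 / 2) * (g x + (- 1) * g (?t x)))"
      by (intro testf_scale testf_add g(1) testt)
    show "D (\<lambda>x. (1 / 2) * (g x + (- 1) * g (?t x))) = D f" using Dg g(2) by simp
    show "(1 / 2) * (g y + (- 1) * g (?t y)) = 0" if "y \<in> E" for y using same[OF that] by simp
  qed
qed

text \<open>Stronger than support in \<open>E\<close>: the values of a test function on
  \<open>E\<close> alone determine \<open>D\<close>.\<close>

definition annihilated :: "'g set \<Rightarrow> bool" where
  "annihilated E \<longleftrightarrow> (\<forall>f. testf f \<longrightarrow> (\<forall>x\<in>E. f x = 0) \<longrightarrow> D f = 0)"

text \<open>Compactness of \<open>A \<inter> E\<close> modulo the centre, for \<open>A\<close> open
  and compact modulo the centre, with cosets of members of \<open>KK\<close> as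
  neighbourhoods.\<close>

definition coverable :: "'g set \<Rightarrow> bool" where
  "coverable E \<longleftrightarrow> (\<forall>A. \<forall>L\<in>KK. finite (cosets A L) \<longrightarrow> (\<forall>x\<in>A. \<forall>k\<in>L. x * k \<in> A) \<longrightarrow>
     (\<forall>r. (\<forall>x\<in>A \<inter> E. r x \<in> KK) \<longrightarrow> (\<exists>I\<subseteq>A \<inter> E. finite I \<and> A \<inter> E \<subseteq> (\<Union>x\<in>I. lcos x (r x)))))"

lemma finite_Inter_KK: "finite I \<Longrightarrow> L \<in> KK \<Longrightarrow> (\<And>x. x \<in> I \<Longrightarrow> r x \<in> KK) \<Longrightarrow> \<exists>M\<in>KK. M \<subseteq> L \<and> (\<forall>x\<in>I. M \<subseteq> r x)"
proof (induction I rule: finite_induct)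
  case (insert x I)
  then obtain M where "M \<in> KK" "M \<subseteq> L" "\<forall>x\<in>I. M \<subseteq> r x" by blast
  then show ?case using insert.prems by (intro bexI[of _ "M \<inter> r x"] KK_Int) auto
qed auto

lemma testf_coset: "L \<in> KK \<Longrightarrow> testf (\<lambda>x. if x \<in> lcos y L then 1 else 0)"
proof -
  assume L: "L \<in> KK"
  have Ls: "subgp L" using L KK_subgp by blast
  have 1: "x * k \<in> lcos y L \<longleftrightarrow> x \<in> lcos y L" if "k \<in> L" for x k
  proof
    assume "x * k \<in> lcos y L"
    then have "inverse y * (x * k) * inverse k \<in> L"
      unfolding lcos_def by (intro subgpD(2)[OF Ls _ subgpD(3)[OF Ls that]]) simp
    then show "x \<in> lcos y L" by (simp add: lcos_def mult.assoc)
  next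
    assume "x \<in> lcos y L"
    then have "inverse y * x * k \<in> L"
      unfolding lcos_def by (intro subgpD(2)[OF Ls _ that]) simp
    then show "x * k \<in> lcos y L" by (simp add: lcos_def mult.assoc)
  qed
  have 2: "k * x \<in> lcos y L \<longleftrightarrow> x \<in> lcos y L" if k: "k \<in> conjs y L" for x k
  proof -
    have kk: "inverse y * k * y \<in> L" "inverse (inverse y * k * y) \<in> L"
      using k subgpD(3)[OF Ls, of "inverse y * k * y"] by (auto simp only: conjs_def mem_Collect_eq)
    have "(inverse y * k * y) * (inverse y * x) \<in> L" if "inverse y * x \<in> L"
      using subgpD(2)[OF Ls kk(1) that] .
    moreover have "inverse (inverse y * k * y) * (inverse y * (k * x)) \<in> L" if "inverse y * (k * x) \<in> L"
      using subgpD(2)[OF Ls kk(2) that] .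
    ultimately show ?thesis by (auto simp: lcos_def mult.assoc)
  qed
  show ?thesis
  proof (rule testfI[OF L _ KK_conjs[OF L] _ L])
    show "rinv L (\<lambda>x. if x \<in> lcos y L then 1 else 0 :: complex)" by (simp add: rinv_def 1)
    show "(if k * x \<in> lcos y L then 1 else 0) = (if x \<in> lcos y L then 1 else 0 :: complex)" if "k \<in> conjs y L" for k x
      using 2[OF that] by simp
    show "fsupp L (\<lambda>x. if x \<in> lcos y L then 1 else 0 :: complex)"
      using finite_cosets_lcos[OF L L, of y] by (simp add: fsupp_def)
  qed
qed

text \<open>Cut \<open>f\<close> into pieces supported on small cosets. A piece whose coset misses
  \<open>E\<close> vanishes there already; one whose coset meets \<open>E\<close> does so at a point
  where \<open>f\<close> is nonzero, hence outside \<open>E'\<close>, and lies in a neighbourhood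
  witnessing killability. Replacing the pieces makes all of \<open>f\<close> vanish on
  \<open>E\<close>.\<close>

lemma annihilated_step:
  assumes E: "annihilated E" "coverable E" and k: "\<And>x. x \<in> E \<Longrightarrow> x \<notin> E' \<Longrightarrow> killable E x"
  shows "annihilated E'"
  unfolding annihilated_def
proof (intro allI impI)
  fix f assume f: "testf f" "\<forall>x\<in>E'. f x = 0"
  obtain L where L: "L \<in> KK" "rinv L f" "\<forall>k\<in>L. \<forall>x. f (k * x) = f x" "\<forall>M\<in>KK. fsupp M f"
    using testfD[OF f(1)] by blast
  let ?A = "{x. f x \<noteq> 0}"
  define r where "r x = (SOME K. K \<in> KK \<and> (\<forall>f. testf f \<longrightarrow> (\<forall>y. f y \<noteq> 0 \<longrightarrow> y \<in> lcos x K) \<longrightarrow>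
     (\<exists>g. testf g \<and> D g = D f \<and> (\<forall>y\<in>E. g y = 0))))" for x
  have r: "r x \<in> KK \<and> (\<forall>f. testf f \<longrightarrow> (\<forall>y. f y \<noteq> 0 \<longrightarrow> y \<in> lcos x (r x)) \<longrightarrow>
     (\<exists>g. testf g \<and> D g = D f \<and> (\<forall>y\<in>E. g y = 0)))" if "x \<in> ?A \<inter> E" for x
  proof -
    have "killable E x" using that f(2) k by blast
    then have "\<exists>K. K \<in> KK \<and> (\<forall>f. testf f \<longrightarrow> (\<forall>y. f y \<noteq> 0 \<longrightarrow> y \<in> lcos x K) \<longrightarrow>
     (\<exists>g. testf g \<and> D g = D f \<and> (\<forall>y\<in>E. g y = 0)))" unfolding killable_def by blast
    then show ?thesis unfolding r_def by (rule someI_ex)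
  qed
  have fin: "finite (cosets ?A L)" using L by (auto simp: fsupp_def)
  have st: "\<forall>x\<in>?A. \<forall>k\<in>L. x * k \<in> ?A" using L(2) by (auto simp: rinv_def)
  have rK: "\<forall>x\<in>?A \<inter> E. r x \<in> KK" using r by blast
  have "\<exists>I\<subseteq>?A \<inter> E. finite I \<and> ?A \<inter> E \<subseteq> (\<Union>x\<in>I. lcos x (r x))"
    using E(2)[unfolded coverable_def, THEN spec, THEN bspec, OF L(1), THEN mp, OF fin, THEN mp, OF st, THEN spec, THEN mp, OF rK] .
  then obtain I where I: "I \<subseteq> ?A \<inter> E" "finite I" "?A \<inter> E \<subseteq> (\<Union>x\<in>I. lcos x (r x))"
    by blast
  obtain M where M: "M \<in> KK" "M \<subseteq> L" "\<forall>x\<in>I. M \<subseteq> r x"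
    using finite_Inter_KK[OF I(2) L(1), of r] r I(1) by blast
  have Ms: "subgp M" using M KK_subgp by blast
  have finM: "finite (cosets ?A M)" using L(4) M(1) by (auto simp: fsupp_def)
  let ?F = "\<lambda>c x. f (rp c) * (if x \<in> lcos (rp c) M then 1 else 0)"
  have tF: "testf (?F c)" for c by (rule testf_scale[OF testf_coset[OF M(1)]])
  have f_eq: "f x = (\<Sum>c\<in>cosets ?A M. ?F c x)" for x
  proof (cases "f x = 0")
    case True
    have "?F c x = 0" if "c \<in> cosets ?A M" for c
    proof (cases "x \<in> lcos (rp c) M")
      case t: True
      then have "f x = f (rp c)" using rinvD[OF rinv_mono[OF L(2) M(2)] Ms] by blast
      then show ?thesis using True by simp
    qed simp
    then have "(\<Sum>c\<in>cosets ?A M. ?F c x) = 0" by (intro sum.neutral ballI)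
    then show ?thesis using True by simp
  next
    case False
    let ?c = "lcos x M"
    have c: "?c \<in> cosets ?A M" using False by (auto simp: cosets_def)
    have "?F c x = (if c = ?c then f x else 0)" if "c \<in> cosets ?A M" for c
    proof -
      have lc: "lcos (rp c) M = c" using lcos_rp'[OF Ms that] .
      show ?thesis
      proof (cases "x \<in> c")
        case True
        then have "c = ?c" "f x = f (rp c)"
          using lcos_eqI[OF Ms, of x "rp c"] rinvD[OF rinv_mono[OF L(2) M(2)] Ms, of x "rp c"] lc by auto
        then show ?thesis using lc True by simp
      next
        case False
        then have "c \<noteq> ?c" using mem_lcos_self[OF Ms, of x] by blast
        then show ?thesis using lc False by simp
      qed
    qed
    then have "(\<Sum>c\<in>cosets ?A M. ?F c x) = (\<Sum>c\<in>cosets ?A M. if c = ?c then f x else 0)"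
      by (intro sum.cong) auto
    then show ?thesis using c finM by simp
  qed
  have ex: "\<exists>g. testf g \<and> D g = D (?F c) \<and> (\<forall>y\<in>E. g y = 0)" if c: "c \<in> cosets ?A M" for c
  proof (cases "c \<inter> E = {}")
    case True
    then have "\<forall>y\<in>E. ?F c y = 0" using lcos_rp'[OF Ms c] by auto
    then show ?thesis using tF by blast
  next
    case False
    then obtain y where y: "y \<in> c" "y \<in> E" by blast
    have lc: "lcos (rp c) M = c" using lcos_rp'[OF Ms c] .
    have cy: "c = lcos y M" using lcos_eqI[OF Ms, of y "rp c"] y lc by simp
    obtain x0 where x0: "f x0 \<noteq> 0" "c = lcos x0 M" using c by (auto simp: cosets_def)
    then have "f y \<noteq> 0" using rinvD[OF rinv_mono[OF L(2) M(2)] Ms, of y x0] y by simp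
    then obtain x where x: "x \<in> I" "y \<in> lcos x (r x)" using I(3) y by blast
    have rx: "r x \<in> KK" using r x I by blast
    have "lcos y (r x) = lcos x (r x)" using lcos_eqI[OF KK_subgp[OF rx] x(2)] .
    moreover have "c \<subseteq> lcos y (r x)" unfolding cy using M(3) x by (auto simp: lcos_def)
    ultimately have "\<forall>y. ?F c y \<noteq> 0 \<longrightarrow> y \<in> lcos x (r x)" using lc by (auto split: if_splits)
    then show ?thesis using r[of x] x I tF[of c] by blast
  qed
  have "\<forall>c\<in>cosets ?A M. \<exists>g. testf g \<and> D g = D (?F c) \<and> (\<forall>y\<in>E. g y = 0)" using ex by blast
  from bchoice[OF this] obtain G where
    G: "\<forall>c\<in>cosets ?A M. testf (G c) \<and> D (G c) = D (?F c) \<and> (\<forall>y\<in>E. G c y = 0)" ..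
  have tG: "testf (G c)" if "c \<in> cosets ?A M" for c using G that by blast
  have "f = (\<lambda>x. \<Sum>c\<in>cosets ?A M. ?F c x)" by (rule ext) (rule f_eq)
  then have "D f = D (\<lambda>x. \<Sum>c\<in>cosets ?A M. ?F c x)" by (rule arg_cong)
  also have "\<dots> = (\<Sum>c\<in>cosets ?A M. D (?F c))" by (rule D_sum[OF finM tF])
  also have "\<dots> = (\<Sum>c\<in>cosets ?A M. D (G c))" using G by (intro sum.cong) auto
  also have "\<dots> = D (\<lambda>x. \<Sum>c\<in>cosets ?A M. G c x)" by (rule D_sum[OF finM tG, symmetric])
  also have "\<dots> = 0"
    using E(1) testf_sum[OF finM tG] G unfolding annihilated_def by auto
  finally show "D f = 0" .
qed

end

section \<open>Local compactness of the field\<close>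

context finite_extension_Qp
begin

lemma absv_dist: "absv x = dist x 0"
  using dist_absv[of x 0] by simp

lemma absv_nonneg [simp]: "absv x \<ge> 0"
  by (simp add: absv_dist)

lemma absv_zero_iff [simp]: "absv x = 0 \<longleftrightarrow> x = 0"
  by (simp add: absv_dist)

lemma absv_0 [simp]: "absv 0 = 0"
  by simp

lemma absv_pos [simp]: "absv x > 0 \<longleftrightarrow> x \<noteq> 0"
  by (simp add: absv_dist)

lemma absv_one [simp]: "absv 1 = 1"
  using absv_mult[of 1 1] absv_zero_iff[of 1] by simp

lemma absv_minus_one: "absv (- 1) = 1"
proof -
  have "absv (- 1) * absv (- 1) = 1" using absv_mult[of "-1" "-1"] by simp
  then show ?thesis using absv_nonneg[of "-1"] by (metis abs_of_nonneg abs_square_eq_1 power2_eq_square)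
qed

lemma absv_minus [simp]: "absv (- x) = absv x"
  using absv_mult[of "-1" x] absv_minus_one by simp

lemma absv_add_le: "absv x \<le> r \<Longrightarrow> absv y \<le> r \<Longrightarrow> absv (x + y) \<le> r"
  using absv_ultrametric[of x y] by simp

lemma absv_add_less: "absv x < r \<Longrightarrow> absv y < r \<Longrightarrow> absv (x + y) < r"
  using absv_ultrametric[of x y] by simp

lemma absv_diff_le: "absv x \<le> r \<Longrightarrow> absv y \<le> r \<Longrightarrow> absv (x - y) \<le> r"
  using absv_add_le[of x r "- y"] by simp

lemma absv_sum_le: "finite A \<Longrightarrow> 0 \<le> r \<Longrightarrow> (\<And>a. a \<in> A \<Longrightarrow> absv (f a) \<le> r) \<Longrightarrow> absv (sum f A) \<le> r"
  by (induction A rule: finite_induct) (auto intro: absv_add_le)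

lemma absv_inverse: "absv (inverse x) = inverse (absv x)"
proof (cases "x = 0")
  case False
  then have "absv x * absv (inverse x) = 1" by (simp flip: absv_mult)
  then show ?thesis by (rule inverse_unique[symmetric])
qed simp

lemma absv_divide: "absv (x / y) = absv x / absv y"
  by (simp add: divide_inverse absv_mult absv_inverse)

lemma absv_power: "absv (x ^ n) = absv x ^ n"
  by (induction n) (simp_all add: absv_mult)

lemma absv_of_nat_le: "absv (of_nat n) \<le> 1"
  by (induction n) (auto intro: absv_add_le)

lemma absv_of_int_le: "absv (of_int n) \<le> 1"
  by (cases n rule: int_cases2) (use absv_of_nat_le in simp_all)

lemma absv_p: "absv (of_nat p) = 1 / real p"
proof -
  have "multiplicity (int p) (int p) = 1"
    using prime_p by (simp add: prime_nat_iff)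
  moreover have "quotient_of (of_nat p) = (int p, 1)"
    using quotient_of_int[of "int p"] by simp
  ultimately show ?thesis
    using absv_of_rat[of "of_nat p"] prime_gt_0_nat[OF prime_p]
    by (simp add: padic_abs_def power_int_minus divide_inverse)
qed

lemma p_gt_1: "real p > 1"
  using prime_gt_1_nat[OF prime_p] by simp

text \<open>In a Bezout relation \<open>u * p + v * b = 1\<close> the first term has absolute value
  below one, so the second cannot.\<close>

lemma absv_of_int_unit:
  assumes "\<not> int p dvd b"
  shows "absv (of_int b) = 1"
proof -
  have "coprime (int p) b"
    using assms prime_p by (simp add: prime_imp_coprime)
  then obtain u v where uv: "u * int p + v * b = 1"
    using bezout_int[of "int p" b] by auto
  have "absv (of_int (v * b)) \<ge> 1"
  proof (rule ccontr)
    assume "\<not> ?thesis"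
    then have 1: "absv (of_int (v * b)) < 1" by simp
    have "absv (of_int (u * int p)) \<le> 1 * (1 / real p)"
      using absv_of_int_le[of u] by (simp only: of_int_mult of_int_of_nat_eq absv_mult absv_p) (intro mult_right_mono, auto)
    also have "\<dots> < 1" using p_gt_1 by simp
    finally have "absv (of_int (u * int p) + of_int (v * b)) < 1" using 1 by (rule absv_add_less)
    moreover have "of_int (u * int p) + of_int (v * b) = (1 :: 'k)"
      by (simp only: of_int_add[symmetric] uv of_int_1)
    ultimately show False by simp
  qed
  moreover have "absv (of_int (v * b)) \<le> absv (of_int b)"
    using absv_of_int_le[of v] by (simp add: absv_mult mult_left_le_one_le)
  ultimately show ?thesis using absv_of_int_le[of b] by simp
qed

lemma tendsto_absv: "(f \<longlongrightarrow> a) F \<longleftrightarrow> (\<forall>e>0. eventually (\<lambda>x. absv (f x - a) < e) F)"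
  by (simp add: tendsto_iff dist_absv)

text \<open>The type class only supplies a field and a metric; continuity of the field operations
  has to come from \<open>absv\<close>.\<close>

lemma tendsto_k_add:
  fixes f g :: "'b \<Rightarrow> 'k"
  assumes "(f \<longlongrightarrow> a) F" "(g \<longlongrightarrow> b) F"
  shows "((\<lambda>x. f x + g x) \<longlongrightarrow> a + b) F"
  unfolding tendsto_absv
proof (intro allI impI)
  fix e :: real assume "e > 0"
  then have "eventually (\<lambda>x. absv (f x - a) < e) F" "eventually (\<lambda>x. absv (g x - b) < e) F"
    using assms by (auto simp: tendsto_absv)
  then show "eventually (\<lambda>x. absv (f x + g x - (a + b)) < e) F"
  proof eventually_elim
    case (elim x)
    then show ?case using absv_add_less[of "f x - a" e "g x - b"] by (simp add: algebra_simps)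
  qed
qed

lemma tendsto_k_minus: "((f :: 'b \<Rightarrow> 'k) \<longlongrightarrow> a) F \<Longrightarrow> ((\<lambda>x. - f x) \<longlongrightarrow> - a) F"
  unfolding tendsto_absv
proof (intro allI impI)
  fix e :: real assume *: "\<forall>e>0. eventually (\<lambda>x. absv (f x - a) < e) F" "e > 0"
  have "absv (- f x - (- a)) = absv (f x - a)" for x
    using absv_minus[of "f x - a"] by (simp add: algebra_simps)
  then show "eventually (\<lambda>x. absv (- f x - (- a)) < e) F" using * by simp
qed

lemma tendsto_k_diff: "((f :: 'b \<Rightarrow> 'k) \<longlongrightarrow> a) F \<Longrightarrow> (g \<longlongrightarrow> b) F \<Longrightarrow> ((\<lambda>x. f x - g x) \<longlongrightarrow> a - b) F"
  using tendsto_k_add[of f a F "\<lambda>x. - g x" "- b"] tendsto_k_minus[of g b F] by simp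

lemma tendsto_k_mult:
  fixes f g :: "'b \<Rightarrow> 'k"
  assumes "(f \<longlongrightarrow> a) F" "(g \<longlongrightarrow> b) F"
  shows "((\<lambda>x. f x * g x) \<longlongrightarrow> a * b) F"
  unfolding tendsto_absv
proof (intro allI impI)
  fix e :: real assume e: "e > 0"
  define d where "d = min 1 (e / (1 + absv a + absv b))"
  have pos: "1 + absv a + absv b > 0" using absv_nonneg[of a] absv_nonneg[of b] by linarith
  have d: "d > 0" "d \<le> 1" "d \<le> e / (1 + absv a + absv b)" unfolding d_def using e pos by auto
  have "d * (1 + absv a + absv b) \<le> e" using d(3) pos by (simp add: pos_le_divide_eq)
  then have de: "d + d * absv a + d * absv b \<le> e" by (simp add: algebra_simps)
  have nn: "d * absv a \<ge> 0" "d * absv b \<ge> 0" using d by simp_all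
  have "eventually (\<lambda>x. absv (f x - a) < d) F" "eventually (\<lambda>x. absv (g x - b) < d) F"
    using assms d by (auto simp: tendsto_absv)
  then show "eventually (\<lambda>x. absv (f x * g x - a * b) < e) F"
  proof eventually_elim
    case (elim x)
    have 1: "absv ((f x - a) * (g x - b)) < e"
    proof -
      have "absv (f x - a) * absv (g x - b) \<le> absv (f x - a) * 1"
        using elim d by (intro mult_left_mono) auto
      then show ?thesis using elim de nn unfolding absv_mult by linarith
    qed
    have 2: "absv (a * (g x - b)) < e"
    proof -
      have "absv a * absv (g x - b) \<le> absv a * d" using elim by (intro mult_left_mono) auto
      then show ?thesis using de nn d unfolding absv_mult mult.commute[of "absv a" d] by linarith
    qed
    have 3: "absv ((f x - a) * b) < e"
    proof -
      have "absv (f x - a) * absv b \<le> d * absv b" using elim by (intro mult_right_mono) auto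
      then show ?thesis using de nn d unfolding absv_mult by linarith
    qed
    have "f x * g x - a * b = (f x - a) * (g x - b) + (a * (g x - b) + (f x - a) * b)" by (simp add: algebra_simps)
    then show ?case using absv_add_less[OF 1 absv_add_less[OF 2 3]] by simp
  qed
qed

lemma tendsto_k_inverse:
  fixes f :: "'b \<Rightarrow> 'k"
  assumes f: "(f \<longlongrightarrow> a) F" and a: "a \<noteq> 0"
  shows "((\<lambda>x. inverse (f x)) \<longlongrightarrow> inverse a) F"
  unfolding tendsto_absv
proof (intro allI impI)
  fix e :: real assume e: "e > 0"
  define d where "d = min (absv a) (e * absv a * absv a)"
  have d: "d > 0" "d \<le> absv a" "d \<le> e * absv a * absv a" unfolding d_def using e a by auto
  then have "eventually (\<lambda>x. absv (f x - a) < d) F" using f by (auto simp: tendsto_absv)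
  then show "eventually (\<lambda>x. absv (inverse (f x) - inverse a) < e) F"
  proof eventually_elim
    case (elim x)
    have fa: "absv (f x) \<ge> absv a"
    proof (rule ccontr)
      assume "\<not> ?thesis"
      then have "absv (f x) < absv a" by simp
      moreover have "absv (- (f x - a)) < absv a" using elim d unfolding absv_minus by linarith
      ultimately have "absv (f x + - (f x - a)) < absv a" by (rule absv_add_less)
      then show False by simp
    qed
    have ap: "absv a > 0" using a by simp
    then have "absv (f x) > 0" using fa by linarith
    then have f0: "f x \<noteq> 0" by simp
    have "inverse (f x) - inverse a = - ((f x - a) / (f x * a))"
      using f0 a by (simp add: divide_simps)
    then have "absv (inverse (f x) - inverse a) = absv (f x - a) / (absv (f x) * absv a)"
      by (simp add: absv_divide absv_mult)
    also have "\<dots> \<le> absv (f x - a) / (absv a * absv a)"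
      using fa ap f0 by (intro divide_left_mono mult_right_mono mult_pos_pos) auto
    also have "\<dots> < e" using elim d ap by (simp add: pos_divide_less_eq mult.assoc)
    finally show ?case .
  qed
qed

lemma tendsto_k_divide:
  "((f :: 'b \<Rightarrow> 'k) \<longlongrightarrow> a) F \<Longrightarrow> (g \<longlongrightarrow> b) F \<Longrightarrow> b \<noteq> 0 \<Longrightarrow> ((\<lambda>x. f x / g x) \<longlongrightarrow> a / b) F"
  unfolding divide_inverse by (intro tendsto_k_mult tendsto_k_inverse)

abbreviation Qp :: "'k set" where
  "Qp \<equiv> closure \<rat>"

lemma Qp_ops:
  assumes "x \<in> Qp" "y \<in> Qp"
  shows "x + y \<in> Qp" "x * y \<in> Qp" "- x \<in> Qp" "inverse x \<in> Qp"
proof -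
  obtain f g where fg: "\<And>n. f n \<in> \<rat>" "f \<longlonglongrightarrow> x" "\<And>n. g n \<in> \<rat>" "g \<longlonglongrightarrow> y"
    using assms unfolding closure_sequential by blast
  show "x + y \<in> Qp" "x * y \<in> Qp" "- x \<in> Qp"
    unfolding closure_sequential
    using tendsto_k_add[OF fg(2,4)] tendsto_k_mult[OF fg(2,4)] tendsto_k_minus[OF fg(2)] fg(1,3)
    by (meson Rats_add Rats_mult Rats_minus_iff)+
  show "inverse x \<in> Qp"
  proof (cases "x = 0")
    case True
    then show ?thesis using assms(1) by simp
  next
    case False
    then show ?thesis unfolding closure_sequential
      using tendsto_k_inverse[OF fg(2)] fg(1) by (meson Rats_inverse)
  qed
qed

lemma Rats_sub_Qp: "q \<in> \<rat> \<Longrightarrow> q \<in> Qp"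
  using closure_subset by blast

lemma Qp_zero: "0 \<in> Qp"
  by (intro Rats_sub_Qp) simp

text \<open>Approximate \<open>x\<close> by a rational \<open>a / b\<close> in lowest terms. Its
  absolute value is at most one, which keeps \<open>p\<close> out of \<open>b\<close>; so
  \<open>b\<close> is invertible modulo \<open>p ^ n\<close>, and the residue of \<open>a\<close>
  times that inverse is the required number.\<close>

lemma approx_integer:
  assumes x: "x \<in> Qp" "absv x \<le> 1"
  shows "\<exists>m<p ^ n. absv (x - of_nat m) \<le> (1 / real p) ^ n"
proof -
  have e: "(1 / real p) ^ n > 0" using p_gt_1 by simp
  obtain q where q: "q \<in> \<rat>" "absv (q - x) < (1 / real p) ^ n"
    using x(1) e unfolding closure_approachable by (metis dist_absv)
  have le1: "(1 / real p) ^ n \<le> 1" using p_gt_1 by (simp add: power_le_one)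
  have q1: "absv q \<le> 1" using absv_add_le[of "q - x" 1 x] q le1 x by simp
  obtain r where r: "q = of_rat r" using q(1) by (auto elim: Rats_cases)
  obtain a b where ab: "quotient_of r = (a, b)" by force
  have b0: "b > 0" and cop: "coprime a b" using ab quotient_of_denom_pos quotient_of_coprime by auto
  have rq: "r = of_int a / of_int b" using quotient_of_div[OF ab] .
  have qab: "q = of_int a / of_int b" unfolding r rq by (simp add: of_rat_divide)
  have pb: "\<not> int p dvd b"
  proof
    assume "int p dvd b"
    then obtain c where c: "b = int p * c" by auto
    have "\<not> int p dvd a"
      using coprime_common_divisor[OF cop _ \<open>int p dvd b\<close>] prime_gt_1_nat[OF prime_p] by auto
    then have "absv q = 1 / absv (of_int b)" unfolding qab by (simp add: absv_divide absv_of_int_unit)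
    moreover have "absv (of_int b) \<le> 1 / real p"
      unfolding c using absv_of_int_le[of c] by (simp add: absv_mult absv_p) (simp add: divide_right_mono)
    moreover have "absv (of_int b) > 0" using b0 by simp
    ultimately have "absv q \<ge> real p"
      using p_gt_1 by (simp add: le_divide_eq mult.commute)
    then show False using q1 p_gt_1 by simp
  qed
  then have "coprime b (int p)" using prime_p prime_imp_coprime[of "int p" b] by (simp add: coprime_commute)
  then have "coprime b (int p ^ n)" by simp
  then obtain u v where uv: "u * b + v * int p ^ n = 1" using bezout_int[of b "int p ^ n"] by auto
  define m where "m = nat ((a * u) mod (int p ^ n))"
  have pn: "int p ^ n > 0" using prime_gt_0_nat[OF prime_p] by simp
  have m: "int m = (a * u) mod (int p ^ n)" unfolding m_def using pn by simp
  have "int p ^ n dvd a - b * int m"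
  proof -
    have "int p ^ n dvd a * u - int m" unfolding m by (simp add: mod_eq_dvd_iff[symmetric])
    then have "int p ^ n dvd b * (a * u - int m) + a * v * int p ^ n" by simp
    also have "b * (a * u - int m) + a * v * int p ^ n = a * (u * b + v * int p ^ n) - b * int m"
      by (simp add: algebra_simps)
    finally show ?thesis by (simp add: uv)
  qed
  then obtain w where w: "a - b * int m = int p ^ n * w" by auto
  have bb: "(of_int b :: 'k) \<noteq> 0" using b0 by simp
  have "q - of_nat m = of_int (a - b * int m) / of_int b" unfolding qab using bb by (simp add: field_simps)
  then have "absv (q - of_nat m) = absv (of_int (int p ^ n * w))"
    unfolding w using absv_of_int_unit[OF pb] by (simp add: absv_divide)
  also have "\<dots> \<le> (1 / real p) ^ n * 1"
    using absv_of_int_le[of w] by (simp add: absv_mult absv_power absv_p mult_left_le)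
  finally have "absv (q - of_nat m) \<le> (1 / real p) ^ n" by simp
  moreover have "absv (- (q - x)) \<le> (1 / real p) ^ n" using q(2) by (simp only: absv_minus less_imp_le)
  ultimately have "absv (- (q - x) + (q - of_nat m)) \<le> (1 / real p) ^ n" by (intro absv_add_le)
  then have "absv (x - of_nat m) \<le> (1 / real p) ^ n" by (simp add: algebra_simps)
  moreover have "m < p ^ n"
  proof -
    have "int m < int p ^ n" unfolding m using pn by simp
    then show ?thesis by (metis of_nat_less_iff of_nat_power)
  qed
  ultimately show ?thesis by blast
qed

lemma p_power_bound:
  obtains j where "(r::real) \<le> real p ^ j"
  using real_arch_pow[OF p_gt_1, of r] by (meson less_imp_le)

text \<open>Multiplication by a power of \<open>p\<close> moves the ball into the integers, where
  the residues modulo a higher power form a finite net. Completeness comes from the closure of the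
  rationals.\<close>

lemma compact_Qp_ball: "compact {x \<in> Qp. absv x \<le> r}"
  unfolding compact_eq_totally_bounded
proof (intro conjI allI impI)
  have "closed {x. absv x \<le> r}"
  proof -
    have "{x. absv x \<le> r} = cball 0 r" by (auto simp: absv_dist dist_commute)
    then show ?thesis by simp
  qed
  then have "complete (Qp \<inter> {x. absv x \<le> r})"
    by (intro complete_Int_closed complete_Qp)
  then show "complete {x \<in> Qp. absv x \<le> r}" by (simp add: Int_def)
  fix e :: real assume e: "e > 0"
  obtain j where j: "r \<le> real p ^ j" by (rule p_power_bound)
  obtain n where n: "(1 / real p) ^ n < e" using real_arch_pow_inv[OF e, of "1 / real p"] p_gt_1 by auto
  let ?c = "of_nat p ^ j :: 'k"
  have c: "absv ?c = 1 / real p ^ j" "?c \<noteq> 0"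
    using prime_gt_0_nat[OF prime_p] by (simp_all add: absv_power absv_p power_divide)
  have "{x \<in> Qp. absv x \<le> r} \<subseteq> (\<Union>y\<in>(\<lambda>m. of_nat m / ?c) ` {..<p ^ (n + j)}. ball y e)"
  proof clarify
    fix x assume x: "x \<in> Qp" "absv x \<le> r"
    have "?c \<in> Qp" by (intro Rats_sub_Qp) simp
    then have 1: "?c * x \<in> Qp" using x Qp_ops(2) by blast
    have 2: "absv (?c * x) \<le> 1" using c x j p_gt_1 by (simp add: absv_mult divide_le_eq)
    obtain m where m: "m < p ^ (n + j)" "absv (?c * x - of_nat m) \<le> (1 / real p) ^ (n + j)"
      using approx_integer[OF 1 2] by blast
    have "x - of_nat m / ?c = (?c * x - of_nat m) / ?c" using c(2) by (simp add: field_simps)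
    then have "absv (x - of_nat m / ?c) = absv (?c * x - of_nat m) * real p ^ j"
      using c by (simp add: absv_divide)
    also have "\<dots> \<le> (1 / real p) ^ (n + j) * real p ^ j" using m(2) by (intro mult_right_mono) auto
    also have "\<dots> = (1 / real p) ^ n" using p_gt_1 by (simp add: power_add power_divide)
    finally have "dist x (of_nat m / ?c) < e" using n by (simp add: dist_absv)
    then show "x \<in> (\<Union>y\<in>(\<lambda>m. of_nat m / ?c) ` {..<p ^ (n + j)}. ball y e)"
      using m(1) by (auto simp: dist_commute intro!: bexI[of _ m])
  qed
  then show "\<exists>k. finite k \<and> {x \<in> Qp. absv x \<le> r} \<subseteq> (\<Union>x\<in>k. ball x e)"
    by (intro exI[of _ "(\<lambda>m. of_nat m / ?c) ` {..<p ^ (n + j)}"]) simp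
qed

definition Qspan :: "'k set \<Rightarrow> 'k set" where
  "Qspan B = {x. \<exists>c. (\<forall>b\<in>B. c b \<in> Qp) \<and> x = (\<Sum>b\<in>B. c b * b)}"

lemma Qspan_ops:
  assumes "x \<in> Qspan B" "y \<in> Qspan B" "a \<in> Qp"
  shows "x + y \<in> Qspan B" "a * x \<in> Qspan B"
proof -
  obtain c d where cd: "\<forall>b\<in>B. c b \<in> Qp" "x = (\<Sum>b\<in>B. c b * b)" "\<forall>b\<in>B. d b \<in> Qp" "y = (\<Sum>b\<in>B. d b * b)"
    using assms unfolding Qspan_def by blast
  have "x + y = (\<Sum>b\<in>B. (c b + d b) * b)" "a * x = (\<Sum>b\<in>B. (a * c b) * b)"
    by (simp_all add: cd sum.distrib distrib_right sum_distrib_left mult.assoc)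
  moreover have "\<forall>b\<in>B. c b + d b \<in> Qp" "\<forall>b\<in>B. a * c b \<in> Qp" using cd assms(3) Qp_ops by blast+
  ultimately show "x + y \<in> Qspan B" "a * x \<in> Qspan B"
    unfolding Qspan_def mem_Collect_eq by meson+
qed

lemma Qspan_insert:
  assumes "finite B" "b \<notin> B"
  shows "Qspan (insert b B) = {w + l * b | w l. w \<in> Qspan B \<and> l \<in> Qp}"
proof (intro set_eqI iffI)
  fix x assume "x \<in> Qspan (insert b B)"
  then obtain c where c: "\<forall>b\<in>insert b B. c b \<in> Qp" "x = (\<Sum>b\<in>insert b B. c b * b)" unfolding Qspan_def by blast
  have "x = (\<Sum>b\<in>B. c b * b) + c b * b" using assms c(2) by simp
  moreover have "(\<Sum>b\<in>B. c b * b) \<in> Qspan B" using c(1) unfolding Qspan_def by blast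
  ultimately show "x \<in> {w + l * b | w l. w \<in> Qspan B \<and> l \<in> Qp}" using c(1) by blast
next
  fix x assume "x \<in> {w + l * b | w l. w \<in> Qspan B \<and> l \<in> Qp}"
  then obtain c l where c: "\<forall>b\<in>B. c b \<in> Qp" "l \<in> Qp" "x = (\<Sum>b\<in>B. c b * b) + l * b" unfolding Qspan_def by blast
  have "(\<Sum>a\<in>B. (c(b := l)) a * a) = (\<Sum>a\<in>B. c a * a)" using assms(2) by (intro sum.cong) auto
  then have "x = (\<Sum>a\<in>insert b B. (c(b := l)) a * a)" using assms c(3) by simp
  then show "x \<in> Qspan (insert b B)" unfolding Qspan_def using c by (intro CollectI exI[of _ "c(b := l)"]) auto
qed

lemma Qspan_ball_closed:
  assumes "\<And>r. compact {x \<in> W. absv x \<le> r}"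
  shows "closed W"
  unfolding closed_sequential_limits
proof (intro allI impI)
  fix f l assume f: "(\<forall>n. f n \<in> W) \<and> f \<longlonglongrightarrow> l"
  then have "eventually (\<lambda>n. absv (f n - l) < 1) sequentially" unfolding tendsto_absv by auto
  moreover have "absv (f n) \<le> max 1 (absv l)" if "absv (f n - l) < 1" for n
    using absv_add_le[of "f n - l" "max 1 (absv l)" l] that by simp
  ultimately have "eventually (\<lambda>n. f n \<in> {x \<in> W. absv x \<le> max 1 (absv l)}) sequentially"
    using f by (auto elim: eventually_mono)
  then have "l \<in> {x \<in> W. absv x \<le> max 1 (absv l)}"
    using f by (intro Lim_in_closed_set[OF compact_imp_closed[OF assms] _ trivial_limit_sequentially, of f]) auto
  then show "l \<in> W" by simp
qed

text \<open>A new generator \<open>b\<close> outside the span \<open>W\<close> of the old ones has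
  positive distance \<open>d\<close> from \<open>W\<close>, as \<open>W\<close> is closed by
  induction. This bounds the coefficient of \<open>b\<close> by \<open>r / d\<close>, so the ball is
  a closed part of the image of a product of compact sets.\<close>

lemma compact_Qspan_ball: "finite B \<Longrightarrow> compact {x \<in> Qspan B. absv x \<le> r}"
proof (induction B arbitrary: r rule: finite_induct)
  case empty
  have "{x \<in> Qspan {}. absv x \<le> r} \<subseteq> {0}" by (auto simp: Qspan_def)
  then show ?case by (meson finite.emptyI finite_imp_compact finite_insert finite_subset)
next
  case (insert b B)
  let ?W = "Qspan B"
  have W0: "0 \<in> ?W" unfolding Qspan_def using Qp_zero by (intro CollectI exI[of _ "\<lambda>_. 0"]) simp
  show ?case
  proof (cases "b \<in> ?W")
    case True
    have "Qspan (insert b B) = ?W"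
    proof (intro set_eqI iffI)
      fix x assume "x \<in> Qspan (insert b B)"
      then show "x \<in> ?W" unfolding Qspan_insert[OF insert(1,2)] using True Qspan_ops by blast
    next
      fix x assume "x \<in> ?W"
      then have "x = x + 0 * b \<and> x \<in> ?W \<and> 0 \<in> Qp" using Qp_zero by simp
      then show "x \<in> Qspan (insert b B)" unfolding Qspan_insert[OF insert(1,2)] by blast
    qed
    then show ?thesis using insert.IH by simp
  next
    case False
    have cl: "closed ?W" using insert.IH by (rule Qspan_ball_closed)
    obtain d where d: "d > 0" "\<And>w. w \<in> ?W \<Longrightarrow> absv (b - w) \<ge> d"
    proof -
      have "open (- ?W)" using cl by (simp add: open_Compl)
      then obtain d where "d > 0" "ball b d \<subseteq> - ?W" using False openE by blast
      then show ?thesis using that[of d] by (auto simp: dist_absv subset_iff not_le dest: leI)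
    qed
    let ?R = "max r (r / d * absv b)"
    let ?K = "(\<lambda>q. fst q + snd q * b) ` ({x \<in> ?W. absv x \<le> ?R} \<times> {l \<in> Qp. absv l \<le> r / d})"
    have "continuous_on UNIV (\<lambda>q. fst q + snd q * b)"
      unfolding continuous_on_def
      by (intro ballI tendsto_k_add tendsto_k_mult tendsto_fst tendsto_snd tendsto_const tendsto_ident_at)
    then have "compact ?K"
      by (rule compact_continuous_image[OF continuous_on_subset compact_Times[OF insert.IH compact_Qp_ball]]) simp
    moreover have "{x \<in> Qspan (insert b B). absv x \<le> r} = ?K \<inter> {x. absv x \<le> r}"
    proof (intro set_eqI iffI)
      fix x assume x: "x \<in> {x \<in> Qspan (insert b B). absv x \<le> r}"
      then obtain w l where wl: "x = w + l * b" "w \<in> ?W" "l \<in> Qp" unfolding Qspan_insert[OF insert(1,2)] by blast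
      have l: "absv l \<le> r / d"
      proof (cases "l = 0")
        case True
        then show ?thesis using x d order_trans[OF absv_nonneg, of x r] by simp
      next
        case False
        have "- (inverse l) * w \<in> ?W" by (rule Qspan_ops(2)[OF wl(2) wl(2)], rule Qp_ops(3)[OF Qp_ops(4)[OF wl(3) wl(3)] wl(3)])
        then have "d \<le> absv (b - (- (inverse l) * w))" by (rule d(2))
        moreover have "x = l * (b - (- (inverse l) * w))" using False by (simp add: wl(1) distrib_left)
        ultimately have "absv l * d \<le> absv x" using mult_left_mono[of d _ "absv l"] by (simp add: absv_mult)
        then show ?thesis using x d(1) by (simp add: pos_le_divide_eq)
      qed
      have "absv (l * b) \<le> ?R" using mult_right_mono[OF l, of "absv b"] unfolding absv_mult by simp
      then have "absv (x - l * b) \<le> ?R" using x by (intro absv_diff_le) auto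
      then have "absv w \<le> ?R" by (simp add: wl(1))
      then have "(w, l) \<in> {x \<in> ?W. absv x \<le> ?R} \<times> {l \<in> Qp. absv l \<le> r / d}" using wl l by simp
      then have "fst (w, l) + snd (w, l) * b \<in> ?K" by (rule imageI)
      then show "x \<in> ?K \<inter> {x. absv x \<le> r}" using wl(1) x by simp
    next
      fix x assume x: "x \<in> ?K \<inter> {x. absv x \<le> r}"
      then obtain q where q: "x = fst q + snd q * b" "q \<in> {x \<in> ?W. absv x \<le> ?R} \<times> {l \<in> Qp. absv l \<le> r / d}"
        by (elim IntE imageE)
      have "x = fst q + snd q * b \<and> fst q \<in> ?W \<and> snd q \<in> Qp" using q unfolding mem_Times_iff mem_Collect_eq by simp
      moreover have "absv x \<le> r" using x by simp
      ultimately show "x \<in> {x \<in> Qspan (insert b B). absv x \<le> r}" unfolding Qspan_insert[OF insert(1,2)] mem_Collect_eq by blast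
    qed
    moreover have "closed {x. absv x \<le> r}"
    proof -
      have "{x. absv x \<le> r} = cball 0 r" by (auto simp: absv_dist dist_commute)
      then show ?thesis by simp
    qed
    ultimately show ?thesis by (simp only: compact_Int_closed)
  qed
qed

lemma compact_ball: "compact {x. absv x \<le> r}"
proof -
  obtain B :: "'k set" where B: "finite B" "\<forall>x. x \<in> Qspan B" using finite_over_Qp unfolding Qspan_def by blast
  then show ?thesis using compact_Qspan_ball[OF B(1), of r] by simp
qed

end

section \<open>The topological group\<close>

instantiation gsp6 :: ("{field,topological_space}") topological_space
begin
definition open_gsp6 :: "'a gsp6 set \<Rightarrow> bool" where
  "open_gsp6 U \<longleftrightarrow> (\<exists>V. open V \<and> U = mat_of -` V)"
instance
proof
  show "open (UNIV :: 'a gsp6 set)" unfolding open_gsp6_def by (intro exI[of _ UNIV]) simp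
  show "open (S \<inter> T)" if "open S" "open T" for S T :: "'a gsp6 set"
  proof -
    obtain V W where "open V" "S = mat_of -` V" "open W" "T = mat_of -` W" using \<open>open S\<close> \<open>open T\<close> unfolding open_gsp6_def by blast
    then show ?thesis unfolding open_gsp6_def by (intro exI[of _ "V \<inter> W"]) auto
  qed
  show "open (\<Union>K)" if "\<forall>S\<in>K. open S" for K :: "'a gsp6 set set"
  proof -
    have "\<forall>S\<in>K. \<exists>V. open V \<and> S = mat_of -` V" using that unfolding open_gsp6_def .
    from bchoice[OF this] obtain V where "\<forall>S\<in>K. open (V S) \<and> S = mat_of -` V S" by blast
    then show ?thesis unfolding open_gsp6_def by (intro exI[of _ "\<Union>S\<in>K. V S"]) auto
  qed
qed
end

lemma continuous_on_mat_of:
  fixes A :: "'k::{field,topological_space} gsp6 set"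
  shows "continuous_on A mat_of"
proof -
  have "open (mat_of -` V :: 'k gsp6 set)" if "open V" for V using that unfolding open_gsp6_def by blast
  then have "continuous_on (UNIV :: 'k gsp6 set) mat_of" by (simp add: continuous_on_open_vimage[OF open_UNIV])
  then show ?thesis by (rule continuous_on_subset) simp
qed

lemma continuous_on_gsp6: "continuous_on A f \<longleftrightarrow> continuous_on A (\<lambda>x. mat_of (f x))"
proof
  assume "continuous_on A f"
  then show "continuous_on A (\<lambda>x. mat_of (f x))" using continuous_on_compose2[OF continuous_on_mat_of] by blast
next
  assume *: "continuous_on A (\<lambda>x. mat_of (f x))"
  show "continuous_on A f"
    unfolding continuous_on_open_invariant
  proof (intro allI impI)
    fix B :: "'b gsp6 set" assume "open B"
    then obtain V where V: "open V" "B = mat_of -` V" unfolding open_gsp6_def by blast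
    then have "(\<lambda>x. mat_of (f x)) -` V \<inter> A = f -` B \<inter> A" by auto
    then show "\<exists>T. open T \<and> T \<inter> A = f -` B \<inter> A" using * V(1) unfolding continuous_on_open_invariant by metis
  qed
qed

lemma compact_vec:
  fixes S :: "'i::finite \<Rightarrow> 'a::topological_space set"
  assumes "\<And>i. compact (S i)"
  shows "compact {v :: 'a^'i. \<forall>i. v $ i \<in> S i}"
proof -
  have "compactin (product_topology (\<lambda>i. euclidean) UNIV) (Pi\<^sub>E UNIV S)"
    unfolding compactin_PiE using assms by simp
  then have c: "compact (Pi\<^sub>E UNIV S)" unfolding euclidean_product_topology compactin_euclidean_iff .
  then have "continuous_on (Pi\<^sub>E UNIV S) (\<lambda>f. vec_lambda f :: 'a^'i)"
    by (intro continuous_on_vec_lambda[of _ "\<lambda>i f. f i", simplified]) (rule continuous_on_product_coordinates[THEN continuous_on_subset], simp)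
  then have "compact (vec_lambda ` Pi\<^sub>E UNIV S :: ('a^'i) set)" using c by (rule compact_continuous_image)
  moreover have "(vec_lambda ` Pi\<^sub>E UNIV S) = {v :: 'a^'i. \<forall>i. v $ i \<in> S i}"
  proof (intro set_eqI iffI)
    fix v assume "v \<in> {v :: 'a^'i. \<forall>i. v $ i \<in> S i}"
    then have "v = vec_lambda (\<lambda>i. v $ i)" "(\<lambda>i. v $ i) \<in> Pi\<^sub>E UNIV S" by auto
    then show "v \<in> vec_lambda ` Pi\<^sub>E UNIV S" by blast
  qed auto
  ultimately show ?thesis by simp
qed

named_theorems kcont

definition scalars :: "'k::field gsp6 set" where
  "scalars = {del (sc c) | c. c \<noteq> 0}"

lemma scalars_bl: "x \<in> scalars \<longleftrightarrow> (\<exists>c. c \<noteq> 0 \<and> (\<forall>i j. bl x i j = (if i = j then sc c else 0)))"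
proof
  assume "x \<in> scalars"
  then obtain c where c: "x = del (sc c)" "c \<noteq> 0" unfolding scalars_def by blast
  show "\<exists>c. c \<noteq> 0 \<and> (\<forall>i j. bl x i j = (if i = j then sc c else 0))"
    using c bl_del(1)[of "sc c"] by (intro exI[of _ c]) simp
next
  assume "\<exists>c. c \<noteq> 0 \<and> (\<forall>i j. bl x i j = (if i = j then sc c else 0))"
  then obtain c where c: "c \<noteq> 0" "\<forall>i j. bl x i j = (if i = j then sc c else 0)" by blast
  then have "x = del (sc c)" using bl_del(1)[of "sc c"] by (intro bl_eqI) simp
  then show "x \<in> scalars" unfolding scalars_def using c by blast
qed

lemma scalars_central: "z \<in> scalars \<Longrightarrow> z * x = x * z"
proof -
  assume "z \<in> scalars"
  then obtain c where c: "\<forall>i j. bl z i j = (if i = j then sc c else 0)" unfolding scalars_bl by blast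
  show ?thesis
  proof (rule bl_eqI)
    fix i j show "bl (z * x) i j = bl (x * z) i j"
      by (induct i rule: index3; induct j rule: index3) (simp_all add: bl_mult c sc_comm)
  qed
qed

lemma scalars_subgp: "subgp scalars"
  unfolding subgp_def
proof (intro conjI ballI)
  show "1 \<in> scalars" unfolding scalars_bl by (intro exI[of _ 1]) (simp add: bl_one)
  fix x y :: "'a gsp6" assume "x \<in> scalars" "y \<in> scalars"
  then obtain c d where c: "c \<noteq> 0" "\<forall>i j. bl x i j = (if i = j then sc c else 0)"
     and d: "d \<noteq> 0" "\<forall>i j. bl y i j = (if i = j then sc d else 0)" unfolding scalars_bl by blast
  have "\<forall>i j. bl (x * y) i j = (if i = j then sc (c * d) else 0)"
    unfolding forall_3 by (simp add: bl_mult c d)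
  then show "x * y \<in> scalars" unfolding scalars_bl using c d by (intro exI[of _ "c * d"]) simp
next
  fix x :: "'a gsp6" assume "x \<in> scalars"
  then obtain c where c: "c \<noteq> 0" "x = del (sc c)" unfolding scalars_def by blast
  have n: "nrm (sc c) \<noteq> 0" "nrm (sc (1 / c)) \<noteq> 0" using c by auto
  have "x * del (sc (1 / c)) = 1"
  proof (rule bl_eqI)
    fix i j show "bl (x * del (sc (1 / c))) i j = bl 1 i j"
      using c(1) by (induct i rule: index3; induct j rule: index3) (simp_all add: bl_mult c(2) bl_del[OF n(1)] bl_del[OF n(2)] bl_one sc_inverse)
  qed
  then have "inverse x = del (sc (1 / c))" by (rule inv_unique)
  then show "inverse x \<in> scalars" unfolding scalars_def using c(1) by (intro CollectI exI[of _ "1 / c"]) simp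
qed

context finite_extension_Qp
begin

lemma cont_k [kcont]:
  fixes f g :: "'x::topological_space \<Rightarrow> 'k"
  shows "continuous_on A f \<Longrightarrow> continuous_on A g \<Longrightarrow> continuous_on A (\<lambda>x. f x + g x)"
    "continuous_on A f \<Longrightarrow> continuous_on A g \<Longrightarrow> continuous_on A (\<lambda>x. f x - g x)"
    "continuous_on A f \<Longrightarrow> continuous_on A g \<Longrightarrow> continuous_on A (\<lambda>x. f x * g x)"
    "continuous_on A f \<Longrightarrow> continuous_on A (\<lambda>x. - f x)"
    "continuous_on A f \<Longrightarrow> continuous_on A g \<Longrightarrow> (\<And>x. x \<in> A \<Longrightarrow> g x \<noteq> 0) \<Longrightarrow> continuous_on A (\<lambda>x. f x / g x)"
    "continuous_on A (\<lambda>x. c :: 'k)"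
  unfolding continuous_on_def
  by (blast intro: tendsto_k_add tendsto_k_diff tendsto_k_mult tendsto_k_minus tendsto_k_divide tendsto_const)+

text \<open>Continuity entry by entry, as the type \<open>m2\<close> carries no topology.\<close>

definition mcont :: "'x::topological_space set \<Rightarrow> ('x \<Rightarrow> 'k m2) \<Rightarrow> bool" where
  "mcont A g \<longleftrightarrow> continuous_on A (\<lambda>x. e11 (g x)) \<and> continuous_on A (\<lambda>x. e12 (g x)) \<and>
     continuous_on A (\<lambda>x. e21 (g x)) \<and> continuous_on A (\<lambda>x. e22 (g x))"

lemma mcontD [kcont]:
  assumes "mcont A g"
  shows "continuous_on A (\<lambda>x. e11 (g x))" "continuous_on A (\<lambda>x. e12 (g x))"
    "continuous_on A (\<lambda>x. e21 (g x))" "continuous_on A (\<lambda>x. e22 (g x))"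
    "continuous_on A (\<lambda>x. nrm (g x))" "continuous_on A (\<lambda>x. tr (g x))"
  using assms unfolding mcont_def nrm_def tr_def by (auto intro: kcont)

lemma mcont_intros [kcont]:
  "mcont A f \<Longrightarrow> mcont A g \<Longrightarrow> mcont A (\<lambda>x. f x + g x)"
  "mcont A f \<Longrightarrow> mcont A g \<Longrightarrow> mcont A (\<lambda>x. f x - g x)"
  "mcont A f \<Longrightarrow> mcont A g \<Longrightarrow> mcont A (\<lambda>x. f x * g x)"
  "mcont A f \<Longrightarrow> mcont A (\<lambda>x. - f x)"
  "mcont A f \<Longrightarrow> mcont A (\<lambda>x. star (f x))"
  "continuous_on A h \<Longrightarrow> mcont A (\<lambda>x. sc (h x))"
  "mcont A (\<lambda>x. c)"
  "continuous_on A h1 \<Longrightarrow> continuous_on A h2 \<Longrightarrow> continuous_on A h3 \<Longrightarrow> continuous_on A h4 \<Longrightarrow>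
     mcont A (\<lambda>x. M2 (h1 x) (h2 x) (h3 x) (h4 x))"
  unfolding mcont_def by (auto intro: cont_k)

lemma mcont_subset: "mcont A g \<Longrightarrow> B \<subseteq> A \<Longrightarrow> mcont B g"
  unfolding mcont_def by (auto intro: continuous_on_subset)

lemma continuous_on_vec_iff: "continuous_on A (f :: 'x::topological_space \<Rightarrow> 'a::topological_space^'i) \<longleftrightarrow> (\<forall>i. continuous_on A (\<lambda>x. f x $ i))"
  using continuous_on_vec_lambda[of A "\<lambda>i x. f x $ i"] continuous_on_component[of A f] by auto

lemma continuous_on_mat_iff:
  fixes f :: "'x::topological_space \<Rightarrow> 'k mat6"
  shows "continuous_on A f \<longleftrightarrow> (\<forall>i j. mcont A (\<lambda>x. blk (f x) i j))"
proof -
  have "continuous_on A f \<longleftrightarrow> (\<forall>i a j b. continuous_on A (\<lambda>x. f x $ (i, a) $ (j, b)))"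
    unfolding continuous_on_vec_iff split_paired_All ..
  also have "\<dots> \<longleftrightarrow> (\<forall>i j. mcont A (\<lambda>x. blk (f x) i j))"
    unfolding mcont_def blk_def forall_2 by auto
  finally show ?thesis .
qed

lemma cont_gsp6_iff:
  "continuous_on A (f :: 'x::topological_space \<Rightarrow> 'k gsp6) \<longleftrightarrow> (\<forall>i j. mcont A (\<lambda>x. bl (f x) i j))"
  unfolding continuous_on_gsp6 continuous_on_mat_iff bl_def ..

lemma mcont_bl [kcont]: "continuous_on A (f :: 'x::topological_space \<Rightarrow> 'k gsp6) \<Longrightarrow> mcont A (\<lambda>x. bl (f x) i j)"
  unfolding cont_gsp6_iff by blast

lemma sim_eq: "sim x = e11 (bl x 2 1 * star (bl x 2 3) + bl x 2 2 * star (bl x 2 2) + bl x 2 3 * star (bl x 2 1))"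
  unfolding row_rel by simp

lemma cont_sim [kcont]: "continuous_on A (f :: 'x::topological_space \<Rightarrow> 'k gsp6) \<Longrightarrow> continuous_on A (\<lambda>x. sim (f x))"
  unfolding sim_eq by (intro kcont)

lemma cont_group [kcont]:
  fixes f g :: "'x::topological_space \<Rightarrow> 'k gsp6"
  assumes f: "continuous_on A f"
  shows "continuous_on A g \<Longrightarrow> continuous_on A (\<lambda>x. f x * g x)" "continuous_on A (\<lambda>x. inverse (f x))"
proof -
  assume "continuous_on A g"
  then show "continuous_on A (\<lambda>x. f x * g x)" unfolding cont_gsp6_iff[of A "\<lambda>x. f x * g x"] bl_mult using f by (intro allI kcont)
next
  show "continuous_on A (\<lambda>x. inverse (f x))" unfolding cont_gsp6_iff[of A "\<lambda>x. inverse (f x)"] bl_inverse using f sim(1) by (intro allI kcont)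
qed

lemma cont_del [kcont]:
  "mcont A g \<Longrightarrow> (\<And>x. x \<in> A \<Longrightarrow> nrm (g x) \<noteq> 0) \<Longrightarrow> continuous_on A (\<lambda>x. del (g x))"
  unfolding cont_gsp6_iff
proof (intro allI)
  fix i j :: 3 assume g: "mcont A g" "\<And>x. x \<in> A \<Longrightarrow> nrm (g x) \<noteq> 0"
  have "mcont A (\<lambda>x. if i = j then g x else 0)" using g(1) by (cases "i = j") (simp_all add: kcont)
  moreover have "mcont A (\<lambda>x. bl (del (g x)) i j) = mcont A (\<lambda>x. if i = j then g x else 0)"
    unfolding mcont_def using g(2) by (intro conj_cong continuous_on_cong refl) (simp_all add: bl_del)
  ultimately show "mcont A (\<lambda>x. bl (del (g x)) i j)" by simp
qed

lemma mcont_cong: "(\<And>x. x \<in> A \<Longrightarrow> f x = g x) \<Longrightarrow> mcont A f = mcont A g"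
  unfolding mcont_def by (intro conj_cong continuous_on_cong refl) simp_all

lemma cont_uel [kcont]:
  assumes X: "mcont A X" and Z: "mcont A Z" and t: "\<And>x. x \<in> A \<Longrightarrow> tr (Z x) = - nrm (X x)"
  shows "continuous_on A (\<lambda>x. uel (X x) (Z x))"
  unfolding cont_gsp6_iff forall_3
proof (intro conjI)
  note b = bl_uel[OF t]
  show "mcont A (\<lambda>x. bl (uel (X x) (Z x)) 1 1)" "mcont A (\<lambda>x. bl (uel (X x) (Z x)) 1 2)" "mcont A (\<lambda>x. bl (uel (X x) (Z x)) 1 3)"
    "mcont A (\<lambda>x. bl (uel (X x) (Z x)) 2 1)" "mcont A (\<lambda>x. bl (uel (X x) (Z x)) 2 2)" "mcont A (\<lambda>x. bl (uel (X x) (Z x)) 2 3)"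
    "mcont A (\<lambda>x. bl (uel (X x) (Z x)) 3 1)" "mcont A (\<lambda>x. bl (uel (X x) (Z x)) 3 2)" "mcont A (\<lambda>x. bl (uel (X x) (Z x)) 3 3)"
    using X Z by (simp_all add: b kcont cong: mcont_cong)
qed

lemma cont_id_const [kcont]: "continuous_on A (\<lambda>x. x)" "continuous_on A (\<lambda>x. c)"
  by (simp_all)

lemma open_neq: "continuous_on UNIV (f :: 'x::topological_space \<Rightarrow> 'k) \<Longrightarrow> open {x. f x \<noteq> 0}"
proof -
  assume "continuous_on UNIV f"
  then have "open (f -` (- {0}))" by (intro open_vimage) auto
  then show ?thesis by (simp add: vimage_def)
qed

lemma closed_eq: "continuous_on UNIV (f :: 'x::topological_space \<Rightarrow> 'k) \<Longrightarrow> closed {x. f x = 0}"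
  using open_neq[of f] by (simp add: closed_def Collect_neg_eq)

lemma closed_meq: "mcont UNIV f \<Longrightarrow> closed {x. f x = 0}"
proof -
  assume "mcont UNIV f"
  then have "closed ({x. e11 (f x) = 0} \<inter> {x. e12 (f x) = 0} \<inter> {x. e21 (f x) = 0} \<inter> {x. e22 (f x) = 0})"
    unfolding mcont_def by (intro closed_Int closed_eq) simp_all
  moreover have "{x. e11 (f x) = 0} \<inter> {x. e12 (f x) = 0} \<inter> {x. e21 (f x) = 0} \<inter> {x. e22 (f x) = 0} = {x. f x = 0}"
    by (auto simp: m2_eq_iff)
  ultimately show ?thesis by simp
qed

lemma compact_gsp6: "compact (mat_of ` C) \<Longrightarrow> compact (C :: 'k gsp6 set)"
proof -
  assume c: "compact (mat_of ` C)"
  have "continuous_on (mat_of ` C) Abs_gsp6"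
    unfolding continuous_on_gsp6
    by (rule continuous_on_cong[THEN iffD2, OF refl _ continuous_on_id]) (auto simp: gsp6.mat_of_inverse)
  then have "compact (Abs_gsp6 ` mat_of ` C)" using c by (rule compact_continuous_image)
  moreover have "Abs_gsp6 ` mat_of ` C = C" by (force simp: gsp6.mat_of_inverse)
  ultimately show ?thesis by simp
qed

text \<open>Principal congruence subgroups; for \<open>r < 1\<close> they are compact open subgroups
  forming a basis at the identity.\<close>

definition Kr :: "real \<Rightarrow> 'k gsp6 set" where
  "Kr r = {x. \<forall>i j. absv ((mat_of x - mat 1) $ i $ j) \<le> r}"

lemma absv_matrix_mult_le:
  fixes A B :: "'k^'n^'n"
  assumes "\<And>i j. absv (A $ i $ j) \<le> r" "\<And>i j. absv (B $ i $ j) \<le> s" "r \<ge> 0" "s \<ge> 0"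
  shows "absv ((A ** B) $ i $ j) \<le> r * s"
  unfolding matrix_matrix_mult_def
  by (simp, intro absv_sum_le) (auto simp: absv_mult assms intro!: mult_mono)

lemma mat_diff_ring:
  fixes A B :: "'k^'n^'n"
  shows "(A - B) ** C = A ** C - B ** C" "C ** (A - B) = C ** A - C ** B"
  by (simp_all add: vec_eq_iff matrix_matrix_mult_def left_diff_distrib right_diff_distrib sum_subtractf)

lemma Kr_subgp: assumes r: "0 < r" "r < 1" shows "subgp (Kr r)"
  unfolding subgp_def
proof (intro conjI ballI)
  show "1 \<in> Kr r" unfolding Kr_def using r by simp
  fix x y assume "x \<in> Kr r" "y \<in> Kr r"
  then have a: "absv ((mat_of x - mat 1) $ i $ j) \<le> r" "absv ((mat_of y - mat 1) $ i $ j) \<le> r" for i j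
    unfolding Kr_def by blast+
  have b: "mat_of (x * y) - mat 1 = (mat_of x - mat 1) ** (mat_of y - mat 1) + (mat_of x - mat 1) + (mat_of y - mat 1)"
    by (simp add: mat_diff_ring)
  have "r * r \<le> r" using r by (simp add: mult_left_le)
  then have "absv (((mat_of x - mat 1) ** (mat_of y - mat 1)) $ i $ j) \<le> r" for i j
    using absv_matrix_mult_le[OF a, of i j] r by linarith
  then show "x * y \<in> Kr r" unfolding Kr_def b mem_Collect_eq vector_add_component using a by (intro allI absv_add_le) blast+
next
  fix x assume "x \<in> Kr r"
  then have a: "absv ((mat_of x - mat 1) $ i $ j) \<le> r" for i j unfolding Kr_def by blast
  let ?Y = "mat_of (inverse x)"
  define M where "M = Max (range (\<lambda>(i, j). absv (?Y $ i $ j)))"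
  have M: "absv (?Y $ i $ j) \<le> M" for i j unfolding M_def by (intro Max_ge) auto
  have M0: "M \<ge> 0" using order_trans[OF absv_nonneg M] .
  have "mat_of x ** ?Y = mat 1" by (simp flip: mat_of_mult)
  then have eq: "?Y - mat 1 = - ((mat_of x - mat 1) ** ?Y)" by (simp add: mat_diff_ring)
  have c: "absv ((?Y - mat 1) $ i $ j) \<le> r * M" for i j
    unfolding eq using absv_matrix_mult_le[OF a M] r M0 by simp
  \<comment> \<open>The largest entry \<open>M\<close> of the inverse cannot satisfy
    \<open>M \<le> r * M\<close> unless it is zero, so the inverse has integral entries.\<close>
  have "M \<le> max 1 (r * M)"
  proof -
    have "M \<in> range (\<lambda>(i, j). absv (?Y $ i $ j))" unfolding M_def by (intro Max_in) auto
    then obtain i j where ij: "M = absv (?Y $ i $ j)" by auto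
    have "absv ((mat 1 :: 'k mat6) $ i $ j) \<le> max 1 (r * M)" by (simp add: mat_def le_max_iff_disj)
    moreover have "absv ((?Y - mat 1) $ i $ j) \<le> max 1 (r * M)" using c[of i j] by simp
    ultimately have "absv ((?Y - mat 1) $ i $ j + (mat 1 :: 'k mat6) $ i $ j) \<le> max 1 (r * M)" by (intro absv_add_le)
    then show ?thesis by (simp add: ij)
  qed
  moreover have "r * M < M" if "M > 0" using that r by simp
  ultimately have "M \<le> 1" using M0 by linarith
  then have "r * M \<le> r" using r by (simp add: mult_left_le)
  then show "inverse x \<in> Kr r" unfolding Kr_def using order_trans[OF c] by blast
qed

lemma open_k_cball: "r > 0 \<Longrightarrow> open {a. absv (a - c) \<le> r}"
  unfolding open_dist
proof (intro ballI)
  fix x assume r: "r > 0" "x \<in> {a. absv (a - c) \<le> r}"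
  have "absv (y - c) \<le> r" if "absv (y - x) < r" for y
    using absv_add_le[of "y - x" r "x - c"] that r by simp
  then show "\<exists>e>0. \<forall>y. dist y x < e \<longrightarrow> y \<in> {a. absv (a - c) \<le> r}" using r by (intro exI[of _ r]) (auto simp: dist_absv)
qed

lemma open_Kr: "r > 0 \<Longrightarrow> open (Kr r)"
proof -
  assume r: "r > 0"
  have "Kr r = (\<Inter>i. \<Inter>j. (\<lambda>x. mat_of x $ i $ j) -` {a. absv (a - (mat 1 :: 'k mat6) $ i $ j) \<le> r})"
    unfolding Kr_def by auto
  moreover have "open ((\<lambda>x. mat_of x $ i $ j) -` {a. absv (a - (mat 1 :: 'k mat6) $ i $ j) \<le> r})" for i j
    by (intro open_vimage open_k_cball r continuous_intros continuous_on_mat_of)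
  ultimately show ?thesis by (simp add: open_INT)
qed

lemma Kr_basis: assumes "open S" "1 \<in> S" shows "\<exists>r. 0 < r \<and> r < 1 \<and> Kr r \<subseteq> S"
proof -
  obtain V where V: "open V" "S = mat_of -` V" using assms(1) unfolding open_gsp6_def by blast
  then have 1: "mat 1 \<in> V" using assms(2) by simp
  obtain A where A: "\<forall>i. open (A i) \<and> (mat 1 :: 'k mat6) $ i \<in> A i" "\<forall>y. (\<forall>i. y $ i \<in> A i) \<longrightarrow> y \<in> V"
    using V(1) 1 unfolding open_vec_def by metis
  have "\<forall>i. \<exists>B. (\<forall>j. open (B j) \<and> (mat 1 :: 'k mat6) $ i $ j \<in> B j) \<and> (\<forall>y. (\<forall>j. y $ j \<in> B j) \<longrightarrow> y \<in> A i)"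
    using A(1) unfolding open_vec_def by metis
  then obtain B where B: "\<And>i j. open (B i j)" "\<And>i j. (mat 1 :: 'k mat6) $ i $ j \<in> B i j" "\<And>i y. (\<forall>j. y $ j \<in> B i j) \<Longrightarrow> y \<in> A i"
    by metis
  have "\<exists>e>0. \<forall>a. absv (a - (mat 1 :: 'k mat6) $ i $ j) < e \<longrightarrow> a \<in> B i j" for i j
    using B(1,2)[of i j] unfolding open_dist dist_absv by blast
  then obtain e where e: "\<And>i j. e i j > 0" "\<And>i j a. absv (a - (mat 1 :: 'k mat6) $ i $ j) < e i j \<Longrightarrow> a \<in> B i j" by metis
  define r where "r = Min (insert 1 (range (\<lambda>(i, j). e i j))) / 2"
  have m: "Min (insert 1 (range (\<lambda>(i, j). e i j))) > 0" using e(1) by (subst Min_gr_iff) auto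
  have re: "r < e i j" for i j
  proof -
    have "Min (insert 1 (range (\<lambda>(i, j). e i j))) \<le> e i j" by (intro Min_le) (auto intro!: image_eqI[of _ _ "(i, j)"])
    then show ?thesis unfolding r_def using m by linarith
  qed
  have r1: "0 < r" "r < 1"
  proof -
    have "Min (insert 1 (range (\<lambda>(i, j). e i j))) \<le> 1" by (intro Min_le) auto
    then show "0 < r" "r < 1" unfolding r_def using m by linarith+
  qed
  have "Kr r \<subseteq> S"
  proof
    fix x assume "x \<in> Kr r"
    then have "absv (mat_of x $ i $ j - (mat 1 :: 'k mat6) $ i $ j) \<le> r" for i j
      unfolding Kr_def vector_minus_component by blast
    then have "mat_of x $ i $ j \<in> B i j" for i j by (intro e(2) le_less_trans[OF _ re])
    then show "x \<in> S" using B(3) A(2) V(2) by blast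
  qed
  then show ?thesis using r1 by blast
qed

text \<open>The similitude equations, with the factor read off from block \<open>(2, 2)\<close>, are
  closed in a compact ball of matrices. A limit could only fail to lie in the group if the factor
  vanished, and near the identity it is congruent to one.\<close>

lemma compact_Kr: assumes r: "0 < r" "r < 1" shows "compact (Kr r)"
proof (rule compact_gsp6)
  let ?B = "{A :: 'k mat6. \<forall>i. A $ i \<in> {v. \<forall>j. v $ j \<in> {a. absv (a - (mat 1 :: 'k mat6) $ i $ j) \<le> r}}}"
  have "compact {a. absv (a - c) \<le> r}" for c
  proof -
    have "compact ((\<lambda>a. a + c) ` {a. absv a \<le> r})"
      by (intro compact_continuous_image compact_ball cont_k cont_id_const)
    also have "(\<lambda>a. a + c) ` {a. absv a \<le> r} = {a. absv (a - c) \<le> r}"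
      by (auto intro: image_eqI[of _ _ "x - c" for x])
    finally show ?thesis .
  qed
  then have B: "compact ?B" by (intro compact_vec)
  let ?c = "\<lambda>A :: 'k mat6. e11 (herm (blk A) 2 2)"
  let ?H = "{A. \<forall>i j. herm (blk A) i j - (if j = rv i then sc (?c A) else 0) = 0}"
  have "closed ?H"
  proof -
    have m: "mcont UNIV (\<lambda>A :: 'k mat6. blk A i j)" for i j using continuous_on_mat_iff[of UNIV "\<lambda>A. A"] by simp
    have mh: "mcont UNIV (\<lambda>A :: 'k mat6. herm (blk A) i j)" for i j unfolding herm_def by (intro kcont m)
    have "mcont UNIV (\<lambda>A. herm (blk A) i j - (if j = rv i then sc (?c A) else 0))" for i j
      by (cases "j = rv i") (simp_all add: mh kcont)
    then show ?thesis by (intro closed_Collect_all closed_meq)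
  qed
  then have "compact (?B \<inter> ?H)" using B by (intro compact_Int_closed)
  moreover have "mat_of ` Kr r = ?B \<inter> ?H"
  proof (intro set_eqI iffI)
    fix A assume "A \<in> mat_of ` Kr r"
    then obtain x where x: "A = mat_of x" "x \<in> Kr r" by blast
    have "hrel (blk A) (sim x)" using sim(2)[of x] by (simp add: x(1) bl_def)
    then have "\<forall>i j. herm (blk A) i j = (if j = rv i then sc (sim x) else 0)" unfolding hrel_def .
    then have "A \<in> ?H" by simp
    moreover have "A \<in> ?B" using x unfolding Kr_def by simp
    ultimately show "A \<in> ?B \<inter> ?H" by blast
  next
    fix A assume A: "A \<in> ?B \<inter> ?H"
    then have h: "hrel (blk A) (?c A)" unfolding hrel_def by (simp split: if_splits)
    have e: "absv (A $ i $ j - (mat 1 :: 'k mat6) $ i $ j) \<le> r" for i j using A unfolding Int_iff mem_Collect_eq by blast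
    have d: "absv (A $ i $ j) \<le> r" if "i \<noteq> j" for i j using e[of i j] that by (simp add: mat_def)
    have "?c A \<noteq> 0"
    proof
      assume c0: "?c A = 0"
      let ?a = "\<lambda>i a j b. A $ (i, a) $ (j, b)"
      have r1: "absv (x * y) \<le> r" if "absv x \<le> r" "absv y \<le> 1" for x y
        using mult_mono[of "absv x" r "absv y" 1] that r by (simp add: absv_mult)
      have n: "absv (?a i a j b) \<le> r" if "i \<noteq> j" for i a j b using d[of "(i, a)" "(j, b)"] that by simp
      have n': "absv (?a i a j b) \<le> 1" if "i \<noteq> j" for i a j b using n[OF that] r by (meson less_imp_le order_trans)
      have t: "absv (?a 2 1 2 1 - 1) \<le> r" "absv (?a 2 2 2 2 - 1) \<le> r" "absv (?a 2 1 2 2) \<le> r" "absv (?a 2 2 2 1) \<le> r"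
        using e[of "(2, 1)" "(2, 1)"] e[of "(2, 2)" "(2, 2)"] d[of "(2, 1)" "(2, 2)"] d[of "(2, 2)" "(2, 1)"] by (simp_all add: mat_def)
      have t1: "absv (?a 2 2 2 2) \<le> 1" using absv_add_le[of "?a 2 2 2 2 - 1" 1 1] t r by simp
      have t2: "absv (?a 2 2 2 1) \<le> 1" using t r by (meson less_imp_le order_trans)
      \<comment> \<open>The upper left entry of \<open>herm\<close> at \<open>(2, 2)\<close>, if
        zero, expresses \<open>-1\<close> by products each having a factor of absolute value at most
        \<open>r\<close>.\<close>
      have "- 1 = (?a 2 1 1 1 * ?a 2 2 3 2 - ?a 2 1 1 2 * ?a 2 2 3 1) + ((?a 2 1 3 1 * ?a 2 2 1 2 - ?a 2 1 3 2 * ?a 2 2 1 1)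
          + ((?a 2 1 2 1 - 1) * ?a 2 2 2 2 + ((?a 2 2 2 2 - 1) - ?a 2 1 2 2 * ?a 2 2 2 1)))"
        using c0 by (simp add: herm_def blk_def algebra_simps)
      also have "absv \<dots> \<le> r"
        by (intro absv_add_le absv_diff_le r1 n n' t t1 t2) simp_all
      finally show False using r by simp
    qed
    then have "A \<in> GSp6" unfolding GSp6_iff using h by blast
    then have "mat_of (Abs_gsp6 A) = A" by (rule Abs_gsp6_inverse)
    moreover have "Abs_gsp6 A \<in> Kr r" unfolding Kr_def using e by (simp add: calculation)
    ultimately show "A \<in> mat_of ` Kr r" by (metis imageI)
  qed
  ultimately show "compact (mat_of ` Kr r)" by simp
qed

end

section \<open>Open subgroups that are compact modulo the centre\<close>

text \<open>All members contain the scalars, so compactness modulo the centre turns into finiteness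
  of the index between any two of them.\<close>

definition KKs :: "'k::{field,topological_space} gsp6 set set" where
  "KKs = {K. subgp K \<and> scalars \<subseteq> K \<and> open K \<and>
     (\<exists>C. compact C \<and> K \<subseteq> {c * z | c z. c \<in> C \<and> z \<in> scalars})}"

lemma KKsI: "subgp K \<Longrightarrow> scalars \<subseteq> K \<Longrightarrow> open K \<Longrightarrow> compact C \<Longrightarrow>
    (\<And>x. x \<in> K \<Longrightarrow> \<exists>c z. x = c * z \<and> c \<in> C \<and> z \<in> scalars) \<Longrightarrow> K \<in> KKs"
  unfolding KKs_def by auto

lemma KKsD:
  assumes "K \<in> KKs"
  shows "subgp K" "scalars \<subseteq> K" "open K"
    "\<exists>C. compact C \<and> (\<forall>x\<in>K. \<exists>c z. x = c * z \<and> c \<in> C \<and> z \<in> scalars)"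
proof -
  show "subgp K" "scalars \<subseteq> K" "open K" using assms unfolding KKs_def by simp_all
  obtain C where "compact C" "K \<subseteq> {c * z | c z. c \<in> C \<and> z \<in> scalars}" using assms unfolding KKs_def by auto
  then show "\<exists>C. compact C \<and> (\<forall>x\<in>K. \<exists>c z. x = c * z \<and> c \<in> C \<and> z \<in> scalars)"
    by (intro exI[of _ C]) auto
qed

context finite_extension_Qp
begin

lemma open_lcos: "open K \<Longrightarrow> open (lcos x K :: 'k gsp6 set)"
proof -
  assume "open K"
  then have "open ((\<lambda>y. inverse x * y) -` K)" by (intro open_vimage kcont)
  then show ?thesis by (simp add: lcos_def vimage_def)
qed

lemma finite_cosets_compact:
  fixes C :: "'k gsp6 set"
  assumes C: "compact C" and L: "subgp L" "open L"
  shows "finite (cosets C L)"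
proof -
  obtain D where D: "D \<subseteq> C" "finite D" "C \<subseteq> (\<Union>x\<in>D. lcos x L)"
    by (rule compactE_image[OF C, of C "\<lambda>x. lcos x L"]) (use open_lcos[OF L(2)] mem_lcos_self[OF L(1)] in blast)+
  have "cosets C L \<subseteq> (\<lambda>x. lcos x L) ` D"
  proof
    fix c assume "c \<in> cosets C L"
    then obtain y where y: "y \<in> C" "c = lcos y L" by (auto simp: cosets_def)
    then obtain x where x: "x \<in> D" "y \<in> lcos x L" using D(3) by blast
    then have "c = lcos x L" using lcos_eqI[OF L(1)] y by simp
    then show "c \<in> (\<lambda>x. lcos x L) ` D" using x by blast
  qed
  then show ?thesis using D(2) finite_subset by blast
qed

lemma lcos_scalar: "subgp L \<Longrightarrow> scalars \<subseteq> L \<Longrightarrow> z \<in> scalars \<Longrightarrow> lcos (c * z) L = lcos c L"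
proof -
  assume L: "subgp L" "scalars \<subseteq> L" "z \<in> scalars"
  have "inverse z \<in> L" using subgpD(3)[OF scalars_subgp L(3)] L(2) by (rule rev_subsetD)
  moreover have "inverse (c * z) * c = inverse z" by (simp add: mult.assoc)
  ultimately show ?thesis using lcos_eq_iff[OF L(1), of "c * z" c] by simp
qed

definition Krz :: "real \<Rightarrow> 'k gsp6 set" where
  "Krz r = {k * z | k z. k \<in> Kr r \<and> z \<in> scalars}"

lemma Krz_KKs: assumes r: "0 < r" "r < 1" shows "Krz r \<in> KKs"
proof -
  have K: "subgp (Kr r)" using Kr_subgp r by blast
  have "subgp (Krz r)"
    unfolding subgp_def
  proof (intro conjI ballI)
    show "1 \<in> Krz r" unfolding Krz_def using subgpD(1)[OF K] subgpD(1)[OF scalars_subgp] by (intro CollectI exI[of _ 1]) simp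
    fix x y assume "x \<in> Krz r" "y \<in> Krz r"
    then obtain k z l w where kz: "x = k * z" "y = l * w" "k \<in> Kr r" "l \<in> Kr r" "z \<in> scalars" "w \<in> scalars" unfolding Krz_def by blast
    have "x * y = k * (z * l) * w" unfolding kz(1,2) by (simp only: mult.assoc)
    also have "\<dots> = (k * l) * (z * w)" unfolding scalars_central[OF kz(5), of l] by (simp only: mult.assoc)
    finally have "x * y = (k * l) * (z * w)" .
    moreover have "k * l \<in> Kr r" "z * w \<in> scalars" by (rule subgpD(2)[OF K kz(3,4)], rule subgpD(2)[OF scalars_subgp kz(5,6)])
    ultimately show "x * y \<in> Krz r" unfolding Krz_def by blast
  next
    fix x assume "x \<in> Krz r"
    then obtain k z where kz: "x = k * z" "k \<in> Kr r" "z \<in> scalars" unfolding Krz_def by blast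
    have zi: "inverse z \<in> scalars" by (rule subgpD(3)[OF scalars_subgp kz(3)])
    have "inverse x = inverse k * inverse z" using scalars_central[OF zi] by (simp add: kz(1))
    then show "inverse x \<in> Krz r" unfolding Krz_def using subgpD(3)[OF K kz(2)] zi by blast
  qed
  moreover have "scalars \<subseteq> Krz r"
  proof
    fix z :: "'k gsp6" assume "z \<in> scalars"
    then show "z \<in> Krz r" unfolding Krz_def using subgpD(1)[OF K] by (intro CollectI exI[of _ 1] exI[of _ z]) simp
  qed
  moreover have "open (Krz r)"
  proof -
    have "Krz r = (\<Union>z\<in>scalars. lcos z (Kr r))"
    proof (intro set_eqI iffI)
      fix x assume "x \<in> Krz r"
      then obtain k z where kz: "x = k * z" "k \<in> Kr r" "z \<in> scalars" unfolding Krz_def by blast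
      have "x = z * k" using scalars_central[OF kz(3)] kz(1) by simp
      then show "x \<in> (\<Union>z\<in>scalars. lcos z (Kr r))" using kz by (intro UN_I[of z]) (simp_all add: lcos_def)
    next
      fix x assume "x \<in> (\<Union>z\<in>scalars. lcos z (Kr r))"
      then obtain z where z: "z \<in> scalars" "inverse z * x \<in> Kr r" unfolding lcos_def by blast
      have "x = (inverse z * x) * z" using scalars_central[OF z(1), of "inverse z * x"] by simp
      then show "x \<in> Krz r" unfolding Krz_def using z by blast
    qed
    moreover have "open (\<Union>z\<in>scalars. lcos z (Kr r))" using open_lcos[OF open_Kr[OF r(1)]] by (intro open_UN ballI)
    ultimately show ?thesis by simp
  qed
  moreover have "compact (Kr r)" using compact_Kr r by blast
  ultimately show ?thesis by (rule KKsI) (auto simp: Krz_def)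
qed

text \<open>A member of \<open>KKs\<close> contains all scalars and so does not shrink into a small
  neighbourhood; it does so after a scalar correction of each point.\<close>

lemma KKs_nbhd:
  fixes x :: "'k gsp6"
  assumes "open S" "x \<in> S"
  shows "\<exists>K\<in>KKs. \<forall>y\<in>lcos x K. \<exists>z\<in>scalars. y * z \<in> S"
proof -
  have "open ((\<lambda>y. x * y) -` S)" using assms(1) by (intro open_vimage kcont)
  then obtain r where r: "0 < r" "r < 1" "Kr r \<subseteq> (\<lambda>y. x * y) -` S" using Kr_basis[of "(\<lambda>y. x * y) -` S"] assms(2) by auto
  have "\<exists>z\<in>scalars. y * z \<in> S" if y: "y \<in> lcos x (Krz r)" for y
  proof -
    obtain k z where kz: "inverse x * y = k * z" "k \<in> Kr r" "z \<in> scalars" using y unfolding lcos_def Krz_def by blast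
    have "y = x * (k * z)" by (simp flip: kz(1))
    then have "y * inverse z = x * k" by (simp add: mult.assoc)
    then have "y * inverse z \<in> S" using r(3) kz(2) by auto
    then show ?thesis using subgpD(3)[OF scalars_subgp kz(3)] by blast
  qed
  then show ?thesis using Krz_KKs[OF r(1,2)] by blast
qed

lemma coset_system_KKs: "coset_system (KKs :: 'k gsp6 set set)"
proof
  show "(KKs :: 'k gsp6 set set) \<noteq> {}" using Krz_KKs[of "1/2"] by auto
  fix K :: "'k gsp6 set" assume K: "K \<in> KKs"
  then show "subgp K" by (rule KKsD)
  obtain C where C: "compact C" "\<And>x. x \<in> K \<Longrightarrow> \<exists>c z. x = c * z \<and> c \<in> C \<and> z \<in> scalars" using KKsD(4)[OF K] by blast
  note K' = KKsD(1-3)[OF K]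
  show "conjs x K \<in> KKs" for x
  proof -
    have "subgp (conjs x K)" by (rule subgp_conjs[OF K'(1)])
    moreover have "scalars \<subseteq> conjs x K"
    proof
      fix z :: "'k gsp6" assume z: "z \<in> scalars"
      have "inverse x * z * x = z" using scalars_central[OF z, of x] by (simp add: mult.assoc)
      then show "z \<in> conjs x K" unfolding conjs_def using z K'(2) by auto
    qed
    moreover have "open (conjs x K)"
    proof -
      have "open ((\<lambda>y. inverse x * y * x) -` K)" using K'(3) by (intro open_vimage kcont)
      then show ?thesis by (simp add: conjs_def vimage_def)
    qed
    moreover have "compact ((\<lambda>y. x * y * inverse x) ` C)" using C(1) by (intro compact_continuous_image kcont)
    moreover have "\<exists>c z. y = c * z \<and> c \<in> (\<lambda>y. x * y * inverse x) ` C \<and> z \<in> scalars" if y: "y \<in> conjs x K" for y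
    proof -
      obtain c z where cz: "inverse x * y * x = c * z" "c \<in> C" "z \<in> scalars" using C(2)[of "inverse x * y * x"] y unfolding conjs_def by blast
      have "y = x * (inverse x * y * x) * inverse x" by (simp add: mult.assoc)
      also have "\<dots> = (x * c * inverse x) * z" unfolding cz(1) using scalars_central[OF cz(3), of "inverse x"] by (simp add: mult.assoc)
      finally show ?thesis using cz(2,3) by (intro exI[of _ "x * c * inverse x"] exI[of _ z]) simp
    qed
    ultimately show ?thesis by (rule KKsI)
  qed
  fix L :: "'k gsp6 set" assume L: "L \<in> KKs"
  note L' = KKsD(1-3)[OF L]
  have "subgp (K \<inter> L)" using K'(1) L'(1) unfolding subgp_def by auto
  moreover have "scalars \<subseteq> K \<inter> L" using K'(2) L'(2) by blast
  ultimately show "K \<inter> L \<in> KKs" using open_Int[OF K'(3) L'(3)] C by (auto intro: KKsI[of "K \<inter> L" C])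
  have "cosets K L \<subseteq> cosets C L"
  proof
    fix c assume "c \<in> cosets K L"
    then obtain k where k: "k \<in> K" "c = lcos k L" by (auto simp: cosets_def)
    then obtain d z where dz: "k = d * z" "d \<in> C" "z \<in> scalars" using C(2)[of k] by blast
    then have "c = lcos d L" using lcos_scalar[OF L'(1,2)] k by simp
    then show "c \<in> cosets C L" using dz by (auto simp: cosets_def)
  qed
  then show "finite (cosets K L)" using finite_cosets_compact[OF C(1) L'(1,3)] finite_subset by blast
qed

sublocale cs: coset_system "KKs :: 'k gsp6 set set"
  by (rule coset_system_KKs)

text \<open>A compact set \<open>?Q\<close> meets every scalar class in \<open>A\<close>. As
  \<open>A\<close>, \<open>E\<close> and the subgroups \<open>r x\<close> are stable under scalars,
  a finite cover of the part in \<open>?Q\<close> covers everything.\<close>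

lemma closed_coverable:
  fixes E :: "'k gsp6 set"
  assumes E: "closed E" "\<And>x z. x \<in> E \<Longrightarrow> z \<in> scalars \<Longrightarrow> x * z \<in> E"
    and A: "L \<in> KKs" "finite (cosets A L)" "\<And>x k. x \<in> A \<Longrightarrow> k \<in> L \<Longrightarrow> x * k \<in> A"
    and r: "\<And>x. x \<in> A \<inter> E \<Longrightarrow> r x \<in> KKs"
  shows "\<exists>I\<subseteq>A \<inter> E. finite I \<and> A \<inter> E \<subseteq> (\<Union>x\<in>I. lcos x (r x))"
proof -
  obtain C where C: "compact C" "\<And>x. x \<in> L \<Longrightarrow> \<exists>c z. x = c * z \<and> c \<in> C \<and> z \<in> scalars" using KKsD(4)[OF A(1)] by blast
  note L = KKsD(1-3)[OF A(1)]
  let ?Q = "(\<Union>c\<in>cosets A L. (\<lambda>y. rp c * y) ` C)"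
  have Q: "compact ?Q" using C(1) A(2) by (intro compact_UN ballI compact_continuous_image kcont)
  have Aeq: "A = (\<Union>x\<in>A. lcos x L)"
  proof (intro set_eqI iffI)
    fix y assume "y \<in> (\<Union>x\<in>A. lcos x L)"
    then obtain x where x: "x \<in> A" "inverse x * y \<in> L" unfolding lcos_def by blast
    then have "x * (inverse x * y) \<in> A" by (rule A(3))
    then show "y \<in> A" by simp
  qed (use mem_lcos_self[OF L(1)] in blast)
  have "closed A"
  proof -
    have "- A = (\<Union>x\<in>- A. lcos x L)"
    proof (intro set_eqI iffI)
      fix y assume "y \<in> (\<Union>x\<in>- A. lcos x L)"
      then obtain x where x: "x \<notin> A" "inverse x * y \<in> L" unfolding lcos_def by blast
      show "y \<in> - A"
      proof
        assume "y \<in> A"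
        then have "y * inverse (inverse x * y) \<in> A" by (rule A(3)[OF _ subgpD(3)[OF L(1) x(2)]])
        then show False using x(1) by simp
      qed
    qed (use mem_lcos_self[OF L(1)] in blast)
    moreover have "open (\<Union>x\<in>- A. lcos x L)" using open_lcos[OF L(3)] by blast
    ultimately show ?thesis by (simp add: closed_def)
  qed
  then have cpt: "compact (?Q \<inter> (A \<inter> E))" using Q E(1) by (intro compact_Int_closed closed_Int)
  have opn: "open (lcos x (r x))" if "x \<in> A \<inter> E" for x by (rule open_lcos[OF KKsD(3)[OF r[OF that]]])
  have self: "x \<in> lcos x (r x)" if "x \<in> A \<inter> E" for x by (rule mem_lcos_self[OF KKsD(1)[OF r[OF that]]])
  have "?Q \<inter> (A \<inter> E) \<subseteq> (\<Union>x\<in>A \<inter> E. lcos x (r x))" using self by blast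
  from compactE_image[OF cpt opn this]
  obtain I where I: "I \<subseteq> A \<inter> E" "finite I" "?Q \<inter> (A \<inter> E) \<subseteq> (\<Union>x\<in>I. lcos x (r x))" .
  have "A \<inter> E \<subseteq> (\<Union>x\<in>I. lcos x (r x))"
  proof
    fix y assume y: "y \<in> A \<inter> E"
    let ?c = "lcos y L"
    have c: "?c \<in> cosets A L" using y by (auto simp: cosets_def)
    have "rp ?c \<in> lcos y L" by (rule rp_lcos[OF L(1)])
    then have "inverse y * rp ?c \<in> L" by (simp only: lcos_def mem_Collect_eq)
    then have "inverse (inverse y * rp ?c) \<in> L" by (rule subgpD(3)[OF L(1)])
    then have "inverse (rp ?c) * y \<in> L" by simp
    then obtain d z where dz: "inverse (rp ?c) * y = d * z" "d \<in> C" "z \<in> scalars" using C(2)[of "inverse (rp ?c) * y"] by blast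
    have "y * inverse z = rp ?c * (inverse (rp ?c) * y) * inverse z" by simp
    also have "\<dots> = rp ?c * d" unfolding dz(1) by (simp add: mult.assoc)
    finally have yz: "y * inverse z = rp ?c * d" .
    have zi: "inverse z \<in> scalars" by (rule subgpD(3)[OF scalars_subgp dz(3)])
    have "y * inverse z \<in> ?Q" unfolding yz by (rule UN_I[OF c imageI[OF dz(2)]])
    moreover have "y * inverse z \<in> A \<inter> E" using y by (intro IntI E(2)[OF _ zi] A(3)[OF _ subsetD[OF L(2) zi]]) simp_all
    ultimately obtain x where x: "x \<in> I" "y * inverse z \<in> lcos x (r x)" using I(3) by blast
    have rx: "subgp (r x)" "scalars \<subseteq> r x" using KKsD(1,2)[OF r] x(1) I(1) by blast+
    have "inverse x * (y * inverse z) * z \<in> r x" by (rule subgpD(2)[OF rx(1)]) (use x(2) dz(3) rx(2) in \<open>auto simp: lcos_def\<close>)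
    then have "y \<in> lcos x (r x)" unfolding lcos_def by (simp add: mult.assoc)
    then show "y \<in> (\<Union>x\<in>I. lcos x (r x))" using x by blast
  qed
  then show ?thesis using I by blast
qed

end

section \<open>The Shalika subgroup and its character\<close>

lemma Sh_bl:
  assumes "x \<in> Sh"
  shows "bl x 3 1 = 0" "bl x 3 2 = 0" "bl x 2 1 = 0" "bl x 2 2 = bl x 1 1" "bl x 3 3 = bl x 1 1" "nrm (bl x 1 1) \<noteq> 0"
proof -
  obtain g X Z where *: "x = del g * uel X Z" "nrm g \<noteq> 0" "tr Z = - nrm X" using assms by (auto simp: Sh_eq)
  show "bl x 3 1 = 0" "bl x 3 2 = 0" "bl x 2 1 = 0" "bl x 2 2 = bl x 1 1" "bl x 3 3 = bl x 1 1" "nrm (bl x 1 1) \<noteq> 0"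
    by (simp_all add: *(1) bl_mult bl_del[OF *(2)] bl_uel[OF *(3)] *(2))
qed

lemma Sh_del: "nrm g \<noteq> 0 \<Longrightarrow> del g \<in> Sh"
  by (simp add: mem_Sh_iff bl_del)

lemma Sh_uel: "tr Z = - nrm X \<Longrightarrow> uel X Z \<in> Sh"
  by (simp add: mem_Sh_iff bl_uel)

lemma Sh_subgp: "subgp Sh"
  unfolding subgp_def
proof (intro conjI ballI)
  show "1 \<in> Sh" by (simp add: mem_Sh_iff bl_one)
  fix x y :: "'a gsp6" assume xy: "x \<in> Sh" "y \<in> Sh"
  show "x * y \<in> Sh" by (simp add: mem_Sh_iff bl_mult Sh_bl[OF xy(1)] Sh_bl[OF xy(2)])
next
  fix x :: "'a gsp6" assume x: "x \<in> Sh"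
  show "inverse x \<in> Sh" by (simp add: mem_Sh_iff bl_inverse Sh_bl[OF x])
qed

lemma scalars_Sh: "scalars \<subseteq> Sh"
  unfolding scalars_def by (auto intro: Sh_del)

lemma eps_sq: "eps * eps = 1"
proof (rule bl_eqI)
  fix i j show "bl (eps * eps :: 'a gsp6) i j = bl 1 i j"
    by (induct i rule: index3; induct j rule: index3) (simp_all add: bl_mult bl_eps bl_one)
qed

lemma eps_Sh: "s \<in> Sh \<Longrightarrow> eps * s * eps \<in> Sh"
  by (simp add: mem_Sh_iff bl_mult bl_eps)

lemma bl_uel_mult: "tr Z = - nrm X \<Longrightarrow> bl (uel X Z * x) 1 j = bl x 1 j + X * bl x 2 j + Z * bl x 3 j"
  "tr Z = - nrm X \<Longrightarrow> bl (uel X Z * x) 2 j = bl x 2 j - star X * bl x 3 j"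
  "tr Z = - nrm X \<Longrightarrow> bl (uel X Z * x) 3 j = bl x 3 j"
  by (simp_all add: bl_mult bl_uel)

lemma bl_mult_uel: "tr Z = - nrm X \<Longrightarrow> bl (x * uel X Z) i 1 = bl x i 1"
  "tr Z = - nrm X \<Longrightarrow> bl (x * uel X Z) i 2 = bl x i 1 * X + bl x i 2"
  "tr Z = - nrm X \<Longrightarrow> bl (x * uel X Z) i 3 = bl x i 1 * Z - bl x i 2 * star X + bl x i 3"
  by (simp_all add: bl_mult bl_uel)

lemma bl_del_mult: "nrm g \<noteq> 0 \<Longrightarrow> bl (del g * x) i j = g * bl x i j"
  by (induct i rule: index3) (simp_all add: bl_mult bl_del)

lemma bl_mult_del: "nrm g \<noteq> 0 \<Longrightarrow> bl (x * del g) i j = bl x i j * g"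
  by (induct j rule: index3) (simp_all add: bl_mult bl_del)

lemma chi_uel: "tr Z = - nrm X \<Longrightarrow> chi \<psi> (uel X Z) = \<psi> (- tr X)"
  by (simp add: chi_eq Sh_uel bl_uel)

context
  fixes \<psi> :: "'k::{field_char_0,topological_space} \<Rightarrow> complex"
  assumes psi: "smooth_additive_character \<psi>"
begin

lemma psi_add: "\<psi> (x + y) = \<psi> x * \<psi> y" and psi_zero: "\<psi> 0 = 1" and psi_open: "open {x. \<psi> x = 1}"
  using psi unfolding smooth_additive_character_def by auto

lemma psi_nonzero: "\<psi> x \<noteq> 0"
  using psi_add[of x "- x"] psi_zero by auto

lemma psi_minus: "\<psi> (- x) = inverse (\<psi> x)"
  using psi_add[of x "- x"] psi_zero psi_nonzero[of x] by (simp add: inverse_unique)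

text \<open>Block \<open>(1, 2)\<close> of the product is \<open>g * b + a * h\<close>; cyclicity of
  the trace removes the conjugation by \<open>h\<close>.\<close>

lemma chi_mult:
  assumes x: "x \<in> Sh" and y: "y \<in> Sh"
  shows "chi \<psi> (x * y) = chi \<psi> x * chi \<psi> y"
proof -
  let ?g = "bl x 1 1" and ?h = "bl y 1 1" and ?a = "bl x 1 2" and ?b = "bl y 1 2"
  have n: "nrm ?g \<noteq> 0" "nrm ?h \<noteq> 0" using Sh_bl x y by blast+
  have "tr (star (?g * ?h) * (?g * ?b + ?a * ?h)) = tr (star ?h * (star ?g * ?g) * ?b) + tr (star ?h * star ?g * ?a * ?h)"
    by (simp add: distrib_left mult.assoc)
  also have "\<dots> = nrm ?g * tr (star ?h * ?b) + tr (?h * (star ?h * star ?g * ?a))"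
    by (simp only: mult_star tr_comm[of "star ?h * star ?g * ?a" ?h]) (simp add: tr_def nrm_def algebra_simps)
  also have "tr (?h * (star ?h * star ?g * ?a)) = nrm ?h * tr (star ?g * ?a)"
    by (simp add: mult.assoc[symmetric] mult_star) (simp add: mult.assoc)
  finally have t: "tr (star (?g * ?h) * (?g * ?b + ?a * ?h)) = nrm ?g * tr (star ?h * ?b) + nrm ?h * tr (star ?g * ?a)" .
  have "chi \<psi> (x * y) = \<psi> (- (tr (star (?g * ?h) * (?g * ?b + ?a * ?h)) / (nrm ?g * nrm ?h)))"
    by (subst chi_eq[OF subgpD(2)[OF Sh_subgp x y]]) (simp add: bl_mult Sh_bl[OF x] Sh_bl[OF y])
  also have "\<dots> = \<psi> (- (tr (star ?g * ?a) / nrm ?g) + - (tr (star ?h * ?b) / nrm ?h))"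
    unfolding t using n by (intro arg_cong[of _ _ \<psi>]) (simp add: field_simps)
  finally show ?thesis unfolding psi_add chi_eq[OF x] chi_eq[OF y] .
qed

lemma chi_nonzero: "x \<in> Sh \<Longrightarrow> chi \<psi> x \<noteq> 0"
  by (simp add: chi_eq psi_nonzero)

lemma chi_eps: "s \<in> Sh \<Longrightarrow> chi \<psi> (eps * s * eps) = inverse (chi \<psi> s)"
  by (simp add: chi_eq eps_Sh bl_mult bl_eps psi_minus[symmetric])

end

section \<open>The killable points form an open invariant set\<close>

context skew_system
begin

lemma killable_translate:
  assumes E: "invariant E" and x: "killable E x" and st: "s \<in> H" "t \<in> H"
  shows "killable E (s * x * t)"
proof -
  obtain K where K: "K \<in> KK" and kill: "\<And>f. testf f \<Longrightarrow> (\<forall>y. f y \<noteq> 0 \<longrightarrow> y \<in> lcos x K) \<Longrightarrow>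
     \<exists>g. testf g \<and> D g = D f \<and> (\<forall>y\<in>E. g y = 0)" using x unfolding killable_def by auto
  have K': "conjs (inverse t) K \<in> KK" using K by (rule KK_conjs)
  have inv: "inverse s \<in> H" "inverse t \<in> H" using subgpD(3)[OF H] st by auto
  have D_tr: "D (\<lambda>y. f (inverse a * y * b)) = \<theta> a * inverse (\<theta> b) * D f" if f: "testf f" and ab: "a \<in> H" "b \<in> H" for f a b
  proof -
    have "testf (\<lambda>y. f (inverse a * y))" using testf_translate[OF f, of "inverse a" 1] by simp
    from D_right[OF this ab(2)] D_left[OF f ab(1)] show ?thesis by (simp add: mult.assoc)
  qed
  show ?thesis
    unfolding killable_def
  proof (intro bexI[OF _ K'] allI impI)
    fix f assume f: "testf f" "\<forall>y. f y \<noteq> 0 \<longrightarrow> y \<in> lcos (s * x * t) (conjs (inverse t) K)"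
    have 1: "testf (\<lambda>y. f (s * y * t))" by (rule testf_translate[OF f(1)])
    have "\<forall>y. f (s * y * t) \<noteq> 0 \<longrightarrow> y \<in> lcos x K"
    proof (intro allI impI)
      fix y assume "f (s * y * t) \<noteq> 0"
      then have "s * y * t \<in> lcos (s * x * t) (conjs (inverse t) K)" using f(2) by simp
      then show "y \<in> lcos x K" by (simp add: lcos_def conjs_def mult.assoc)
    qed
    from kill[OF 1 this] obtain g where g: "testf g" "D g = D (\<lambda>y. f (s * y * t))" "\<forall>y\<in>E. g y = 0" by auto
    have Dg: "D g = inverse (\<theta> s) * inverse (\<theta> t) * D f"
      using D_tr[OF f(1) inv(1) st(2)] theta_inverse[OF st(1)] by (simp add: g(2))
    have h: "testf (\<lambda>y. g (inverse s * y * inverse t))" by (rule testf_translate[OF g(1)])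
    have "D (\<lambda>y. g (inverse s * y * inverse t)) = \<theta> s * \<theta> t * D g"
      using D_tr[OF g(1) st(1) inv(2)] theta_inverse[OF st(2)] by simp
    also have "\<dots> = D f" unfolding Dg using theta_nz[OF st(1)] theta_nz[OF st(2)] by (simp add: field_simps)
    finally have "D (\<lambda>y. g (inverse s * y * inverse t)) = D f" .
    moreover have "\<forall>y\<in>E. g (inverse s * y * inverse t) = 0"
    proof
      fix y assume "y \<in> E"
      then have "inverse s * y * inverse t \<in> E" using E inv unfolding invariant_def by simp
      then show "g (inverse s * y * inverse t) = 0" using g(3) by simp
    qed
    ultimately show "\<exists>g. testf g \<and> D g = D f \<and> (\<forall>y\<in>E. g y = 0)" using h by (intro exI conjI)
  qed
qed

lemma testf_tau: "testf f \<Longrightarrow> testf (\<lambda>x. f (\<epsilon> * inverse x * \<epsilon>))"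
  using testf_inverse[OF testf_translate[of f \<epsilon> \<epsilon>]] by simp

lemma eps_cancel: "\<epsilon> * (\<epsilon> * x) = x" "inverse \<epsilon> = \<epsilon>"
proof -
  show "inverse \<epsilon> = \<epsilon>" by (rule inv_unique[OF eps_sq])
  then show "\<epsilon> * (\<epsilon> * x) = x" using inv_mult_cancel[of \<epsilon> x] by simp
qed

lemma killable_tau:
  assumes E: "invariant E" and x: "killable E x"
  shows "killable E (\<epsilon> * inverse x * \<epsilon>)"
proof -
  obtain K where K: "K \<in> KK" and kill: "\<And>f. testf f \<Longrightarrow> (\<forall>y. f y \<noteq> 0 \<longrightarrow> y \<in> lcos x K) \<Longrightarrow>
     \<exists>g. testf g \<and> D g = D f \<and> (\<forall>y\<in>E. g y = 0)" using x unfolding killable_def by auto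
  have Ks: "subgp K" by (rule KK_subgp[OF K])
  have K': "conjs (\<epsilon> * x) K \<in> KK" using K by (rule KK_conjs)
  show ?thesis
    unfolding killable_def
  proof (intro bexI[OF _ K'] allI impI)
    fix f assume f: "testf f" "\<forall>y. f y \<noteq> 0 \<longrightarrow> y \<in> lcos (\<epsilon> * inverse x * \<epsilon>) (conjs (\<epsilon> * x) K)"
    note 1 = testf_tau[OF f(1)]
    have "\<forall>y. f (\<epsilon> * inverse y * \<epsilon>) \<noteq> 0 \<longrightarrow> y \<in> lcos x K"
    proof (intro allI impI)
      fix y assume "f (\<epsilon> * inverse y * \<epsilon>) \<noteq> 0"
      then have "\<epsilon> * inverse y * \<epsilon> \<in> lcos (\<epsilon> * inverse x * \<epsilon>) (conjs (\<epsilon> * x) K)" using f(2) by simp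
      then have "inverse y * x \<in> K" by (simp add: lcos_def conjs_def mult.assoc eps_cancel)
      from subgpD(3)[OF Ks this] show "y \<in> lcos x K" by (simp add: lcos_def)
    qed
    from kill[OF 1 this] obtain g where g: "testf g" "D g = D (\<lambda>y. f (\<epsilon> * inverse y * \<epsilon>))" "\<forall>y\<in>E. g y = 0" by auto
    note 2 = testf_tau[OF g(1)]
    have "D (\<lambda>y. g (\<epsilon> * inverse y * \<epsilon>)) = D f"
      using D_skew[OF g(1)] D_skew[OF f(1)] g(2) by simp
    moreover have "\<forall>y\<in>E. g (\<epsilon> * inverse y * \<epsilon>) = 0" using E g(3) unfolding invariant_def by simp
    ultimately show "\<exists>g. testf g \<and> D g = D f \<and> (\<forall>y\<in>E. g y = 0)" using 2 by (intro exI conjI)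
  qed
qed

text \<open>The witness for \<open>x\<close> serves every point of the same coset, so killability is
  an open condition.\<close>

lemma killable_coset:
  assumes "killable E x"
  shows "\<exists>K\<in>KK. \<forall>y\<in>lcos x K. killable E y"
proof -
  obtain K where K: "K \<in> KK" "\<forall>f. testf f \<longrightarrow> (\<forall>y. f y \<noteq> 0 \<longrightarrow> y \<in> lcos x K) \<longrightarrow>
     (\<exists>g. testf g \<and> D g = D f \<and> (\<forall>y\<in>E. g y = 0))" using assms unfolding killable_def by auto
  have "killable E y" if "y \<in> lcos x K" for y
    unfolding killable_def using lcos_eqI[OF KK_subgp[OF K(1)] that] K(2) by (intro bexI[OF _ K(1)]) simp
  then show ?thesis using K(1) by auto
qed

definition residue :: "'g set \<Rightarrow> 'g set" where
  "residue E = {x \<in> E. \<not> killable E x}"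

lemma invariant_residue:
  assumes E: "invariant E"
  shows "invariant (residue E)"
proof -
  have "s * x * t \<in> residue E" if s: "s \<in> H" and t: "t \<in> H" and x: "x \<in> residue E" for s t x
  proof -
    have "s * x * t \<in> E" using E s t x unfolding invariant_def residue_def by simp
    moreover have "\<not> killable E (s * x * t)"
    proof
      assume "killable E (s * x * t)"
      from killable_translate[OF E this subgpD(3)[OF H s] subgpD(3)[OF H t]]
      show False using x unfolding residue_def by (simp add: mult.assoc)
    qed
    ultimately show ?thesis unfolding residue_def by simp
  qed
  moreover have "\<epsilon> * inverse x * \<epsilon> \<in> residue E" if x: "x \<in> residue E" for x
  proof -
    have "\<epsilon> * inverse x * \<epsilon> \<in> E" using E x unfolding invariant_def residue_def by simp
    moreover have "\<not> killable E (\<epsilon> * inverse x * \<epsilon>)"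
    proof
      assume "killable E (\<epsilon> * inverse x * \<epsilon>)"
      from killable_tau[OF E this] show False using x eps_sq unfolding residue_def by (simp add: mult.assoc eps_cancel)
    qed
    ultimately show ?thesis unfolding residue_def by simp
  qed
  ultimately show ?thesis unfolding invariant_def by blast
qed

end

text \<open>Off-diagonal entries are detected by a nilpotent matrix unit, and distinct diagonal
  entries by the swap. Commutators thus supply invertible elements, here for conjugating
  \<open>g\<close> to \<open>star g\<close> and later for the open stratum.\<close>

lemma nonscalar_commutator:
  assumes "\<And>c. g \<noteq> sc (c :: 'k::field)"
  shows "\<exists>y. nrm (g * y - y * g) \<noteq> 0"
proof -
  have "nrm (g * M2 0 1 0 0 - M2 0 1 0 0 * g) = - (e21 g * e21 g)"
    "nrm (g * M2 0 0 1 0 - M2 0 0 1 0 * g) = - (e12 g * e12 g)"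
    by (simp_all add: nrm_def)
  moreover have "e21 g = 0 \<Longrightarrow> e12 g = 0 \<Longrightarrow> nrm (g * M2 0 1 1 0 - M2 0 1 1 0 * g) = (e11 g - e22 g) * (e11 g - e22 g)"
    by (simp add: nrm_def algebra_simps)
  moreover have "e21 g = 0 \<Longrightarrow> e12 g = 0 \<Longrightarrow> e11 g \<noteq> e22 g" using assms[of "e11 g"] by (auto simp: m2_eq_iff)
  ultimately have "nrm (g * M2 0 1 0 0 - M2 0 1 0 0 * g) \<noteq> 0 \<or> nrm (g * M2 0 0 1 0 - M2 0 0 1 0 * g) \<noteq> 0 \<or>
      nrm (g * M2 0 1 1 0 - M2 0 1 1 0 * g) \<noteq> 0"
    by (cases "e21 g = 0"; cases "e12 g = 0") simp_all
  then show ?thesis by (elim disjE) (intro exI, assumption)+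
qed

locale shalika = finite_extension_Qp p absv
  for p :: nat and absv :: "'k::{field_char_0,metric_space} \<Rightarrow> real" +
  fixes \<psi> :: "'k \<Rightarrow> complex"
  assumes psi: "smooth_additive_character \<psi>" and psi_nontrivial: "nontrivial_character \<psi>"
begin

lemma tendsto_p_power: "(\<lambda>n. of_nat p ^ n * (x :: 'k)) \<longlonglongrightarrow> 0"
  unfolding tendsto_absv
proof (intro allI impI)
  fix e :: real assume e: "e > 0"
  have "(\<lambda>n. (1 / real p) ^ n * absv x) \<longlonglongrightarrow> 0 * absv x"
    using p_gt_1 by (intro tendsto_mult tendsto_const LIMSEQ_power_zero) simp
  then have "\<forall>\<^sub>F n in sequentially. (1 / real p) ^ n * absv x < e" using e by (intro order_tendstoD) auto
  then show "\<forall>\<^sub>F n in sequentially. absv (of_nat p ^ n * x - 0) < e"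
    by (simp add: absv_mult absv_power absv_p)
qed

text \<open>\<open>p ^ n * x\<close> tends to zero and so enters the open kernel; hence
  \<open>\<psi> x\<close> is a root of unity.\<close>

lemma psi_cmod: "cmod (\<psi> x) = 1"
proof -
  have pow: "\<psi> (of_nat n * x) = \<psi> x ^ n" for n
  proof (induction n)
    case (Suc n)
    have "\<psi> (of_nat (Suc n) * x) = \<psi> (x + of_nat n * x)" by (simp add: distrib_right)
    then show ?case by (simp only: psi_add[OF psi] Suc power_Suc)
  qed (simp add: psi_zero[OF psi])
  have "eventually (\<lambda>n. of_nat p ^ n * x \<in> {x. \<psi> x = 1}) sequentially"
    by (rule topological_tendstoD[OF tendsto_p_power psi_open[OF psi]]) (simp add: psi_zero[OF psi])
  from eventually_happens'[OF sequentially_bot this]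
  obtain n where "of_nat p ^ n * x \<in> {x. \<psi> x = 1}" by (elim exE)
  then have "\<psi> x ^ (p ^ n) = 1" using pow[of "p ^ n"] unfolding of_nat_power mem_Collect_eq by (simp only:)
  then have "cmod (\<psi> x) ^ (p ^ n) = 1 ^ (p ^ n)" unfolding norm_power[symmetric] power_one by (simp only: norm_one)
  moreover have "p ^ n > 0" using prime_gt_0_nat[OF prime_p] by simp
  ultimately show ?thesis by (rule power_eq_imp_eq_base[OF _ norm_ge_zero zero_le_one])
qed

lemma chi_cmod: "s \<in> Sh \<Longrightarrow> cmod (chi \<psi> s) = 1"
  by (simp add: chi_eq psi_cmod)

lemma chi_one: "chi \<psi> 1 = 1"
  using chi_mult[OF psi, of 1 1] subgpD(1)[OF Sh_subgp] chi_nonzero[OF psi, of 1] by simp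

lemma chi_inverse: "s \<in> Sh \<Longrightarrow> chi \<psi> (inverse s) = inverse (chi \<psi> s)"
  using chi_mult[OF psi, of s "inverse s"] subgpD(3)[OF Sh_subgp, of s] chi_one
  by (simp add: inverse_unique)

lemma chi_scalar: "z \<in> scalars \<Longrightarrow> chi \<psi> z = 1"
proof -
  assume z: "z \<in> scalars"
  then obtain c where c: "\<forall>i j. bl z i j = (if i = j then sc c else 0)" unfolding scalars_bl by blast
  show ?thesis using z scalars_Sh by (subst chi_eq) (auto simp: c psi_zero[OF psi])
qed

lemma chi_smooth: "\<exists>N\<in>KKs. \<forall>s\<in>Sh \<inter> N. chi \<psi> s = 1"
proof -
  let ?O = "{x. nrm (bl x 1 1) \<noteq> (0 :: 'k)}"
  let ?f = "\<lambda>x. - (tr (star (bl x 1 1) * bl x 1 2) / nrm (bl x 1 1))"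
  have O: "open ?O" by (intro open_neq kcont)
  have f: "continuous_on ?O ?f" by (intro kcont) simp
  have op: "open (?f -` {y. \<psi> y = 1} \<inter> ?O)"
    by (rule f[unfolded continuous_on_open_vimage[OF O], rule_format, OF psi_open[OF psi]])
  have one: "1 \<in> ?f -` {y. \<psi> y = 1} \<inter> ?O" by (simp add: bl_one psi_zero[OF psi])
  from Kr_basis[OF op one] obtain r where r: "0 < r" "r < 1" "Kr r \<subseteq> ?f -` {y. \<psi> y = 1} \<inter> ?O"
    by (elim exE conjE)
  have "chi \<psi> s = 1" if s: "s \<in> Sh" "s \<in> Krz r" for s
  proof -
    obtain k z where kz: "s = k * z" "k \<in> Kr r" "z \<in> scalars" using s(2) unfolding Krz_def by auto
    have zS: "z \<in> Sh" using kz(3) scalars_Sh by (rule rev_subsetD)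
    have "s * inverse z = k" by (simp add: kz(1) mult.assoc)
    then have kS: "k \<in> Sh" using subgpD(2)[OF Sh_subgp s(1) subgpD(3)[OF Sh_subgp zS]] by simp
    have "chi \<psi> k = 1" unfolding chi_eq[OF kS] using subsetD[OF r(3) kz(2)] by simp
    then show ?thesis unfolding kz(1) chi_mult[OF psi kS zS] by (simp add: chi_scalar kz(3))
  qed
  then have "\<forall>s\<in>Sh \<inter> Krz r. chi \<psi> s = 1" by simp
  then show ?thesis using Krz_KKs[OF r(1,2)] by (intro bexI)
qed

text \<open>A torus element of the group: conjugating by its inverse scales \<open>X\<close> by
  \<open>1 / s\<close> and \<open>Z\<close> by the square of that factor.\<close>

definition conj_diag :: "'k \<Rightarrow> 'k gsp6" where
  "conj_diag s = gmk (vector [vector [sc s, 0, 0], vector [0, 1, 0], vector [0, 0, sc (1 / s)]])"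

lemma bl_conj_diag:
  assumes "s \<noteq> 0"
  shows "bl (conj_diag s) i j = (if i = j then (if i = 1 then sc s else if i = 2 then 1 else sc (1 / s)) else 0)"
    "sim (conj_diag s) = 1"
proof -
  have h: "hrel (\<lambda>i j. vector [vector [sc s, 0, 0], vector [0, 1, 0], vector [0, 0, sc (1 / s)]] $ i $ j) (1 :: 'k)"
    unfolding hrel_iff3 herm_def using assms by (simp add: sc_inverse)
  show "sim (conj_diag s) = 1" unfolding conj_diag_def by (rule bl_gmk(2)[OF h]) simp
  show "bl (conj_diag s) i j = (if i = j then (if i = 1 then sc s else if i = 2 then 1 else sc (1 / s)) else 0)"
    unfolding conj_diag_def bl_gmk(1)[OF h one_neq_zero] by (induct i rule: index3; induct j rule: index3) simp_all
qed

lemma nrm_sc_mult: "nrm (sc c * X) = c * c * nrm X"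
  by simp

lemma uel_scale: 
  assumes s: "s \<noteq> 0" and t: "tr Z = - nrm X"
  shows "uel X Z * conj_diag s = conj_diag s * uel (sc (1 / s) * X) (sc (1 / s * (1 / s)) * Z)"
proof -
  have t': "tr (sc (1 / s * (1 / s)) * Z) = - nrm (sc (1 / s) * X)" unfolding nrm_sc_mult tr_simps(7) t by simp
  show ?thesis
    by (rule bl_eqI3; unfold bl_uel_mult[OF t] bl_mult[of "conj_diag s"] bl_uel[OF t'] bl_conj_diag[OF s])
      (use s in \<open>simp_all add: m2_eq_iff\<close>)
qed

text \<open>A torus element contracts the given unipotent element into \<open>Krz (1/2)\<close>, so
  the element lies in a conjugate of that group. This gives it modulus one and makes it usable in
  averages.\<close>

lemma uel_KKs: assumes t: "tr Z = - nrm (X :: 'k m2)" shows "\<exists>K\<in>KKs. uel X Z \<in> K"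
proof -
  let ?u = "\<lambda>c. uel (sc c * X) (sc (c * c) * Z)"
  have "continuous_on UNIV ?u" using t by (intro kcont) (simp add: nrm_sc_mult del: sc_simps)
  then have "open (?u -` Krz (1/2))" using KKsD(3)[OF Krz_KKs[of "1/2"]] by (intro open_vimage) auto
  moreover have "?u 0 = 1"
    by (rule bl_eqI3) (simp_all add: bl_uel bl_one)
  then have "0 \<in> ?u -` Krz (1/2)" using subgpD(1)[OF KKsD(1)[OF Krz_KKs[of "1/2"]]] by simp
  ultimately have "eventually (\<lambda>n. of_nat p ^ n * 1 \<in> ?u -` Krz (1/2)) sequentially"
    using tendsto_p_power[of 1] by (intro topological_tendstoD)
  then obtain n where n: "?u (of_nat p ^ n) \<in> Krz (1/2)" unfolding eventually_sequentially by auto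
  let ?s = "1 / of_nat p ^ n :: 'k"
  have s: "?s \<noteq> 0" using prime_gt_0_nat[OF prime_p] by simp
  have "inverse (conj_diag ?s) * uel X Z * conj_diag ?s = ?u (of_nat p ^ n)"
    using uel_scale[OF s t] by (simp add: mult.assoc)
  then have "uel X Z \<in> conjs (conj_diag ?s) (Krz (1/2))" unfolding conjs_def using n by simp
  then show ?thesis using cs.KK_conjs[OF Krz_KKs[of "1/2"], of "conj_diag ?s"] by (intro bexI) simp_all
qed

lemma modulus_uel: "tr Z = - nrm (X :: 'k m2) \<Longrightarrow> cs.modulus (uel X Z) = 1"
  using uel_KKs[of Z X] by (auto intro: cs.modulus_eq_1)

lemma modulus_scalar: "z \<in> scalars \<Longrightarrow> cs.modulus (z :: 'k gsp6) = 1"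
  using cs.modulus_eq_1[OF Krz_KKs[of "1/2"], of z] KKsD(2)[OF Krz_KKs[of "1/2"]] by auto

lemma del_mult: "nrm g \<noteq> 0 \<Longrightarrow> nrm h \<noteq> 0 \<Longrightarrow> del g * del h = del (g * h)"
proof -
  assume g: "nrm g \<noteq> 0" "nrm h \<noteq> 0"
  then have gh: "nrm (g * h) \<noteq> 0" by simp
  show ?thesis by (rule bl_eqI) (simp add: bl_del_mult[OF g(1)] bl_del[OF g(2)] bl_del[OF gh])
qed

text \<open>A commutator \<open>h = g * y - y * g\<close> has trace zero, and so has
  \<open>h * g\<close>; hence \<open>h * g = - star (h * g) = star g * h\<close>.\<close>

lemma star_conjugate:
  assumes "\<And>c. g \<noteq> sc (c :: 'k)"
  shows "\<exists>h. nrm h \<noteq> 0 \<and> h * g = star g * h"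
proof -
  have eq: "(g * y - y * g) * g = star g * (g * y - y * g)" for y
    by (simp add: m2_eq_iff algebra_simps)
  obtain y where "nrm (g * y - y * g) \<noteq> 0" using nonscalar_commutator[OF assms] by (elim exE)
  then show ?thesis by (intro exI[of _ "g * y - y * g"] conjI eq)
qed

text \<open>For \<open>g\<close> not scalar, \<open>del g\<close> and \<open>del (star g)\<close>
  are conjugate, so they have equal moduli, while their product is scalar. The modulus of
  \<open>del g\<close> is then positive with square one.\<close>

lemma modulus_Sh:
  assumes "s \<in> Sh"
  shows "cs.modulus s = 1"
proof -
  obtain g X Z where s: "s = del g * uel X Z" "nrm g \<noteq> 0" "tr Z = - nrm X" using assms by (auto simp: Sh_eq)
  have "cs.modulus (del g) = 1"
  proof (cases "\<exists>c. g = sc c")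
    case True
    then obtain c where c: "g = sc c" by blast
    then show ?thesis using s(2) by (intro modulus_scalar) (auto simp: scalars_def)
  next
    case False
    then obtain h where h: "nrm h \<noteq> 0" "h * g = star g * h" using star_conjugate[of g] by blast
    have n: "nrm (star g) \<noteq> 0" "nrm (sc (nrm g)) \<noteq> 0" using s(2) by simp_all
    have "del h * del g = del (star g) * del h" using h s(2) n by (simp add: del_mult)
    from arg_cong[OF this, of cs.modulus] have "cs.modulus (del g) = cs.modulus (del (star g))"
      using cs.modulus_pos[of "del h"] by (simp add: cs.modulus_mult)
    moreover have "del (star g) * del g = del (sc (nrm g))" using s(2) n by (simp add: del_mult mult_star)
    from arg_cong[OF this, of cs.modulus] have "cs.modulus (del (star g)) * cs.modulus (del g) = 1"
      using s(2) modulus_scalar[of "del (sc (nrm g))"] by (auto simp: cs.modulus_mult scalars_def)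
    ultimately have "cs.modulus (del g) * cs.modulus (del g) = 1" by simp
    then show ?thesis using cs.modulus_pos[of "del g"] by (metis abs_of_pos abs_square_eq_1 power2_eq_square)
  qed
  then show ?thesis unfolding s(1) cs.modulus_mult modulus_uel[OF s(3)] by simp
qed

end

section \<open>Continuous families of stabilizers and involutions\<close>

locale shalika_distribution = shalika p absv \<psi>
  for p :: nat and absv :: "'k::{field_char_0,metric_space} \<Rightarrow> real" and \<psi> :: "'k \<Rightarrow> complex" +
  fixes D :: "('k gsp6 \<Rightarrow> complex) \<Rightarrow> complex"
  assumes skew_D: "cs.skew_distribution Sh (chi \<psi>) eps D"
begin

sublocale sk: skew_system KKs Sh scalars "chi \<psi>" eps D
proof
  show "subgp (Sh :: 'k gsp6 set)" by (rule Sh_subgp)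
  show "chi \<psi> (s * t) = chi \<psi> s * chi \<psi> t" if "s \<in> Sh" "t \<in> Sh" for s t by (rule chi_mult[OF psi that])
  show "chi \<psi> s \<noteq> 0" if "s \<in> Sh" for s by (rule chi_nonzero[OF psi that])
  show "\<exists>N\<in>KKs. \<forall>s\<in>Sh \<inter> N. chi \<psi> s = 1" by (rule chi_smooth)
  show "eps * eps = (1 :: 'k gsp6)" by (rule eps_sq)
  show "eps * s * eps \<in> Sh" if "s \<in> Sh" for s :: "'k gsp6" by (rule eps_Sh[OF that])
  show "chi \<psi> (eps * s * eps) = inverse (chi \<psi> s)" if "s \<in> Sh" for s by (rule chi_eps[OF psi that])
  show "scalars \<subseteq> K" if "K \<in> KKs" for K :: "'k gsp6 set" by (rule KKsD(2)[OF that])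
  show "z * x = x * z" if "z \<in> scalars" for z x :: "'k gsp6" by (rule scalars_central[OF that])
  show "cs.skew_distribution Sh (chi \<psi>) eps D" by (rule skew_D)
qed

lemma invariantD:
  assumes "sk.invariant E" "x \<in> E"
  shows "s \<in> Sh \<Longrightarrow> t \<in> Sh \<Longrightarrow> s * x * t \<in> E" "z \<in> scalars \<Longrightarrow> x * z \<in> E"
proof -
  show 1: "s * x * t \<in> E" if "s \<in> Sh" "t \<in> Sh" for s t
    using assms that unfolding sk.invariant_def by simp
  show "x * z \<in> E" if "z \<in> scalars"
    using 1[of 1 z] subgpD(1)[OF Sh_subgp] subsetD[OF scalars_Sh that] by simp
qed

lemma closed_residue:
  assumes E: "closed E"
  shows "closed (sk.residue E)"
proof -
  let ?A = "{x. sk.killable E x}"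
  have "open ?A"
  proof (subst open_subopen, intro ballI)
    fix x assume "x \<in> ?A"
    then have "sk.killable E x" by simp
    from sk.killable_coset[OF this] obtain K where K: "K \<in> KKs" "\<forall>y\<in>lcos x K. sk.killable E y" by (elim bexE)
    then show "\<exists>T. open T \<and> x \<in> T \<and> T \<subseteq> ?A"
      using open_lcos[OF KKsD(3)[OF K(1)]] mem_lcos_self[OF KKsD(1)[OF K(1)]] by (intro exI[of _ "lcos x K"]) auto
  qed
  then have "closed (E \<inter> - ?A)" using E by (intro closed_Int) (simp_all only: closed_Compl)
  moreover have "E \<inter> - ?A = sk.residue E" unfolding sk.residue_def by auto
  ultimately show ?thesis by simp
qed

text \<open>Progress of the localization is recorded by the equations \<open>P\<close> alone; the
  closed invariant set carrying \<open>D\<close> stays anonymous.\<close>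

definition stage :: "('k gsp6 \<Rightarrow> bool) \<Rightarrow> bool" where
  "stage P \<longleftrightarrow> (\<exists>E. sk.annihilated E \<and> closed E \<and> sk.invariant E \<and> (\<forall>x\<in>E. P x))"

lemma stage_all: "stage (\<lambda>x. True)"
  unfolding stage_def
proof (intro exI[of _ UNIV] conjI)
  show "sk.annihilated UNIV"
    unfolding sk.annihilated_def
  proof (intro allI impI)
    fix f assume f: "cs.testf f" "\<forall>x\<in>UNIV. f x = 0"
    then have "f = (\<lambda>x. 0 * f x)" by (simp add: fun_eq_iff)
    then show "D f = 0" using sk.D_scale[OF f(1), of 0] by simp
  qed
qed (simp_all add: sk.invariant_def)

text \<open>The new set consists of the points of the old one that are not killable. Every point
  violating \<open>Q\<close> must be killed using only closedness, invariance and the equations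
  \<open>P\<close>.\<close>

lemma stage_step:
  assumes P: "stage P"
    and kill: "\<And>E x. closed E \<Longrightarrow> sk.invariant E \<Longrightarrow> (\<And>y. y \<in> E \<Longrightarrow> P y) \<Longrightarrow> x \<in> E \<Longrightarrow> \<not> Q x \<Longrightarrow> sk.killable E x"
  shows "stage (\<lambda>x. P x \<and> Q x)"
proof -
  obtain E where E: "sk.annihilated E" "closed E" "sk.invariant E" "\<And>x. x \<in> E \<Longrightarrow> P x"
    using P unfolding stage_def by auto
  have cov: "sk.coverable E"
    unfolding sk.coverable_def
  proof (intro allI ballI impI)
    fix A L :: "'k gsp6 set" and r :: "'k gsp6 \<Rightarrow> 'k gsp6 set"
    assume "L \<in> KKs" "finite (cosets A L)" and 1: "\<forall>x\<in>A. \<forall>k\<in>L. x * k \<in> A" and 2: "\<forall>x\<in>A \<inter> E. r x \<in> KKs"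
    then show "\<exists>I\<subseteq>A \<inter> E. finite I \<and> A \<inter> E \<subseteq> (\<Union>x\<in>I. lcos x (r x))"
      by (intro closed_coverable[OF E(2) invariantD(2)[OF E(3)]]) auto
  qed
  show ?thesis
    unfolding stage_def
  proof (intro exI[of _ "sk.residue E"] conjI ballI)
    show "sk.annihilated (sk.residue E)"
      by (rule sk.annihilated_step[OF E(1) cov]) (simp add: sk.residue_def)
    show "closed (sk.residue E)" by (rule closed_residue[OF E(2)])
    show "sk.invariant (sk.residue E)" by (rule sk.invariant_residue[OF E(3)])
    fix x assume "x \<in> sk.residue E"
    then have x: "x \<in> E" "\<not> sk.killable E x" unfolding sk.residue_def by simp_all
    then show "P x" "Q x" using E(4) kill[OF E(2,3,4)] by auto
  qed
qed

definition rel_open :: "'k gsp6 set \<Rightarrow> 'k gsp6 set \<Rightarrow> bool" where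
  "rel_open E V \<longleftrightarrow> (\<exists>O'. open O' \<and> V = E \<inter> O')"

text \<open>
  The normal form \<open>W x\<close> of \<open>x\<close> has to depend continuously on \<open>x\<close>, since the killing criteria need a
  neighbourhood of \<open>x0\<close> on which the stabilizing elements vary continuously.
\<close>

definition moved :: "'k gsp6 set \<Rightarrow> ('k gsp6 \<Rightarrow> 'k gsp6) \<Rightarrow> bool" where
  "moved V W \<longleftrightarrow> (\<exists>S1 S2. continuous_on V S1 \<and> continuous_on V S2 \<and>
     (\<forall>x\<in>V. S1 x \<in> Sh \<and> S2 x \<in> Sh \<and> W x = S1 x * x * S2 x))"

lemma moved_id: "moved V (\<lambda>x. x)"
  unfolding moved_def by (intro exI[of _ "\<lambda>x. 1"] conjI) (simp_all add: subgpD(1)[OF Sh_subgp])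

lemma moved_step:
  assumes W: "moved V W" and s: "continuous_on V s" "continuous_on V t" "\<And>x. x \<in> V \<Longrightarrow> s x \<in> Sh" "\<And>x. x \<in> V \<Longrightarrow> t x \<in> Sh"
  shows "moved V (\<lambda>x. s x * W x * t x)"
proof -
  obtain S1 S2 where S: "continuous_on V S1" "continuous_on V S2" "\<And>x. x \<in> V \<Longrightarrow> S1 x \<in> Sh \<and> S2 x \<in> Sh \<and> W x = S1 x * x * S2 x"
    using W unfolding moved_def by auto
  have "continuous_on V (\<lambda>x. s x * S1 x)" "continuous_on V (\<lambda>x. S2 x * t x)" by (intro kcont S s)+
  moreover have "\<forall>x\<in>V. s x * S1 x \<in> Sh \<and> S2 x * t x \<in> Sh \<and> s x * W x * t x = s x * S1 x * x * (S2 x * t x)"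
  proof (intro ballI conjI)
    fix x assume x: "x \<in> V"
    show "s x * S1 x \<in> Sh" "S2 x * t x \<in> Sh"
      using S(3)[OF x] s(3,4)[OF x] by (auto intro: subgpD(2)[OF Sh_subgp])
    show "s x * W x * t x = s x * S1 x * x * (S2 x * t x)" using S(3)[OF x] by (simp add: mult.assoc)
  qed
  ultimately show ?thesis unfolding moved_def by (intro exI conjI)
qed

lemma moved_cont: "moved V W \<Longrightarrow> continuous_on V W"
proof -
  assume "moved V W"
  then obtain S1 S2 where S: "continuous_on V S1" "continuous_on V S2" "\<And>x. x \<in> V \<Longrightarrow> W x = S1 x * x * S2 x"
    unfolding moved_def by auto
  have "continuous_on V (\<lambda>x. S1 x * x * S2 x)" by (intro kcont S)
  then show ?thesis using S(3) by (simp cong: continuous_on_cong)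
qed

lemma moved_mem: "moved V W \<Longrightarrow> rel_open E V \<Longrightarrow> sk.invariant E \<Longrightarrow> x \<in> V \<Longrightarrow> W x \<in> E"
proof -
  assume *: "moved V W" "rel_open E V" "sk.invariant E" "x \<in> V"
  then have "x \<in> E" unfolding rel_open_def by auto
  then show ?thesis using *(1,4) invariantD(1)[OF *(3)] unfolding moved_def by fastforce
qed

lemma rel_open_nbhd:
  assumes V: "rel_open E V" "x0 \<in> V" and f: "continuous_on V f" and U: "open U" "f x0 \<in> U"
  shows "\<exists>S. open S \<and> x0 \<in> S \<and> (\<forall>y\<in>E \<inter> S. y \<in> V \<and> f y \<in> U)"
proof -
  obtain Q where Q: "open Q" "V = E \<inter> Q" using V(1) unfolding rel_open_def by auto
  obtain T where T: "open T" "T \<inter> V = f -` U \<inter> V" using f U(1) unfolding continuous_on_open_invariant by metis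
  have "x0 \<in> T \<inter> V" unfolding T(2) using V(2) U(2) by simp
  moreover have "y \<in> V \<and> f y \<in> U" if "y \<in> E \<inter> (T \<inter> Q)" for y
  proof -
    have "y \<in> T \<inter> V" using that Q(2) by simp
    then show ?thesis unfolding T(2) by simp
  qed
  ultimately show ?thesis using T(1) Q V(2) by (intro exI[of _ "T \<inter> Q"] conjI ballI) (auto intro: open_Int)
qed

text \<open>Undoing \<open>W x = S1 x * x * S2 x\<close> replaces \<open>s\<close> by
  \<open>inverse (S1 x) * s x * (eps * inverse (S2 x) * eps)\<close> and conjugates the square by
  \<open>S2 x\<close>, which does nothing to a scalar.\<close>

lemma kill_involution:
  assumes E: "sk.invariant E" and V: "rel_open E V" "x0 \<in> V" and W: "moved V W"
    and s: "continuous_on V s" "\<And>x. x \<in> V \<Longrightarrow> s x \<in> Sh"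
    and inv: "\<And>x. x \<in> V \<Longrightarrow> (inverse (W x) * (s x * eps)) * (inverse (W x) * (s x * eps)) \<in> scalars"
  shows "sk.killable E x0"
proof -
  obtain S1 S2 where S: "continuous_on V S1" "continuous_on V S2" "\<And>x. x \<in> V \<Longrightarrow> S1 x \<in> Sh" "\<And>x. x \<in> V \<Longrightarrow> S2 x \<in> Sh"
    "\<And>x. x \<in> V \<Longrightarrow> W x = S1 x * x * S2 x"
    using W unfolding moved_def by auto
  define s' where "s' x = inverse (S1 x) * s x * (eps * inverse (S2 x) * eps)" for x
  have s': "continuous_on V s'" unfolding s'_def by (intro kcont S s)
  have s'S: "s' x \<in> Sh" if "x \<in> V" for x
    unfolding s'_def by (intro subgpD(2)[OF Sh_subgp] subgpD(3)[OF Sh_subgp] eps_Sh S(3,4) s(2) that)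
  have inv': "(inverse x * (s' x * eps)) * (inverse x * (s' x * eps)) \<in> scalars" if "x \<in> V" for x
  proof -
    let ?w = "inverse (W x) * (s x * eps)"
    have "inverse x * (s' x * eps) = S2 x * ?w * inverse (S2 x)"
      unfolding S(5)[OF that] s'_def by (simp add: mult.assoc eps_sq)
    then have "(inverse x * (s' x * eps)) * (inverse x * (s' x * eps)) = S2 x * (?w * ?w) * inverse (S2 x)"
      by (simp add: mult.assoc)
    also have "\<dots> = ?w * ?w * S2 x * inverse (S2 x)" unfolding scalars_central[OF inv[OF that], of "S2 x"] ..
    also have "\<dots> = ?w * ?w" unfolding mult.assoc[of "?w * ?w"] mult_inv_self mult_1_right ..
    finally show ?thesis using inv[OF that] by simp
  qed
  have K1: "Krz (1/2) \<in> KKs" by (rule Krz_KKs) simp_all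
  have "continuous_on V (\<lambda>x. s' x * inverse (s' x0))" by (intro kcont s')
  moreover have "s' x0 * inverse (s' x0) \<in> Krz (1/2)" using subgpD(1)[OF KKsD(1)[OF K1]] by simp
  ultimately obtain T where T: "open T" "x0 \<in> T" "\<And>y. y \<in> E \<inter> T \<Longrightarrow> y \<in> V \<and> s' y * inverse (s' x0) \<in> Krz (1/2)"
    using rel_open_nbhd[OF V _ KKsD(3)[OF K1]] by metis
  \<comment> \<open>Cosets of members of \<open>KKs\<close> are small only up to scalars, so the
    continuous data are evaluated at a scalar multiple \<open>y * z\<close> of the point.\<close>
  obtain K where K: "K \<in> KKs" "\<And>y. y \<in> lcos x0 K \<Longrightarrow> \<exists>z\<in>scalars. y * z \<in> T" using KKs_nbhd[OF T(1,2)] by metis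
  show ?thesis
  proof (rule sk.killable_involution[OF E K(1) K1 s'S[OF V(2)]])
    fix y assume y: "y \<in> lcos x0 K" "y \<in> E"
    obtain z where z: "z \<in> scalars" "y * z \<in> T" using K(2)[OF y(1)] by (elim bexE)
    have yz: "y * z \<in> V" "s' (y * z) * inverse (s' x0) \<in> Krz (1/2)" using T(3)[of "y * z"] z invariantD(2)[OF E y(2)] by auto
    have a: "s' (y * z) * inverse (s' x0) \<in> Sh \<inter> Krz (1/2)"
      using yz(2) subgpD(2)[OF Sh_subgp s'S[OF yz(1)] subgpD(3)[OF Sh_subgp s'S[OF V(2)]]] by simp
    let ?w = "inverse y * (s' (y * z) * eps)"
    have w: "inverse (y * z) * (s' (y * z) * eps) = inverse z * ?w" by (simp add: mult.assoc)
    have zi: "inverse z \<in> scalars" by (rule subgpD(3)[OF scalars_subgp z(1)])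
    have "?w * ?w = (z * z) * ((inverse z * ?w) * (inverse z * ?w))"
    proof -
      have "(inverse z * ?w) * (inverse z * ?w) = inverse z * (?w * inverse z) * ?w" by (simp add: mult.assoc)
      also have "\<dots> = inverse z * (inverse z * (?w * ?w))" unfolding scalars_central[OF zi, of ?w, symmetric] by (simp only: mult.assoc)
      finally show ?thesis by (simp only: mult.assoc mult_inv_cancel)
    qed
    also have "\<dots> \<in> scalars"
      using subgpD(2)[OF scalars_subgp subgpD(2)[OF scalars_subgp z(1,1)] inv'[OF yz(1)]] unfolding w .
    finally have ww: "?w * ?w \<in> scalars" .
    show "\<exists>a\<in>Sh \<inter> Krz (1 / 2). (inverse y * (a * s' x0 * eps)) * (inverse y * (a * s' x0 * eps)) \<in> scalars"
      by (rule bexI[OF _ a]) (use ww in \<open>simp add: mult.assoc\<close>)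
  qed
qed

text \<open>At \<open>x0\<close> the transported elements are conjugate to each other by
  \<open>x0\<close>, so an open subgroup compact modulo the centre around one yields one around the
  other. By continuity, nearby stabilizing elements stay in these subgroups and have locally
  constant characters.\<close>

lemma kill_stabilizer:
  assumes E: "sk.invariant E" and V: "rel_open E V" "x0 \<in> V" and W: "moved V W"
    and ab: "continuous_on V a" "continuous_on V b" "\<And>x. x \<in> V \<Longrightarrow> a x \<in> Sh" "\<And>x. x \<in> V \<Longrightarrow> b x \<in> Sh"
      "\<And>x. x \<in> V \<Longrightarrow> a x * W x = W x * b x"
    and K0: "a x0 \<in> K0 \<or> b x0 \<in> K0" "K0 \<in> KKs" and neq: "chi \<psi> (a x0) \<noteq> chi \<psi> (b x0)"
  shows "sk.killable E x0"
proof -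
  obtain S1 S2 where S: "continuous_on V S1" "continuous_on V S2" "\<And>x. x \<in> V \<Longrightarrow> S1 x \<in> Sh" "\<And>x. x \<in> V \<Longrightarrow> S2 x \<in> Sh"
    "\<And>x. x \<in> V \<Longrightarrow> W x = S1 x * x * S2 x"
    using W unfolding moved_def by auto
  define a' where "a' x = inverse (S1 x) * a x * S1 x" for x
  define b' where "b' x = S2 x * b x * inverse (S2 x)" for x
  have c: "continuous_on V a'" "continuous_on V b'" unfolding a'_def b'_def by (intro kcont S ab)+
  have aS: "a' x \<in> Sh" "b' x \<in> Sh" if "x \<in> V" for x
    unfolding a'_def b'_def by (intro subgpD(2)[OF Sh_subgp] subgpD(3)[OF Sh_subgp] S(3,4) ab(3,4) that)+
  have eq: "a' x * x = x * b' x" if "x \<in> V" for x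
  proof -
    have "a x * (S1 x * x * S2 x) = S1 x * x * S2 x * b x" using ab(5)[OF that] unfolding S(5)[OF that] .
    then have "inverse (S1 x) * (a x * (S1 x * x * S2 x)) * inverse (S2 x) = inverse (S1 x) * (S1 x * x * S2 x * b x) * inverse (S2 x)" by simp
    then show ?thesis unfolding a'_def b'_def by (simp add: mult.assoc)
  qed
  have chi_conj: "chi \<psi> (u * s * inverse u) = chi \<psi> s" "chi \<psi> (inverse u * s * u) = chi \<psi> s" if us: "u \<in> Sh" "s \<in> Sh" for u s
  proof -
    note ui = subgpD(3)[OF Sh_subgp us(1)]
    show "chi \<psi> (u * s * inverse u) = chi \<psi> s"
      using chi_nonzero[OF psi us(1)]
      by (simp add: chi_mult[OF psi subgpD(2)[OF Sh_subgp us] ui] chi_mult[OF psi us] chi_inverse[OF us(1)])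
    show "chi \<psi> (inverse u * s * u) = chi \<psi> s"
      using chi_nonzero[OF psi us(1)]
      by (simp add: chi_mult[OF psi subgpD(2)[OF Sh_subgp ui us(2)] us(1)] chi_mult[OF psi ui us(2)] chi_inverse[OF us(1)])
  qed
  have neq': "chi \<psi> (a' x0) \<noteq> chi \<psi> (b' x0)"
    unfolding a'_def b'_def using neq V(2) by (simp add: chi_conj S(3,4) ab(3,4))
  have "\<exists>K\<in>KKs. b' x0 \<in> K"
    using K0(1)
  proof
    assume "b x0 \<in> K0"
    then have "b' x0 \<in> conjs (S2 x0) K0" unfolding b'_def conjs_def by (simp add: mult.assoc)
    then show ?thesis using cs.KK_conjs[OF K0(2)] by (intro bexI)
  next
    assume "a x0 \<in> K0"
    then have "a' x0 \<in> conjs (inverse (S1 x0)) K0" unfolding a'_def conjs_def by (simp add: mult.assoc)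
    moreover have "a' x0 = x0 * b' x0 * inverse x0" using eq[OF V(2)] by (simp flip: eq[OF V(2)] add: mult.assoc)
    ultimately have "b' x0 \<in> conjs (inverse x0) (conjs (inverse (S1 x0)) K0)" by (simp add: conjs_def[of "inverse x0"])
    then show ?thesis using cs.KK_conjs[OF cs.KK_conjs[OF K0(2)]] by (intro bexI)
  qed
  then obtain K2 where K2: "K2 \<in> KKs" "b' x0 \<in> K2" by (elim bexE)
  define K1 where "K1 = conjs x0 K2"
  have K1: "K1 \<in> KKs" unfolding K1_def by (rule cs.KK_conjs[OF K2(1)])
  have ax0: "a' x0 \<in> K1" unfolding K1_def conjs_def using eq[OF V(2)] K2(2) by (simp add: mult.assoc)
  obtain N where N: "N \<in> KKs" "\<And>s. s \<in> Sh \<Longrightarrow> s \<in> N \<Longrightarrow> chi \<psi> s = 1" using chi_smooth by auto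
  have nbhd: "\<exists>S. open S \<and> x0 \<in> S \<and> (\<forall>y\<in>E \<inter> S. y \<in> V \<and> g y \<in> M \<and> chi \<psi> (g y) = chi \<psi> (g x0))"
    if g: "continuous_on V g" "\<And>x. x \<in> V \<Longrightarrow> g x \<in> Sh" "g x0 \<in> M" "M \<in> KKs" for g M
  proof -
    have MN: "M \<inter> N \<in> KKs" by (rule cs.KK_Int[OF g(4) N(1)])
    have "continuous_on V (\<lambda>x. inverse (g x0) * g x)" by (intro kcont g)
    moreover have "inverse (g x0) * g x0 \<in> M \<inter> N" using subgpD(1)[OF KKsD(1)[OF MN]] by simp
    ultimately obtain T where T: "open T" "x0 \<in> T" "\<And>y. y \<in> E \<inter> T \<Longrightarrow> y \<in> V \<and> inverse (g x0) * g y \<in> M \<inter> N"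
      using rel_open_nbhd[OF V _ KKsD(3)[OF MN]] by metis
    have "y \<in> V \<and> g y \<in> M \<and> chi \<psi> (g y) = chi \<psi> (g x0)" if y: "y \<in> E \<inter> T" for y
    proof -
      have yV: "y \<in> V" and yM: "inverse (g x0) * g y \<in> M" and yN: "inverse (g x0) * g y \<in> N" using T(3)[OF y] by auto
      have "g x0 * (inverse (g x0) * g y) \<in> M" by (rule subgpD(2)[OF KKsD(1)[OF g(4)] g(3) yM])
      moreover have h: "inverse (g x0) * g y \<in> Sh" by (rule subgpD(2)[OF Sh_subgp subgpD(3)[OF Sh_subgp g(2)[OF V(2)]] g(2)[OF yV]])
      have "chi \<psi> (g x0 * (inverse (g x0) * g y)) = chi \<psi> (g x0)"
        using chi_mult[OF psi g(2)[OF V(2)] h] N(2)[OF h yN] by simp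
      ultimately show ?thesis using yV by simp
    qed
    then show ?thesis using T(1,2) by (intro exI[of _ T] conjI) auto
  qed
  obtain T1 where T1: "open T1" "x0 \<in> T1" "\<And>y. y \<in> E \<inter> T1 \<Longrightarrow> y \<in> V \<and> a' y \<in> K1 \<and> chi \<psi> (a' y) = chi \<psi> (a' x0)"
    using nbhd[OF c(1) aS(1) ax0 K1] by auto
  obtain T2 where T2: "open T2" "x0 \<in> T2" "\<And>y. y \<in> E \<inter> T2 \<Longrightarrow> y \<in> V \<and> b' y \<in> K2 \<and> chi \<psi> (b' y) = chi \<psi> (b' x0)"
    using nbhd[OF c(2) aS(2) K2(2,1)] by auto
  obtain K where K: "K \<in> KKs" "\<And>y. y \<in> lcos x0 K \<Longrightarrow> \<exists>z\<in>scalars. y * z \<in> T1 \<inter> T2"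
    using KKs_nbhd[OF open_Int[OF T1(1) T2(1)] IntI[OF T1(2) T2(2)]] by metis
  show ?thesis
  proof (rule sk.killable_stabilizer[OF E K(1) K1 K2(1)])
    fix y assume y: "y \<in> lcos x0 K" "y \<in> E"
    obtain z where z: "z \<in> scalars" "y * z \<in> T1 \<inter> T2" using K(2)[OF y(1)] by (elim bexE)
    have yz: "y * z \<in> E" by (rule invariantD(2)[OF E y(2) z(1)])
    have 1: "y * z \<in> V" "a' (y * z) \<in> K1" "chi \<psi> (a' (y * z)) = chi \<psi> (a' x0)" using T1(3)[of "y * z"] yz z(2) by auto
    have 2: "b' (y * z) \<in> K2" "chi \<psi> (b' (y * z)) = chi \<psi> (b' x0)" using T2(3)[of "y * z"] yz z(2) by auto
    have "a' (y * z) * (y * z) = y * z * b' (y * z)" by (rule eq[OF 1(1)])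
    then have "a' (y * z) * y * z = y * b' (y * z) * z" using scalars_central[OF z(1), of "b' (y * z)"] by (simp add: mult.assoc)
    then have "a' (y * z) * y = y * b' (y * z)" by simp
    moreover have "a' (y * z) \<in> Sh \<inter> K1" "b' (y * z) \<in> Sh \<inter> K2" using 1 2 aS by simp_all
    moreover have "chi \<psi> (a' (y * z)) \<noteq> chi \<psi> (b' (y * z))" using neq' 1 2 by simp
    ultimately show "\<exists>a\<in>Sh \<inter> K1. \<exists>b\<in>Sh \<inter> K2. a * y = y * b \<and> chi \<psi> a \<noteq> chi \<psi> b" by (intro bexI conjI)
  qed
qed

lemma killable_transport:
  assumes "sk.invariant E" "s \<in> Sh" "t \<in> Sh" "sk.killable E (s * x * t)"
  shows "sk.killable E x"
  using sk.killable_translate[OF assms(1,4) subgpD(3)[OF Sh_subgp assms(2)] subgpD(3)[OF Sh_subgp assms(3)]]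
  by (simp add: mult.assoc)

end

lemma inverse_del: "nrm g \<noteq> 0 \<Longrightarrow> inverse (del g) = del (sc (1 / nrm g) * star g)"
proof (rule inv_unique)
  assume g: "nrm g \<noteq> 0"
  have n: "nrm (sc (1 / nrm g) * star g) \<noteq> 0" using g by simp
  show "del g * del (sc (1 / nrm g) * star g) = 1"
  proof (rule bl_eqI)
    fix i j
    have "g * (sc (1 / nrm g) * star g) = 1"
      unfolding sc_left[of g "1 / nrm g"] mult_star using g by (rule sc_inverse)
    then show "bl (del g * del (sc (1 / nrm g) * star g)) i j = bl 1 i j"
      by (simp add: bl_del_mult[OF g] bl_del[OF n] bl_one del: sc_simps)
  qed
qed

lemma bl_conj_uel:
  assumes t: "tr Z = - nrm X"
  shows "bl (x * uel X Z * inverse x) i j = (if i = j then 1 else 0) +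
    sc (1 / sim x) * (bl x i 1 * X * star (bl x (rv j) 2) + bl x i 1 * Z * star (bl x (rv j) 1)
      - bl x i 2 * star X * star (bl x (rv j) 1))"
proof -
  have s: "A * (sc (1 / sim x) * B) = sc (1 / sim x) * (A * B)" for A B by (rule sc_left)
  have "bl (x * inverse x) i j = bl x i 1 * bl (inverse x) 1 j + bl x i 2 * bl (inverse x) 2 j + bl x i 3 * bl (inverse x) 3 j"
    by (rule bl_mult)
  then have 1: "bl x i 1 * bl (inverse x) 1 j + bl x i 2 * bl (inverse x) 2 j + bl x i 3 * bl (inverse x) 3 j = (if i = j then 1 else 0)"
    by (simp add: bl_one)
  have "bl (x * uel X Z * inverse x) i j = (bl x i 1 * bl (inverse x) 1 j + bl x i 2 * bl (inverse x) 2 j + bl x i 3 * bl (inverse x) 3 j)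
     + (bl x i 1 * X * bl (inverse x) 2 j + bl x i 1 * Z * bl (inverse x) 3 j - bl x i 2 * star X * bl (inverse x) 3 j)"
    unfolding bl_mult[of "x * uel X Z"] bl_mult_uel[OF t] by (simp add: algebra_simps)
  also have "bl x i 1 * X * bl (inverse x) 2 j + bl x i 1 * Z * bl (inverse x) 3 j - bl x i 2 * star X * bl (inverse x) 3 j =
    sc (1 / sim x) * (bl x i 1 * X * star (bl x (rv j) 2) + bl x i 1 * Z * star (bl x (rv j) 1)
      - bl x i 2 * star X * star (bl x (rv j) 1))"
    unfolding bl_inverse rv_simps s by (simp only: distrib_left right_diff_distrib)
  finally show ?thesis unfolding 1 .
qed

lemma rank_one_entry:
  assumes "M \<noteq> (0 :: 'k::field m2)"
  shows "\<exists>g h. nrm g \<noteq> 0 \<and> nrm h \<noteq> 0 \<and> e12 (g * M * h) \<noteq> 0"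
proof -
  let ?I = "1 :: 'k m2" and ?J = "M2 0 1 1 0 :: 'k m2"
  have n: "nrm ?I \<noteq> 0" "nrm ?J \<noteq> 0" by (simp_all add: nrm_def)
  have "e12 (?I * M * ?I) = e12 M" "e12 (?I * M * ?J) = e11 M" "e12 (?J * M * ?I) = e22 M" "e12 (?J * M * ?J) = e21 M"
    by simp_all
  moreover have "e12 M \<noteq> 0 \<or> e11 M \<noteq> 0 \<or> e22 M \<noteq> 0 \<or> e21 M \<noteq> 0" using assms by (auto simp: m2_eq_iff)
  ultimately show ?thesis using n by metis
qed

text \<open>Row and column operations that divide only by the entry \<open>e12\<close>; they vary
  continuously wherever that entry is nonzero.\<close>

lemma rank_one_normal:
  assumes "nrm M = 0" "e12 M \<noteq> (0 :: 'k::field)"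
  shows "M2 (1 / e12 M) 0 (- e22 M / e12 M) 1 * M * M2 1 0 (- e11 M / e12 M) 1 = M2 0 1 0 0"
proof -
  have "e11 M * e22 M = e12 M * e21 M" using assms(1) by (simp add: nrm_def)
  then show ?thesis using assms(2) by (simp add: m2_eq_iff field_simps)
qed

lemma involution_swap:
  assumes "(inverse y * w) * (inverse y * w) \<in> scalars"
  shows "(inverse w * y) * (inverse w * y) \<in> scalars"
  using subgpD(3)[OF scalars_subgp assms] by (simp add: mult.assoc)

lemma bl_eps_mult: "bl (eps * x) i j = (if i = 2 then - bl x i j else bl x i j)"
  by (induct i rule: index3) (simp_all add: bl_mult bl_eps)

context shalika_distribution
begin

lemma psi_scale: "t \<noteq> 0 \<Longrightarrow> \<exists>c. \<psi> (c * t) \<noteq> 1"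
proof -
  assume t: "t \<noteq> 0"
  obtain x where "\<psi> x \<noteq> 1" using psi_nontrivial unfolding nontrivial_character_def by (elim exE)
  then have "\<psi> ((x / t) * t) \<noteq> 1" using t by simp
  then show ?thesis by (rule exI)
qed

lemma rel_open_all: "rel_open E E"
  unfolding rel_open_def by (intro exI[of _ UNIV]) simp

lemma rel_open_sub:
  assumes "rel_open E V" "continuous_on V f"
  shows "rel_open E {x \<in> V. f x \<noteq> (0 :: 'k)}"
proof -
  obtain Q where Q: "open Q" "V = E \<inter> Q" using assms(1) unfolding rel_open_def by auto
  have "open (- {0 :: 'k})" by (intro open_Compl) simp
  then obtain T where T: "open T" "T \<inter> V = f -` (- {0}) \<inter> V" using assms(2) unfolding continuous_on_open_invariant by metis
  have "{x \<in> V. f x \<noteq> 0} = f -` (- {0}) \<inter> V" by auto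
  also have "\<dots> = E \<inter> (T \<inter> Q)" unfolding T(2)[symmetric] using Q(2) by auto
  finally show ?thesis unfolding rel_open_def using open_Int[OF T(1) Q(1)] by (intro exI conjI)
qed

lemma moved_mono: "moved V W \<Longrightarrow> U \<subseteq> V \<Longrightarrow> moved U W"
  unfolding moved_def by (meson continuous_on_subset subsetD)

lemma moved_del:
  assumes W: "moved V W" and g: "mcont V g" "\<And>x. x \<in> V \<Longrightarrow> nrm (g x) \<noteq> 0"
    and h: "mcont V h" "\<And>x. x \<in> V \<Longrightarrow> nrm (h x) \<noteq> 0"
  shows "moved V (\<lambda>x. del (g x) * W x * del (h x))"
  by (intro moved_step[OF W] kcont g h Sh_del)

lemma moved_uel:
  assumes W: "moved V W" and XZ: "mcont V X" "mcont V Z" "\<And>x. x \<in> V \<Longrightarrow> tr (Z x) = - nrm (X x)"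
    and XZ': "mcont V X'" "mcont V Z'" "\<And>x. x \<in> V \<Longrightarrow> tr (Z' x) = - nrm (X' x)"
  shows "moved V (\<lambda>x. uel (X x) (Z x) * W x * uel (X' x) (Z' x))"
  by (intro moved_step[OF W] kcont XZ XZ' Sh_uel)

lemma sim_uel2: "tr Z = - nrm X \<Longrightarrow> tr Z' = - nrm X' \<Longrightarrow> sim (uel X Z * w * uel X' Z') = sim w"
  by (simp add: sim_mult bl_uel)

text \<open>With \<open>X\<close> of norm zero and \<open>Z\<close> of trace zero the condition on
  unipotent blocks survives scaling, and the equation \<open>a * W = W * b\<close> becomes linear in
  the pairs. The hypotheses \<open>eq1\<close>, \<open>eq2\<close>, \<open>eq3\<close> are its three
  block rows.\<close>

lemma kill_nilpotent:
  assumes E: "sk.invariant E" and V: "rel_open E V" "x0 \<in> V" and W: "moved V W"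
    and c: "mcont V X" "mcont V Z" "mcont V X'" "mcont V Z'"
    and n: "\<And>x. x \<in> V \<Longrightarrow> nrm (X x) = 0 \<and> tr (Z x) = 0 \<and> nrm (X' x) = 0 \<and> tr (Z' x) = 0"
    and eq1: "\<And>x. x \<in> V \<Longrightarrow> X' x * bl (W x) 2 1 + Z' x * bl (W x) 3 1 = 0 \<and>
        X' x * bl (W x) 2 2 + Z' x * bl (W x) 3 2 = bl (W x) 1 1 * X x \<and>
        X' x * bl (W x) 2 3 + Z' x * bl (W x) 3 3 = bl (W x) 1 1 * Z x - bl (W x) 1 2 * star (X x)"
    and eq2: "\<And>x. x \<in> V \<Longrightarrow> star (X' x) * bl (W x) 3 1 = 0 \<and>
        - (star (X' x) * bl (W x) 3 2) = bl (W x) 2 1 * X x \<and>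
        - (star (X' x) * bl (W x) 3 3) = bl (W x) 2 1 * Z x - bl (W x) 2 2 * star (X x)"
    and eq3: "\<And>x. x \<in> V \<Longrightarrow> bl (W x) 3 1 * X x = 0 \<and> bl (W x) 3 1 * Z x = bl (W x) 3 2 * star (X x)"
    and neq: "tr (X' x0) \<noteq> tr (X x0)"
  shows "sk.killable E x0"
proof -
  \<comment> \<open>Nontriviality of \<psi> enters here: some multiple of the nonzero difference of
    traces lies outside its kernel.\<close>
  obtain k where k: "\<psi> (k * (tr (X' x0) - tr (X x0))) \<noteq> 1" using psi_scale neq by (metis right_minus_eq)
  let ?a = "\<lambda>x. uel (sc k * X' x) (sc k * Z' x)" and ?b = "\<lambda>x. uel (sc k * X x) (sc k * Z x)"
  have t: "tr (sc k * Z x) = - nrm (sc k * X x)" "tr (sc k * Z' x) = - nrm (sc k * X' x)" if "x \<in> V" for x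
    using n[OF that] by simp_all
  have s: "A * (sc k * B) = sc k * (A * B)" "star (sc k * B) = sc k * star B" for A B :: "'k m2"
    by (rule sc_left, simp add: sc_comm)
  have eq: "?a x * W x = W x * ?b x" if x: "x \<in> V" for x
  proof (rule bl_eqI3; unfold bl_uel_mult[OF t(2)[OF x]] bl_mult_uel[OF t(1)[OF x]] s mult.assoc)
    note e = eq1[OF x] eq2[OF x] eq3[OF x]
    have sc: "sc k * A + sc k * B = sc k * (A + B)" "sc k * A - sc k * B = sc k * (A - B)" for A B :: "'k m2" by (simp_all add: distrib_left right_diff_distrib)
    show "bl (W x) 1 1 + sc k * (X' x * bl (W x) 2 1) + sc k * (Z' x * bl (W x) 3 1) = bl (W x) 1 1"
      unfolding add.assoc sc using e by simp
    show "bl (W x) 1 2 + sc k * (X' x * bl (W x) 2 2) + sc k * (Z' x * bl (W x) 3 2) = sc k * (bl (W x) 1 1 * X x) + bl (W x) 1 2"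
      unfolding add.assoc sc using e by (simp add: add.commute)
    show "bl (W x) 1 3 + sc k * (X' x * bl (W x) 2 3) + sc k * (Z' x * bl (W x) 3 3) =
      sc k * (bl (W x) 1 1 * Z x) - sc k * (bl (W x) 1 2 * star (X x)) + bl (W x) 1 3"
      unfolding add.assoc sc using e by (simp add: add.commute)
    show "bl (W x) 2 1 - sc k * (star (X' x) * bl (W x) 3 1) = bl (W x) 2 1" using e by simp
    show "bl (W x) 2 2 - sc k * (star (X' x) * bl (W x) 3 2) = sc k * (bl (W x) 2 1 * X x) + bl (W x) 2 2"
    proof -
      have "bl (W x) 2 1 * X x = - (star (X' x) * bl (W x) 3 2)" using e by simp
      then show ?thesis by simp
    qed
    show "bl (W x) 2 3 - sc k * (star (X' x) * bl (W x) 3 3) =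
      sc k * (bl (W x) 2 1 * Z x) - sc k * (bl (W x) 2 2 * star (X x)) + bl (W x) 2 3"
    proof -
      have "bl (W x) 2 1 * Z x - bl (W x) 2 2 * star (X x) = - (star (X' x) * bl (W x) 3 3)" using e by simp
      then show ?thesis unfolding sc by simp
    qed
    show "bl (W x) 3 2 = sc k * (bl (W x) 3 1 * X x) + bl (W x) 3 2" using e by simp
    show "bl (W x) 3 3 = sc k * (bl (W x) 3 1 * Z x) - sc k * (bl (W x) 3 2 * star (X x)) + bl (W x) 3 3"
      using e by simp
  qed simp
  obtain K0 where K0: "K0 \<in> KKs" "?b x0 \<in> K0" using uel_KKs[OF t(1)[OF V(2)]] by (elim bexE)
  have "chi \<psi> (?a x0) \<noteq> chi \<psi> (?b x0)"
  proof
    assume "chi \<psi> (?a x0) = chi \<psi> (?b x0)"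
    then have "\<psi> (- (k * tr (X' x0))) = \<psi> (- (k * tr (X x0)))" unfolding chi_uel[OF t(2)[OF V(2)]] chi_uel[OF t(1)[OF V(2)]] tr_simps(7) .
    then have "inverse (\<psi> (k * tr (X' x0))) = inverse (\<psi> (k * tr (X x0)))" by (simp only: psi_minus[OF psi])
    then have "\<psi> (k * tr (X' x0)) = \<psi> (k * tr (X x0))" by simp
    moreover have "\<psi> (k * (tr (X' x0) - tr (X x0))) = \<psi> (k * tr (X' x0)) * inverse (\<psi> (k * tr (X x0)))"
      using psi_add[OF psi, of "k * tr (X' x0)" "- (k * tr (X x0))"] by (simp add: psi_minus[OF psi] right_diff_distrib)
    ultimately show False using k psi_nonzero[OF psi] by simp
  qed
  then show ?thesis
    by (intro kill_stabilizer[OF E V W _ _ _ _ eq _ K0(1)] disjI2 K0(2) kcont c Sh_uel t)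
qed

end

section \<open>Killing the strata\<close>

text \<open>
  The blocks of \<open>x\<close> are written \<open>a1, a2, a3\<close> (first row), \<open>b1, b2, b3\<close> (second row) and \<open>C, d, e\<close> (third row);
  the double coset of \<open>x\<close> is stratified by the degeneration of \<open>C\<close>, then of \<open>d\<close> and \<open>b1\<close>.
\<close>

lemma trace_nondegenerate:
  assumes "K \<noteq> (0 :: 'k::field m2)"
  shows "\<exists>N. nrm N = 0 \<and> tr (K * N) \<noteq> 0"
proof -
  have "e11 K \<noteq> 0 \<or> e12 K \<noteq> 0 \<or> e21 K \<noteq> 0 \<or> e22 K \<noteq> 0" using assms by (auto simp: m2_eq_iff)
  moreover have "tr (K * M2 1 0 0 0) = e11 K" "tr (K * M2 0 0 1 0) = e12 K" "tr (K * M2 0 1 0 0) = e21 K" "tr (K * M2 0 0 0 1) = e22 K"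
    by (simp_all add: tr_def)
  moreover have "nrm (M2 1 0 0 0 :: 'k m2) = 0" "nrm (M2 0 0 1 0 :: 'k m2) = 0" "nrm (M2 0 1 0 0 :: 'k m2) = 0" "nrm (M2 0 0 0 1 :: 'k m2) = 0"
    by (simp_all add: nrm_def)
  ultimately have "(nrm (M2 1 0 0 0 :: 'k m2) = 0 \<and> tr (K * M2 1 0 0 0) \<noteq> 0) \<or> (nrm (M2 0 0 1 0 :: 'k m2) = 0 \<and> tr (K * M2 0 0 1 0) \<noteq> 0) \<or>
     (nrm (M2 0 1 0 0 :: 'k m2) = 0 \<and> tr (K * M2 0 1 0 0) \<noteq> 0) \<or> (nrm (M2 0 0 0 1 :: 'k m2) = 0 \<and> tr (K * M2 0 0 0 1) \<noteq> 0)" by auto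
  then show ?thesis by (elim disjE) (rule exI, assumption)+
qed

context shalika_distribution
begin

text \<open>Let \<open>r\<close> be the last block row of \<open>x\<close> and \<open>q\<close> the
  column of its reflected stars, which is \<open>sim x\<close> times the first column of
  \<open>inverse x\<close>. The right element minus one is
  \<open>q * C * e3 - e1 * star C * r\<close>, where \<open>e1\<close> and \<open>e3\<close> are the
  first unit column and the last unit row; this is strictly upper triangular since \<open>C\<close>
  has norm zero. Conjugation by \<open>x\<close> sends \<open>q\<close> to a multiple of
  \<open>e1\<close> and \<open>r\<close> to \<open>e3\<close>, so the left element has the same
  shape. No division occurs, so the formulas are continuous on all of \<open>E\<close>.\<close>

lemma kill_C_trace:
  assumes E: "sk.invariant E" and rk: "\<And>y. y \<in> E \<Longrightarrow> nrm (bl y 3 1) = 0" and x0: "x0 \<in> E"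
    and neq: "tr (star (bl x0 3 1) * (bl x0 2 1 + bl x0 3 2)) \<noteq> 0"
  shows "sk.killable E x0"
proof -
  let ?C = "\<lambda>x. bl x 3 1"
  let ?X = "\<lambda>x. - (star (?C x) * bl x 3 2)" and ?Z = "\<lambda>x. star (bl x 3 3) * ?C x - star (?C x) * bl x 3 3"
  let ?X' = "\<lambda>x. ?C x * star (bl x 2 1)" and ?Z' = "\<lambda>x. ?C x * star (bl x 1 1) - bl x 1 1 * star (?C x)"
  show ?thesis
  proof (rule kill_nilpotent[OF E rel_open_all x0 moved_id])
    show "mcont E ?X" "mcont E ?Z" "mcont E ?X'" "mcont E ?Z'" by (intro kcont)+
    fix x assume x: "x \<in> E"
    let ?a1 = "bl x 1 1" and ?a2 = "bl x 1 2" and ?a3 = "bl x 1 3" and ?b1 = "bl x 2 1" and ?b2 = "bl x 2 2" and ?b3 = "bl x 2 3"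
    let ?d = "bl x 3 2" and ?e = "bl x 3 3" and ?c = "bl x 3 1" and ?l = "sc (sim x)"
    have CC: "?c * star ?c = 0" "star ?c * ?c = 0" using rk[OF x] by (simp_all add: mult_star)
    show "nrm (?X x) = 0 \<and> tr (?Z x) = 0 \<and> nrm (?X' x) = 0 \<and> tr (?Z' x) = 0"
      using rk[OF x] tr_comm[of "star ?e" ?c] tr_simps(5)[of "star ?e * ?c"] tr_comm[of ?c "star ?a1"] tr_simps(5)[of "?c * star ?a1"] by simp
    have r33: "?c * star ?e + ?d * star ?d + ?e * star ?c = 0" using row_rel[of x 3 3] by simp
    have r23: "?b1 * star ?e + ?b2 * star ?d + ?b3 * star ?c = 0" using row_rel[of x 2 3] by simp
    have r13: "?a1 * star ?e + ?a2 * star ?d + ?a3 * star ?c = ?l" using row_rel[of x 1 3] by simp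
    have c11: "star ?c * ?a1 + star ?b1 * ?b1 + star ?a1 * ?c = 0" using col_rel[of x 1 1] by simp
    have c12: "star ?c * ?a2 + star ?b1 * ?b2 + star ?a1 * ?d = 0" using col_rel[of x 1 2] by simp
    have c13: "star ?c * ?a3 + star ?b1 * ?b3 + star ?a1 * ?e = ?l" using col_rel[of x 1 3] by simp
    have CCl: "?c * (star ?c * A) = 0" "star ?c * (?c * A) = 0" for A using CC by (simp_all flip: mult.assoc)
    have m11: "?c * star ?b1 * ?b1 + ?c * star ?a1 * ?c = 0"
      using arg_cong[OF c11, of "\<lambda>A. ?c * A"] by (simp add: distrib_left mult.assoc CCl)
    have m12: "?c * star ?b1 * ?b2 + ?c * star ?a1 * ?d = 0"
      using arg_cong[OF c12, of "\<lambda>A. ?c * A"] by (simp add: distrib_left mult.assoc CCl)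
    have m13: "?c * star ?b1 * ?b3 + ?c * star ?a1 * ?e = ?c * ?l"
      using arg_cong[OF c13, of "\<lambda>A. ?c * A"] by (simp add: distrib_left mult.assoc CCl)
    have n13: "?a1 * star ?e * ?c + ?a2 * star ?d * ?c = ?c * ?l"
      using arg_cong[OF r13, of "\<lambda>A. A * ?c"] by (simp add: distrib_right mult.assoc CC sc_comm[of ?c "sim x"])
    have n23: "?b1 * star ?e * ?c + ?b2 * star ?d * ?c = 0"
      using arg_cong[OF r23, of "\<lambda>A. A * ?c"] by (simp add: distrib_right mult.assoc CC)
    have n33: "?c * star ?e * ?c + ?d * star ?d * ?c = 0"
      using arg_cong[OF r33, of "\<lambda>A. A * ?c"] by (simp add: distrib_right mult.assoc CC)
    have "?X' x * ?b3 + ?Z' x * ?e = ?c * ?l - ?a1 * star ?c * ?e" using m13 by (simp add: left_diff_distrib mult.assoc add_diff_eq)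
    also have "\<dots> = ?a1 * ?Z x - ?a2 * star (?X x)" unfolding n13[symmetric] by (simp add: algebra_simps)
    finally have e13: "?X' x * ?b3 + ?Z' x * ?e = ?a1 * ?Z x - ?a2 * star (?X x)" .
    show "?X' x * ?b1 + ?Z' x * ?c = 0 \<and> ?X' x * ?b2 + ?Z' x * ?d = ?a1 * ?X x \<and>
        ?X' x * ?b3 + ?Z' x * ?e = ?a1 * ?Z x - ?a2 * star (?X x)"
      using m11 m12 e13 by (simp add: left_diff_distrib mult.assoc CC add_diff_eq)
    have e23: "- (star (?X' x) * ?e) = ?b1 * ?Z x - ?b2 * star (?X x)"
      using n23 by (simp add: algebra_simps eq_neg_iff_add_eq_0)
    show "star (?X' x) * ?c = 0 \<and> - (star (?X' x) * ?d) = ?b1 * ?X x \<and> - (star (?X' x) * ?e) = ?b1 * ?Z x - ?b2 * star (?X x)"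
      using e23 by (simp add: mult.assoc CC)
    have "?c * ?Z x = ?c * star ?e * ?c" by (simp add: right_diff_distrib mult.assoc CCl)
    also have "\<dots> = ?d * star (?X x)" using n33 by (simp add: mult.assoc add_eq_0_iff)
    finally show "?c * ?X x = 0 \<and> ?c * ?Z x = ?d * star (?X x)" by (simp add: CCl)
  next
    have "tr (bl x0 3 1 * star (bl x0 2 1)) = tr (star (bl x0 3 1) * bl x0 2 1)"
      using tr_simps(5)[of "star (bl x0 3 1) * bl x0 2 1"] tr_comm[of "bl x0 3 1"] by simp
    moreover have "tr (star (bl x0 3 1) * bl x0 2 1) + tr (star (bl x0 3 1) * bl x0 3 2) \<noteq> 0"
      using neq unfolding distrib_left tr_simps(2) .
    ultimately show "tr (?X' x0) \<noteq> tr (?X x0)" unfolding tr_simps(4) eq_neg_iff_add_eq_0 by simp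
  qed
qed

text \<open>The left element is \<open>uel N 0\<close>, and \<open>?X\<close> and \<open>?Z\<close>
  are the blocks of its conjugate by the inverse of \<open>W x\<close>. The hypotheses on
  \<open>N\<close> say that this conjugate is again unipotent.\<close>

lemma kill_diagonal:
  assumes E: "sk.invariant E" and V: "rel_open E V" "x0 \<in> V" and W: "moved V W" and N: "mcont V N"
    and 0: "\<And>x. x \<in> V \<Longrightarrow> bl (W x) 2 1 = 0" "\<And>x. x \<in> V \<Longrightarrow> bl (W x) 3 2 = 0"
    and n: "\<And>x. x \<in> V \<Longrightarrow> nrm (N x) = 0"
    and NC: "\<And>x. x \<in> V \<Longrightarrow> star (N x) * bl (W x) 3 1 = 0"
    and CN: "\<And>x. x \<in> V \<Longrightarrow> bl (W x) 3 1 * star (bl (W x) 3 3) * N x = 0"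
    and aN: "\<And>x. x \<in> V \<Longrightarrow> bl (W x) 1 1 * star (bl (W x) 3 3) * N x = sc (sim (W x)) * N x"
    and neq: "tr (star (bl (W x0) 3 3) * N x0 * bl (W x0) 2 2) \<noteq> sim (W x0) * tr (N x0)"
  shows "sk.killable E x0"
proof -
  let ?i = "\<lambda>x. sc (1 / sim (W x))"
  let ?T = "\<lambda>x. star (bl (W x) 3 3) * N x * bl (W x) 2 3"
  let ?X = "\<lambda>x. ?i x * (star (bl (W x) 3 3) * N x * bl (W x) 2 2)"
  let ?Z = "\<lambda>x. ?i x * (?T x - star (?T x))"
  note Wc = moved_cont[OF W]
  show ?thesis
  proof (rule kill_nilpotent[OF E V W, where X = ?X and Z = ?Z and X' = N and Z' = "\<lambda>x. 0"])
    show "mcont V ?X" "mcont V ?Z" "mcont V (\<lambda>x. 0)" by (intro kcont Wc N sim)+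
    show "mcont V N" by (rule N)
    fix x assume x: "x \<in> V"
    let ?w = "W x" and ?N = "N x"
    let ?a1 = "bl ?w 1 1" and ?a2 = "bl ?w 1 2" and ?b2 = "bl ?w 2 2" and ?b3 = "bl ?w 2 3" and ?e = "bl ?w 3 3" and ?c = "bl ?w 3 1"
    let ?l = "sc (sim ?w)" and ?j = "sc (1 / sim ?w)"
    have s: "A * (?j * B) = ?j * (A * B)" "A * ?j = ?j * A" for A B by (rule sc_left, rule sc_comm)
    have st: "star (?j * B) = ?j * star B" for B by (simp add: sc_comm[of "star B" "1 / sim ?w"])
    have jl: "?j * (?l * B) = B" for B using sc_inverse(1)[OF sim(1)[of ?w]] by (simp flip: mult.assoc)
    have r22: "?b2 * star ?b2 = ?l" using row_rel[of ?w 2 2] by (simp add: 0[OF x])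
    have r22': "star ?b2 * ?b2 = ?l" using r22 by (simp add: mult_star)
    have r12: "?a1 * star ?b3 + ?a2 * star ?b2 = 0" using row_rel[of ?w 1 2] by (simp add: 0[OF x])
    have r23: "?b3 * star ?c = 0" using row_rel[of ?w 2 3] by (simp add: 0[OF x])
    have r23': "?c * star ?b3 = 0" using arg_cong[OF r23, of star] by simp
    show "nrm (?X x) = 0 \<and> tr (?Z x) = 0 \<and> nrm ?N = 0 \<and> tr (0 :: 'k m2) = 0"
      using n[OF x] tr_simps(5)[of "?T x"] unfolding nrm_sc_mult tr_simps(7) nrm_simps(3) by (simp only: tr_simps) simp
    have aN': "?a1 * (star ?e * (?N * B)) = ?l * (?N * B)" for B
      using arg_cong[OF aN[OF x], of "\<lambda>A. A * B"] by (simp add: mult.assoc)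
    have CN': "?c * (star ?e * (?N * B)) = 0" for B
      using arg_cong[OF CN[OF x], of "\<lambda>A. A * B"] by (simp add: mult.assoc)
    have "?a1 * ?Z x - ?a2 * star (?X x) = ?j * (?a1 * (star ?e * (?N * ?b3)) - (?a1 * star ?b3 + ?a2 * star ?b2) * (star ?N * ?e))"
      unfolding s st by (simp add: algebra_simps)
    also have "\<dots> = ?N * ?b3" unfolding r12 aN' by (simp add: jl)
    finally show "?N * bl ?w 2 1 + 0 * ?c = 0 \<and> ?N * ?b2 + 0 * bl ?w 3 2 = ?a1 * ?X x \<and>
        ?N * ?b3 + 0 * ?e = ?a1 * ?Z x - ?a2 * star (?X x)"
      unfolding s by (simp add: 0[OF x] mult.assoc aN' jl)
    have "?b2 * star (?X x) = ?j * (?b2 * star ?b2 * (star ?N * ?e))" unfolding s st by (simp add: mult.assoc)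
    also have "\<dots> = star ?N * ?e" unfolding r22 mult.assoc jl ..
    finally show "star ?N * ?c = 0 \<and> - (star ?N * bl ?w 3 2) = bl ?w 2 1 * ?X x \<and>
        - (star ?N * ?e) = bl ?w 2 1 * ?Z x - ?b2 * star (?X x)"
      using NC[OF x] by (simp add: 0[OF x])
    have cb: "?c * (star ?b3 * B) = 0" for B using r23' by (simp flip: mult.assoc)
    show "?c * ?X x = 0 \<and> ?c * ?Z x = bl ?w 3 2 * star (?X x)"
      unfolding s by (simp add: 0[OF x] mult.assoc right_diff_distrib CN' cb)
  next
    show "tr (N x0) \<noteq> tr (?X x0)"
    proof
      assume "tr (N x0) = tr (?X x0)"
      then have "tr (N x0) = 1 / sim (W x0) * tr (star (bl (W x0) 3 3) * N x0 * bl (W x0) 2 2)" by (simp only: tr_simps(7))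
      then show False using neq sim(1)[of "W x0"] by simp
    qed
  qed
qed

text \<open>The right element has \<open>X = 0\<close> and trivial character; its conjugate by
  \<open>x\<close> has middle block proportional to \<open>a1 * Z * star b1\<close>. As
  \<open>b1\<close> has norm zero, \<open>star b1 * a1 * star b1\<close> is
  \<open>tr (star b1 * a1)\<close> times \<open>star b1\<close>, so the trace factors and
  \<open>N\<close> can be chosen to make it nonzero.\<close>

lemma kill_C_zero_trace:
  assumes E: "sk.invariant E" and C: "\<And>y. y \<in> E \<Longrightarrow> bl y 3 1 = 0" and x0: "x0 \<in> E"
    and neq: "tr (star (bl x0 2 1) * bl x0 1 1) \<noteq> 0"
  shows "sk.killable E x0"
proof -
  have b0: "bl x0 2 1 \<noteq> 0" using neq by auto
  have "star (bl x0 2 1) \<noteq> 0"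
  proof
    assume "star (bl x0 2 1) = 0"
    from arg_cong[OF this, of star] show False using b0 by simp
  qed
  then obtain N where N: "tr (star (bl x0 2 1) * N) \<noteq> 0" using trace_nondegenerate by metis
  let ?Z = "\<lambda>x. star (bl x 2 1) * N - star N * bl x 2 1"
  let ?i = "\<lambda>x. sc (1 / sim x)"
  let ?X' = "\<lambda>x. ?i x * (bl x 1 1 * ?Z x * star (bl x 2 1))" and ?Z' = "\<lambda>x. ?i x * (bl x 1 1 * ?Z x * star (bl x 1 1))"
  show ?thesis
  proof (rule kill_nilpotent[OF E rel_open_all x0 moved_id, where X = "\<lambda>x. 0" and Z = ?Z and X' = ?X' and Z' = ?Z'])
    show "mcont E (\<lambda>x. 0)" "mcont E ?Z" "mcont E ?X'" "mcont E ?Z'" by (intro kcont sim)+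
    fix x assume x: "x \<in> E"
    let ?a1 = "bl x 1 1" and ?b1 = "bl x 2 1" and ?b2 = "bl x 2 2" and ?b3 = "bl x 2 3" and ?d = "bl x 3 2" and ?e = "bl x 3 3"
    let ?l = "sc (sim x)" and ?j = "sc (1 / sim x)"
    have s: "A * (?j * B) = ?j * (A * B)" "A * ?j = ?j * A" for A B by (rule sc_left, rule sc_comm)
    have st: "star (?j * B) = ?j * star B" for B by (simp add: sc_comm[of "star B" "1 / sim x"])
    have jl: "?j * (B * ?l) = B" for B using sc_inverse(1)[OF sim(1)[of x]] by (simp add: sc_comm[of B "sim x"] flip: mult.assoc)
    have c11: "star ?b1 * ?b1 = 0" using col_rel[of x 1 1] by (simp add: C[OF x])
    have nb: "nrm ?b1 = 0" using c11 by (simp add: mult_star)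
    have c11': "?b1 * star ?b1 = 0" using nb by (simp add: mult_star)
    have c12: "star ?b1 * ?b2 + star ?a1 * ?d = 0" using col_rel[of x 1 2] by (simp add: C[OF x])
    have c13: "star ?b1 * ?b3 + star ?a1 * ?e = ?l" using col_rel[of x 1 3] by (simp add: C[OF x])
    have starZ: "star (?Z x) = - ?Z x" by simp
    have b0: "?b1 * (star ?b1 * B) = 0" "star ?b1 * (?b1 * B) = 0" for B using c11 c11' by (simp_all flip: mult.assoc)
    have bZb: "?b1 * (?Z x * (star ?b1 * B)) = 0" for B by (simp add: right_diff_distrib left_diff_distrib mult.assoc b0)
    have trZ: "tr (?Z x) = 0" using tr_simps(5)[of "star ?b1 * N"] by simp
    have "tr (?a1 * ?Z x * star ?a1) = nrm ?a1 * tr (?Z x)"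
    proof -
      have "tr (?a1 * ?Z x * star ?a1) = tr (star ?a1 * ?a1 * ?Z x)" using tr_comm[of "?a1 * ?Z x" "star ?a1"] by (simp add: mult.assoc)
      then show ?thesis by (simp add: mult_star)
    qed
    then show "nrm (0 :: 'k m2) = 0 \<and> tr (?Z x) = 0 \<and> nrm (?X' x) = 0 \<and> tr (?Z' x) = 0"
      unfolding nrm_sc_mult tr_simps(7) nrm_simps(3,4) nb trZ by simp
    have h12: "?X' x * ?b2 + ?Z' x * ?d = ?j * (?a1 * (?Z x * (star ?b1 * ?b2 + star ?a1 * ?d)))"
      by (simp only: distrib_left mult.assoc)
    have h13: "?X' x * ?b3 + ?Z' x * ?e = ?j * (?a1 * (?Z x * (star ?b1 * ?b3 + star ?a1 * ?e)))"
      by (simp only: distrib_left mult.assoc)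
    have e13: "?X' x * ?b3 + ?Z' x * ?e = ?a1 * ?Z x"
      unfolding h13 c13 using jl[of "?a1 * ?Z x"] by (simp only: mult.assoc)
    have "?X' x * ?b1 = 0" by (simp only: mult.assoc c11 mult_zero_right)
    then show "?X' x * ?b1 + ?Z' x * bl x 3 1 = 0 \<and> ?X' x * ?b2 + ?Z' x * ?d = ?a1 * 0 \<and> ?X' x * ?b3 + ?Z' x * ?e = ?a1 * ?Z x - bl x 1 2 * star 0"
      using e13 unfolding h12 c12 C[OF x] by simp
    have sX: "star (?X' x) = - (?j * (?b1 * (?Z x * star ?a1)))" unfolding st unfolding star_simps(2) starZ star_simps(1) by (simp only: mult.assoc minus_mult_left[symmetric] minus_mult_right[symmetric])
    have "star ?a1 * ?d = - (star ?b1 * ?b2)" using c12 by (simp add: add_eq_0_iff2 add.commute)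
    then have h22: "star (?X' x) * ?d = 0" unfolding sX by (simp only: mult.assoc minus_mult_left[symmetric] minus_mult_right[symmetric] bZb) simp
    have "star ?a1 * ?e = ?l - star ?b1 * ?b3" using c13 by (simp add: algebra_simps)
    then have "?b1 * (?Z x * (star ?a1 * ?e)) = ?b1 * (?Z x * ?l) - ?b1 * (?Z x * (star ?b1 * ?b3))" by (simp only: right_diff_distrib)
    then have "- (star (?X' x) * ?e) = ?j * (?b1 * (?Z x * ?l))" unfolding sX bZb by (simp only: mult.assoc minus_mult_left[symmetric] minus_minus diff_zero)
    also have "\<dots> = ?b1 * ?Z x" using jl[of "?b1 * ?Z x"] by (simp only: mult.assoc)
    finally show "star (?X' x) * bl x 3 1 = 0 \<and> - (star (?X' x) * ?d) = ?b1 * 0 \<and> - (star (?X' x) * ?e) = ?b1 * ?Z x - ?b2 * star 0"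
      using h22 by (simp add: C[OF x])
    show "bl x 3 1 * 0 = 0 \<and> bl x 3 1 * ?Z x = ?d * star 0" by (simp add: C[OF x])
  next
    let ?a = "bl x0 1 1" and ?b = "bl x0 2 1"
    have "star ?b * ?b = 0" using col_rel[of x0 1 1] by (simp add: C[OF x0])
    then have "nrm ?b = 0" by (simp add: mult_star)
    then have bb: "?b * star ?b = 0" by (simp add: mult_star)
    have "star ?b * ?a + star ?a * ?b = sc (tr (star ?b * ?a))" using mult_star(3)[of "star ?b * ?a"] by simp
    from arg_cong[OF this, of "\<lambda>A. A * star ?b"]
    have k: "star ?b * ?a * star ?b = sc (tr (star ?b * ?a)) * star ?b"
      by (simp only: distrib_right mult.assoc bb mult_zero_right add_0_right)
    have "tr (?a * ?Z x0 * star ?b) = tr (star ?b * ?a * star ?b * N)"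
    proof -
      have "?a * ?Z x0 * star ?b = ?a * star ?b * N * star ?b" by (simp add: algebra_simps bb)
      also have "tr \<dots> = tr (star ?b * (?a * star ?b * N))" by (rule tr_comm)
      finally show ?thesis by (simp only: mult.assoc)
    qed
    also have "\<dots> = tr (star ?b * ?a) * tr (star ?b * N)" unfolding k by (simp add: mult.assoc)
    finally have "tr (?a * ?Z x0 * star ?b) \<noteq> 0" using neq N by simp
    then show "tr (?X' x0) \<noteq> tr (0 :: 'k m2)" unfolding tr_simps(7) using sim(1)[of x0] by simp
  qed
qed

text \<open>With \<open>y = x * eps\<close> the element \<open>inverse x * y\<close> is
  \<open>eps\<close> itself, an involution.\<close>

lemma kill_Sh:
  assumes E: "sk.invariant E" and S: "\<And>y. y \<in> E \<Longrightarrow> y \<in> Sh" and x0: "x0 \<in> E"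
  shows "sk.killable E x0"
proof (rule kill_involution[OF E rel_open_all x0 moved_id, of "\<lambda>x. x"])
  fix x assume x: "x \<in> E"
  have "(inverse x * (x * eps)) * (inverse x * (x * eps)) = 1" by (simp add: eps_sq)
  then show "(inverse x * (x * eps)) * (inverse x * (x * eps)) \<in> scalars" using subgpD(1)[OF scalars_subgp] by simp
qed (rule continuous_on_id, rule S)

end

lemma bl_uel2:
  assumes "tr Z = - nrm X" "tr Z' = - nrm X'"
  shows "bl (uel X Z * w * uel X' Z') 3 1 = bl w 3 1"
    "bl (uel X Z * w * uel X' Z') 3 2 = bl w 3 1 * X' + bl w 3 2"
    "bl (uel X Z * w * uel X' Z') 3 3 = bl w 3 1 * Z' - bl w 3 2 * star X' + bl w 3 3"
    "bl (uel X Z * w * uel X' Z') 2 1 = bl w 2 1 - star X * bl w 3 1"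
    "bl (uel X Z * w * uel X' Z') 2 2 = (bl w 2 1 - star X * bl w 3 1) * X' + (bl w 2 2 - star X * bl w 3 2)"
    "bl (uel X Z * w * uel X' Z') 2 3 = (bl w 2 1 - star X * bl w 3 1) * Z' - (bl w 2 2 - star X * bl w 3 2) * star X'
      + (bl w 2 3 - star X * bl w 3 3)"
    "bl (uel X Z * w * uel X' Z') 1 1 = bl w 1 1 + X * bl w 2 1 + Z * bl w 3 1"
    "bl (uel X Z * w * uel X' Z') 1 2 = (bl w 1 1 + X * bl w 2 1 + Z * bl w 3 1) * X' + (bl w 1 2 + X * bl w 2 2 + Z * bl w 3 2)"
    "bl (uel X Z * w * uel X' Z') 1 3 = (bl w 1 1 + X * bl w 2 1 + Z * bl w 3 1) * Z'
      - (bl w 1 2 + X * bl w 2 2 + Z * bl w 3 2) * star X' + (bl w 1 3 + X * bl w 2 3 + Z * bl w 3 3)"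
  by (simp_all only: bl_mult_uel[OF assms(2)] bl_uel_mult[OF assms(1)])

lemma traceless_square: "tr A = 0 \<Longrightarrow> A * A = sc (- nrm A)"
proof -
  assume "tr A = 0"
  then have "A + star A = 0" using mult_star(3)[of A] by simp
  then have "star A = - A" by (simp add: eq_neg_iff_add_eq_0 add.commute)
  then have "- (A * A) = sc (nrm A)" using mult_star(1)[of A] by simp
  from arg_cong[OF this, of uminus] show ?thesis by simp
qed

lemma bl_inverse_del_eps_mult:
  assumes "nrm g \<noteq> 0"
  shows "bl (inverse (del g * eps) * w) i j =
    (if i = 2 then - (sc (1 / nrm g) * star g * bl w i j) else sc (1 / nrm g) * star g * bl w i j)"
proof -
  have n: "nrm (sc (1 / nrm g) * star g) \<noteq> 0" using assms by simp
  have "inverse (del g * eps) * w = eps * (del (sc (1 / nrm g) * star g) * w)"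
    using inv_unique[OF eps_sq] by (simp add: inverse_del[OF assms] mult.assoc)
  then show ?thesis by (simp only: bl_eps_mult bl_del_mult[OF n])
qed

section \<open>The open stratum, where \<open>C\<close> is invertible\<close>

context shalika_distribution
begin

text \<open>Multiples of \<open>C\<close> clear first \<open>b1\<close> and \<open>d\<close>, then
  \<open>a1\<close> and \<open>e\<close>. The middle block is untouched if \<open>b1\<close> and
  \<open>d\<close> vanish from the start, since the first pair of unipotents then has
  \<open>X = 0\<close>.\<close>

lemma open_normal_form:
  assumes E: "sk.invariant E"
  defines "V \<equiv> {x \<in> E. nrm (bl x 3 1) \<noteq> 0}"
  shows "\<exists>W. moved V W \<and> (\<forall>x\<in>V. bl (W x) 3 1 = bl x 3 1 \<and> bl (W x) 3 2 = 0 \<and> bl (W x) 3 3 = 0 \<and>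
     bl (W x) 2 1 = 0 \<and> bl (W x) 1 1 = 0 \<and> (bl x 3 2 = 0 \<and> bl x 2 1 = 0 \<longrightarrow> bl (W x) 2 2 = bl x 2 2))"
proof -
  let ?C = "\<lambda>x :: 'k gsp6. bl x 3 1" and ?j = "\<lambda>x :: 'k gsp6. sc (1 / nrm (bl x 3 1))"
  let ?X = "\<lambda>x. ?j x * (?C x * star (bl x 2 1))" and ?X' = "\<lambda>x. - (?j x * (star (?C x) * bl x 3 2))"
  \<comment> \<open>Any matrix with the prescribed trace would serve; a single corner entry is a
    continuous choice.\<close>
  let ?Z = "\<lambda>x. M2 (- nrm (?X x)) 0 0 0" and ?Z' = "\<lambda>x. M2 (- nrm (?X' x)) 0 0 0"
  have n: "nrm (?C x) \<noteq> 0" if "x \<in> V" for x using that unfolding V_def by simp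
  have t: "tr (?Z x) = - nrm (?X x)" "tr (?Z' x) = - nrm (?X' x)" for x by (simp_all add: tr_def)
  have jn: "?j x * sc (nrm (?C x)) = 1" if "x \<in> V" for x by (rule sc_inverse(1)[OF n[OF that]])
  have s: "A * (sc c * B) = sc c * (A * B)" "star (sc c * B) = sc c * star B" for A B and c :: 'k by (rule sc_left, simp add: sc_comm)
  define W1 where "W1 x = uel (?X x) (?Z x) * x * uel (?X' x) (?Z' x)" for x
  have W1: "moved V W1" unfolding W1_def
    by (rule moved_uel[OF moved_id _ _ t(1) _ _ t(2)]; intro kcont n; assumption)
  have B1: "bl (W1 x) 3 1 = ?C x \<and> bl (W1 x) 3 2 = 0 \<and> bl (W1 x) 2 1 = 0 \<and> (bl x 3 2 = 0 \<and> bl x 2 1 = 0 \<longrightarrow> bl (W1 x) 2 2 = bl x 2 2)" if x: "x \<in> V" for x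
  proof -
    have "?C x * ?X' x = - (?j x * (?C x * star (?C x)) * bl x 3 2)" by (simp only: mult_minus_right s mult.assoc)
    then have 1: "?C x * ?X' x = - bl x 3 2" by (simp only: mult_star jn[OF x] mult_1_left)
    have "star (?X x) * ?C x = ?j x * (bl x 2 1 * (star (?C x) * ?C x))" by (simp only: s star_simps mult.assoc)
    also have "\<dots> = bl x 2 1 * (?j x * sc (nrm (?C x)))" by (simp only: mult_star s)
    finally have 2: "star (?X x) * ?C x = bl x 2 1" by (simp only: jn[OF x] mult_1_right)
    show ?thesis unfolding W1_def bl_uel2[OF t] 1 2 by simp
  qed
  let ?U = "\<lambda>x. - (?j x * (bl (W1 x) 1 1 * star (?C x)))" and ?U' = "\<lambda>x. - (?j x * (star (?C x) * bl (W1 x) 3 3))"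
  \<comment> \<open>A unipotent element with \<open>X = 0\<close> needs a traceless
    \<open>Z\<close>; the row relation at \<open>(3, 3)\<close> and the column relation at
    \<open>(1, 1)\<close> say just that.\<close>
  have t2: "tr (?U x) = - nrm (0 :: 'k m2)" "tr (?U' x) = - nrm (0 :: 'k m2)" if x: "x \<in> V" for x
  proof -
    let ?w = "W1 x"
    have "?C x * star (bl ?w 3 3) + bl ?w 3 3 * star (?C x) = 0" using row_rel[of ?w 3 3] B1[OF x] by simp
    then have "tr (bl ?w 3 3 * star (?C x)) = 0" using mult_star(3)[of "bl ?w 3 3 * star (?C x)"] by (simp add: add.commute)
    then show "tr (?U' x) = - nrm (0 :: 'k m2)" unfolding tr_comm[of "bl ?w 3 3"] by (simp only: tr_simps nrm_simps mult_zero_right minus_zero)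
    have "star (?C x) * bl ?w 1 1 + star (bl ?w 1 1) * ?C x = 0" using col_rel[of ?w 1 1] B1[OF x] by simp
    then have "tr (star (?C x) * bl ?w 1 1) = 0" using mult_star(3)[of "star (?C x) * bl ?w 1 1"] by simp
    then show "tr (?U x) = - nrm (0 :: 'k m2)" unfolding tr_comm[of "star (?C x)"] by (simp only: tr_simps nrm_simps mult_zero_right minus_zero)
  qed
  define W2 where "W2 x = uel 0 (?U x) * W1 x * uel 0 (?U' x)" for x
  have W2: "moved V W2" unfolding W2_def
    by (rule moved_uel[OF W1 _ _ t2(1) _ _ t2(2)]; (intro kcont n moved_cont[OF W1]; assumption)?; assumption?)
  have "bl (W2 x) 3 1 = bl x 3 1 \<and> bl (W2 x) 3 2 = 0 \<and> bl (W2 x) 3 3 = 0 \<and>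
     bl (W2 x) 2 1 = 0 \<and> bl (W2 x) 1 1 = 0 \<and> (bl x 3 2 = 0 \<and> bl x 2 1 = 0 \<longrightarrow> bl (W2 x) 2 2 = bl x 2 2)" if x: "x \<in> V" for x
  proof -
    have "?C x * ?U' x = - (?j x * (?C x * star (?C x)) * bl (W1 x) 3 3)" by (simp only: mult_minus_right s mult.assoc)
    then have 1: "?C x * ?U' x = - bl (W1 x) 3 3" by (simp only: mult_star jn[OF x] mult_1_left)
    have "?U x * ?C x = - (?j x * (bl (W1 x) 1 1 * (star (?C x) * ?C x)))" by (simp only: mult_minus_left mult.assoc)
    also have "\<dots> = - (bl (W1 x) 1 1 * (?j x * sc (nrm (?C x))))" by (simp only: mult_star s)
    finally have 2: "?U x * ?C x = - bl (W1 x) 1 1" by (simp only: jn[OF x] mult_1_right)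
    note b = B1[OF x]
    show ?thesis unfolding W2_def bl_uel2[OF t2[OF x]] using b 1 2 by simp
  qed
  then show ?thesis by (intro exI[of _ W2] conjI[OF W2] ballI)
qed

text \<open>The relations leave only \<open>C\<close>, the middle block and a multiple of
  \<open>C\<close> in the upper right corner. Multiplied by the inverse of \<open>g\<close>, both
  \<open>C\<close> and the middle block become traceless, and a traceless matrix has scalar square;
  the norms make all three diagonal blocks of the square equal to
  \<open>- (sim w / nrm g)\<close>.\<close>

lemma open_involution:
  assumes w: "bl w 3 2 = 0" "bl w 3 3 = 0" "bl w 2 1 = 0" "bl w 1 1 = 0" and n: "nrm (bl w 3 1) \<noteq> (0 :: 'k)"
    and g: "nrm g \<noteq> 0" "tr (star (bl w 3 1) * g) = 0" "tr (star (bl w 2 2) * g) = 0"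
  shows "(inverse w * (del g * eps)) * (inverse w * (del g * eps)) \<in> scalars"
proof (rule involution_swap)
  let ?C = "bl w 3 1" and ?h = "sc (1 / nrm g) * star g" and ?l = "sim w"
  have r13: "bl w 1 3 * star ?C = sc ?l" using row_rel[of w 1 3] w by simp
  have a3: "bl w 1 3 = sc (?l / nrm ?C) * ?C"
  proof -
    have "bl w 1 3 * sc (nrm ?C) = sc ?l * ?C" using arg_cong[OF r13, of "\<lambda>A. A * ?C"] by (simp add: mult.assoc mult_star)
    then have "bl w 1 3 * sc (nrm ?C) * sc (1 / nrm ?C) = sc ?l * ?C * sc (1 / nrm ?C)" by simp
    then have "bl w 1 3 = sc ?l * (sc (1 / nrm ?C) * ?C)" using sc_inverse(2)[OF n] by (simp only: mult.assoc mult_1_right sc_comm[of ?C "1 / nrm ?C"])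
    also have "\<dots> = sc (?l / nrm ?C) * ?C" by (simp only: mult.assoc[symmetric] sc_simps(6)[symmetric] times_divide_eq_right mult_1_right)
    finally show ?thesis .
  qed
  have z: "A = 0" if "star ?C * A = 0" for A
  proof -
    have "?C * (star ?C * A) = 0" using that by simp
    then have "sc (nrm ?C) * A = 0" by (simp add: mult_star flip: mult.assoc)
    then have "sc (1 / nrm ?C) * (sc (nrm ?C) * A) = 0" by simp
    then show ?thesis using sc_inverse(1)[OF n] by (simp add: mult.assoc[symmetric])
  qed
  have "bl w 2 3 * star ?C = 0" using row_rel[of w 2 3] w by simp
  then have b3: "bl w 2 3 = 0"
  proof -
    assume "bl w 2 3 * star ?C = 0"
    then have "bl w 2 3 * star ?C * ?C = 0" by simp
    then have "bl w 2 3 * sc (nrm ?C) = 0" by (simp add: mult.assoc mult_star)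
    then have "bl w 2 3 * sc (nrm ?C) * sc (1 / nrm ?C) = 0" by simp
    then show ?thesis using sc_inverse(2)[OF n] by (simp add: mult.assoc)
  qed
  have a2: "bl w 1 2 = 0" by (rule z) (use col_rel[of w 1 2] w in simp)
  have "bl w 2 2 * star (bl w 2 2) = sc ?l" using row_rel[of w 2 2] w by simp
  then have nb: "nrm (bl w 2 2) = ?l" unfolding mult_star by (simp only: sc_eq_iff)
  define M where "M = inverse (del g * eps) * w"
  note Mb = bl_inverse_del_eps_mult[OF g(1), of w, folded M_def]
  let ?P = "?h * ?C" and ?Q = "?h * bl w 2 2"
  have tg: "tr (?h * A) = 0" if "tr (star A * g) = 0" for A
  proof -
    have "tr (star g * A) = tr (star (star A * g))" unfolding star_simps(2) star_simps(1) ..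
    also have "\<dots> = 0" unfolding tr_simps(5) by (rule that)
    finally show ?thesis unfolding mult.assoc tr_simps(7) by simp
  qed
  note tP = tg[OF g(2)] and tQ = tg[OF g(3)]
  have nh: "nrm ?h = 1 / nrm g" using g(1) by simp
  have PP: "sc (?l / nrm ?C) * ?P * ?P = sc (- (?l / nrm g))" "?P * (sc (?l / nrm ?C) * ?P) = sc (- (?l / nrm g))"
  proof -
    have "?P * ?P = sc (- (nrm ?C / nrm g))" unfolding traceless_square[OF tP] nrm_simps(3)[of ?h] nh by simp
    then have "sc (?l / nrm ?C) * (?P * ?P) = sc (?l / nrm ?C * - (nrm ?C / nrm g))" by (simp only: sc_simps(6))
    also have "?l / nrm ?C * - (nrm ?C / nrm g) = - (?l / nrm g)" using n by simp
    finally have P: "sc (?l / nrm ?C) * (?P * ?P) = sc (- (?l / nrm g))" .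
    then show "sc (?l / nrm ?C) * ?P * ?P = sc (- (?l / nrm g))" by (simp only: mult.assoc)
    show "?P * (sc (?l / nrm ?C) * ?P) = sc (- (?l / nrm g))" unfolding sc_left[of ?P "?l / nrm ?C" ?P] by (rule P)
  qed
  have QQ: "?Q * ?Q = sc (- (?l / nrm g))" unfolding traceless_square[OF tQ] nrm_simps(3)[of ?h] nh nb by simp
  have a3h: "?h * bl w 1 3 = sc (?l / nrm ?C) * ?P" unfolding a3 by (rule sc_left)
  have Mz: "bl M 1 1 = 0" "bl M 1 2 = 0" "bl M 2 1 = 0" "bl M 2 3 = 0" "bl M 3 2 = 0" "bl M 3 3 = 0"
    unfolding Mb using w b3 a2 by simp_all
  have Mv: "bl M 1 3 = sc (?l / nrm ?C) * ?P" "bl M 3 1 = ?P" "bl M 2 2 = - ?Q"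
    unfolding Mb a3h by simp_all
  have "M * M \<in> scalars"
    unfolding scalars_bl
  proof (intro exI[of _ "- (?l / nrm g)"] conjI)
    show "- (?l / nrm g) \<noteq> 0" using sim(1)[of w] g(1) by simp
    have D: "bl (M * M) 1 1 = sc (- (?l / nrm g))" "bl (M * M) 2 2 = sc (- (?l / nrm g))" "bl (M * M) 3 3 = sc (- (?l / nrm g))"
      unfolding bl_mult[of M M] Mz Mv minus_mult_minus QQ PP mult_zero_left mult_zero_right add_0_left add_0_right by (rule refl)+
    have F: "bl (M * M) 1 2 = 0" "bl (M * M) 1 3 = 0" "bl (M * M) 2 1 = 0" "bl (M * M) 2 3 = 0" "bl (M * M) 3 1 = 0" "bl (M * M) 3 2 = 0"
      unfolding bl_mult[of M M] Mz mult_zero_left mult_zero_right add_0_left add_0_right by (rule refl)+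
    show "\<forall>i j. bl (M * M) i j = (if i = j then sc (- (?l / nrm g)) else 0)"
      unfolding forall_3 D F by simp
  qed
  then show "inverse (del g * eps) * w * (inverse (del g * eps) * w) \<in> scalars" unfolding M_def .
qed

text \<open>If \<open>C\<close> and the middle block \<open>b2\<close> are linearly independent, an
  invertible matrix trace-orthogonal to both can be written down continuously through a commutator
  with \<open>star C * b2\<close>.\<close>

lemma kill_open_independent:
  assumes E: "sk.invariant E" and x0: "x0 \<in> E" "nrm (bl x0 3 1) \<noteq> 0" "bl x0 3 2 = 0" "bl x0 2 1 = 0"
    and ns: "\<And>m. star (bl x0 3 1) * bl x0 2 2 \<noteq> sc m"
  shows "sk.killable E x0"
proof -
  let ?V = "{x \<in> E. nrm (bl x 3 1) \<noteq> 0}"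
  have V: "rel_open E ?V" by (intro rel_open_sub[OF rel_open_all] kcont)
  from open_normal_form[OF E]
  obtain W where W: "moved ?V W" and B': "\<forall>x\<in>?V. bl (W x) 3 1 = bl x 3 1 \<and> bl (W x) 3 2 = 0 \<and> bl (W x) 3 3 = 0 \<and>
     bl (W x) 2 1 = 0 \<and> bl (W x) 1 1 = 0 \<and> (bl x 3 2 = 0 \<and> bl x 2 1 = 0 \<longrightarrow> bl (W x) 2 2 = bl x 2 2)"
    by (elim exE conjE)
  note B = bspec[OF B']
  obtain N where N: "nrm (star (bl x0 3 1) * bl x0 2 2 * N - N * (star (bl x0 3 1) * bl x0 2 2)) \<noteq> 0"
    using nonscalar_commutator[OF ns] by (elim exE)
  let ?C = "\<lambda>x. bl (W x) 3 1" and ?b = "\<lambda>x. bl (W x) 2 2"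
  \<comment> \<open>With \<open>h = star C * b2\<close> this is \<open>C * (h * N - N * h)\<close>,
    because \<open>C * star C\<close> is scalar. A commutator with \<open>h\<close> is
    trace-orthogonal to \<open>1\<close> and to \<open>star h\<close>, which gives the two trace
    conditions.\<close>
  let ?g = "\<lambda>x. sc (nrm (?C x)) * (?b x * N) - ?C x * N * (star (?C x) * ?b x)"
  have Cg: "star (?C x) * ?g x = sc (nrm (?C x)) * (star (?C x) * ?b x * N - N * (star (?C x) * ?b x))" for x
  proof -
    have "star (?C x) * ?g x = sc (nrm (?C x)) * (star (?C x) * ?b x * N) - (star (?C x) * ?C x) * (N * (star (?C x) * ?b x))"
      by (simp only: right_diff_distrib sc_left[of "star (?C x)"] mult.assoc)
    then show ?thesis by (simp only: mult_star right_diff_distrib)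
  qed
  note Wc = moved_cont[OF W]
  have gc: "mcont ?V ?g" by (intro kcont Wc)
  let ?U = "{x \<in> ?V. nrm (?g x) \<noteq> 0}"
  have U: "rel_open E ?U" by (intro rel_open_sub[OF V] kcont gc)
  have x0V: "x0 \<in> ?V" using x0 by simp
  have b0: "?C x0 = bl x0 3 1" "?b x0 = bl x0 2 2" using B[OF x0V] x0 by simp_all
  have "nrm (star (?C x0)) * nrm (?g x0) = nrm (sc (nrm (?C x0))) * nrm (star (?C x0) * ?b x0 * N - N * (star (?C x0) * ?b x0))"
    using arg_cong[OF Cg[of x0], of nrm] unfolding nrm_simps(3)[of "star (?C x0)"] nrm_simps(3)[of "sc (nrm (?C x0))"] .
  also have "\<dots> \<noteq> 0" using N x0(2) unfolding b0 nrm_simps(5) by (simp only: mult_eq_0_iff) simp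
  finally have "nrm (?g x0) \<noteq> 0" by (metis mult_zero_right)
  then have x0U: "x0 \<in> ?U" using x0V by simp
  show ?thesis
  proof (rule kill_involution[OF E U x0U moved_mono[OF W], where s = "\<lambda>x. del (?g x)"])
    show "?U \<subseteq> ?V" by (rule Collect_restrict)
    show "continuous_on ?U (\<lambda>x. del (?g x))" by (intro kcont mcont_subset[OF gc]) auto
    fix x assume x: "x \<in> ?U"
    then show "del (?g x) \<in> Sh" by (intro Sh_del) simp
    have xV: "x \<in> ?V" and ng: "nrm (?g x) \<noteq> 0" using x by simp_all
    note b = B[OF xV]
    have 1: "tr (star (?C x) * ?g x) = 0" unfolding Cg tr_simps(7) tr_simps(3) tr_comm[of N] by (simp only: mult.assoc diff_self mult_zero_right)
    have "star (?b x) * (sc (nrm (?C x)) * (?b x * N)) = sc (nrm (?C x)) * (star (?b x) * ?b x * N)"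
      unfolding sc_left[of "star (?b x)" "nrm (?C x)"] mult.assoc ..
    also have "\<dots> = sc (nrm (?C x) * nrm (?b x)) * N" unfolding mult_star sc_simps(6) mult.assoc ..
    finally have "star (?b x) * ?g x = sc (nrm (?C x) * nrm (?b x)) * N - star (star (?C x) * ?b x) * (N * (star (?C x) * ?b x))"
      unfolding right_diff_distrib by (simp only: star_simps mult.assoc)
    then have "tr (star (?b x) * ?g x) = nrm (?C x) * nrm (?b x) * tr N - tr (star (star (?C x) * ?b x) * (N * (star (?C x) * ?b x)))"
      by (simp only: tr_simps(3,7))
    also have "tr (star (star (?C x) * ?b x) * (N * (star (?C x) * ?b x))) = tr (N * ((star (?C x) * ?b x) * star (star (?C x) * ?b x)))"
      unfolding tr_comm[of "star (star (?C x) * ?b x)"] by (simp only: mult.assoc)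
    also have "\<dots> = nrm (?C x) * nrm (?b x) * tr N" by (simp only: mult_star(1)[of "star (?C x) * ?b x"] tr_simps(8) nrm_simps)
    finally have 2: "tr (star (?b x) * ?g x) = 0" by simp
    show "(inverse (W x) * (del (?g x) * eps)) * (inverse (W x) * (del (?g x) * eps)) \<in> scalars"
      by (rule open_involution[OF _ _ _ _ _ ng 1 2]) (use b xV in simp_all)
  qed
qed

text \<open>The normal form of any remaining point with invertible \<open>C\<close> lies in
  \<open>E\<close>, so by \<open>dep\<close> its middle block is a multiple of \<open>C\<close>. The
  commutator construction then degenerates, but the two trace conditions coincide up to a factor,
  and \<open>C\<close> times \<open>diag(1, -1)\<close> satisfies them continuously.\<close>

lemma kill_open:
  assumes E: "sk.invariant E" and x0: "x0 \<in> E" "nrm (bl x0 3 1) \<noteq> 0"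
    and dep: "\<And>y. y \<in> E \<Longrightarrow> nrm (bl y 3 1) \<noteq> 0 \<Longrightarrow> bl y 3 2 = 0 \<Longrightarrow> bl y 2 1 = 0 \<Longrightarrow> \<exists>m. star (bl y 3 1) * bl y 2 2 = sc m"
  shows "sk.killable E x0"
proof -
  let ?V = "{x \<in> E. nrm (bl x 3 1) \<noteq> 0}"
  have V: "rel_open E ?V" by (intro rel_open_sub[OF rel_open_all] kcont)
  from open_normal_form[OF E]
  obtain W where W: "moved ?V W" and B': "\<forall>x\<in>?V. bl (W x) 3 1 = bl x 3 1 \<and> bl (W x) 3 2 = 0 \<and> bl (W x) 3 3 = 0 \<and>
     bl (W x) 2 1 = 0 \<and> bl (W x) 1 1 = 0 \<and> (bl x 3 2 = 0 \<and> bl x 2 1 = 0 \<longrightarrow> bl (W x) 2 2 = bl x 2 2)"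
    by (elim exE conjE)
  note B = bspec[OF B']
  let ?g = "\<lambda>x. bl (W x) 3 1 * M2 1 0 0 (- 1)"
  have gc: "mcont ?V ?g" by (intro kcont moved_cont[OF W])
  have ng: "nrm (?g x) \<noteq> 0" if "x \<in> ?V" for x
  proof -
    have "nrm (?g x) = - nrm (bl (W x) 3 1)" unfolding nrm_simps(3) by (simp add: nrm_def)
    then show ?thesis using that B[OF that] by simp
  qed
  show ?thesis
  proof (rule kill_involution[OF E V _ W, where s = "\<lambda>x. del (?g x)"])
    show "x0 \<in> ?V" using x0 by simp
    show "continuous_on ?V (\<lambda>x. del (?g x))" by (intro kcont gc ng)
    fix x assume x: "x \<in> ?V"
    show "del (?g x) \<in> Sh" by (intro Sh_del ng x)
    note b = B[OF x]
    have WE: "W x \<in> E" by (rule moved_mem[OF W V E x])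
    have nC: "nrm (bl (W x) 3 1) \<noteq> 0" using b x by simp
    obtain m where m: "star (bl (W x) 3 1) * bl (W x) 2 2 = sc m" using dep[OF WE nC] b by auto
    have 1: "tr (star (bl (W x) 3 1) * ?g x) = 0" by (simp only: mult.assoc[symmetric] mult_star tr_simps(7)) (simp add: tr_def)
    have "star (bl (W x) 2 2) * bl (W x) 3 1 = sc m" using arg_cong[OF m, of star] by simp
    then have 2: "tr (star (bl (W x) 2 2) * ?g x) = 0" by (simp only: mult.assoc[symmetric] tr_simps(7)) (simp add: tr_def)
    show "(inverse (W x) * (del (?g x) * eps)) * (inverse (W x) * (del (?g x) * eps)) \<in> scalars"
      by (rule open_involution[OF _ _ _ _ nC ng[OF x] 1 2]) (use b in simp_all)
  qed
qed

end

section \<open>The strata where \<open>C\<close> has rank one\<close>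

text \<open>The similitude relations determine every entry left open: only \<open>C\<close>,
  \<open>d\<close>, \<open>b1\<close> and three blocks with entries \<open>- sim w\<close> and plus
  or minus \<open>sim w / r\<close> survive, and \<open>eps * w\<close> squares to
  \<open>- sim w\<close>.\<close>

lemma antidiagonal_involution:
  fixes w :: "'k::field gsp6"
  assumes r: "r \<noteq> 0" and C: "bl w 3 1 = M2 0 1 0 0" and d: "bl w 3 2 = M2 0 0 r 0" and b1: "bl w 2 1 = M2 0 0 (- r) 0"
    and b2: "e11 (bl w 2 2) = 0" "e21 (bl w 2 2) = 0" "e22 (bl w 2 2) = 0"
    and e: "e11 (bl w 3 3) = 0" "e12 (bl w 3 3) = 0" and a1: "e12 (bl w 1 1) = 0" "e22 (bl w 1 1) = 0"
    and a2: "e11 (bl w 1 2) = 0" and b3: "e22 (bl w 2 3) = 0"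
  shows "(inverse w * (1 * eps)) * (inverse w * (1 * eps)) \<in> scalars"
proof (rule involution_swap)
  let ?l = "sim w"
  have r33: "e21 (bl w 3 3) = 0" using row_rel[of w 3 3] by (simp add: C d e m2_eq_iff)
  have r23: "e22 (bl w 3 3) = 0 \<and> e12 (bl w 2 2) = 0 \<and> e11 (bl w 2 3) = 0 \<and> e21 (bl w 2 3) = 0"
    using row_rel[of w 2 3] r by (simp add: C d b1 e b2 m2_eq_iff)
  have c11: "e21 (bl w 1 1) = 0" using col_rel[of w 1 1] by (simp add: C b1 a1 m2_eq_iff)
  have c12: "e11 (bl w 1 1) = 0 \<and> e21 (bl w 1 2) = 0"
    using col_rel[of w 1 2] r by (simp add: C b1 d a1 b2 c11 r23 m2_eq_iff)
  have a10: "bl w 1 1 = 0" using c11 c12 a1 by (simp add: m2_eq_iff)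
  have e0: "bl w 3 3 = 0" using r33 r23 e by (simp add: m2_eq_iff)
  have b20: "bl w 2 2 = 0" using r23 b2 by (simp add: m2_eq_iff)
  have r13: "- (e12 (bl w 1 2) * r) = ?l \<and> e22 (bl w 1 2) = 0 \<and> e11 (bl w 1 3) = 0 \<and> - e21 (bl w 1 3) = ?l"
    using row_rel[of w 1 3] r by (auto simp: C d a10 e0 m2_eq_iff)
  have r12: "e12 (bl w 1 3) = 0 \<and> e22 (bl w 1 3) = 0"
    using row_rel[of w 1 2] r by (simp add: b1 a10 b20 m2_eq_iff)
  have r22: "r * e12 (bl w 2 3) = ?l" using row_rel[of w 2 2] by (simp add: b1 b20 m2_eq_iff)
  have a2v: "bl w 1 2 = M2 0 (- (?l / r)) 0 0"
  proof -
    have "e12 (bl w 1 2) * r = - ?l" using r13 by (metis minus_minus)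
    then have "e12 (bl w 1 2) = - (?l / r)" using r by (simp add: field_simps)
    then show ?thesis using r13 c12 a2 by (simp add: m2_eq_iff)
  qed
  have b3v: "bl w 2 3 = M2 0 (?l / r) 0 0"
  proof -
    have "e12 (bl w 2 3) = ?l / r" using r22 r by (auto simp: field_simps)
    then show ?thesis using r23 b3 by (simp add: m2_eq_iff)
  qed
  have a3v: "bl w 1 3 = M2 0 0 (- ?l) 0"
  proof -
    have "e21 (bl w 1 3) = - ?l" using r13 by (auto simp: minus_equation_iff)
    then show ?thesis using r13 r12 by (simp add: m2_eq_iff)
  qed
  define M where "M = inverse (1 * eps) * w"
  have M: "bl M i j = (if i = 2 then - bl w i j else bl w i j)" for i j
    unfolding M_def mult_1_left inv_unique[OF eps_sq] by (rule bl_eps_mult)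
  have "M * M \<in> scalars"
    unfolding scalars_bl
  proof (intro exI[of _ "- ?l"] conjI)
    show "- ?l \<noteq> 0" using sim(1)[of w] by simp
    show "\<forall>i j. bl (M * M) i j = (if i = j then sc (- ?l) else 0)"
      unfolding forall_3 bl_mult[of M M] M using r by (simp add: C d b1 a10 e0 b20 a2v b3v a3v m2_eq_iff)
  qed
  then show "inverse (1 * eps) * w * (inverse (1 * eps) * w) \<in> scalars" unfolding M_def .
qed

text \<open>The signs in \<open>diag(a, -f)\<close> are chosen so that its inverse, applied together
  with \<open>eps\<close> to \<open>w\<close>, gives an element of square one.\<close>

lemma cusp_involution:
  fixes w :: "'k::field gsp6"
  assumes C: "bl w 3 1 = M2 0 1 0 0" and d: "bl w 3 2 = 0" and b1: "bl w 2 1 = 0" and b3: "bl w 2 3 = 0" and a2: "bl w 1 2 = 0"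
    and e: "bl w 3 3 = M2 0 0 0 f" and a1: "bl w 1 1 = M2 a 0 0 0" and a3: "bl w 1 3 = M2 0 0 (- sim w) 0"
    and af: "a * f = sim w" and b2: "bl w 2 2 = M2 a b 0 f"
  shows "nrm (M2 a 0 0 (- f)) \<noteq> 0" "(inverse w * (del (M2 a 0 0 (- f)) * eps)) * (inverse w * (del (M2 a 0 0 (- f)) * eps)) \<in> scalars"
proof -
  let ?g = "M2 a 0 0 (- f)"
  have a0: "a \<noteq> 0" "f \<noteq> 0" using af sim(1)[of w] by auto
  show n: "nrm ?g \<noteq> 0" using a0 by (simp add: nrm_def)
  have h: "sc (1 / nrm ?g) * star ?g = M2 (1 / a) 0 0 (- (1 / f))" using a0 by (simp add: m2_eq_iff nrm_def)
  define M where "M = inverse (del ?g * eps) * w"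
  note M = bl_inverse_del_eps_mult[OF n, of w, folded M_def, unfolded h]
  have "M * M \<in> scalars"
    unfolding scalars_bl
  proof (intro exI[of _ 1] conjI)
    show "\<forall>i j. bl (M * M) i j = (if i = j then sc 1 else 0)"
      unfolding forall_3 bl_mult[of M M] M using a0 by (simp add: C d b1 b3 a2 e a1 a3 b2 af[symmetric] m2_eq_iff)
  qed simp
  then show "(inverse w * (del ?g * eps)) * (inverse w * (del ?g * eps)) \<in> scalars"
    unfolding M_def by (rule involution_swap)
qed

context shalika_distribution
begin

text \<open>The row and column operations of \<open>rank_one_normal\<close> are defined where the
  \<open>e12\<close> entry of the block is nonzero, and they are the identity at a point already
  normalized.\<close>

lemma rank_one_local:
  assumes E: "sk.invariant E" and rk: "\<And>y. y \<in> E \<Longrightarrow> nrm (bl y i j) = 0" and x0: "x0 \<in> E" "bl x0 i j = M2 0 1 0 0"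
  shows "\<exists>V W. rel_open E V \<and> x0 \<in> V \<and> moved V W \<and> W x0 = x0 \<and> (\<forall>y\<in>V. bl (W y) i j = M2 0 1 0 0)"
proof -
  let ?V = "{y \<in> E. e12 (bl y i j) \<noteq> 0}"
  have V: "rel_open E ?V" by (intro rel_open_sub[OF rel_open_all] kcont)
  let ?g = "\<lambda>y. M2 (1 / e12 (bl y i j)) 0 (- e22 (bl y i j) / e12 (bl y i j)) 1"
  let ?h = "\<lambda>y. M2 1 0 (- e11 (bl y i j) / e12 (bl y i j)) 1"
  have n: "nrm (?g y) \<noteq> 0" "nrm (?h y) \<noteq> 0" if "y \<in> ?V" for y using that by (simp_all add: nrm_def)
  have c: "mcont ?V ?g" "mcont ?V ?h" by (intro kcont; simp)+
  define W where "W y = del (?g y) * y * del (?h y)" for y :: "'k gsp6"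
  have W: "moved ?V W" unfolding W_def by (rule moved_del[OF moved_id c(1) n(1) c(2) n(2)])
  have "bl (W y) i j = M2 0 1 0 0" if y: "y \<in> ?V" for y
    unfolding W_def bl_mult_del[OF n(2)[OF y]] bl_del_mult[OF n(1)[OF y]] using y by (intro rank_one_normal rk) simp_all
  moreover have "W x0 = x0"
  proof -
    have "?g x0 = 1" "?h x0 = 1" unfolding x0(2) by (simp_all add: m2_eq_iff)
    moreover have "del 1 = (1 :: 'k gsp6)" by (rule bl_eqI) (simp add: bl_del bl_one)
    ultimately show ?thesis unfolding W_def by simp
  qed
  moreover have "x0 \<in> ?V" using x0 by simp
  ultimately show ?thesis using V W by (intro exI[of _ ?V] exI[of _ W]) simp
qed

text \<open>Killability is invariant under the Shalika group, so block diagonal translations may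
  first bring a nonzero block of norm zero into standard position at the point itself.\<close>

lemma rank_one_reduce:
  assumes E: "sk.invariant E" and rk: "\<And>y. y \<in> E \<Longrightarrow> nrm (bl y i j) = 0" and x: "x \<in> E" "bl x i j \<noteq> 0"
    and kill: "\<And>g h x0. nrm g \<noteq> 0 \<Longrightarrow> nrm h \<noteq> 0 \<Longrightarrow> (\<And>i j. bl x0 i j = g * bl x i j * h) \<Longrightarrow> x0 \<in> E \<Longrightarrow> bl x0 i j = M2 0 1 0 0 \<Longrightarrow> sk.killable E x0"
  shows "sk.killable E x"
proof -
  obtain g0 h0 where g0: "nrm g0 \<noteq> 0" "nrm h0 \<noteq> 0" "e12 (g0 * bl x i j * h0) \<noteq> 0" using rank_one_entry[OF x(2)] by (elim exE conjE)
  let ?m = "g0 * bl x i j * h0"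
  let ?g = "M2 (1 / e12 ?m) 0 (- e22 ?m / e12 ?m) 1 * g0" and ?h = "h0 * M2 1 0 (- e11 ?m / e12 ?m) 1"
  have n: "nrm ?g \<noteq> 0" "nrm ?h \<noteq> 0"
    unfolding nrm_simps(3)[of _ g0] nrm_simps(3)[of h0] using g0 by (simp_all add: nrm_def[of "M2 _ _ _ _"])
  have m: "nrm ?m = 0" using rk[OF x(1)] by simp
  have b: "bl (del ?g * x * del ?h) i j = ?g * bl x i j * ?h" for i j
    unfolding bl_mult_del[OF n(2)] bl_del_mult[OF n(1)] ..
  have "sk.killable E (del ?g * x * del ?h)"
  proof (rule kill[OF n b])
    show "del ?g * x * del ?h \<in> E" by (rule invariantD(1)[OF E x(1) Sh_del[OF n(1)] Sh_del[OF n(2)]])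
    show "bl (del ?g * x * del ?h) i j = M2 0 1 0 0" using rank_one_normal[OF m g0(3)] unfolding b by (simp only: mult.assoc)
  qed
  then show ?thesis by (rule killable_transport[OF E Sh_del[OF n(1)] Sh_del[OF n(2)]])
qed

text \<open>Here \<open>a1 * star e = sim x\<close>, so lying outside \<open>Sh\<close> means that
  \<open>b2 * star e - sim x\<close> is nonzero; a matrix \<open>N\<close> of norm zero detects this
  by the trace and serves as a constant family in \<open>kill_diagonal\<close>.\<close>

lemma kill_block_triangular:
  assumes E: "sk.invariant E" and 0: "\<And>y. y \<in> E \<Longrightarrow> bl y 3 1 = 0" "\<And>y. y \<in> E \<Longrightarrow> bl y 3 2 = 0" "\<And>y. y \<in> E \<Longrightarrow> bl y 2 1 = 0"
    and x0: "x0 \<in> E" "x0 \<notin> Sh"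
  shows "sk.killable E x0"
proof -
  let ?K = "bl x0 2 2 * star (bl x0 3 3) - sc (sim x0)"
  have ae: "bl y 1 1 * star (bl y 3 3) = sc (sim y)" if "y \<in> E" for y using row_rel[of y 1 3] by (simp add: 0[OF that])
  have "?K \<noteq> 0"
  proof
    assume "?K = 0"
    then have "(bl x0 2 2 - bl x0 1 1) * star (bl x0 3 3) = 0" using ae[OF x0(1)] by (simp add: left_diff_distrib)
    then have "(bl x0 2 2 - bl x0 1 1) * star (bl x0 3 3) * bl x0 3 3 = 0" by simp
    then have "(bl x0 2 2 - bl x0 1 1) * sc (nrm (bl x0 3 3)) = 0" by (simp only: mult.assoc mult_star)
    moreover have "nrm (bl x0 3 3) \<noteq> 0"
    proof -
      have "nrm (bl x0 1 1) * nrm (bl x0 3 3) = sim x0 * sim x0" using arg_cong[OF ae[OF x0(1)], of nrm] by simp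
      then show ?thesis using sim(1)[of x0] by (metis mult_eq_0_iff)
    qed
    ultimately have "bl x0 2 2 = bl x0 1 1" by (simp add: m2_eq_iff)
    then have "x0 \<in> Sh" unfolding mem_Sh_iff using 0[OF x0(1)] by simp
    then show False using x0(2) by simp
  qed
  then obtain N where N: "nrm N = 0" "tr (?K * N) \<noteq> 0" using trace_nondegenerate by metis
  show ?thesis
  proof (rule kill_diagonal[OF E rel_open_all x0(1) moved_id, of "\<lambda>x. N"])
    show "tr (star (bl x0 3 3) * N * bl x0 2 2) \<noteq> sim x0 * tr N"
    proof
      assume "tr (star (bl x0 3 3) * N * bl x0 2 2) = sim x0 * tr N"
      then have "tr (bl x0 2 2 * (star (bl x0 3 3) * N)) = sim x0 * tr N" unfolding tr_comm[of "star (bl x0 3 3) * N"] .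
      then show False using N(2) by (simp add: left_diff_distrib mult.assoc)
    qed
  qed (simp_all add: 0 N ae kcont)
qed

text \<open>Once \<open>C\<close> is a matrix unit, the trace hypotheses say that \<open>d\<close>
  has a nonzero lower left entry \<open>r\<close> and \<open>b1\<close> the opposite one. These two
  pivots, together with the one in \<open>C\<close>, suffice to reach the form of
  \<open>antidiagonal_involution\<close>.\<close>

lemma kill_antidiagonal:
  assumes E: "sk.invariant E" and rk: "\<And>y. y \<in> E \<Longrightarrow> nrm (bl y 3 1) = 0"
    and tt: "\<And>y. y \<in> E \<Longrightarrow> tr (star (bl y 3 1) * (bl y 2 1 + bl y 3 2)) = 0"
    and x: "x \<in> E" "tr (star (bl x 3 1) * bl x 3 2) \<noteq> 0"
  shows "sk.killable E x"
proof (rule rank_one_reduce[OF E rk x(1)])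
  show "bl x 3 1 \<noteq> 0" using x(2) by auto
  fix g h x0 assume g: "nrm g \<noteq> 0" "nrm h \<noteq> 0" "\<And>i j. bl x0 i j = g * bl x i j * h" and x0: "x0 \<in> E" "bl x0 3 1 = M2 0 1 0 0"
  have "star (bl x0 3 1) * bl x0 3 2 = star h * star (bl x 3 1) * (star g * g) * bl x 3 2 * h" unfolding g(3) by (simp add: mult.assoc)
  also have "\<dots> = sc (nrm g) * (star h * star (bl x 3 1) * bl x 3 2 * h)"
    unfolding mult_star sc_comm[of "star h * star (bl x 3 1)" "nrm g"] by (simp only: mult.assoc)
  finally have "tr (star (bl x0 3 1) * bl x0 3 2) = nrm g * tr (star h * star (bl x 3 1) * bl x 3 2 * h)" by (simp only: tr_simps(7))
  also have "tr (star h * star (bl x 3 1) * bl x 3 2 * h) = tr (h * star h * (star (bl x 3 1) * bl x 3 2))"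
    unfolding tr_comm[of _ h] by (simp only: mult.assoc)
  finally have "tr (star (bl x0 3 1) * bl x0 3 2) \<noteq> 0" using g(1,2) x(2) by (simp add: mult_star)
  then have rho0: "e21 (bl x0 3 2) \<noteq> 0" unfolding x0(2) by (simp add: tr_def)
  have "\<exists>V W. rel_open E V \<and> x0 \<in> V \<and> moved V W \<and> W x0 = x0 \<and> (\<forall>y\<in>V. bl (W y) 3 1 = M2 0 1 0 0)"
    by (rule rank_one_local[OF E _ x0]) (rule rk)
  then
  obtain V W where V: "rel_open E V" "x0 \<in> V" and W: "moved V W" "W x0 = x0" and C: "\<forall>y\<in>V. bl (W y) 3 1 = M2 0 1 0 0"
    by (elim exE conjE)
  note Wc = moved_cont[OF W(1)]
  let ?r = "\<lambda>y. e21 (bl (W y) 3 2)"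
  let ?U = "{y \<in> V. ?r y \<noteq> 0}"
  have U: "rel_open E ?U" by (intro rel_open_sub[OF V(1)] kcont Wc)
  have x0U: "x0 \<in> ?U" using V(2) W(2) rho0 by simp
  have UV: "?U \<subseteq> V" by (rule Collect_restrict)
  have WU: "moved ?U W" by (rule moved_mono[OF W(1) UV])
  note WUc = moved_cont[OF WU]
  have w0: "bl (W y) 3 1 = M2 0 1 0 0" "?r y \<noteq> 0" "e21 (bl (W y) 2 1) = - ?r y" if y: "y \<in> ?U" for y
  proof -
    show c: "bl (W y) 3 1 = M2 0 1 0 0" "?r y \<noteq> 0" using y C by auto
    have "W y \<in> E" by (rule moved_mem[OF WU U E y])
    from tt[OF this] have "- e21 (bl (W y) 2 1) = ?r y" unfolding c by (simp add: tr_def)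
    from arg_cong[OF this, of uminus] show "e21 (bl (W y) 2 1) = - ?r y" by (simp only: minus_minus)
  qed
  \<comment> \<open>Upper unipotent factors on either side preserve the matrix unit in
    \<open>C\<close>; they clear one entry of \<open>b1\<close> and one of \<open>d\<close>.\<close>
  let ?g = "\<lambda>y. M2 1 (e11 (bl (W y) 2 1) / ?r y) 0 1" and ?h = "\<lambda>y. M2 1 (- e22 (bl (W y) 3 2) / ?r y) 0 1"
  have n: "nrm (?g y) \<noteq> 0" "nrm (?h y) \<noteq> 0" for y by (simp_all add: nrm_def)
  define W1 where "W1 y = del (?g y) * W y * del (?h y)" for y
  have W1: "moved ?U W1" unfolding W1_def
    by (rule moved_del[OF WU _ n(1) _ n(2)]; intro kcont WUc w0(2); assumption)
  note W1c = moved_cont[OF W1]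
  have b1: "bl (W1 y) i j = ?g y * bl (W y) i j * ?h y" for y i j
    unfolding W1_def bl_mult_del[OF n(2)] bl_del_mult[OF n(1)] ..
  have w1: "bl (W1 y) 3 1 = M2 0 1 0 0" "e21 (bl (W1 y) 3 2) = ?r y" "e22 (bl (W1 y) 3 2) = 0"
    "e11 (bl (W1 y) 2 1) = 0" "e21 (bl (W1 y) 2 1) = - ?r y" if y: "y \<in> ?U" for y
    unfolding b1 using w0(1)[OF y] w0(2)[OF y] w0(3)[OF y] by (simp_all add: m2_eq_iff)
  let ?d = "\<lambda>y. bl (W1 y) 3 2" and ?b = "\<lambda>y. bl (W1 y) 2 1" and ?c = "\<lambda>y. bl (W1 y) 2 2"
  \<comment> \<open>These three numbers clear three entries of the middle block through the pivots
    of \<open>d\<close> and \<open>b1\<close>; the other entries of \<open>?X\<close> and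
    \<open>?X'\<close> clear what \<open>C\<close> reaches in \<open>b1\<close> and
    \<open>d\<close>.\<close>
  let ?s = "\<lambda>y. (e21 (?c y) - e22 (?b y) * e11 (?d y)) / ?r y" and ?q = "\<lambda>y. (e11 (?c y) - e12 (?b y) * e11 (?d y)) / ?r y"
  let ?t = "\<lambda>y. (e22 (?c y) - e22 (?b y) * e12 (?d y)) / ?r y"
  let ?X = "\<lambda>y. M2 (?s y) (- ?q y) (- e22 (?b y)) (e12 (?b y))" and ?X' = "\<lambda>y. M2 0 (?t y) (- e11 (?d y)) (- e12 (?d y))"
  let ?Z = "\<lambda>y. M2 (- nrm (?X y)) 0 0 0" and ?Z' = "\<lambda>y. M2 (- nrm (?X' y)) 0 0 0"
  have t: "tr (?Z y) = - nrm (?X y)" "tr (?Z' y) = - nrm (?X' y)" for y by (simp_all add: tr_def)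
  have c: "mcont ?U ?X" "mcont ?U ?X'" by (intro kcont W1c WUc w0(2); assumption)+
  have c': "mcont ?U ?Z" "mcont ?U ?Z'" by (intro mcont_intros(8) cont_k(4,6) mcontD(5) c)+
  define W2 where "W2 y = uel (?X y) (?Z y) * W1 y * uel (?X' y) (?Z' y)" for y
  have W2: "moved ?U W2" unfolding W2_def by (rule moved_uel[OF W1 c(1) c'(1) t(1) c(2) c'(2) t(2)])
  note W2c = moved_cont[OF W2]
  have w2: "bl (W2 y) 3 1 = M2 0 1 0 0" "bl (W2 y) 3 2 = M2 0 0 (?r y) 0" "bl (W2 y) 2 1 = M2 0 0 (- ?r y) 0"
    "e11 (bl (W2 y) 2 2) = 0" "e21 (bl (W2 y) 2 2) = 0" "e22 (bl (W2 y) 2 2) = 0" if y: "y \<in> ?U" for y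
    unfolding W2_def bl_uel2[OF t] w1(1)[OF y] using w1(2-5)[OF y] w0(2)[OF y] by (simp_all add: m2_eq_iff)
  \<comment> \<open>Traceless corner blocks with \<open>X = 0\<close> clear two entries each of
    \<open>a1\<close> and \<open>e\<close> through \<open>C\<close>; the entries divided by the
    pivot clear one entry of \<open>a2\<close> and one of \<open>b3\<close>.\<close>
  let ?Y = "\<lambda>y. M2 (- e12 (bl (W2 y) 1 1)) (- e11 (bl (W2 y) 1 2) / ?r y) (- e22 (bl (W2 y) 1 1)) (e12 (bl (W2 y) 1 1))"
  let ?Y' = "\<lambda>y. M2 (e12 (bl (W2 y) 3 3)) (e22 (bl (W2 y) 2 3) / ?r y) (- e11 (bl (W2 y) 3 3)) (- e12 (bl (W2 y) 3 3))"
  have u: "tr (?Y y) = - nrm (0 :: 'k m2)" "tr (?Y' y) = - nrm (0 :: 'k m2)" for y by (simp_all add: tr_def)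
  have cu: "mcont ?U (\<lambda>y. 0)" "mcont ?U ?Y" "mcont ?U ?Y'" by (intro kcont W2c WUc w0(2); assumption?)+
  define W3 where "W3 y = uel 0 (?Y y) * W2 y * uel 0 (?Y' y)" for y
  have W3: "moved ?U W3" unfolding W3_def by (rule moved_uel[OF W2 cu(1,2) u(1) cu(1,3) u(2)])
  show "sk.killable E x0"
  proof (rule kill_involution[OF E U x0U W3, where s = "\<lambda>y. 1"])
    fix y assume y: "y \<in> ?U"
    show "(1 :: 'k gsp6) \<in> Sh" by (rule subgpD(1)[OF Sh_subgp])
    note r = w0(2)[OF y]
    show "(inverse (W3 y) * (1 * eps)) * (inverse (W3 y) * (1 * eps)) \<in> scalars"
      by (rule antidiagonal_involution[OF r]; unfold W3_def bl_uel2[OF u] w2(1-3)[OF y])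
        (use r w2(4-6)[OF y] in \<open>simp_all add: m2_eq_iff\<close>)
  qed (rule continuous_on_const)
qed

text \<open>With both traces zero, the pivots of \<open>d\<close> and \<open>b1\<close> move to the
  diagonal. In the resulting normal form there is a unipotent element with nontrivial character
  whose conjugate lies in \<open>Sh\<close> and has vanishing block \<open>(1, 2)\<close>, hence
  trivial character.\<close>

lemma kill_unipotent:
  assumes E: "sk.invariant E" and rk: "\<And>y. y \<in> E \<Longrightarrow> nrm (bl y 3 1) = 0"
    and tt: "\<And>y. y \<in> E \<Longrightarrow> tr (star (bl y 3 1) * (bl y 2 1 + bl y 3 2)) = 0" "\<And>y. y \<in> E \<Longrightarrow> tr (star (bl y 3 1) * bl y 3 2) = 0"
    and x: "x \<in> E" "star (bl x 3 1) * bl x 3 2 \<noteq> 0"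
  shows "sk.killable E x"
proof (rule rank_one_reduce[OF E rk x(1)])
  show "bl x 3 1 \<noteq> 0" using x(2) by auto
  fix g h x0 assume g: "nrm g \<noteq> 0" "nrm h \<noteq> 0" "\<And>i j. bl x0 i j = g * bl x i j * h" and x0: "x0 \<in> E" "bl x0 3 1 = M2 0 1 0 0"
  have "star (bl x0 3 1) * bl x0 3 2 = star h * star (bl x 3 1) * (star g * g) * bl x 3 2 * h" unfolding g(3) by (simp add: mult.assoc)
  also have "\<dots> = sc (nrm g) * (star h * (star (bl x 3 1) * bl x 3 2) * h)"
    unfolding mult_star sc_comm[of "star h * star (bl x 3 1)" "nrm g"] by (simp only: mult.assoc)
  finally have eq: "star (bl x0 3 1) * bl x0 3 2 = sc (nrm g) * (star h * (star (bl x 3 1) * bl x 3 2) * h)" .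
  have ne0: "star (bl x0 3 1) * bl x0 3 2 \<noteq> 0"
  proof
    assume "star (bl x0 3 1) * bl x0 3 2 = 0"
    then have "sc (nrm g) * (star h * (star (bl x 3 1) * bl x 3 2) * h) = 0" unfolding eq .
    then have "star h * (star (bl x 3 1) * bl x 3 2) * h = 0" using g(1) by (simp add: m2_eq_iff)
    then have "h * (star h * (star (bl x 3 1) * bl x 3 2) * h) * star h = 0" by simp
    then have "sc (nrm h) * (star (bl x 3 1) * bl x 3 2) * sc (nrm h) = 0" unfolding mult_star(1)[of h, symmetric] by (simp only: mult.assoc)
    then have "star (bl x 3 1) * bl x 3 2 = 0" using g(2) by (simp add: m2_eq_iff)
    then show False using x(2) by simp
  qed
  have "\<exists>V W. rel_open E V \<and> x0 \<in> V \<and> moved V W \<and> W x0 = x0 \<and> (\<forall>y\<in>V. bl (W y) 3 1 = M2 0 1 0 0)"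
    by (rule rank_one_local[OF E _ x0]) (rule rk)
  then
  obtain V W where V: "rel_open E V" "x0 \<in> V" and W: "moved V W" "W x0 = x0" and C: "\<forall>y\<in>V. bl (W y) 3 1 = M2 0 1 0 0"
    by (elim exE conjE)
  note Wc = moved_cont[OF W(1)]
  let ?r = "\<lambda>y. e22 (bl (W y) 3 2)"
  let ?U = "{y \<in> V. ?r y \<noteq> 0}"
  have U: "rel_open E ?U" by (intro rel_open_sub[OF V(1)] kcont Wc)
  have WE: "W y \<in> E" if "y \<in> V" for y by (rule moved_mem[OF W(1) V(1) E that])
  have rho0: "?r x0 \<noteq> 0"
    using tt(2)[OF x0(1)] ne0 unfolding W(2) x0(2) by (simp add: m2_eq_iff tr_def)
  have x0U: "x0 \<in> ?U" using V(2) rho0 by simp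
  have UV: "?U \<subseteq> V" by (rule Collect_restrict)
  have WU: "moved ?U W" by (rule moved_mono[OF W(1) UV])
  note WUc = moved_cont[OF WU]
  have w0: "bl (W y) 3 1 = M2 0 1 0 0" "?r y \<noteq> 0" "e21 (bl (W y) 3 2) = 0" "e21 (bl (W y) 2 1) = 0" if y: "y \<in> ?U" for y
  proof -
    show c: "bl (W y) 3 1 = M2 0 1 0 0" "?r y \<noteq> 0" using y C by auto
    have E': "W y \<in> E" by (rule moved_mem[OF WU U E y])
    show d: "e21 (bl (W y) 3 2) = 0" using tt(2)[OF E'] unfolding c by (simp add: tr_def)
    show "e21 (bl (W y) 2 1) = 0" using tt(1)[OF E'] d unfolding c by (simp add: tr_def)
  qed
  let ?d = "\<lambda>y. bl (W y) 3 2" and ?b = "\<lambda>y. bl (W y) 2 1" and ?c = "\<lambda>y. bl (W y) 2 2"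
  let ?s = "\<lambda>y. (e22 (?c y) - e22 (?b y) * e12 (?d y)) / ?r y" and ?q = "\<lambda>y. (e12 (?c y) - e12 (?b y) * e12 (?d y)) / ?r y"
  let ?X = "\<lambda>y. M2 (?s y) (- ?q y) (- e22 (?b y)) (e12 (?b y))" and ?X' = "\<lambda>y. M2 0 0 (- e11 (?d y)) (- e12 (?d y))"
  let ?Z = "\<lambda>y. M2 (- nrm (?X y)) 0 0 0" and ?Z' = "\<lambda>y. M2 (- nrm (?X' y)) 0 0 0"
  have t: "tr (?Z y) = - nrm (?X y)" "tr (?Z' y) = - nrm (?X' y)" for y by (simp_all add: tr_def)
  have c: "mcont ?U ?X" "mcont ?U ?X'" by (intro kcont WUc w0(2); assumption)+
  have c': "mcont ?U ?Z" "mcont ?U ?Z'" by (intro mcont_intros(8) cont_k(4,6) mcontD(5) c)+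
  define W1 where "W1 y = uel (?X y) (?Z y) * W y * uel (?X' y) (?Z' y)" for y
  have W1: "moved ?U W1" unfolding W1_def by (rule moved_uel[OF WU c(1) c'(1) t(1) c(2) c'(2) t(2)])
  note W1c = moved_cont[OF W1]
  define B where "B y = e11 (bl (W1 y) 2 1)" for y
  have Bc: "continuous_on ?U B" unfolding B_def by (intro kcont W1c)
  have w1: "bl (W1 y) 3 1 = M2 0 1 0 0" "bl (W1 y) 3 2 = M2 0 0 0 (?r y)" "bl (W1 y) 2 1 = M2 (B y) 0 0 0"
    "e12 (bl (W1 y) 2 2) = 0" "e22 (bl (W1 y) 2 2) = 0" if y: "y \<in> ?U" for y
    unfolding B_def W1_def bl_uel2[OF t] w0(1)[OF y] using w0(2-4)[OF y] by (simp_all add: m2_eq_iff)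
  \<comment> \<open>If \<open>B y\<close> vanished, the row relation at \<open>(2, 2)\<close> would
    make the middle block invertible, but its second column is zero.\<close>
  have Bn: "B y \<noteq> 0" if y: "y \<in> ?U" for y
  proof
    assume "B y = 0"
    then have "bl (W1 y) 2 2 * star (bl (W1 y) 2 2) = sc (sim (W1 y))" using row_rel[of "W1 y" 2 2] by (simp add: w1[OF y] m2_eq_iff)
    then have "nrm (bl (W1 y) 2 2) = sim (W1 y)" by (simp add: mult_star)
    then show False using sim(1)[of "W1 y"] w1(4,5)[OF y] by (simp add: nrm_def)
  qed
  let ?P = "\<lambda>y. M2 (- e11 (bl (W1 y) 2 2) / B y) 0 0 0"
  let ?Y = "\<lambda>y. M2 (- e12 (bl (W1 y) 1 1)) 0 (- e22 (bl (W1 y) 1 1)) (e12 (bl (W1 y) 1 1))"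
  let ?Y' = "\<lambda>y. M2 (e12 (bl (W1 y) 3 3)) 0 (- e11 (bl (W1 y) 3 3)) (- e12 (bl (W1 y) 3 3))"
  have u: "tr (?Y y) = - nrm (0 :: 'k m2)" "tr (?Y' y) = - nrm (?P y)" for y by (simp_all add: tr_def nrm_def)
  have cu: "mcont ?U (\<lambda>y. 0)" "mcont ?U ?Y" "mcont ?U ?P" "mcont ?U ?Y'" by (intro kcont W1c Bc Bn; assumption?)+
  define W2 where "W2 y = uel 0 (?Y y) * W1 y * uel (?P y) (?Y' y)" for y
  have W2: "moved ?U W2" unfolding W2_def by (rule moved_uel[OF W1 cu(1,2) u(1) cu(3,4) u(2)])
  note W2c = moved_cont[OF W2]
  have w2: "bl (W2 y) 3 1 = M2 0 1 0 0" "bl (W2 y) 3 2 = M2 0 0 0 (?r y)" "bl (W2 y) 2 1 = M2 (B y) 0 0 0"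
    "e11 (bl (W2 y) 2 2) = 0" "e12 (bl (W2 y) 2 2) = 0" "e22 (bl (W2 y) 2 2) = 0" "e11 (bl (W2 y) 3 3) = 0" "e12 (bl (W2 y) 3 3) = 0"
    "e12 (bl (W2 y) 1 1) = 0" "e22 (bl (W2 y) 1 1) = 0" if y: "y \<in> ?U" for y
    unfolding W2_def bl_uel2[OF u] w1(1-3)[OF y] using w1(4,5)[OF y] Bn[OF y] by (simp_all add: m2_eq_iff)
  have w3: "bl (W2 y) 3 3 = 0" "bl (W2 y) 2 2 = 0" "bl (W2 y) 1 1 = 0" "e11 (bl (W2 y) 1 2) = sim (W2 y) / ?r y" "e21 (bl (W2 y) 1 2) = 0"
    if y: "y \<in> ?U" for y
  proof -
    note w = w2[OF y]
    have r: "?r y \<noteq> 0" by (rule w0(2)[OF y])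
    have e21: "e21 (bl (W2 y) 3 3) = 0" using row_rel[of "W2 y" 3 3] by (simp add: w m2_eq_iff)
    have 1: "e22 (bl (W2 y) 3 3) = 0 \<and> e21 (bl (W2 y) 2 2) = 0"
      using row_rel[of "W2 y" 2 3] r Bn[OF y] by (simp add: w m2_eq_iff)
    show e0: "bl (W2 y) 3 3 = 0" "bl (W2 y) 2 2 = 0" using 1 e21 w by (simp_all add: m2_eq_iff)
    have a21: "e21 (bl (W2 y) 1 1) = 0" using col_rel[of "W2 y" 1 1] by (simp add: w m2_eq_iff)
    have "e11 (bl (W2 y) 1 1) = 0" using col_rel[of "W2 y" 1 2] r by (simp add: w e0 a21 m2_eq_iff)
    then show a0: "bl (W2 y) 1 1 = 0" using w a21 by (simp add: m2_eq_iff)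
    have 2: "e11 (bl (W2 y) 1 2) * ?r y = sim (W2 y) \<and> e21 (bl (W2 y) 1 2) = 0"
      using row_rel[of "W2 y" 1 3] r by (simp add: w e0 a0 m2_eq_iff)
    then show "e21 (bl (W2 y) 1 2) = 0" by simp
    show "e11 (bl (W2 y) 1 2) = sim (W2 y) / ?r y" using 2 r by (simp add: eq_divide_eq)
  qed
  obtain m where m: "\<psi> (m * (- 1)) \<noteq> 1" using psi_scale[of "- 1"] by auto
  \<comment> \<open>The coefficient of the corner block is forced: it makes the diagonal blocks
    \<open>(1, 1)\<close> and \<open>(2, 2)\<close> of the conjugate \<open>?a y\<close>
    agree.\<close>
  let ?b = "\<lambda>y. uel (M2 0 0 0 m) (M2 0 (m * sim (W2 y) / (?r y * B y * B y)) 0 0)"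
  have tb: "tr (M2 0 (m * sim (W2 y) / (?r y * B y * B y)) 0 0) = - nrm (M2 0 0 0 m)" for y by (simp add: tr_def nrm_def)
  have bc: "continuous_on ?U ?b"
  proof (rule cont_uel[OF _ _ tb])
    show "mcont ?U (\<lambda>y. M2 0 0 0 m)" by (intro kcont)
    have nz: "?r y * B y * B y \<noteq> 0" if "y \<in> ?U" for y using w0(2)[OF that] Bn[OF that] by simp
    show "mcont ?U (\<lambda>y. M2 0 (m * sim (W2 y) / (?r y * B y * B y)) 0 0)"
      by (intro mcont_intros(8) cont_k cont_sim Bc W2c mcontD(1,4) mcont_bl WUc W1c nz)
  qed
  let ?a = "\<lambda>y. W2 y * ?b y * inverse (W2 y)"
  have a: "bl (?a y) 3 1 = 0" "bl (?a y) 3 2 = 0" "bl (?a y) 2 1 = 0" "bl (?a y) 2 2 = bl (?a y) 1 1" "bl (?a y) 1 2 = 0" if y: "y \<in> ?U" for y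
    unfolding bl_conj_uel[OF tb] rv_simps w2(1-3)[OF y] w3(1-3)[OF y]
    using w3(4,5)[OF y] w0(2)[OF y] Bn[OF y] sim(1)[of "W2 y"] by (simp_all add: m2_eq_iff)
  have aS: "?a y \<in> Sh" if y: "y \<in> ?U" for y unfolding mem_Sh_iff using a[OF y] by simp
  obtain K0 where K0: "?b x0 \<in> K0" "K0 \<in> KKs" using uel_KKs[OF tb[of x0]] by (elim bexE)
  show "sk.killable E x0"
  proof (rule kill_stabilizer[OF E U x0U W2 _ bc aS Sh_uel[OF tb] _ disjI2[OF K0(1)] K0(2)])
    show "continuous_on ?U ?a" by (intro kcont W2c bc)
    show "?a y * W2 y = W2 y * ?b y" for y by (simp add: mult.assoc)
    have "chi \<psi> (?a x0) = 1" unfolding chi_eq[OF aS[OF x0U]] a(5)[OF x0U] by (simp add: psi_zero[OF psi])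
    moreover have "chi \<psi> (?b x0) = \<psi> (m * (- 1))" unfolding chi_uel[OF tb] by (simp add: tr_def)
    ultimately show "chi \<psi> (?a x0) \<noteq> chi \<psi> (?b x0)" using m by simp
  qed
qed

text \<open>The hypotheses place the image of \<open>d\<close> in that of \<open>C\<close> and make
  \<open>b1\<close> vanish on the kernel of \<open>C\<close>, so multiples of \<open>C\<close> clear
  both. The multipliers have norm zero, which permits \<open>Z = 0\<close>.\<close>

lemma cusp_normal_form:
  assumes E: "sk.invariant E" and rk: "\<And>y. y \<in> E \<Longrightarrow> nrm (bl y 3 1) = 0"
    and Cd: "\<And>y. y \<in> E \<Longrightarrow> star (bl y 3 1) * bl y 3 2 = 0" and bC: "\<And>y. y \<in> E \<Longrightarrow> bl y 2 1 * star (bl y 3 1) = 0"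
    and x0: "x0 \<in> E" "bl x0 3 1 = M2 0 1 0 0"
  shows "\<exists>V W. rel_open E V \<and> x0 \<in> V \<and> moved V W \<and> (bl x0 2 1 = 0 \<and> bl x0 3 2 = 0 \<longrightarrow> W x0 = x0) \<and>
    (\<forall>y\<in>V. bl (W y) 3 1 = M2 0 1 0 0 \<and> bl (W y) 2 1 = 0 \<and> bl (W y) 3 2 = 0)"
proof -
  have "\<exists>V W. rel_open E V \<and> x0 \<in> V \<and> moved V W \<and> W x0 = x0 \<and> (\<forall>y\<in>V. bl (W y) 3 1 = M2 0 1 0 0)"
    by (rule rank_one_local[OF E _ x0]) (rule rk)
  then obtain V W where V: "rel_open E V" "x0 \<in> V" and W: "moved V W" "W x0 = x0" and C: "\<forall>y\<in>V. bl (W y) 3 1 = M2 0 1 0 0"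
    by (elim exE conjE)
  note Wc = moved_cont[OF W(1)]
  let ?X = "\<lambda>y. M2 0 0 (- e22 (bl (W y) 2 1)) (e12 (bl (W y) 2 1))" and ?X' = "\<lambda>y. M2 0 0 (- e11 (bl (W y) 3 2)) (- e12 (bl (W y) 3 2))"
  have t: "tr 0 = - nrm (?X y)" "tr 0 = - nrm (?X' y)" for y by (simp_all add: nrm_def)
  have c: "mcont V ?X" "mcont V ?X'" "mcont V (\<lambda>y. 0)" by (intro kcont Wc)+
  define W1 where "W1 y = uel (?X y) 0 * W y * uel (?X' y) 0" for y
  have W1: "moved V W1" unfolding W1_def by (rule moved_uel[OF W(1) c(1,3) t(1) c(2,3) t(2)])
  have "bl (W1 y) 3 1 = M2 0 1 0 0 \<and> bl (W1 y) 2 1 = 0 \<and> bl (W1 y) 3 2 = 0" if y: "y \<in> V" for y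
  proof -
    have C': "bl (W y) 3 1 = M2 0 1 0 0" using C y by simp
    have WE: "W y \<in> E" by (rule moved_mem[OF W(1) V(1) E y])
    have d: "e21 (bl (W y) 3 2) = 0 \<and> e22 (bl (W y) 3 2) = 0" using Cd[OF WE] unfolding C' by (simp add: m2_eq_iff)
    have b: "e11 (bl (W y) 2 1) = 0 \<and> e21 (bl (W y) 2 1) = 0" using bC[OF WE] unfolding C' by (simp add: m2_eq_iff)
    show ?thesis unfolding W1_def bl_uel2[OF t] C' using d b by (simp add: m2_eq_iff)
  qed
  moreover have "W1 x0 = x0" if "bl x0 2 1 = 0 \<and> bl x0 3 2 = 0"
  proof -
    have z: "M2 0 0 0 0 = (0 :: 'k m2)" by (simp add: m2_eq_iff)
    have "uel 0 0 = (1 :: 'k gsp6)" by (rule bl_eqI3) (simp_all add: bl_uel bl_one)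
    then show ?thesis unfolding W1_def W(2) using that by (simp add: z)
  qed
  ultimately show ?thesis using V W1 by (intro exI[of _ V] exI[of _ W1] conjI impI ballI) simp_all
qed

text \<open>Every matrix \<open>N\<close> whose image lies in that of \<open>C\<close> satisfies the
  constraints of \<open>kill_diagonal\<close>; such \<open>N\<close> have norm zero, and one of them
  detects the failure of the equation in \<open>ne\<close>.\<close>

lemma kill_cusp_generic:
  assumes E: "sk.invariant E" and rk: "\<And>y. y \<in> E \<Longrightarrow> nrm (bl y 3 1) = 0"
    and Cd: "\<And>y. y \<in> E \<Longrightarrow> star (bl y 3 1) * bl y 3 2 = 0" and bC: "\<And>y. y \<in> E \<Longrightarrow> bl y 2 1 * star (bl y 3 1) = 0"
    and x0: "x0 \<in> E" "bl x0 3 1 = M2 0 1 0 0" "bl x0 2 1 = 0" "bl x0 3 2 = 0"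
    and ne: "bl x0 2 2 * star (bl x0 3 3) * M2 0 1 0 0 \<noteq> sc (sim x0) * M2 0 1 0 0"
  shows "sk.killable E x0"
proof -
  have "\<exists>V W. rel_open E V \<and> x0 \<in> V \<and> moved V W \<and> (bl x0 2 1 = 0 \<and> bl x0 3 2 = 0 \<longrightarrow> W x0 = x0) \<and>
    (\<forall>y\<in>V. bl (W y) 3 1 = M2 0 1 0 0 \<and> bl (W y) 2 1 = 0 \<and> bl (W y) 3 2 = 0)"
    by (rule cusp_normal_form[OF E _ _ _ x0(1,2)]) (fact rk Cd bC)+
  then obtain V W where V: "rel_open E V" "x0 \<in> V" and W: "moved V W" and W0: "bl x0 2 1 = 0 \<and> bl x0 3 2 = 0 \<longrightarrow> W x0 = x0"
    and B: "\<forall>y\<in>V. bl (W y) 3 1 = M2 0 1 0 0 \<and> bl (W y) 2 1 = 0 \<and> bl (W y) 3 2 = 0"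
    by (elim exE conjE)
  have Wx: "W x0 = x0" using W0 x0 by simp
  let ?K = "bl x0 2 2 * star (bl x0 3 3) * M2 0 1 0 0 - sc (sim x0) * M2 0 1 0 0"
  have "?K \<noteq> 0" using ne by simp
  then obtain N0 where N0: "tr (?K * N0) \<noteq> 0" using trace_nondegenerate by metis
  let ?N = "M2 0 1 0 0 * N0"
  have w: "bl (W y) 3 1 = M2 0 1 0 0" "bl (W y) 2 1 = 0" "bl (W y) 3 2 = 0" if "y \<in> V" for y using B that by simp_all
  show ?thesis
  proof (rule kill_diagonal[OF E V W, of "\<lambda>y. ?N"])
    show "mcont V (\<lambda>y. ?N)" by (rule kcont)
    fix y assume y: "y \<in> V"
    show "bl (W y) 2 1 = 0" "bl (W y) 3 2 = 0" by (rule w[OF y])+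
    show "nrm ?N = 0" unfolding nrm_simps(3) by (simp add: nrm_def)
    show "star ?N * bl (W y) 3 1 = 0" unfolding w[OF y] by (simp add: m2_eq_iff)
    have e: "e21 (bl (W y) 3 3) = 0" using row_rel[of "W y" 3 3] by (simp add: w[OF y] m2_eq_iff)
    show "bl (W y) 3 1 * star (bl (W y) 3 3) * ?N = 0" unfolding w[OF y] using e by (simp add: m2_eq_iff)
    have "bl (W y) 1 1 * star (bl (W y) 3 3) + bl (W y) 1 3 * star (M2 0 1 0 0) = sc (sim (W y))"
      using row_rel[of "W y" 1 3] by (simp add: w[OF y])
    from arg_cong[OF this, of "\<lambda>A. A * ?N"]
    have "bl (W y) 1 1 * star (bl (W y) 3 3) * ?N + bl (W y) 1 3 * (star (M2 0 1 0 0) * ?N) = sc (sim (W y)) * ?N"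
      by (simp only: distrib_right mult.assoc)
    moreover have "star (M2 0 1 0 0) * ?N = 0" by (simp add: m2_eq_iff)
    ultimately show "bl (W y) 1 1 * star (bl (W y) 3 3) * ?N = sc (sim (W y)) * ?N" by simp
  next
    show "tr (star (bl (W x0) 3 3) * ?N * bl (W x0) 2 2) \<noteq> sim (W x0) * tr ?N"
    proof
      assume "tr (star (bl (W x0) 3 3) * ?N * bl (W x0) 2 2) = sim (W x0) * tr ?N"
      then have "tr (bl x0 2 2 * (star (bl x0 3 3) * ?N)) = sim x0 * tr ?N" unfolding Wx tr_comm[of "star (bl x0 3 3) * ?N"] .
      then show False using N0 unfolding left_diff_distrib tr_simps(3) mult.assoc tr_simps(7) by simp
    qed
  qed
qed

text \<open>The equation \<open>gd\<close>, valid at all normalized points of \<open>E\<close>,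
  fixes the first column of the middle block and its norm fixes the last diagonal entry. After the
  other blocks are cleared this is the shape required by \<open>cusp_involution\<close>.\<close>

lemma kill_cusp:
  assumes E: "sk.invariant E" and rk: "\<And>y. y \<in> E \<Longrightarrow> nrm (bl y 3 1) = 0"
    and Cd: "\<And>y. y \<in> E \<Longrightarrow> star (bl y 3 1) * bl y 3 2 = 0" and bC: "\<And>y. y \<in> E \<Longrightarrow> bl y 2 1 * star (bl y 3 1) = 0"
    and gd: "\<And>y. y \<in> E \<Longrightarrow> bl y 3 1 = M2 0 1 0 0 \<Longrightarrow> bl y 2 1 = 0 \<Longrightarrow> bl y 3 2 = 0 \<Longrightarrow>
       bl y 2 2 * star (bl y 3 3) * M2 0 1 0 0 = sc (sim y) * M2 0 1 0 0"
    and x: "x \<in> E" "bl x 3 1 \<noteq> 0"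
  shows "sk.killable E x"
proof (rule rank_one_reduce[OF E rk x])
  fix x0 assume x0: "x0 \<in> E" "bl x0 3 1 = M2 0 1 0 0"
  have "\<exists>V W. rel_open E V \<and> x0 \<in> V \<and> moved V W \<and> (bl x0 2 1 = 0 \<and> bl x0 3 2 = 0 \<longrightarrow> W x0 = x0) \<and>
    (\<forall>y\<in>V. bl (W y) 3 1 = M2 0 1 0 0 \<and> bl (W y) 2 1 = 0 \<and> bl (W y) 3 2 = 0)"
    by (rule cusp_normal_form[OF E _ _ _ x0]) (fact rk Cd bC)+
  then obtain V W where V: "rel_open E V" "x0 \<in> V" and W: "moved V W"
    and B: "\<forall>y\<in>V. bl (W y) 3 1 = M2 0 1 0 0 \<and> bl (W y) 2 1 = 0 \<and> bl (W y) 3 2 = 0"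
    by (elim exE conjE)
  note Wc = moved_cont[OF W]
  have w: "bl (W y) 3 1 = M2 0 1 0 0" "bl (W y) 2 1 = 0" "bl (W y) 3 2 = 0" if "y \<in> V" for y using B that by simp_all
  have b3: "e11 (bl (W y) 2 3) = 0" "e21 (bl (W y) 2 3) = 0" if y: "y \<in> V" for y
    using row_rel[of "W y" 2 3] by (simp_all add: w[OF y] m2_eq_iff)
  have r22: "nrm (bl (W y) 2 2) = sim (W y)" if y: "y \<in> V" for y
    using row_rel[of "W y" 2 2] by (simp add: w[OF y] mult_star)
  \<comment> \<open>\<open>bl (W y) 2 2 * star (?P y)\<close> equals \<open>bl (W y) 2 3\<close>,
    since the middle block times its star is the scalar \<open>sim (W y)\<close>; so
    \<open>?P\<close> removes block \<open>(2, 3)\<close>. It has norm zero because that block has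
    rank at most one.\<close>
  let ?P = "\<lambda>y. sc (1 / sim (W y)) * (star (bl (W y) 2 3) * bl (W y) 2 2)"
  let ?Y = "\<lambda>y. M2 (- e12 (bl (W y) 1 1)) 0 (- e22 (bl (W y) 1 1)) (e12 (bl (W y) 1 1))"
  let ?Y' = "\<lambda>y. M2 (e12 (bl (W y) 3 3)) 0 (- e11 (bl (W y) 3 3)) (- e12 (bl (W y) 3 3))"
  have u: "tr (?Y y) = - nrm (0 :: 'k m2)" for y by (simp add: tr_def)
  have u': "tr (?Y' y) = - nrm (?P y)" if y: "y \<in> V" for y
  proof -
    have "nrm (bl (W y) 2 3) = 0" using b3[OF y] by (simp add: nrm_def)
    then have "nrm (?P y) = 0" unfolding nrm_simps(3,4) by (simp only: mult_zero_left mult_zero_right)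
    then show ?thesis by (simp add: tr_def)
  qed
  have cu: "mcont V (\<lambda>y. 0)" "mcont V ?Y" "mcont V ?P" "mcont V ?Y'" by (intro kcont Wc sim)+
  define W1 where "W1 y = uel 0 (?Y y) * W y * uel (?P y) (?Y' y)" for y
  have W1: "moved V W1" unfolding W1_def by (rule moved_uel[OF W cu(1,2) u cu(3,4) u'])
  note W1c = moved_cont[OF W1]
  have w1: "bl (W1 y) 3 1 = M2 0 1 0 0" "bl (W1 y) 2 1 = 0" "bl (W1 y) 3 2 = 0" "bl (W1 y) 2 3 = 0"
    "e11 (bl (W1 y) 3 3) = 0" "e12 (bl (W1 y) 3 3) = 0" "e12 (bl (W1 y) 1 1) = 0" "e22 (bl (W1 y) 1 1) = 0" if y: "y \<in> V" for y
  proof -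
    note b = bl_uel2[OF u[of y] u'[OF y], of "W y", folded W1_def[of y]]
    show "bl (W1 y) 3 1 = M2 0 1 0 0" "bl (W1 y) 2 1 = 0" unfolding b w[OF y] by simp_all
    show "bl (W1 y) 3 2 = 0" unfolding b w[OF y] using b3[OF y] by (simp add: m2_eq_iff)
    have s: "star (?P y) = sc (1 / sim (W y)) * (star (bl (W y) 2 2) * bl (W y) 2 3)" by (simp add: sc_comm[of "star _ * _" "1 / sim (W y)"])
    have "bl (W y) 2 2 * star (?P y) = sc (1 / sim (W y)) * (bl (W y) 2 2 * star (bl (W y) 2 2) * bl (W y) 2 3)"
      unfolding s sc_left[of "bl (W y) 2 2"] by (simp only: mult.assoc)
    also have "\<dots> = sc (1 / sim (W y)) * sc (sim (W y)) * bl (W y) 2 3" unfolding mult_star r22[OF y] by (simp only: mult.assoc)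
    also have "\<dots> = bl (W y) 2 3" unfolding sc_inverse(1)[OF sim(1)] by simp
    finally show "bl (W1 y) 2 3 = 0" unfolding b w[OF y] by simp
    show "e11 (bl (W1 y) 3 3) = 0" "e12 (bl (W1 y) 3 3) = 0" "e12 (bl (W1 y) 1 1) = 0" "e22 (bl (W1 y) 1 1) = 0"
      unfolding b w[OF y] by simp_all
  qed
  have w2: "bl (W1 y) 1 2 = 0" "bl (W1 y) 3 3 = M2 0 0 0 (e22 (bl (W1 y) 3 3))" "bl (W1 y) 1 1 = M2 (e11 (bl (W1 y) 1 1)) 0 0 0"
    "e11 (bl (W1 y) 1 1) * e22 (bl (W1 y) 3 3) = sim (W1 y)" "e11 (bl (W1 y) 1 3) = 0" "e21 (bl (W1 y) 1 3) = - sim (W1 y)" "e22 (bl (W1 y) 1 3) = 0"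
    if y: "y \<in> V" for y
  proof -
    note v = w1[OF y]
    have b2: "star (bl (W1 y) 2 2) * bl (W1 y) 2 2 = sc (sim (W1 y))" using row_rel[of "W1 y" 2 2] v by (simp add: mult_star)
    have "bl (W1 y) 1 2 * star (bl (W1 y) 2 2) = 0" using row_rel[of "W1 y" 1 2] v by simp
    then have "bl (W1 y) 1 2 * star (bl (W1 y) 2 2) * bl (W1 y) 2 2 = 0" by simp
    then have "bl (W1 y) 1 2 * sc (sim (W1 y)) = 0" unfolding mult.assoc b2 .
    then show a2: "bl (W1 y) 1 2 = 0" using sim(1)[of "W1 y"] by (simp add: m2_eq_iff)
    have e21: "e21 (bl (W1 y) 3 3) = 0" using row_rel[of "W1 y" 3 3] by (simp add: v m2_eq_iff)
    then show "bl (W1 y) 3 3 = M2 0 0 0 (e22 (bl (W1 y) 3 3))" using v(5,6) unfolding m2_eq_iff by simp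
    have a21: "e21 (bl (W1 y) 1 1) = 0" using col_rel[of "W1 y" 1 1] by (simp add: v m2_eq_iff)
    then show "bl (W1 y) 1 1 = M2 (e11 (bl (W1 y) 1 1)) 0 0 0" using v(7,8) unfolding m2_eq_iff by simp
    have r13: "e11 (bl (W1 y) 1 1) * e22 (bl (W1 y) 3 3) = sim (W1 y) \<and> e11 (bl (W1 y) 1 3) = 0 \<and> - e21 (bl (W1 y) 1 3) = sim (W1 y)"
      using row_rel[of "W1 y" 1 3] by (simp add: v a2 e21 a21 m2_eq_iff)
    then show af: "e11 (bl (W1 y) 1 1) * e22 (bl (W1 y) 3 3) = sim (W1 y)" and "e11 (bl (W1 y) 1 3) = 0" by simp_all
    from r13 have "- e21 (bl (W1 y) 1 3) = sim (W1 y)" by simp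
    from arg_cong[OF this, of uminus] show "e21 (bl (W1 y) 1 3) = - sim (W1 y)" by (simp only: minus_minus)
    have "e11 (bl (W1 y) 1 1) * e22 (bl (W1 y) 1 3) = 0" using row_rel[of "W1 y" 1 1] by (simp add: v a2 a21 m2_eq_iff)
    moreover have "e11 (bl (W1 y) 1 1) \<noteq> 0" using af sim(1)[of "W1 y"] by auto
    ultimately show "e22 (bl (W1 y) 1 3) = 0" by simp
  qed
  have f0: "e22 (bl (W1 y) 3 3) \<noteq> 0" if y: "y \<in> V" for y using w2(4)[OF y] sim(1)[of "W1 y"] by auto
  \<comment> \<open>The invertible corner entry of \<open>e\<close> is the pivot for the last
    unwanted entry of block \<open>(1, 3)\<close>.\<close>
  let ?Q = "\<lambda>y. M2 0 (- e12 (bl (W1 y) 1 3) / e22 (bl (W1 y) 3 3)) 0 0"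
  have q: "tr (?Q y) = - nrm (0 :: 'k m2)" "tr (0 :: 'k m2) = - nrm (0 :: 'k m2)" for y by (simp_all add: tr_def)
  have cq: "mcont V ?Q" by (intro kcont W1c f0; assumption?)
  define W2 where "W2 y = uel 0 (?Q y) * W1 y * uel 0 0" for y
  have W2: "moved V W2" unfolding W2_def by (rule moved_uel[OF W1 cu(1) cq q(1) cu(1,1) q(2)])
  let ?a = "\<lambda>y. e11 (bl (W1 y) 1 1)" and ?f = "\<lambda>y. e22 (bl (W1 y) 3 3)"
  have w3: "bl (W2 y) 3 1 = M2 0 1 0 0" "bl (W2 y) 3 2 = 0" "bl (W2 y) 2 1 = 0" "bl (W2 y) 2 3 = 0" "bl (W2 y) 1 2 = 0"
    "bl (W2 y) 3 3 = M2 0 0 0 (?f y)" "bl (W2 y) 1 1 = M2 (?a y) 0 0 0" "bl (W2 y) 1 3 = M2 0 0 (- sim (W2 y)) 0"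
    "?a y * ?f y = sim (W2 y)" "bl (W2 y) 2 2 = M2 (?a y) (e12 (bl (W2 y) 2 2)) 0 (?f y)" if y: "y \<in> V" for y
  proof -
    note b = bl_uel2[OF q(1)[of y] q(2), of "W1 y", folded W2_def[of y]] and v = w1[OF y] w2(1,4-7)[OF y]
    have s: "sim (W2 y) = sim (W1 y)" unfolding W2_def by (rule sim_uel2[OF q])
    show C: "bl (W2 y) 3 1 = M2 0 1 0 0" and d: "bl (W2 y) 3 2 = 0" and b1: "bl (W2 y) 2 1 = 0"
      and b3: "bl (W2 y) 2 3 = 0" and "bl (W2 y) 1 2 = 0" unfolding b using v(1-4,9) by simp_all
    have "bl (W2 y) 3 3 = bl (W1 y) 3 3" unfolding b using v by simp
    then show e: "bl (W2 y) 3 3 = M2 0 0 0 (?f y)" using w2(2)[OF y] by simp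
    have "?Q y * M2 0 1 0 0 = 0" by (simp add: m2_eq_iff)
    then have "bl (W2 y) 1 1 = bl (W1 y) 1 1" unfolding b using v(1,2) by simp
    then show "bl (W2 y) 1 1 = M2 (?a y) 0 0 0" using w2(3)[OF y] by simp
    have "?Q y * bl (W1 y) 3 3 = M2 0 (- e12 (bl (W1 y) 1 3)) 0 0" using f0[OF y] v(5,6) w2(2)[OF y]
      by (subst w2(2)[OF y]) (simp add: m2_eq_iff)
    then show "bl (W2 y) 1 3 = M2 0 0 (- sim (W2 y)) 0" unfolding b s using v by (simp add: m2_eq_iff)
    show af: "?a y * ?f y = sim (W2 y)" unfolding s by (rule w2(4)[OF y])
    have WE: "W2 y \<in> E" by (rule moved_mem[OF W2 V(1) E y])
    have "?f y * e11 (bl (W2 y) 2 2) = sim (W2 y) \<and> ?f y * e21 (bl (W2 y) 2 2) = 0"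
      using gd[OF WE C b1 d] unfolding e by (simp add: m2_eq_iff mult.commute)
    then have b2: "e11 (bl (W2 y) 2 2) = ?a y" "e21 (bl (W2 y) 2 2) = 0" using f0[OF y] unfolding af[symmetric] by (simp_all add: mult.commute)
    have "bl (W2 y) 2 2 * star (bl (W2 y) 2 2) = sc (sim (W2 y))" using row_rel[of "W2 y" 2 2] b1 b3 by simp
    then have "nrm (bl (W2 y) 2 2) = sim (W2 y)" by (simp add: mult_star)
    then have "?a y * e22 (bl (W2 y) 2 2) = ?a y * ?f y" unfolding af nrm_def b2 by simp
    moreover have "?a y \<noteq> 0" using af sim(1)[of "W2 y"] by auto
    ultimately have "e22 (bl (W2 y) 2 2) = ?f y" by simp
    then show "bl (W2 y) 2 2 = M2 (?a y) (e12 (bl (W2 y) 2 2)) 0 (?f y)" using b2 unfolding m2_eq_iff by simp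
  qed
  have inv: "nrm (M2 (?a y) 0 0 (- ?f y)) \<noteq> 0"
    "(inverse (W2 y) * (del (M2 (?a y) 0 0 (- ?f y)) * eps)) * (inverse (W2 y) * (del (M2 (?a y) 0 0 (- ?f y)) * eps)) \<in> scalars"
    if y: "y \<in> V" for y
    by (rule cusp_involution[OF w3[OF y]])+
  show "sk.killable E x0"
  proof (rule kill_involution[OF E V W2, where s = "\<lambda>y. del (M2 (?a y) 0 0 (- ?f y))"])
    show "continuous_on V (\<lambda>y. del (M2 (?a y) 0 0 (- ?f y)))" by (intro kcont W1c inv(1); assumption?)
    fix y assume y: "y \<in> V"
    show "del (M2 (?a y) 0 0 (- ?f y)) \<in> Sh" by (rule Sh_del[OF inv(1)[OF y]])
    show "(inverse (W2 y) * (del (M2 (?a y) 0 0 (- ?f y)) * eps)) * (inverse (W2 y) * (del (M2 (?a y) 0 0 (- ?f y)) * eps)) \<in> scalars"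
      by (rule inv(2)[OF y])
  qed
qed

section \<open>The stratum with \<open>C = 0\<close> and \<open>d\<close> of rank one\<close>

text \<open>With \<open>d\<close> a matrix unit, the trace conditions and the column relations leave
  a single nonzero entry \<open>k\<close> in \<open>b1\<close>, at the same place. Conjugation then
  carries a unipotent element with nontrivial character into \<open>Sh\<close>, where the trace
  defining the character is zero.\<close>

lemma kill_nilpotent_d:
  assumes E: "sk.invariant E" and C: "\<And>y. y \<in> E \<Longrightarrow> bl y 3 1 = 0"
    and ba: "\<And>y. y \<in> E \<Longrightarrow> tr (star (bl y 2 1) * bl y 1 1) = 0" and de: "\<And>y. y \<in> E \<Longrightarrow> tr (bl y 3 2 * star (bl y 3 3)) = 0"
    and x: "x \<in> E" "bl x 3 2 \<noteq> 0"
  shows "sk.killable E x"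
proof -
  have rk: "nrm (bl y 3 2) = 0" if "y \<in> E" for y
    using row_rel[of y 3 3] by (simp add: C[OF that] mult_star)
  show ?thesis
  proof (rule rank_one_reduce[OF E rk x])
    fix x0 assume x0: "x0 \<in> E" "bl x0 3 2 = M2 0 1 0 0"
    have "\<exists>V W. rel_open E V \<and> x0 \<in> V \<and> moved V W \<and> W x0 = x0 \<and> (\<forall>y\<in>V. bl (W y) 3 2 = M2 0 1 0 0)"
      by (rule rank_one_local[OF E _ x0]) (rule rk)
    then obtain V W where V: "rel_open E V" "x0 \<in> V" and W: "moved V W" and d': "\<forall>y\<in>V. bl (W y) 3 2 = M2 0 1 0 0"
      by (elim exE conjE)
    note Wc = moved_cont[OF W]
    let ?k = "\<lambda>y. e12 (bl (W y) 2 1)" and ?a = "\<lambda>y. e11 (bl (W y) 1 1)" and ?e = "\<lambda>y. e22 (bl (W y) 1 1)"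
    have w: "bl (W y) 3 1 = 0" "bl (W y) 3 2 = M2 0 1 0 0" "e11 (bl (W y) 2 1) = 0" "e21 (bl (W y) 2 1) = 0" "e22 (bl (W y) 2 1) = 0"
      "?k y \<noteq> 0" "e21 (bl (W y) 1 1) = 0" "?k y * e22 (bl (W y) 2 2) = ?e y" if y: "y \<in> V" for y
    proof -
      have WE: "W y \<in> E" by (rule moved_mem[OF W V(1) E y])
      show c: "bl (W y) 3 1 = 0" by (rule C[OF WE])
      show d: "bl (W y) 3 2 = M2 0 1 0 0" using d' y by simp
      have e21: "e21 (bl (W y) 3 3) = 0" using de[OF WE] by (simp add: d tr_def)
      have c13: "star (bl (W y) 2 1) * bl (W y) 2 3 + star (bl (W y) 1 1) * bl (W y) 3 3 = sc (sim (W y))"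
        using col_rel[of "W y" 1 3] by (simp add: c)
      have r13: "bl (W y) 1 1 * star (bl (W y) 3 3) + bl (W y) 1 2 * star (bl (W y) 3 2) = sc (sim (W y))"
        using row_rel[of "W y" 1 3] by (simp add: c)
      have ra: "?a y * e22 (bl (W y) 3 3) = sim (W y) \<and> e21 (bl (W y) 1 1) * e22 (bl (W y) 3 3) = 0"
        using r13 by (simp add: d e21 m2_eq_iff)
      have a0: "?a y \<noteq> 0" "e22 (bl (W y) 3 3) \<noteq> 0" using ra sim(1)[of "W y"] by auto
      show a21: "e21 (bl (W y) 1 1) = 0" using ra a0 by simp
      have c11: "star (bl (W y) 2 1) * bl (W y) 2 1 = 0" using col_rel[of "W y" 1 1] by (simp add: c)
      have nb: "nrm (bl (W y) 2 1) = 0" using c11 by (simp add: mult_star)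
      have "bl (W y) 2 1 * (star (bl (W y) 2 1) * bl (W y) 2 3) = 0" using nb by (simp add: mult_star flip: mult.assoc)
      then have "bl (W y) 2 1 * star (bl (W y) 1 1) * bl (W y) 3 3 = bl (W y) 2 1 * sc (sim (W y))"
        unfolding c13[symmetric] by (simp add: distrib_left mult.assoc)
      then have b1: "e11 (bl (W y) 2 1) * ?e y * e11 (bl (W y) 3 3) = e11 (bl (W y) 2 1) * sim (W y)"
         "e21 (bl (W y) 2 1) * ?e y * e11 (bl (W y) 3 3) = e21 (bl (W y) 2 1) * sim (W y)"
        by (simp_all add: m2_eq_iff a21 e21)
      have c12: "star (bl (W y) 2 1) * bl (W y) 2 2 + star (bl (W y) 1 1) * bl (W y) 3 2 = 0"
        using col_rel[of "W y" 1 2] by (simp add: c)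
      have "bl (W y) 2 1 * (star (bl (W y) 2 1) * bl (W y) 2 2) = 0" using nb by (simp add: mult_star flip: mult.assoc)
      then have "bl (W y) 2 1 * (star (bl (W y) 1 1) * bl (W y) 3 2) = 0"
        using arg_cong[OF c12, of "\<lambda>A. bl (W y) 2 1 * A"] by (simp add: distrib_left)
      then have b2: "e11 (bl (W y) 2 1) * ?e y = 0" "e21 (bl (W y) 2 1) * ?e y = 0" by (simp_all add: d a21 m2_eq_iff)
      show b11: "e11 (bl (W y) 2 1) = 0" and b21: "e21 (bl (W y) 2 1) = 0" using b1 b2 sim(1)[of "W y"] by simp_all
      have "e22 (bl (W y) 2 1) * ?a y = 0" using ba[OF WE] by (simp add: tr_def b11 b21 a21)
      then show b22: "e22 (bl (W y) 2 1) = 0" using a0 by simp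
      show k: "?k y \<noteq> 0"
      proof
        assume "?k y = 0"
        then have "bl (W y) 2 1 = 0" using b11 b21 b22 by (simp add: m2_eq_iff)
        then have "?e y = 0" using c12 by (simp add: d a21 m2_eq_iff)
        moreover have "?e y * e11 (bl (W y) 3 3) = sim (W y)" using c13 \<open>bl (W y) 2 1 = 0\<close> by (simp add: a21 e21 m2_eq_iff)
        ultimately show False using sim(1)[of "W y"] by simp
      qed
      show "?k y * e22 (bl (W y) 2 2) = ?e y" using c12 by (simp add: d a21 b11 b21 b22 m2_eq_iff)
    qed
    obtain m where m: "\<psi> (m * (- 1)) \<noteq> 1" using psi_scale[of "- 1"] by auto
    \<comment> \<open>This coefficient makes the first two diagonal blocks of the conjugate equal,
      as membership in \<open>Sh\<close> demands.\<close>
    let ?z = "\<lambda>y. m * ?a y / (?k y * ?k y)"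
    let ?b = "\<lambda>y. uel (M2 m 0 0 0) (M2 0 0 (?z y) 0)"
    have tb: "tr (M2 0 0 (?z y) 0) = - nrm (M2 m 0 0 0)" for y by (simp add: tr_def nrm_def)
    have kk: "?k y * ?k y \<noteq> 0" if "y \<in> V" for y using w(6)[OF that] by simp
    have bc: "continuous_on V ?b"
      by (rule cont_uel[OF _ _ tb]; intro mcont_intros(8) cont_k mcontD(1,2) mcont_bl Wc kk; assumption?)
    let ?A = "\<lambda>y. W y * ?b y * inverse (W y)"
    have b1: "bl (W y) 2 1 = M2 0 (?k y) 0 0" if y: "y \<in> V" for y using w[OF y] unfolding m2_eq_iff by simp
    have A: "bl (?A y) 3 1 = 0 \<and> bl (?A y) 3 2 = 0 \<and> bl (?A y) 2 1 = 0 \<and> bl (?A y) 1 1 = 1 + M2 0 (- (m * ?a y / sim (W y))) 0 0 \<and>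
       bl (?A y) 2 2 = bl (?A y) 1 1 \<and> tr (bl (?A y) 1 2) = 0 \<and> e21 (bl (?A y) 1 2) = 0" if y: "y \<in> V" for y
    proof -
      define k where "k = ?k y"
      have k: "bl (W y) 2 1 = M2 0 k 0 0" "k \<noteq> 0" "k * e22 (bl (W y) 2 2) = ?e y" unfolding k_def using b1[OF y] w(6,8)[OF y] by simp_all
      note b = bl_conj_uel[of "M2 0 0 (?z y) 0" "M2 m 0 0 0" "W y", OF tb, unfolded k_def[symmetric] rv_simps]
      have e: "?e y = k * e22 (bl (W y) 2 2)" using k(3) by simp
      show ?thesis
        unfolding k_def[symmetric] unfolding b rv_simps w(1,2)[OF y] k(1) using k(2) w(7)[OF y] e by (simp add: m2_eq_iff tr_def)
    qed
    have AS: "?A y \<in> Sh" if y: "y \<in> V" for y unfolding mem_Sh_iff using A[OF y] by simp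
    have tA: "tr (star (bl (?A y) 1 1) * bl (?A y) 1 2) = 0" if y: "y \<in> V" for y
    proof -
      have a: "bl (?A y) 1 1 = 1 + M2 0 (- (m * ?a y / sim (W y))) 0 0" "tr (bl (?A y) 1 2) = 0" "e21 (bl (?A y) 1 2) = 0" using A[OF y] by simp_all
      show ?thesis unfolding a(1) using a(2,3) by (simp add: tr_def)
    qed
    obtain K0 where K0: "?b x0 \<in> K0" "K0 \<in> KKs" using uel_KKs[OF tb[of x0]] by (elim bexE)
    show "sk.killable E x0"
    proof (rule kill_stabilizer[OF E V W _ bc AS Sh_uel[OF tb] _ disjI2[OF K0(1)] K0(2)])
      show "continuous_on V ?A" by (intro kcont Wc bc)
      show "?A y * W y = W y * ?b y" for y by (simp add: mult.assoc)
      have "chi \<psi> (?A x0) = 1" unfolding chi_eq[OF AS[OF V(2)]] tA[OF V(2)] by (simp add: psi_zero[OF psi])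
      moreover have "chi \<psi> (?b x0) = \<psi> (m * (- 1))" unfolding chi_uel[OF tb] by (simp add: tr_def)
      ultimately show "chi \<psi> (?A x0) \<noteq> chi \<psi> (?b x0)" using m by simp
    qed
  qed
qed

section \<open>Exhausting the group\<close>

text \<open>The involution exchanges \<open>d\<close> with \<open>b1\<close> and \<open>e\<close>
  with \<open>a1\<close>, up to \<open>star\<close>, sign and a scalar. A condition proved for
  \<open>d\<close> on an invariant set therefore also holds for \<open>b1\<close>, and
  conversely.\<close>

lemma bl_tau: "bl (eps * inverse x * eps) i j =
   (if (i = 2) = (j = 2) then sc (1 / sim x) * star (bl x (rv j) (rv i)) else - (sc (1 / sim x) * star (bl x (rv j) (rv i))))"
  by (induct i rule: index3; induct j rule: index3) (simp_all add: bl_mult bl_eps bl_inverse)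

lemma tau_mem: "sk.invariant E \<Longrightarrow> x \<in> E \<Longrightarrow> eps * inverse x * eps \<in> E"
  unfolding sk.invariant_def by simp

lemma sc_mult_zero: "c \<noteq> 0 \<Longrightarrow> sc c * A = 0 \<Longrightarrow> A = (0 :: 'k m2)"
  by (simp add: m2_eq_iff)

lemma stage_mono: "stage P \<Longrightarrow> (\<And>y. P y \<Longrightarrow> Q y) \<Longrightarrow> stage Q"
proof -
  assume P: "stage P" and PQ: "\<And>y. P y \<Longrightarrow> Q y"
  obtain E where "sk.annihilated E" "closed E" "sk.invariant E" "\<forall>x\<in>E. P x" using P unfolding stage_def by (elim exE conjE)
  then show ?thesis unfolding stage_def using PQ by (intro exI[of _ E]) simp
qed

theorem no_skew_distribution:
  assumes f: "cs.testf f"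
  shows "D f = 0"
proof -
  have i: "1 / sim x \<noteq> 0" for x :: "'k gsp6" using sim(1)[of x] by simp
  \<comment> \<open>The condition concerns only points partly in normal form; invariance of the set
    will carry it to all points with invertible \<open>C\<close>.\<close>
  define P1 where "P1 y \<longleftrightarrow> (nrm (bl y 3 1) \<noteq> 0 \<longrightarrow> bl y 3 2 = 0 \<longrightarrow> bl y 2 1 = 0 \<longrightarrow> (\<exists>m. star (bl y 3 1) * bl y 2 2 = sc m))" for y :: "'k gsp6"
  have 1: "stage (\<lambda>y. True \<and> P1 y)"
    by (rule stage_step[OF stage_all]) (auto simp: P1_def intro: kill_open_independent)
  have 2: "stage (\<lambda>y. (True \<and> P1 y) \<and> nrm (bl y 3 1) = 0)"
  proof (rule stage_step[OF 1])
    fix E x assume E: "sk.invariant E" "x \<in> E" "nrm (bl x 3 1) \<noteq> 0" and P: "\<And>y. y \<in> E \<Longrightarrow> True \<and> P1 y"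
    show "sk.killable E x" by (rule kill_open[OF E]) (use P in \<open>auto simp: P1_def\<close>)
  qed
  have 3: "stage (\<lambda>y. ((True \<and> P1 y) \<and> nrm (bl y 3 1) = 0) \<and> tr (star (bl y 3 1) * (bl y 2 1 + bl y 3 2)) = 0)"
    by (rule stage_step[OF 2]) (rule kill_C_trace, simp_all)
  have 4: "stage (\<lambda>y. (((True \<and> P1 y) \<and> nrm (bl y 3 1) = 0) \<and> tr (star (bl y 3 1) * (bl y 2 1 + bl y 3 2)) = 0) \<and>
      tr (star (bl y 3 1) * bl y 3 2) = 0)"
    by (rule stage_step[OF 3]) (rule kill_antidiagonal, simp_all)
  define P5 where "P5 y \<longleftrightarrow> nrm (bl y 3 1) = 0 \<and> star (bl y 3 1) * bl y 3 2 = 0" for y :: "'k gsp6"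
  have "stage (\<lambda>y. ((((True \<and> P1 y) \<and> nrm (bl y 3 1) = 0) \<and> tr (star (bl y 3 1) * (bl y 2 1 + bl y 3 2)) = 0) \<and>
      tr (star (bl y 3 1) * bl y 3 2) = 0) \<and> star (bl y 3 1) * bl y 3 2 = 0)"
    by (rule stage_step[OF 4]) (rule kill_unipotent, simp_all)
  then have 5: "stage P5" by (rule stage_mono) (simp add: P5_def)
  \<comment> \<open>The third equation is the image of the second under the involution.\<close>
  have P5: "nrm (bl y 3 1) = 0" "star (bl y 3 1) * bl y 3 2 = 0" "bl y 2 1 * star (bl y 3 1) = 0"
    if E: "sk.invariant E" and P: "\<And>y. y \<in> E \<Longrightarrow> P5 y" and y: "y \<in> E" for E y
  proof -
    show "nrm (bl y 3 1) = 0" "star (bl y 3 1) * bl y 3 2 = 0" using P[OF y] unfolding P5_def by simp_all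
    let ?t = "eps * inverse y * eps"
    have "star (bl ?t 3 1) * bl ?t 3 2 = 0" using P[OF tau_mem[OF E y]] unfolding P5_def by simp
    then have "sc (1 / sim y) * (sc (1 / sim y) * (bl y 3 1 * star (bl y 2 1))) = 0"
      unfolding bl_tau rv_simps by (simp add: mult.assoc sc_left[of "bl y 3 1"] sc_comm[of "bl y 3 1" "1 / sim y"])
    then have "bl y 3 1 * star (bl y 2 1) = 0" using sc_mult_zero[OF i] by blast
    from arg_cong[OF this, of star] show "bl y 2 1 * star (bl y 3 1) = 0" by simp
  qed
  \<comment> \<open>Again a condition at normalized points only, to be used for the normal forms of
    the other points in \<open>kill_cusp\<close>.\<close>
  define P6 where "P6 y \<longleftrightarrow> (bl y 3 1 = M2 0 1 0 0 \<longrightarrow> bl y 2 1 = 0 \<longrightarrow> bl y 3 2 = 0 \<longrightarrow>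
       bl y 2 2 * star (bl y 3 3) * M2 0 1 0 0 = sc (sim y) * M2 0 1 0 0)" for y :: "'k gsp6"
  have 6: "stage (\<lambda>y. P5 y \<and> P6 y)"
  proof (rule stage_step[OF 5])
    fix E x assume E: "sk.invariant E" "x \<in> E" "\<not> P6 x" and P: "\<And>y. y \<in> E \<Longrightarrow> P5 y"
    note p = P5[OF E(1) P]
    show "sk.killable E x"
      by (rule kill_cusp_generic[OF E(1) p(1) p(2) p(3) E(2)]) (use E(3) in \<open>auto simp: P6_def\<close>)
  qed
  have 7: "stage (\<lambda>y. (P5 y \<and> P6 y) \<and> bl y 3 1 = 0)"
  proof (rule stage_step[OF 6])
    fix E x assume E: "sk.invariant E" "x \<in> E" "bl x 3 1 \<noteq> 0" and P: "\<And>y. y \<in> E \<Longrightarrow> P5 y \<and> P6 y"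
    have P': "P5 y" if "y \<in> E" for y using P[OF that] by simp
    note p = P5[OF E(1) P']
    show "sk.killable E x"
      by (rule kill_cusp[OF E(1) p(1) p(2) p(3) _ E(2,3)]) (use P in \<open>auto simp: P6_def\<close>)
  qed
  have 8: "stage (\<lambda>y. ((P5 y \<and> P6 y) \<and> bl y 3 1 = 0) \<and> tr (star (bl y 2 1) * bl y 1 1) = 0)"
    by (rule stage_step[OF 7]) (rule kill_C_zero_trace, simp_all)
  have 9: "stage (\<lambda>y. (((P5 y \<and> P6 y) \<and> bl y 3 1 = 0) \<and> tr (star (bl y 2 1) * bl y 1 1) = 0) \<and> bl y 3 2 = 0)"
  proof (rule stage_step[OF 8])
    fix E x assume E: "sk.invariant E" "x \<in> E" "bl x 3 2 \<noteq> 0"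
      and P: "\<And>y. y \<in> E \<Longrightarrow> ((P5 y \<and> P6 y) \<and> bl y 3 1 = 0) \<and> tr (star (bl y 2 1) * bl y 1 1) = 0"
    show "sk.killable E x"
    proof (rule kill_nilpotent_d[OF E(1) _ _ _ E(2,3)])
      fix y assume y: "y \<in> E"
      show "bl y 3 1 = 0" "tr (star (bl y 2 1) * bl y 1 1) = 0" using P[OF y] by simp_all
      let ?t = "eps * inverse y * eps"
      have "tr (star (bl ?t 2 1) * bl ?t 1 1) = 0" using P[OF tau_mem[OF E(1) y]] by simp
      then have "tr (sc (1 / sim y) * (sc (1 / sim y) * (bl y 3 2 * star (bl y 3 3)))) = 0"
        unfolding bl_tau rv_simps by (simp add: mult.assoc sc_left[of "bl y 3 2"] sc_comm[of "bl y 3 2" "1 / sim y"])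
      then show "tr (bl y 3 2 * star (bl y 3 3)) = 0" unfolding tr_simps(7) using i[of y] by simp
    qed
  qed
  have 10: "stage (\<lambda>y. ((((P5 y \<and> P6 y) \<and> bl y 3 1 = 0) \<and> tr (star (bl y 2 1) * bl y 1 1) = 0) \<and> bl y 3 2 = 0) \<and> y \<in> Sh)"
  proof (rule stage_step[OF 9])
    fix E x assume E: "sk.invariant E" "x \<in> E" "x \<notin> Sh"
      and P: "\<And>y. y \<in> E \<Longrightarrow> (((P5 y \<and> P6 y) \<and> bl y 3 1 = 0) \<and> tr (star (bl y 2 1) * bl y 1 1) = 0) \<and> bl y 3 2 = 0"
    show "sk.killable E x"
    proof (rule kill_block_triangular[OF E(1) _ _ _ E(2,3)])
      fix y assume y: "y \<in> E"
      show "bl y 3 1 = 0" "bl y 3 2 = 0" using P[OF y] by simp_all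
      have "bl (eps * inverse y * eps) 3 2 = 0" using P[OF tau_mem[OF E(1) y]] by simp
      then have "sc (1 / sim y) * star (bl y 2 1) = 0" unfolding bl_tau rv_simps by simp
      then have "star (bl y 2 1) = 0" by (rule sc_mult_zero[OF i])
      from arg_cong[OF this, of star] show "bl y 2 1 = 0" by simp
    qed
  qed
  \<comment> \<open>The predicate \<open>False\<close> says that the last carrying set is empty, so
    every test function vanishes on it.\<close>
  have "stage (\<lambda>y. (((((P5 y \<and> P6 y) \<and> bl y 3 1 = 0) \<and> tr (star (bl y 2 1) * bl y 1 1) = 0) \<and> bl y 3 2 = 0) \<and> y \<in> Sh) \<and> False)"
    by (rule stage_step[OF 10]) (rule kill_Sh, simp_all)
  then obtain E where E: "sk.annihilated E" "\<forall>x\<in>E. False" unfolding stage_def by auto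
  show ?thesis using E f unfolding sk.annihilated_def by auto
qed

end

section \<open>Multiplicity one\<close>

context shalika
begin

text \<open>Commuting with two elementary unipotents embedded diagonally makes each block scalar; a
  torus element with entries \<open>2\<close>, \<open>1\<close>, \<open>1/2\<close> kills the
  off-diagonal blocks, and two unipotent elements equate the diagonal ones.\<close>

lemma central_scalar:
  assumes z: "\<And>g. z * g = g * (z :: 'k gsp6)"
  shows "z \<in> scalars"
proof -
  have d: "bl z i j * g = g * bl z i j" if "nrm g \<noteq> 0" for g i j
    using arg_cong[OF z[of "del g"], of "\<lambda>x. bl x i j"] by (simp add: bl_mult_del[OF that] bl_del_mult[OF that])
  have sc: "bl z i j = sc (e11 (bl z i j))" for i j
    using d[of "M2 1 1 0 1" i j] d[of "M2 1 0 1 1" i j] by (simp add: m2_eq_iff nrm_def)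
  have t: "bl z i j * bl (conj_diag 2) j j = bl (conj_diag 2) i i * bl z i j" for i j
    using arg_cong[OF z[of "conj_diag 2"], of "\<lambda>x. bl x i j"]
    by (induct i rule: index3; induct j rule: index3) (simp_all add: bl_mult bl_conj_diag)
  have off: "bl z i j = 0" if "i \<noteq> j" for i j
  proof -
    have "i \<noteq> j \<longrightarrow> e11 (bl z i j) = 0"
      using t[of i j] by (induct i rule: index3; induct j rule: index3) (simp_all add: bl_conj_diag m2_eq_iff)
    then have "e11 (bl z i j) = 0" using that by simp
    then show ?thesis using sc[of i j] by simp
  qed
  have u: "tr (M2 0 1 0 0) = - nrm (0 :: 'k m2)" "tr 0 = - nrm (M2 1 0 0 0 :: 'k m2)" by (simp_all add: tr_def nrm_def)
  have 13: "e11 (bl z 1 1) = e11 (bl z 3 3)"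
    using arg_cong[OF z[of "uel 0 (M2 0 1 0 0)"], of "\<lambda>x. e12 (bl x 1 3)"] sc[of 3 3] sc[of 1 1]
    by (simp add: bl_mult_uel[OF u(1)] bl_uel_mult[OF u(1)] off m2_eq_iff)
  have 12: "e11 (bl z 1 1) = e11 (bl z 2 2)"
    using arg_cong[OF z[of "uel (M2 1 0 0 0) 0"], of "\<lambda>x. e11 (bl x 1 2)"]
    by (simp add: bl_mult_uel[OF u(2)] bl_uel_mult[OF u(2)] off)
  let ?c = "e11 (bl z 1 1)"
  have diag: "bl z 1 1 = sc ?c" "bl z 2 2 = sc ?c" "bl z 3 3 = sc ?c" using sc[of 1 1] sc[of 2 2] sc[of 3 3] 12 13 by simp_all
  have "?c \<noteq> 0"
  proof
    assume "?c = 0"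
    then have "bl z i j = 0" for i j using diag off[of i j] by (cases "i = j"; induct i rule: index3) simp_all
    then show False using row_rel[of z 1 3] sim(1)[of z] by simp
  qed
  moreover have "\<forall>i j. bl z i j = (if i = j then sc ?c else 0)"
    unfolding forall_3 using diag off by simp
  ultimately show ?thesis unfolding scalars_bl by (intro exI[of _ ?c] conjI)
qed

lemma open_gsp6_openin:
  assumes "open U"
  shows "openin (top_of_set GSp6) (mat_of ` (U :: 'k gsp6 set))"
proof -
  obtain T where T: "open T" "U = mat_of -` T" using assms unfolding open_gsp6_def by auto
  have "mat_of ` U = GSp6 \<inter> T"
  proof (intro set_eqI iffI)
    fix A assume A: "A \<in> GSp6 \<inter> T"
    then have "mat_of (Abs_gsp6 A) = A" by (simp add: Abs_gsp6_inverse)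
    then show "A \<in> mat_of ` U" using A T(2) by (intro image_eqI[of _ _ "Abs_gsp6 A"]) simp_all
  qed (use T(2) mat_of in auto)
  then show ?thesis using T(1) by (simp add: openin_open_Int)
qed

text \<open>The scalars are absorbed by \<open>K\<close>, and finitely many of the open cosets
  \<open>K d\<close> cover the compact set \<open>C\<close>.\<close>

lemma finite_right_cosets:
  fixes C :: "'k gsp6 set"
  assumes C: "compact C" and K: "subgp K" "open K" "scalars \<subseteq> K"
    and S: "\<And>x. x \<in> S \<Longrightarrow> \<exists>z c. z \<in> scalars \<and> c \<in> C \<and> x = z * c"
  shows "finite ((\<lambda>x. (\<lambda>k. k * x) ` K) ` S)"
proof -
  have im: "(\<lambda>k. k * x) ` K = {y. y * inverse x \<in> K}" for x
  proof (intro set_eqI iffI)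
    fix y assume "y \<in> {y. y * inverse x \<in> K}"
    moreover have "y = y * inverse x * x" by (simp add: mult.assoc)
    ultimately show "y \<in> (\<lambda>k. k * x) ` K" by (intro image_eqI[of _ _ "y * inverse x"]) simp_all
  qed (auto simp: mult.assoc)
  have eq: "{y. y * inverse x \<in> K} = {y. y * inverse x' \<in> K}" if x: "x * inverse x' \<in> K" for x x'
  proof (intro set_eqI, simp only: mem_Collect_eq, intro iffI)
    fix y
    have e: "y * inverse x' = y * inverse x * (x * inverse x')" "y * inverse x = y * inverse x' * inverse (x * inverse x')" by (simp_all add: mult.assoc)
    show "y * inverse x \<in> K \<Longrightarrow> y * inverse x' \<in> K" unfolding e(1) by (rule subgpD(2)[OF K(1) _ x])
    show "y * inverse x' \<in> K \<Longrightarrow> y * inverse x \<in> K" unfolding e(2) by (rule subgpD(2)[OF K(1) _ subgpD(3)[OF K(1) x]])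
  qed
  have op: "open {y. y * inverse x \<in> K}" for x
  proof -
    have "open ((\<lambda>y. y * inverse x) -` K)" using K(2) by (intro open_vimage kcont)
    then show ?thesis by (simp add: vimage_def)
  qed
  have "C \<subseteq> (\<Union>x\<in>C. {y. y * inverse x \<in> K})" using subgpD(1)[OF K(1)] by auto
  from compactE_image[OF C op this] obtain D where D: "D \<subseteq> C" "finite D" "C \<subseteq> (\<Union>x\<in>D. {y. y * inverse x \<in> K})" .
  have "(\<lambda>x. (\<lambda>k. k * x) ` K) ` S \<subseteq> (\<lambda>x. {y. y * inverse x \<in> K}) ` D"
  proof (rule image_subsetI)
    fix x assume "x \<in> S"
    from S[OF this] obtain z c where zc: "z \<in> scalars" "c \<in> C" "x = z * c" by (elim exE conjE)
    obtain d where d: "d \<in> D" "c * inverse d \<in> K" using D(3) zc(2) by auto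
    have "x * inverse d = z * (c * inverse d)" by (simp add: zc(3) mult.assoc)
    then have "x * inverse d \<in> K" using subgpD(2)[OF K(1) subsetD[OF K(3) zc(1)] d(2)] by simp
    then show "(\<lambda>k. k * x) ` K \<in> (\<lambda>x. {y. y * inverse x \<in> K}) ` D" unfolding im eq[OF \<open>x * inverse d \<in> K\<close>] by (intro imageI d(1))
  qed
  then show ?thesis using D(2) finite_subset by blast
qed

text \<open>Because scalars act trivially, the stabilizer of a vector can be enlarged from a
  congruence subgroup to a member of \<open>KKs\<close>. A functional fixed by such a member is
  smooth, and the support condition carries over once the centre is identified with the
  scalars.\<close>

lemma cuspidal_rep_gsp6:
  fixes \<sigma> :: "'k mat6 \<Rightarrow> 'v::ab_group_add \<Rightarrow> 'v"
  assumes irr: "smooth_irrep smul GSp6 \<sigma>" and sc: "supercuspidal smul GSp6 \<sigma>"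
    and central: "\<And>z v. z \<in> scalars \<Longrightarrow> \<sigma> (mat_of z) v = v"
  shows "cuspidal_rep smul KKs (\<lambda>g. \<sigma> (mat_of (g :: 'k gsp6)))"
proof -
  interpret \<sigma>: smooth_irrep smul GSp6 \<sigma> by (rule irr)
  have G: "mat_of g \<in> GSp6" for g :: "'k gsp6" by (rule mat_of)
  have vs: "vector_space smul" by (rule \<sigma>.vector_space_axioms)
  show ?thesis
  proof (intro cuspidal_rep.intro vs coset_system_KKs cuspidal_rep_axioms.intro)
    show "Vector_Spaces.linear smul smul (\<sigma> (mat_of g))" for g :: "'k gsp6" by (rule \<sigma>.rep_linear[OF G])
    show "\<sigma> (mat_of 1) v = v" for v by (simp add: \<sigma>.rep_one)
    show mult: "\<sigma> (mat_of (g * h)) v = \<sigma> (mat_of g) (\<sigma> (mat_of h) v)" for g h :: "'k gsp6" and v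
      unfolding mat_of_mult by (rule \<sigma>.rep_mult[OF G G])
    show "\<exists>K\<in>KKs. \<forall>k\<in>K. \<sigma> (mat_of k) v = v" for v
    proof -
      obtain T where T: "open T" "{g \<in> GSp6. \<sigma> g v = v} = GSp6 \<inter> T" using \<sigma>.smooth[of v] unfolding openin_open by auto
      have "open (mat_of -` T :: 'k gsp6 set)" using T(1) unfolding open_gsp6_def by (intro exI[of _ T]) simp
      moreover have "1 \<in> mat_of -` T"
      proof -
        have "mat_of (1 :: 'k gsp6) \<in> {g \<in> GSp6. \<sigma> g v = v}" using G[of 1] by (simp add: \<sigma>.rep_one)
        then show ?thesis unfolding T(2) by simp
      qed
      ultimately obtain r where r: "0 < r" "r < 1" "Kr r \<subseteq> mat_of -` T" using Kr_basis by metis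
      have "\<sigma> (mat_of k) v = v" if k: "k \<in> Krz r" for k
      proof -
        obtain a z where az: "k = a * z" "a \<in> Kr r" "z \<in> scalars" using k unfolding Krz_def mem_Collect_eq by (elim exE conjE)
        have "mat_of a \<in> GSp6 \<inter> T" using subsetD[OF r(3) az(2)] G by simp
        then have "\<sigma> (mat_of a) v = v" unfolding T(2)[symmetric] by simp
        then show ?thesis unfolding az(1) mult central[OF az(3)] .
      qed
      then show ?thesis using Krz_KKs[OF r(1,2)] by (intro bexI ballI)
    qed
    show "W = {0} \<or> W = UNIV" if W: "module.subspace smul W" "\<And>(g :: 'k gsp6) v. v \<in> W \<Longrightarrow> \<sigma> (mat_of g) v \<in> W" for W
    proof (rule \<sigma>.irreducible[OF W(1)])
      fix g :: "'k mat6" assume "g \<in> GSp6"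
      then have "mat_of (Abs_gsp6 g) = g" by (rule Abs_gsp6_inverse)
      then show "\<sigma> g ` W \<subseteq> W" using W(2)[of _ "Abs_gsp6 g"] by auto
    qed
    fix \<xi> :: "'v \<Rightarrow> complex" and K :: "'k gsp6 set" and v
    assume xi: "Vector_Spaces.linear smul (*) \<xi>" and K: "K \<in> KKs" and inv: "\<And>k v. k \<in> K \<Longrightarrow> \<xi> (\<sigma> (mat_of k) v) = \<xi> v"
    note K' = KKsD(1-3)[OF K]
    let ?A = "{g :: 'k gsp6. \<forall>v. \<xi> (\<sigma> (mat_of g) v) = \<xi> v}"
    have "open ?A"
    proof (subst open_subopen, intro ballI)
      fix g assume g: "g \<in> ?A"
      have "y \<in> ?A" if "y \<in> lcos g K" for y
      proof -
        have h: "inverse g * y \<in> K" using that by (simp add: lcos_def)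
        have g': "\<forall>v. \<xi> (\<sigma> (mat_of g) v) = \<xi> v" using g by simp
        have "\<xi> (\<sigma> (mat_of (g * (inverse g * y))) v) = \<xi> v" for v
          unfolding mult[of g "inverse g * y"] spec[OF g'] by (rule inv[OF h])
        then show ?thesis unfolding mult_inv_cancel by simp
      qed
      then show "\<exists>T. open T \<and> g \<in> T \<and> T \<subseteq> ?A" using open_lcos[OF K'(3)] mem_lcos_self[OF K'(1)]
        by (intro exI[of _ "lcos g K"] conjI subsetI)
    qed
    from open_gsp6_openin[OF this] have "openin (top_of_set GSp6) (mat_of ` ?A)" .
    moreover have "mat_of ` ?A = {g \<in> GSp6. \<forall>v. \<xi> (\<sigma> g v) = \<xi> v}"
    proof (intro set_eqI iffI)
      fix g assume g: "g \<in> {g \<in> GSp6. \<forall>v. \<xi> (\<sigma> g v) = \<xi> v}"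
      then have "mat_of (Abs_gsp6 g) = g" by (simp add: Abs_gsp6_inverse)
      then show "g \<in> mat_of ` ?A" using g by (intro image_eqI[of _ _ "Abs_gsp6 g"]) simp_all
    qed (use G in auto)
    ultimately have xd: "\<xi> \<in> smooth_dual smul GSp6 \<sigma>" unfolding smooth_dual_def using xi by simp
    obtain C where C: "C \<subseteq> GSp6" "compact C" "{g \<in> GSp6. \<xi> (\<sigma> g v) \<noteq> 0} \<subseteq> {z ** c | z c. z \<in> matrix_group_centre GSp6 \<and> c \<in> C}"
      using bspec[OF spec[OF sc[unfolded supercuspidal_def], of v] xd] by (elim exE conjE) blast
    let ?C = "mat_of -` C :: 'k gsp6 set"
    have "mat_of ` ?C = C"
    proof (intro set_eqI iffI)
      fix g assume g: "g \<in> C"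
      then have "mat_of (Abs_gsp6 g) = g" using C(1) by (intro Abs_gsp6_inverse) auto
      then show "g \<in> mat_of ` ?C" using g by (intro image_eqI[of _ _ "Abs_gsp6 g"]) simp_all
    qed auto
    then have cpt: "compact ?C" using C(2) by (intro compact_gsp6) simp
    show "finite ((\<lambda>x. (\<lambda>k. k * x) ` K) ` {x. \<xi> (\<sigma> (mat_of x) v) \<noteq> 0})"
    proof (rule finite_right_cosets[OF cpt K'(1,3,2)])
      fix x assume "x \<in> {x. \<xi> (\<sigma> (mat_of x) v) \<noteq> 0}"
      then have "mat_of x \<in> {z ** c | z c. z \<in> matrix_group_centre GSp6 \<and> c \<in> C}" using C(3) G by auto
      then obtain z c where zc: "mat_of x = z ** c" "z \<in> matrix_group_centre GSp6" "c \<in> C" by auto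
      have z: "z \<in> GSp6" "\<And>g. g \<in> GSp6 \<Longrightarrow> z ** g = g ** z" using zc(2) unfolding matrix_group_centre_def by auto
      have m: "mat_of (Abs_gsp6 z) = z" "mat_of (Abs_gsp6 c) = c" using z(1) zc(3) C(1) by (auto intro: Abs_gsp6_inverse)
      have "Abs_gsp6 z * g = g * Abs_gsp6 z" for g
      proof -
        have "mat_of (Abs_gsp6 z * g) = mat_of (g * Abs_gsp6 z)" unfolding mat_of_mult m by (rule z(2)[OF G])
        then show ?thesis by (simp only: mat_of_inject)
      qed
      then have "Abs_gsp6 z \<in> scalars" by (rule central_scalar)
      moreover have "x = Abs_gsp6 z * Abs_gsp6 c"
      proof -
        have "mat_of x = mat_of (Abs_gsp6 z * Abs_gsp6 c)" unfolding mat_of_mult m by (rule zc(1))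
        then show ?thesis by (simp only: mat_of_inject)
      qed
      moreover have "Abs_gsp6 c \<in> ?C" using m(2) zc(3) by simp
      ultimately show "\<exists>z c. z \<in> scalars \<and> c \<in> ?C \<and> x = z * c" by (intro exI conjI)
    qed
  qed
qed

text \<open>The general theorem needs a representation on which the scalars act trivially, and the
  nonzero functional \<open>l\<close> itself provides this.\<close>

lemma Shalika_functionals_proportional:
  fixes \<sigma> :: "'k mat6 \<Rightarrow> 'v::ab_group_add \<Rightarrow> 'v"
  assumes irr: "smooth_irrep smul GSp6 \<sigma>" and sc: "supercuspidal smul GSp6 \<sigma>"
    and l: "l \<in> Shalika_functionals \<psi> smul \<sigma>" "l u \<noteq> 0" and l': "l' \<in> Shalika_functionals \<psi> smul \<sigma>"
  shows "\<exists>c. \<forall>v. l' v = c * l v"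
proof -
  interpret \<sigma>: smooth_irrep smul GSp6 \<sigma> by (rule irr)
  have G: "mat_of g \<in> GSp6" for g :: "'k gsp6" by (rule mat_of)
  have lin: "Vector_Spaces.linear smul (*) m \<and> (\<forall>s\<in>Sh. \<forall>v. m (\<sigma> (mat_of s) v) = chi \<psi> s * m v)"
    if "m \<in> Shalika_functionals \<psi> smul \<sigma>" for m
    using that unfolding Shalika_functionals_def Hom_character_def chi_def Sh_def by simp
  have l1: "Vector_Spaces.linear smul (*) l" "\<And>s v. s \<in> Sh \<Longrightarrow> l (\<sigma> (mat_of s) v) = chi \<psi> s * l v" using lin[OF l(1)] by auto
  have l1': "Vector_Spaces.linear smul (*) l'" "\<And>s v. s \<in> Sh \<Longrightarrow> l' (\<sigma> (mat_of s) v) = chi \<psi> s * l' v" using lin[OF l'] by auto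
  have lD: "l (v + w) = l v + l w" "l (smul c v) = c * l v" for v w c using l1(1) by (simp_all add: Vector_Spaces.linear_iff)
  have sD: "\<sigma> (mat_of g) (v + w) = \<sigma> (mat_of g) v + \<sigma> (mat_of g) w" "\<sigma> (mat_of g) (smul c v) = smul c (\<sigma> (mat_of g) v)" for g v w c
    using \<sigma>.rep_linear[OF G, of g] by (simp_all add: Vector_Spaces.linear_iff)
  have mult: "\<sigma> (mat_of (g * h)) v = \<sigma> (mat_of g) (\<sigma> (mat_of h) v)" for g h :: "'k gsp6" and v
    unfolding mat_of_mult by (rule \<sigma>.rep_mult[OF G G])
  \<comment> \<open>Vectors whose whole orbit is killed by \<open>l\<close> are zero by
    irreducibility. A scalar commutes with the group and has trivial character, so
    \<open>\<sigma> (mat_of z) v - v\<close> is such a vector.\<close>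
  have central: "\<sigma> (mat_of z) v = v" if z: "z \<in> scalars" for z v
  proof -
    let ?W = "{w. \<forall>g :: 'k gsp6. l (\<sigma> (mat_of g) w) = 0}"
    have l0: "l 0 = 0" using lD(2)[of 0 0] by simp
    have s0: "\<sigma> (mat_of g) 0 = 0" for g using sD(2)[of g 0 0] by simp
    have "\<sigma>.subspace ?W" unfolding \<sigma>.subspace_def by (simp add: sD lD l0 s0)
    moreover have "\<sigma> g ` ?W \<subseteq> ?W" if g: "g \<in> GSp6" for g
    proof (intro image_subsetI CollectI allI)
      fix w h assume w: "w \<in> ?W"
      have "mat_of (Abs_gsp6 g) = g" by (rule Abs_gsp6_inverse[OF g])
      then have "\<sigma> (mat_of h) (\<sigma> g w) = \<sigma> (mat_of (h * Abs_gsp6 g)) w" unfolding mult by simp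
      moreover have "l (\<sigma> (mat_of (h * Abs_gsp6 g)) w) = 0" using w by blast
      ultimately show "l (\<sigma> (mat_of h) (\<sigma> g w)) = 0" by (simp only:)
    qed
    ultimately have "?W = {0} \<or> ?W = UNIV" by (rule \<sigma>.irreducible)
    moreover have "u \<notin> ?W"
    proof
      assume "u \<in> ?W"
      then have "l (\<sigma> (mat_of 1) u) = 0" by blast
      then show False using l(2) by (simp add: \<sigma>.rep_one)
    qed
    ultimately have W: "?W = {0}" by auto
    have "\<sigma> (mat_of z) v - v \<in> ?W"
    proof (intro CollectI allI)
      fix g :: "'k gsp6"
      have "l (\<sigma> (mat_of g) (\<sigma> (mat_of z) v)) = l (\<sigma> (mat_of (z * g)) v)" unfolding mult[symmetric] scalars_central[OF z] ..
      also have "\<dots> = l (\<sigma> (mat_of g) v)" unfolding mult using l1(2)[OF subsetD[OF scalars_Sh z]] chi_scalar[OF z] by simp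
      finally have "l (\<sigma> (mat_of g) (\<sigma> (mat_of z) v)) = l (\<sigma> (mat_of g) v)" .
      moreover have "\<sigma> (mat_of g) (\<sigma> (mat_of z) v) = \<sigma> (mat_of g) (\<sigma> (mat_of z) v - v) + \<sigma> (mat_of g) v"
        unfolding sD(1)[symmetric] by simp
      ultimately show "l (\<sigma> (mat_of g) (\<sigma> (mat_of z) v - v)) = 0" using lD(1)[of "\<sigma> (mat_of g) (\<sigma> (mat_of z) v - v)" "\<sigma> (mat_of g) v"] by simp
    qed
    then show ?thesis unfolding W by simp
  qed
  interpret cuspidal_rep smul KKs "\<lambda>g. \<sigma> (mat_of (g :: 'k gsp6))"
    by (rule cuspidal_rep_gsp6[OF irr sc central])
  show ?thesis
  proof (rule mult_one[where H = Sh and \<theta> = "chi \<psi>" and \<epsilon> = eps and u = u])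
    show "cs.modulus s = 1 \<and> cmod (chi \<psi> s) = 1 \<and> eps * s * eps \<in> Sh \<and> chi \<psi> (eps * s * eps) = inverse (chi \<psi> s)" if s: "s \<in> Sh" for s
      using modulus_Sh[OF s] chi_cmod[OF s] eps_Sh[OF s] chi_eps[OF psi s] by simp
    show "eps * eps = (1 :: 'k gsp6)" by (rule eps_sq)
    show "D f = 0" if D: "cs.skew_distribution Sh (chi \<psi>) eps D" "cs.testf f" for D f
    proof -
      interpret shalika_distribution p absv \<psi> D by unfold_locales (rule D(1))
      show ?thesis by (rule no_skew_distribution[OF D(2)])
    qed
  qed (use l1 l1' l(2) in auto)
qed

end

theorem theorem4p4:
  fixes p :: nat
    and absv :: "'k::{field_char_0,metric_space} \<Rightarrow> real"
    and \<psi> :: "'k \<Rightarrow> complex"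
    and smul :: "complex \<Rightarrow> 'v::ab_group_add \<Rightarrow> 'v"
    and \<sigma> :: "'k mat6 \<Rightarrow> 'v \<Rightarrow> 'v"
  assumes "finite_extension_Qp p absv"
    and "smooth_additive_character \<psi>" and "nontrivial_character \<psi>"
    and "smooth_irrep smul GSp6 \<sigma>"
    and "supercuspidal smul GSp6 \<sigma>"
  shows "functionals_dim_le (Shalika_functionals \<psi> smul \<sigma>) 1"
proof -
  interpret shalika p absv \<psi>
    by (intro shalika.intro assms(1) shalika_axioms.intro assms(2,3))
  interpret fs: vector_space fun_scale by (rule vector_space_fun_scale)
  let ?L = "Shalika_functionals \<psi> smul \<sigma>"
  have "\<exists>l. ?L \<subseteq> fs.span {l}"
  proof (cases "\<exists>l\<in>?L. \<exists>u. l u \<noteq> 0")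
    case True
    then obtain l u where l: "l \<in> ?L" "l u \<noteq> 0" by auto
    have "l' \<in> fs.span {l}" if l': "l' \<in> ?L" for l'
    proof -
      obtain c where "\<forall>v. l' v = c * l v" using Shalika_functionals_proportional[OF assms(4,5) l l'] by auto
      then have "l' = fun_scale c l" unfolding fun_scale_def by (simp add: fun_eq_iff)
      then show ?thesis by (simp add: fs.span_scale fs.span_base)
    qed
    then show ?thesis by (intro exI[of _ l] subsetI)
  next
    case False
    have "l' \<in> fs.span {0}" if "l' \<in> ?L" for l'
    proof -
      have "l' = 0" using False that by (auto simp: fun_eq_iff)
      then show ?thesis by (simp add: fs.span_zero)
    qed
    then show ?thesis by (intro exI[of _ 0] subsetI)
  qed
  then obtain l where l: "?L \<subseteq> fs.span {l}" by (elim exE)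
  have "fs.dim ?L \<le> card {l}" by (rule fs.dim_le_card[OF l]) simp
  then show ?thesis unfolding functionals_dim_le_def using l by (intro conjI exI[of _ "{l}"]) simp_all
qed

end
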